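(* Given an SLP of size $n$ representing a string $S$ of length $N$, the LZ78 factorization of $S$ can be computed in $O(n\sqrt{N} + m\log N)$ time and $O(n\sqrt{N} + m)$ space, where $m$ is the number of factors in the LZ78 factorization of $S$.
   Context: A straight line program (SLP) of size $n$ is a sequence of assignments $X_1 \to expr_1, \ldots, X_n \to expr_n$, where each $X_i$ is a distinct nonterminal and each $expr_i$ is either a single character $a \in \Sigma$ or $X_{\ell(i)}X_{r(i)}$ with $\ell(i), r(i) < i$; $\mathit{val}(X_i)$ is the string derived from $X_i$, and the SLP represents $S = \mathit{val}(X_n)$. The alphabet $\Sigma$ is finite, and the last character of $S$ is a special character \$ occurring nowhere else in $S$. The LZ78 factorization of $S$ is the factorization $S = f_1 \cdots f_m$ where each $f_i \in \Sigma^+$ is the longest prefix of $f_i\cdots f_m$ with $f_i \in \{f_j c \mid 1 \le j < i, c \in \Sigma\}\cup\Sigma$; it is output as the sequence of pairs $(j, c)$ where $f_i = f_j c$ (with $j=0$, $f_0=\varepsilon$ if $f_i$ is a single character). The model of computation is the word RAM with word size at least $\log N$; space is measured in words. *)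

theory Defs
  imports Complex_Main "HOL-Library.Sublist"
begin

section \<open>Straight line programs\<close>

datatype 'a slp_rule = Terminal 'a | Concat nat nat

text \<open>
  A straight line program of size \<open>n\<close> is the list of its right-hand sides. Nonterminals are the
  indices \<open>1, \<dots>, n\<close>; the rule of \<open>X\<^sub>i\<close> is the list element at position \<open>i - 1\<close>.
\<close>

type_synonym 'a slp = "'a slp_rule list"

definition slp_rhs :: "'a slp \<Rightarrow> nat \<Rightarrow> 'a slp_rule" where
  "slp_rhs G i = G ! (i - 1)"

definition is_slp :: "'a set \<Rightarrow> 'a slp \<Rightarrow> bool" where
  "is_slp \<Sigma> G \<longleftrightarrow> G \<noteq> [] \<and>
     (\<forall>i \<in> {1..length G}. case slp_rhs G i of
        Terminal a \<Rightarrow> a \<in> \<Sigma>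
      | Concat l r \<Rightarrow> l \<in> {1..<i} \<and> r \<in> {1..<i})"

text \<open>The guard only serves termination; it always holds under \<^const>\<open>is_slp\<close>.\<close>

function slp_val :: "'a slp \<Rightarrow> nat \<Rightarrow> 'a list" where
  "slp_val G i = (case slp_rhs G i of
      Terminal a \<Rightarrow> [a]
    | Concat l r \<Rightarrow> if l < i \<and> r < i then slp_val G l @ slp_val G r else [])"
  by pat_completeness auto
termination by (relation "measure snd") auto

declare slp_val.simps [simp del]

definition slp_string :: "'a slp \<Rightarrow> 'a list" where
  "slp_string G = slp_val G (length G)"


section \<open>LZ78 factorization\<close>

definition lz78_candidates :: "'a set \<Rightarrow> 'a list set \<Rightarrow> 'a list set" where
  "lz78_candidates \<Sigma> F = {f @ [c] | f c. f \<in> F \<and> c \<in> \<Sigma>} \<union> {[c] | c. c \<in> \<Sigma>}"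

definition longest_prefix_in :: "'a list set \<Rightarrow> 'a list \<Rightarrow> 'a list \<Rightarrow> bool" where
  "longest_prefix_in D s p \<longleftrightarrow> p \<in> D \<and> prefix p s \<and>
     (\<forall>q \<in> D. prefix q s \<longrightarrow> length q \<le> length p)"

definition is_lz78 :: "'a set \<Rightarrow> 'a list \<Rightarrow> 'a list list \<Rightarrow> bool" where
  "is_lz78 \<Sigma> S fs \<longleftrightarrow> concat fs = S \<and>
     (\<forall>i < length fs. longest_prefix_in (lz78_candidates \<Sigma> (set (take i fs)))
                        (concat (drop i fs)) (fs ! i))"

definition lz78 :: "'a set \<Rightarrow> 'a list \<Rightarrow> 'a list list" where
  "lz78 \<Sigma> S = (THE fs. is_lz78 \<Sigma> S fs)"

lemma longest_prefix_in_unique: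
  "longest_prefix_in D s p \<Longrightarrow> longest_prefix_in D s q \<Longrightarrow> p = q"
  unfolding longest_prefix_in_def
  by (metis le_antisym prefix_length_prefix prefix_order.antisym order_refl)

lemma longest_prefix_in_exists:
  assumes "q \<in> D" "prefix q s"
  shows "\<exists>p. longest_prefix_in D s p"
proof -
  let ?P = "\<lambda>p. p \<in> D \<and> prefix p s"
  have "\<forall>p. ?P p \<longrightarrow> length p < Suc (length s)"
    by (auto dest: prefix_length_le)
  then obtain p where "?P p" "\<forall>q. ?P q \<longrightarrow> length q \<le> length p"
    using ex_has_greatest_nat[of ?P q length "Suc (length s)"] assms by auto
  then show ?thesis
    unfolding longest_prefix_in_def by blast
qed

lemma ex1_lz78_aux:
  assumes "set S \<subseteq> \<Sigma>"
  shows "\<exists>!fs. concat fs = S \<and>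
     (\<forall>i < length fs. longest_prefix_in (lz78_candidates \<Sigma> (F \<union> set (take i fs)))
                        (concat (drop i fs)) (fs ! i))"
    (is "\<exists>!fs. ?L F S fs")
  using assms
proof (induction "length S" arbitrary: S F rule: less_induct)
  case less
  let ?L = "\<lambda>F S fs. concat fs = S \<and>
     (\<forall>i < length fs. longest_prefix_in (lz78_candidates \<Sigma> (F \<union> set (take i fs)))
                        (concat (drop i fs)) (fs ! i))"
  have step: "?L F S (f # fs) \<longleftrightarrow> S = f @ concat fs \<and>
      longest_prefix_in (lz78_candidates \<Sigma> F) S f \<and> ?L (insert f F) (concat fs) fs"
    for F S f fs
    by (auto simp: All_less_Suc2)
  show ?case
  proof (cases S)
    case Nil
    have "\<not> ?L F S (f # fs)" for f fs
      unfolding step using Nil by (auto simp: longest_prefix_in_def lz78_candidates_def)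
    then have "?L F S fs \<longleftrightarrow> fs = []" for fs
      using Nil by (cases fs) auto
    then show ?thesis by simp
  next
    case (Cons a S')
    have "[a] \<in> lz78_candidates \<Sigma> F" "prefix [a] S"
      using Cons less.prems by (auto simp: lz78_candidates_def)
    then obtain p where p: "longest_prefix_in (lz78_candidates \<Sigma> F) S p"
      using longest_prefix_in_exists by blast
    then obtain R where R: "S = p @ R" and "p \<noteq> []"
      by (auto simp: longest_prefix_in_def lz78_candidates_def prefix_def)
    then have "length R < length S" "set R \<subseteq> \<Sigma>"
      using less.prems by auto
    then have ex1: "\<exists>!fs. ?L (insert p F) R fs"
      by (rule less.hyps)
    then obtain gs where gs: "?L (insert p F) R gs" by blast
    show ?thesis
    proof (rule ex1I[of _ "p # gs"])
      show "?L F S (p # gs)"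
        unfolding step using gs p R by simp
    next
      fix fs assume fs: "?L F S fs"
      then obtain f fs' where "fs = f # fs'"
        using Cons by (cases fs) auto
      have *: "S = f @ concat fs'" "longest_prefix_in (lz78_candidates \<Sigma> F) S f"
        "?L (insert f F) (concat fs') fs'"
        using fs unfolding \<open>fs = f # fs'\<close> step by metis+
      have "f = p" using longest_prefix_in_unique *(2) p by blast
      moreover from this have "concat fs' = R" using *(1) R by simp
      ultimately have "fs' = gs" using ex1 gs *(3) by blast
      with \<open>f = p\<close> \<open>fs = f # fs'\<close> show "fs = p # gs" by simp
    qed
  qed
qed

lemma ex1_lz78: "set S \<subseteq> \<Sigma> \<Longrightarrow> \<exists>!fs. is_lz78 \<Sigma> S fs"
  using ex1_lz78_aux[of S \<Sigma> "{}"] by (simp add: is_lz78_def)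

text \<open>
  \<open>[] # fs\<close> is the sequence \<open>f\<^sub>0 = \<epsilon>, f\<^sub>1, \<dots>, f\<^sub>m\<close>, so that its element at position \<open>j\<close> is \<open>f\<^sub>j\<close>.
\<close>

definition lz78_pairs :: "'a list list \<Rightarrow> (nat \<times> 'a) list \<Rightarrow> bool" where
  "lz78_pairs fs ps \<longleftrightarrow> length ps = length fs \<and>
     (\<forall>i \<in> {1..length fs}. case ps ! (i - 1) of
        (j, c) \<Rightarrow> j < i \<and> ([] # fs) ! i = ([] # fs) ! j @ [c])"


section \<open>Word RAM\<close>

text \<open>
  Words are the natural numbers below \<open>2 ^ w\<close>. The memory consists of arrays, each addressed by one
  word. A program names the arrays and registers it uses, hence uses constantly many of them; it
  does not depend on \<open>w\<close>. Having several arrays lets a program address \<open>O(2 ^ w)\<close> and not merely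
  \<open>2 ^ w\<close> words, which a word size of exactly \<open>log N\<close> requires.
\<close>

datatype binop = Add | Sub | Mul | Div | Mod | And | Or | Xor | Shl | Shr

fun eval_binop :: "nat \<Rightarrow> binop \<Rightarrow> nat \<Rightarrow> nat \<Rightarrow> nat" where
  "eval_binop w Add x y = (x + y) mod 2 ^ w"
| "eval_binop w Sub x y = nat ((int x - int y) mod 2 ^ w)"
| "eval_binop w Mul x y = (x * y) mod 2 ^ w"
| "eval_binop w Div x y = x div y"
| "eval_binop w Mod x y = x mod y"
| "eval_binop w And x y = Bit_Operations.and x y"
| "eval_binop w Or x y = Bit_Operations.or x y"
| "eval_binop w Xor x y = Bit_Operations.xor x y"
| "eval_binop w Shl x y = push_bit y x mod 2 ^ w"
| "eval_binop w Shr x y = drop_bit y x"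

type_synonym reg = nat
type_synonym arr = nat

datatype instr =
    Const reg nat
  | Move reg reg
  | Bin binop reg reg reg
  | Load reg arr reg
  | Store arr reg reg
  | Jump nat
  | JumpEq reg reg nat
  | JumpLess reg reg nat

type_synonym program = "instr list"

record config =
  pc :: nat
  regs :: "reg \<Rightarrow> nat"
  mem :: "arr \<Rightarrow> nat \<Rightarrow> nat"

fun exec_instr :: "nat \<Rightarrow> instr \<Rightarrow> config \<Rightarrow> config" where
  "exec_instr w (Const d k) s =
     s\<lparr>pc := pc s + 1, regs := (regs s)(d := k mod 2 ^ w)\<rparr>"
| "exec_instr w (Move d x) s =
     s\<lparr>pc := pc s + 1, regs := (regs s)(d := regs s x)\<rparr>"
| "exec_instr w (Bin f d x y) s =
     s\<lparr>pc := pc s + 1, regs := (regs s)(d := eval_binop w f (regs s x) (regs s y))\<rparr>"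
| "exec_instr w (Load d A x) s =
     s\<lparr>pc := pc s + 1, regs := (regs s)(d := mem s A (regs s x))\<rparr>"
| "exec_instr w (Store A x y) s =
     s\<lparr>pc := pc s + 1, mem := (mem s)(A := (mem s A)(regs s x := regs s y))\<rparr>"
| "exec_instr w (Jump l) s = s\<lparr>pc := l\<rparr>"
| "exec_instr w (JumpEq x y l) s =
     s\<lparr>pc := if regs s x = regs s y then l else pc s + 1\<rparr>"
| "exec_instr w (JumpLess x y l) s =
     s\<lparr>pc := if regs s x < regs s y then l else pc s + 1\<rparr>"

definition halted :: "program \<Rightarrow> config \<Rightarrow> bool" where
  "halted P s \<longleftrightarrow> pc s \<ge> length P"

definition step :: "nat \<Rightarrow> program \<Rightarrow> config \<Rightarrow> config" where
  "step w P s = (if halted P s then s else exec_instr w (P ! pc s) s)"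

definition run :: "nat \<Rightarrow> program \<Rightarrow> nat \<Rightarrow> config \<Rightarrow> config" where
  "run w P t = step w P ^^ t"

definition halts :: "nat \<Rightarrow> program \<Rightarrow> config \<Rightarrow> bool" where
  "halts w P s \<longleftrightarrow> (\<exists>t. halted P (run w P t s))"

definition run_time :: "nat \<Rightarrow> program \<Rightarrow> config \<Rightarrow> nat" where
  "run_time w P s = (LEAST t. halted P (run w P t s))"

definition result :: "nat \<Rightarrow> program \<Rightarrow> config \<Rightarrow> config" where
  "result w P s = run w P (run_time w P s) s"

fun instr_regs :: "instr \<Rightarrow> reg set" where
  "instr_regs (Const d k) = {d}"
| "instr_regs (Move d x) = {d, x}"
| "instr_regs (Bin f d x y) = {d, x, y}"
| "instr_regs (Load d A x) = {d, x}"
| "instr_regs (Store A x y) = {x, y}"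
| "instr_regs (Jump l) = {}"
| "instr_regs (JumpEq x y l) = {x, y}"
| "instr_regs (JumpLess x y l) = {x, y}"

fun instr_cells :: "instr \<Rightarrow> config \<Rightarrow> (arr \<times> nat) set" where
  "instr_cells (Load d A x) s = {(A, regs s x)}"
| "instr_cells (Store A x y) s = {(A, regs s x)}"
| "instr_cells _ s = {}"

definition accessed :: "nat \<Rightarrow> program \<Rightarrow> config \<Rightarrow> (arr \<times> nat) set" where
  "accessed w P s =
     (\<Union>t < run_time w P s. let s' = run w P t s in instr_cells (P ! pc s') s')"

text \<open>
  An array contributes all words up to the largest address accessed in it, so sparsely used
  memory is not free. Input and output words are counted.
\<close>

definition run_space :: "nat \<Rightarrow> program \<Rightarrow> config \<Rightarrow> nat" where
  "run_space w P s =
     card (\<Union>i \<in> set P. instr_regs i) + card {(A, a). \<exists>b \<ge> a. (A, b) \<in> accessed w P s}"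


section \<open>Input and output conventions\<close>

text \<open>
  Register 0 holds \<open>n\<close>. For \<open>1 \<le> i \<le> n\<close>, cell \<open>i\<close> of arrays 0 and 1 holds \<open>0\<close> and \<open>a\<close> if
  \<open>X\<^sub>i \<rightarrow> a\<close>, and \<open>l\<close> and \<open>r\<close> if \<open>X\<^sub>i \<rightarrow> X\<^sub>l X\<^sub>r\<close> (here \<open>l \<ge> 1\<close>). Everything else is \<open>0\<close>.
\<close>

definition slp_config :: "nat slp \<Rightarrow> config" where
  "slp_config G = \<lparr>pc = 0, regs = (\<lambda>_. 0)(0 := length G),
     mem = (\<lambda>A i. if i \<in> {1..length G} then
        (case slp_rhs G i of
           Terminal a \<Rightarrow> if A = 1 then a else 0
         | Concat l r \<Rightarrow> if A = 0 then l else if A = 1 then r else 0)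
        else 0)\<rparr>"

text \<open>All input words are below \<open>2 ^ w\<close>; for nonterminal indices this follows from \<open>n < 2 ^ w\<close>.\<close>

definition slp_fits :: "nat \<Rightarrow> nat slp \<Rightarrow> bool" where
  "slp_fits w G \<longleftrightarrow> length G < 2 ^ w \<and> (\<forall>a. Terminal a \<in> set G \<longrightarrow> a < 2 ^ w)"

text \<open>Register 0 holds \<open>m\<close>; cell \<open>i\<close> of arrays 2 and 3 holds the \<open>i\<close>-th pair, \<open>1 \<le> i \<le> m\<close>.\<close>

definition output_pairs :: "config \<Rightarrow> (nat \<times> nat) list" where
  "output_pairs s = map (\<lambda>i. (mem s 2 i, mem s 3 i)) [1..<regs s 0 + 1]"

end

theory Submission
  imports Defs
begin

text \<open>
  A factor of length \<open>l\<close> presupposes distinct factors of all lengths below \<open>l\<close>, so every factor is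
  shorter than a suitable power of two \<open>c = \<Theta>(\<surd>N)\<close>, and every factor except those of a short
  tail is a prefix of a window of length \<open>c\<close> of \<open>S\<close>. Each such window crosses the border between
  the children of its lowest common ancestor in the derivation tree, which leaves at most \<open>n c\<close>
  windows, one for each variable and offset. They are sorted by prefix doubling; the round for
  length \<open>2\<^sup>k\<close> costs \<open>O(n 2\<^sup>k)\<close>, and the geometric sum is \<open>O(n c)\<close>.

  A factor is then the interval of the sorted windows that it is a prefix of. A segment tree stores
  these intervals. Factors that are prefixes of a common window have indices increasing with their
  lengths, so the longest one is the maximal index on a path from a leaf to the root. Adding a
  character to a factor amounts to two binary searches, hence \<open>O(log N)\<close> steps per factor. The window at the
  current position of \<open>S\<close> is found by moving along the at most \<open>n N / c\<close> borders of nodes with at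
  least \<open>c\<close> leaves. The remaining fewer than \<open>2 c\<close> characters are factorized in a plain trie, and so
  is all of \<open>S\<close> if \<open>N = O(n c)\<close>.
\<close>

section \<open>A structured language on top of the word RAM\<close>

text \<open>The obstacle is the budget: each of the \<open>m\<close> factors may cost only O(log N)
  steps, so factors cannot be read character by character outside the part charged to O(n sqrt N).
  Hence factors are kept as intervals of sorted windows. The terminal character makes all factors
  distinct, so a factor of length l forces 1 + ... + l <= N. The window length \<open>c\<close> is a
  power of two with 2 sqrt N <= c <= 4 sqrt N, for which c (c + 1) > 2 N. The alphabet is fixed
  before the program, so its bound \<open>b\<close> may enter the program text and the constants,
  and scanning the children of a trie node costs O(1). The word size may be exactly log N. Then N
  itself is not a word: lengths are stored minus one, comparisons are arranged so that they cannot
  overflow, and absence of overflow is a side condition of the source language. The tables need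
  about 16 c (n + 1) addresses, which are words only if N is large against n c. Where this fails, N
  = O(n sqrt N), and a linear pass over S is affordable; the same holds for N below a constant 2^q
  depending on the alphabet.\<close>

datatype exp =
    Num nat
  | Reg reg
  | MaxWord
  | Op binop exp exp
  | Read arr exp

datatype bexp =
    Less exp exp
  | Equal exp exp
  | Neg bexp
  | Conj bexp bexp

datatype com =
    Skip
  | Assign reg exp  ("_ ::= _" [1000, 61] 61)
  | Write arr exp exp
  | Seq com com  ("_;;/ _" [60, 61] 60)
  | If bexp com com
  | While bexp com

text \<open>Arithmetic on unbounded naturals; \<open>op_safe\<close> is the condition under which
  the machine operation yields the same number. The value 0 of the remaining operators is a dummy,
  which \<open>op_safe\<close> rejects.\<close>

fun op_val :: "binop \<Rightarrow> nat \<Rightarrow> nat \<Rightarrow> nat" where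
  "op_val Add x y = x + y"
| "op_val Sub x y = x - y"
| "op_val Mul x y = x * y"
| "op_val Div x y = x div y"
| "op_val Mod x y = x mod y"
| "op_val Shr x y = x div 2 ^ y"
| "op_val _ x y = 0"

fun op_safe :: "nat \<Rightarrow> binop \<Rightarrow> nat \<Rightarrow> nat \<Rightarrow> bool" where
  "op_safe w Add x y \<longleftrightarrow> x + y < 2 ^ w"
| "op_safe w Sub x y \<longleftrightarrow> y \<le> x \<and> x < 2 ^ w"
| "op_safe w Mul x y \<longleftrightarrow> x * y < 2 ^ w"
| "op_safe w Div x y \<longleftrightarrow> True"
| "op_safe w Mod x y \<longleftrightarrow> True"
| "op_safe w Shr x y \<longleftrightarrow> True"
| "op_safe w _ x y \<longleftrightarrow> False"

type_synonym regfile = "reg \<Rightarrow> nat"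
type_synonym memory = "arr \<Rightarrow> nat \<Rightarrow> nat"

fun val :: "nat \<Rightarrow> exp \<Rightarrow> regfile \<Rightarrow> memory \<Rightarrow> nat" where
  "val w (Num k) r m = k"
| "val w (Reg x) r m = r x"
| "val w MaxWord r m = 2 ^ w - 1"
| "val w (Op f a b) r m = op_val f (val w a r m) (val w b r m)"
| "val w (Read A a) r m = m A (val w a r m)"

text \<open>Under \<open>safe w B\<close>, no operation overflows a word and no address exceeds \<open>B\<close>.\<close>

fun safe :: "nat \<Rightarrow> nat \<Rightarrow> exp \<Rightarrow> regfile \<Rightarrow> memory \<Rightarrow> bool" where
  "safe w B (Num k) r m \<longleftrightarrow> k < 2 ^ w"
| "safe w B (Reg x) r m \<longleftrightarrow> True"
| "safe w B MaxWord r m \<longleftrightarrow> True"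
| "safe w B (Op f a b) r m \<longleftrightarrow> safe w B a r m \<and> safe w B b r m \<and>
     op_safe w f (val w a r m) (val w b r m)"
| "safe w B (Read A a) r m \<longleftrightarrow> safe w B a r m \<and> val w a r m \<le> B"

fun bval :: "nat \<Rightarrow> bexp \<Rightarrow> regfile \<Rightarrow> memory \<Rightarrow> bool" where
  "bval w (Less a b) r m \<longleftrightarrow> val w a r m < val w b r m"
| "bval w (Equal a b) r m \<longleftrightarrow> val w a r m = val w b r m"
| "bval w (Neg b) r m \<longleftrightarrow> \<not> bval w b r m"
| "bval w (Conj a b) r m \<longleftrightarrow> bval w a r m \<and> bval w b r m"

fun bsafe :: "nat \<Rightarrow> nat \<Rightarrow> bexp \<Rightarrow> regfile \<Rightarrow> memory \<Rightarrow> bool" where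
  "bsafe w B (Less a b) r m \<longleftrightarrow> safe w B a r m \<and> safe w B b r m"
| "bsafe w B (Equal a b) r m \<longleftrightarrow> safe w B a r m \<and> safe w B b r m"
| "bsafe w B (Neg b) r m \<longleftrightarrow> bsafe w B b r m"
| "bsafe w B (Conj a b) r m \<longleftrightarrow> bsafe w B a r m \<and> bsafe w B b r m"

text \<open>
  The third component of a state counts loop iterations only: between two of them a program
  executes a bounded number of instructions.
\<close>

inductive exec :: "nat \<Rightarrow> nat \<Rightarrow> com \<Rightarrow> regfile \<times> memory \<times> nat \<Rightarrow> regfile \<times> memory \<times> nat \<Rightarrow> bool"
  for w B where
  Skip: "exec w B Skip s s"
| Assign: "safe w B e r m \<Longrightarrow> exec w B (x ::= e) (r, m, t) (r(x := val w e r m), m, t)"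
| Write: "safe w B a r m \<Longrightarrow> safe w B e r m \<Longrightarrow> val w a r m \<le> B \<Longrightarrow>
    exec w B (Write A a e) (r, m, t) (r, m(A := (m A)(val w a r m := val w e r m)), t)"
| Seq: "exec w B c s s' \<Longrightarrow> exec w B c' s' s'' \<Longrightarrow> exec w B (c ;; c') s s''"
| IfTrue: "bsafe w B b r m \<Longrightarrow> bval w b r m \<Longrightarrow> exec w B c (r, m, t) s' \<Longrightarrow>
    exec w B (If b c c') (r, m, t) s'"
| IfFalse: "bsafe w B b r m \<Longrightarrow> \<not> bval w b r m \<Longrightarrow> exec w B c' (r, m, t) s' \<Longrightarrow>
    exec w B (If b c c') (r, m, t) s'"
| WhileFalse: "bsafe w B b r m \<Longrightarrow> \<not> bval w b r m \<Longrightarrow> exec w B (While b c) (r, m, t) (r, m, t)"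
| WhileTrue: "bsafe w B b r m \<Longrightarrow> bval w b r m \<Longrightarrow> exec w B c (r, m, Suc t) s' \<Longrightarrow>
    exec w B (While b c) s' s'' \<Longrightarrow> exec w B (While b c) (r, m, t) s''"

lemma exec_ticks_mono: "exec w B c s s' \<Longrightarrow> snd (snd s) \<le> snd (snd s')"
  by (induction rule: exec.induct) auto


subsection \<open>Compilation\<close>

text \<open>Registers from \<open>k\<close> upwards are scratch: the value ends up in
  \<open>k\<close>, and what lies below \<open>k\<close> is preserved. The largest word is obtained
  by letting 0 - 1 wrap around, since the program must not depend on \<open>w\<close>.\<close>

fun comp_exp :: "exp \<Rightarrow> reg \<Rightarrow> instr list" where
  "comp_exp (Num c) k = [Const k c]"
| "comp_exp (Reg x) k = [Move k x]"
| "comp_exp MaxWord k = [Const k 0, Const (k + 1) 1, Bin Sub k k (k + 1)]"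
| "comp_exp (Op f a b) k = comp_exp a k @ comp_exp b (k + 1) @ [Bin f k k (k + 1)]"
| "comp_exp (Read A a) k = comp_exp a k @ [Load k A k]"

text \<open>Jump targets are absolute, hence the start address \<open>p\<close>. Truth values are
  materialized as 0 and 1, so that negation is 1 - x and conjunction a product; both conjuncts are
  always evaluated, which is why \<open>bsafe\<close> demands both.\<close>

fun comp_bexp :: "bexp \<Rightarrow> nat \<Rightarrow> reg \<Rightarrow> instr list" where
  "comp_bexp (Less a b) p k = (let c = comp_exp a k @ comp_exp b (k + 1); q = p + length c in
     c @ [JumpLess k (k + 1) (q + 3), Const k 0, Jump (q + 4), Const k 1])"
| "comp_bexp (Equal a b) p k = (let c = comp_exp a k @ comp_exp b (k + 1); q = p + length c in
     c @ [JumpEq k (k + 1) (q + 3), Const k 0, Jump (q + 4), Const k 1])"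
| "comp_bexp (Neg b) p k = comp_bexp b p k @ [Const (k + 1) 1, Bin Sub k (k + 1) k]"
| "comp_bexp (Conj a b) p k = (let c = comp_bexp a p k in
     c @ comp_bexp b (p + length c) (k + 1) @ [Bin Mul k k (k + 1)])"

fun comp :: "reg \<Rightarrow> com \<Rightarrow> nat \<Rightarrow> instr list" where
  "comp k Skip p = []"
| "comp k (x ::= e) p = comp_exp e k @ [Move x k]"
| "comp k (Write A a e) p = comp_exp a k @ comp_exp e (k + 1) @ [Store A k (k + 1)]"
| "comp k (c ;; c') p = (let d = comp k c p in d @ comp k c' (p + length d))"
| "comp k (If b c c') p =
    (let d = comp_bexp b p k; q = p + length d + 2; e = comp k c q; q' = q + length e + 1;
         e' = comp k c' q'
     in d @ [Const (k + 1) 0, JumpEq k (k + 1) q'] @ e @ [Jump (q' + length e')] @ e')"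
| "comp k (While b c) p =
    (let d = comp_bexp b p k; q = p + length d + 2; e = comp k c q
     in d @ [Const (k + 1) 0, JumpEq k (k + 1) (q + length e + 1)] @ e @ [Jump p])"

fun exp_regs :: "exp \<Rightarrow> reg set" where
  "exp_regs (Reg x) = {x}"
| "exp_regs (Op f a b) = exp_regs a \<union> exp_regs b"
| "exp_regs (Read A a) = exp_regs a"
| "exp_regs _ = {}"

fun bexp_regs :: "bexp \<Rightarrow> reg set" where
  "bexp_regs (Less a b) = exp_regs a \<union> exp_regs b"
| "bexp_regs (Equal a b) = exp_regs a \<union> exp_regs b"
| "bexp_regs (Neg b) = bexp_regs b"
| "bexp_regs (Conj a b) = bexp_regs a \<union> bexp_regs b"

fun com_regs :: "com \<Rightarrow> reg set" where
  "com_regs Skip = {}"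
| "com_regs (x ::= e) = insert x (exp_regs e)"
| "com_regs (Write A a e) = exp_regs a \<union> exp_regs e"
| "com_regs (c ;; c') = com_regs c \<union> com_regs c'"
| "com_regs (If b c c') = bexp_regs b \<union> com_regs c \<union> com_regs c'"
| "com_regs (While b c) = bexp_regs b \<union> com_regs c"

lemma finite_exp_regs: "finite (exp_regs e)"
  by (induction e) auto

lemma finite_bexp_regs: "finite (bexp_regs b)"
  by (induction b) (auto simp: finite_exp_regs)

lemma finite_com_regs: "finite (com_regs c)"
  by (induction c) (auto simp: finite_exp_regs finite_bexp_regs)

section \<open>Simulation of commands by compiled code\<close>

definition code_at :: "program \<Rightarrow> nat \<Rightarrow> instr list \<Rightarrow> bool" where
  "code_at P p c \<longleftrightarrow> p + length c \<le> length P \<and> (\<forall>i < length c. P ! (p + i) = c ! i)"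

lemma code_at_append [simp]:
  "code_at P p (c @ c') \<longleftrightarrow> code_at P p c \<and> code_at P (p + length c) c'"
  unfolding code_at_def
  apply (intro iffI conjI)
      apply (auto simp: nth_append all_conj_distrib)
   apply (metis add.assoc add_diff_cancel_left' add_less_cancel_left not_add_less1)
  by (metis add.assoc le_add_diff_inverse leI less_diff_conv2 add.commute)

lemma code_at_Cons [simp]:
  "code_at P p (i # c) \<longleftrightarrow> p < length P \<and> P ! p = i \<and> code_at P (Suc p) c"
  unfolding code_at_def by (auto simp: All_less_Suc2)

lemma code_at_Nil [simp]: "code_at P p [] \<longleftrightarrow> p \<le> length P"
  by (simp add: code_at_def)

text \<open>The address bound travels with the step count, so that one induction over the program
  yields both the time and the space bound.\<close>

inductive steps :: "nat \<Rightarrow> program \<Rightarrow> nat \<Rightarrow> nat \<Rightarrow> config \<Rightarrow> config \<Rightarrow> bool" for w P B where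
  steps_0: "steps w P B 0 s s"
| steps_Suc: "pc s < length P \<Longrightarrow> (\<And>A a. (A, a) \<in> instr_cells (P ! pc s) s \<Longrightarrow> a \<le> B) \<Longrightarrow>
    steps w P B k (exec_instr w (P ! pc s) s) s' \<Longrightarrow> steps w P B (Suc k) s s'"

lemma steps_trans:
  "steps w P B k s s' \<Longrightarrow> steps w P B k' s' s'' \<Longrightarrow> steps w P B (k + k') s s''"
  by (induction rule: steps.induct) (auto intro: steps.intros)

lemma steps_1:
  assumes "pc s < length P" "\<And>A a. (A, a) \<in> instr_cells (P ! pc s) s \<Longrightarrow> a \<le> B"
    "exec_instr w (P ! pc s) s = s'"
  shows "steps w P B 1 s s'"
  using assms unfolding One_nat_def by (auto intro!: steps_Suc steps_0)

text \<open>Registers below \<open>k\<close> are the variables of the source program; above, the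
  machine may hold arbitrary intermediate values.\<close>

definition agree :: "reg \<Rightarrow> regfile \<Rightarrow> regfile \<Rightarrow> bool" where
  "agree k r r' \<longleftrightarrow> (\<forall>x < k. r x = r' x)"

lemma val_agree:
  "exp_regs e \<subseteq> {..<k} \<Longrightarrow> agree k r r' \<Longrightarrow>
     val w e r m = val w e r' m \<and> safe w B e r m = safe w B e r' m"
  by (induction e) (auto simp: agree_def)

lemma bval_agree:
  "bexp_regs b \<subseteq> {..<k} \<Longrightarrow> agree k r r' \<Longrightarrow>
     bval w b r m = bval w b r' m \<and> bsafe w B b r m = bsafe w B b r' m"
proof (induction b)
  case (Less a b)
  then show ?case
    using val_agree[of a k r r' w m B] val_agree[of b k r r' w m B] by simp
next
  case (Equal a b)
  then show ?case
    using val_agree[of a k r r' w m B] val_agree[of b k r r' w m B] by simp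
qed auto

lemma op_val_eq: "op_safe w f x y \<Longrightarrow> eval_binop w f x y = op_val f x y"
  by (cases f) (auto simp: nat_diff_distrib' drop_bit_eq_div of_nat_diff[symmetric]
      simp flip: of_nat_diff intro!: nat_eq_iff[THEN iffD2])


lemma agree_refl [simp]: "agree k r r"
  by (simp add: agree_def)

lemma agree_trans: "agree k r r' \<Longrightarrow> agree k r' r'' \<Longrightarrow> agree k r r''"
  by (simp add: agree_def)

lemma agree_le: "agree k r r' \<Longrightarrow> k' \<le> k \<Longrightarrow> agree k' r r'"
  by (simp add: agree_def)

lemma agree_upd [simp]: "k \<le> x \<Longrightarrow> agree k r (r'(x := v)) = agree k r r'"
  by (auto simp: agree_def)

lemma agree_upd' [simp]: "k \<le> x \<Longrightarrow> agree k r (\<lambda>y. if y = x then v else r' y) = agree k r r'"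
  by (auto simp: agree_def)

lemma comp_exp_correct:
  assumes "code_at P (pc s) (comp_exp e k)" "exp_regs e \<subseteq> {..<k}"
    "safe w B e (regs s) (mem s)"
  shows "\<exists>s'. steps w P B (length (comp_exp e k)) s s' \<and>
    pc s' = pc s + length (comp_exp e k) \<and> regs s' k = val w e (regs s) (mem s) \<and>
    agree k (regs s) (regs s') \<and> mem s' = mem s"
  using assms
proof (induction e arbitrary: k s)
  case (Num c)
  then show ?case
    by (intro exI[of _ "exec_instr w (Const k c) s"] conjI)
      (auto intro: steps_1[simplified])
next
  case (Reg x)
  then show ?case
    by (intro exI[of _ "exec_instr w (Move k x) s"] conjI)
      (auto intro: steps_1[simplified])
next
  case MaxWord
  let ?s1 = "exec_instr w (Const k 0) s"
  let ?s2 = "exec_instr w (Const (k + 1) 1) ?s1"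
  let ?s3 = "exec_instr w (Bin Sub k k (k + 1)) ?s2"
  have "steps w P B (Suc (Suc (Suc 0))) s ?s3"
    using MaxWord by (intro steps_Suc) (auto intro: steps_0)
  moreover have "nat ((0 - int (1 mod 2 ^ w)) mod 2 ^ w) = 2 ^ w - 1"
  proof (cases w)
    case (Suc v)
    have "1 mod (2 * 2 ^ v) = (1::int)"
      using one_le_power[of "2::int" v] by (intro mod_pos_pos_trivial) linarith+
    with Suc show ?thesis
      by (simp add: zmod_zminus1_eq_if nat_diff_distrib' nat_mult_distrib nat_power_eq)
  qed simp
  ultimately show ?case
    by (intro exI[of _ ?s3]) simp
next
  case (Op f a b)
  from Op.prems obtain s1 where s1: "steps w P B (length (comp_exp a k)) s s1"
    "pc s1 = pc s + length (comp_exp a k)" "regs s1 k = val w a (regs s) (mem s)"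
    "agree k (regs s) (regs s1)" "mem s1 = mem s"
    using Op.IH(1)[of s k] by auto
  have agr: "val w b (regs s) (mem s) = val w b (regs s1) (mem s)"
    "safe w B b (regs s) (mem s) = safe w B b (regs s1) (mem s)"
    using Op.prems s1 val_agree[of b k "regs s" "regs s1" w "mem s" B] by auto
  have "\<exists>s'. steps w P B (length (comp_exp b (k + 1))) s1 s' \<and>
    pc s' = pc s1 + length (comp_exp b (k + 1)) \<and>
    regs s' (k + 1) = val w b (regs s1) (mem s1) \<and>
    agree (k + 1) (regs s1) (regs s') \<and> mem s' = mem s1"
    using Op.prems s1 agr by (intro Op.IH(2)) auto
  then obtain s2 where s2: "steps w P B (length (comp_exp b (k + 1))) s1 s2"
    "pc s2 = pc s1 + length (comp_exp b (k + 1))"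
    "regs s2 (k + 1) = val w b (regs s1) (mem s1)"
    "agree (k + 1) (regs s1) (regs s2)" "mem s2 = mem s1"
    by blast
  let ?s3 = "exec_instr w (Bin f k k (k + 1)) s2"
  have "steps w P B 1 s2 ?s3"
    using Op.prems s1 s2 by (intro steps_1) (auto simp: add.assoc)
  from steps_trans[OF s1(1) steps_trans[OF s2(1) this]]
  have "steps w P B (length (comp_exp (Op f a b) k)) s ?s3"
    by simp
  moreover have "regs s2 k = val w a (regs s) (mem s)"
    using s1 s2 by (simp add: agree_def)
  moreover have "agree k (regs s) (regs s2)"
    using s1(4) s2(4) by (meson agree_trans agree_le le_add1)
  ultimately show ?case
    using Op.prems s1 s2 agr
    by (intro exI[of _ ?s3]) (auto simp: op_val_eq)
next
  case (Read A a)
  from Read.prems obtain s1 where s1: "steps w P B (length (comp_exp a k)) s s1"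
    "pc s1 = pc s + length (comp_exp a k)" "regs s1 k = val w a (regs s) (mem s)"
    "agree k (regs s) (regs s1)" "mem s1 = mem s"
    using Read.IH[of s k] by auto
  let ?s2 = "exec_instr w (Load k A k) s1"
  have "steps w P B 1 s1 ?s2"
    using Read.prems s1 by (intro steps_1) auto
  from steps_trans[OF s1(1) this] have "steps w P B (length (comp_exp (Read A a) k)) s ?s2"
    by simp
  then show ?case
    using Read.prems s1 by (intro exI[of _ ?s2]) auto
qed

lemma comp_exp2_correct:
  assumes "code_at P (pc s) (comp_exp a k @ comp_exp b (k + 1))"
    "exp_regs a \<subseteq> {..<k}" "exp_regs b \<subseteq> {..<k}"
    "safe w B a (regs s) (mem s)" "safe w B b (regs s) (mem s)"
  shows "\<exists>s'. steps w P B (length (comp_exp a k @ comp_exp b (k + 1))) s s' \<and>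
    pc s' = pc s + length (comp_exp a k @ comp_exp b (k + 1)) \<and>
    regs s' k = val w a (regs s) (mem s) \<and> regs s' (k + 1) = val w b (regs s) (mem s) \<and>
    agree k (regs s) (regs s') \<and> mem s' = mem s"
proof -
  obtain s1 where s1: "steps w P B (length (comp_exp a k)) s s1"
    "pc s1 = pc s + length (comp_exp a k)" "regs s1 k = val w a (regs s) (mem s)"
    "agree k (regs s) (regs s1)" "mem s1 = mem s"
    using assms comp_exp_correct[of P s a k w B] by auto
  have agr: "val w b (regs s) (mem s) = val w b (regs s1) (mem s)"
    "safe w B b (regs s) (mem s) = safe w B b (regs s1) (mem s)"
    using assms s1 val_agree[of b k "regs s" "regs s1" w "mem s" B] by auto
  have "\<exists>s'. steps w P B (length (comp_exp b (k + 1))) s1 s' \<and>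
    pc s' = pc s1 + length (comp_exp b (k + 1)) \<and>
    regs s' (k + 1) = val w b (regs s1) (mem s1) \<and>
    agree (k + 1) (regs s1) (regs s') \<and> mem s' = mem s1"
    using assms s1 agr by (intro comp_exp_correct) auto
  then obtain s2 where s2: "steps w P B (length (comp_exp b (k + 1))) s1 s2"
    "pc s2 = pc s1 + length (comp_exp b (k + 1))"
    "regs s2 (k + 1) = val w b (regs s1) (mem s1)"
    "agree (k + 1) (regs s1) (regs s2)" "mem s2 = mem s1"
    by blast
  have "regs s2 k = val w a (regs s) (mem s)"
    using s1 s2 by (simp add: agree_def)
  moreover have "agree k (regs s) (regs s2)"
    using s1(4) s2(4) by (meson agree_trans agree_le le_add1)
  ultimately show ?thesis
    using s1 s2 agr steps_trans[OF s1(1) s2(1)] by (intro exI[of _ s2]) auto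
qed

text \<open>\<open>Q\<close> stands for either comparison, so that \<open>Less\<close> and
  \<open>Equal\<close> share the case analysis on the four-instruction epilogue. With
  \<open>w = 0\<close> the constant 1 would be stored as 0.\<close>

lemma test_correct:
  assumes "code_at P (pc s) [J, Const k 0, Jump (pc s + 4), Const k 1]"
    and J: "\<And>s'. exec_instr w J s' = s'\<lparr>pc := if Q s' then pc s + 3 else pc s' + 1\<rparr>"
      "\<And>s'. instr_cells J s' = {}"
    and "w > 0"
  shows "\<exists>s' j. j \<le> 4 \<and> steps w P B j s s' \<and> pc s' = pc s + 4 \<and>
    regs s' = (regs s)(k := if Q s then 1 else 0) \<and> mem s' = mem s"
proof (cases "Q s")
  case True
  let ?s1 = "exec_instr w J s"
  let ?s2 = "exec_instr w (Const k 1) ?s1"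
  have "steps w P B (Suc (Suc 0)) s ?s2"
    using assms True by (intro steps_Suc) (auto intro: steps_0 simp: numeral_eq_Suc)
  then show ?thesis
    using True \<open>w > 0\<close> by (intro exI[of _ ?s2] exI[of _ 2]) (auto simp: J numeral_2_eq_2)
next
  case False
  let ?s1 = "exec_instr w J s"
  let ?s2 = "exec_instr w (Const k 0) ?s1"
  let ?s3 = "exec_instr w (Jump (pc s + 4)) ?s2"
  have "steps w P B (Suc (Suc (Suc 0))) s ?s3"
    using assms False by (intro steps_Suc) (auto intro: steps_0 simp: numeral_eq_Suc)
  then show ?thesis
    using False by (intro exI[of _ ?s3] exI[of _ 3]) (auto simp: J numeral_3_eq_3)
qed

lemma comp_bexp_correct:
  assumes "code_at P (pc s) (comp_bexp b (pc s) k)" "bexp_regs b \<subseteq> {..<k}"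
    "bsafe w B b (regs s) (mem s)" "w > 0"
  shows "\<exists>s' j. j \<le> length (comp_bexp b (pc s) k) \<and> steps w P B j s s' \<and>
    pc s' = pc s + length (comp_bexp b (pc s) k) \<and>
    regs s' k = (if bval w b (regs s) (mem s) then 1 else 0) \<and>
    agree k (regs s) (regs s') \<and> mem s' = mem s"
  using assms(1-3)
proof (induction b arbitrary: k s)
  case (Less a b)
  let ?c = "comp_exp a k @ comp_exp b (k + 1)"
  obtain s1 where s1: "steps w P B (length ?c) s s1" "pc s1 = pc s + length ?c"
    "regs s1 k = val w a (regs s) (mem s)" "regs s1 (k + 1) = val w b (regs s) (mem s)"
    "agree k (regs s) (regs s1)" "mem s1 = mem s"
    using Less.prems comp_exp2_correct[of P s a k b w B] by (auto simp: Let_def)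
  have "\<exists>s' j. j \<le> 4 \<and> steps w P B j s1 s' \<and> pc s' = pc s1 + 4 \<and>
    regs s' = (regs s1)(k := if regs s1 k < regs s1 (k + 1) then 1 else 0) \<and> mem s' = mem s1"
    using Less.prems s1 \<open>w > 0\<close>
    by (intro test_correct[where J = "JumpLess k (k + 1) (pc s1 + 3)"])
      (auto simp: Let_def add.assoc)
  then obtain s2 j where s2: "j \<le> 4" "steps w P B j s1 s2" "pc s2 = pc s1 + 4"
    "regs s2 = (regs s1)(k := if regs s1 k < regs s1 (k + 1) then 1 else 0)" "mem s2 = mem s1"
    by blast
  show ?case
    using s1 s2 steps_trans[OF s1(1) s2(2)]
    by (intro exI[of _ s2] exI[of _ "length ?c + j"]) (auto simp: Let_def)
next
  case (Equal a b)
  let ?c = "comp_exp a k @ comp_exp b (k + 1)"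
  obtain s1 where s1: "steps w P B (length ?c) s s1" "pc s1 = pc s + length ?c"
    "regs s1 k = val w a (regs s) (mem s)" "regs s1 (k + 1) = val w b (regs s) (mem s)"
    "agree k (regs s) (regs s1)" "mem s1 = mem s"
    using Equal.prems comp_exp2_correct[of P s a k b w B] by (auto simp: Let_def)
  have "\<exists>s' j. j \<le> 4 \<and> steps w P B j s1 s' \<and> pc s' = pc s1 + 4 \<and>
    regs s' = (regs s1)(k := if regs s1 k = regs s1 (k + 1) then 1 else 0) \<and> mem s' = mem s1"
    using Equal.prems s1 \<open>w > 0\<close>
    by (intro test_correct[where J = "JumpEq k (k + 1) (pc s1 + 3)"])
      (auto simp: Let_def add.assoc)
  then obtain s2 j where s2: "j \<le> 4" "steps w P B j s1 s2" "pc s2 = pc s1 + 4"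
    "regs s2 = (regs s1)(k := if regs s1 k = regs s1 (k + 1) then 1 else 0)" "mem s2 = mem s1"
    by blast
  show ?case
    using s1 s2 steps_trans[OF s1(1) s2(2)]
    by (intro exI[of _ s2] exI[of _ "length ?c + j"]) (auto simp: Let_def)
next
  case (Neg b)
  from Neg.prems obtain s1 j where s1: "j \<le> length (comp_bexp b (pc s) k)" "steps w P B j s s1"
    "pc s1 = pc s + length (comp_bexp b (pc s) k)"
    "regs s1 k = (if bval w b (regs s) (mem s) then 1 else 0)"
    "agree k (regs s) (regs s1)" "mem s1 = mem s"
    using Neg.IH[of s k] by auto
  let ?s2 = "exec_instr w (Const (k + 1) 1) s1"
  let ?s3 = "exec_instr w (Bin Sub k (k + 1) k) ?s2"
  have "steps w P B (Suc (Suc 0)) s1 ?s3"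
    using Neg.prems s1 by (intro steps_Suc) (auto intro: steps_0)
  from steps_trans[OF s1(2) this] show ?case
    using s1 \<open>w > 0\<close>
    by (intro exI[of _ ?s3] exI[of _ "j + 2"]) (auto simp: numeral_2_eq_2)
next
  case (Conj a b)
  let ?c = "comp_bexp a (pc s) k"
  from Conj.prems obtain s1 i where s1: "i \<le> length ?c" "steps w P B i s s1"
    "pc s1 = pc s + length ?c"
    "regs s1 k = (if bval w a (regs s) (mem s) then 1 else 0)"
    "agree k (regs s) (regs s1)" "mem s1 = mem s"
    using Conj.IH(1)[of s k] by (auto simp: Let_def)
  have agr: "bval w b (regs s) (mem s) = bval w b (regs s1) (mem s)"
    "bsafe w B b (regs s) (mem s) = bsafe w B b (regs s1) (mem s)"
    using Conj.prems s1 bval_agree[of b k "regs s" "regs s1" w "mem s" B] by auto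
  let ?d = "comp_bexp b (pc s1) (k + 1)"
  have "\<exists>s' j. j \<le> length ?d \<and> steps w P B j s1 s' \<and> pc s' = pc s1 + length ?d \<and>
    regs s' (k + 1) = (if bval w b (regs s1) (mem s1) then 1 else 0) \<and>
    agree (k + 1) (regs s1) (regs s') \<and> mem s' = mem s1"
    using Conj.prems s1 agr by (intro Conj.IH(2)) (auto simp: Let_def)
  then obtain s2 j where s2: "j \<le> length ?d" "steps w P B j s1 s2" "pc s2 = pc s1 + length ?d"
    "regs s2 (k + 1) = (if bval w b (regs s1) (mem s1) then 1 else 0)"
    "agree (k + 1) (regs s1) (regs s2)" "mem s2 = mem s1"
    by blast
  let ?s3 = "exec_instr w (Bin Mul k k (k + 1)) s2"
  have "steps w P B 1 s2 ?s3"
    using Conj.prems s1 s2 by (intro steps_1) (auto simp: Let_def add.assoc)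
  from steps_trans[OF s1(2) steps_trans[OF s2(2) this]]
  have "steps w P B (i + (j + 1)) s ?s3" .
  moreover have "regs s2 k = (if bval w a (regs s) (mem s) then 1 else 0)"
    using s1 s2 by (simp add: agree_def)
  moreover have "agree k (regs s) (regs s2)"
    using s1(5) s2(5) by (meson agree_trans agree_le le_add1)
  ultimately show ?case
    using s1 s2 agr \<open>w > 0\<close>
    by (intro exI[of _ ?s3] exI[of _ "i + (j + 1)"]) (auto simp: Let_def)
qed


text \<open>Between two ticks every instruction of the code runs at most once. The ticks cut the run
  into one more stretch than their number, hence the \<open>Suc\<close> in the bound.\<close>

lemma comp_correct:
  assumes "exec w B c \<sigma> \<sigma>'" "w > 0" "com_regs c \<subseteq> {..<k}"
    "code_at P (pc s) (comp k c (pc s))" "agree k (fst \<sigma>) (regs s)" "fst (snd \<sigma>) = mem s"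
  shows "\<exists>s' j. j \<le> length (comp k c (pc s)) * Suc (snd (snd \<sigma>') - snd (snd \<sigma>)) \<and>
    steps w P B j s s' \<and> pc s' = pc s + length (comp k c (pc s)) \<and>
    agree k (fst \<sigma>') (regs s') \<and> fst (snd \<sigma>') = mem s'"
  using assms
proof (induction arbitrary: s rule: exec.induct)
  case (Skip \<sigma>)
  then show ?case
    by (intro exI[of _ s] exI[of _ 0]) (auto intro: steps_0)
next
  case (Assign e r m x t)
  have agr: "val w e r m = val w e (regs s) (mem s)" "safe w B e (regs s) (mem s)"
    using Assign val_agree[of e k r "regs s" w m B] by auto
  obtain s1 where s1: "steps w P B (length (comp_exp e k)) s s1"
    "pc s1 = pc s + length (comp_exp e k)" "regs s1 k = val w e (regs s) (mem s)"
    "agree k (regs s) (regs s1)" "mem s1 = mem s"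
    using Assign agr comp_exp_correct[of P s e k w B] by auto
  let ?s2 = "exec_instr w (Move x k) s1"
  have "steps w P B 1 s1 ?s2"
    using Assign.prems s1 by (intro steps_1) auto
  from steps_trans[OF s1(1) this] show ?case
    using Assign s1 agr
    by (intro exI[of _ ?s2] exI[of _ "length (comp_exp e k) + 1"]) (auto simp: agree_def)
next
  case (Write a r m e A t)
  let ?c = "comp_exp a k @ comp_exp e (k + 1)"
  have agr: "val w e r m = val w e (regs s) (mem s)" "safe w B e (regs s) (mem s)"
    "val w a r m = val w a (regs s) (mem s)" "safe w B a (regs s) (mem s)"
    using Write val_agree[of e k r "regs s" w m B] val_agree[of a k r "regs s" w m B] by auto
  obtain s1 where s1: "steps w P B (length ?c) s s1" "pc s1 = pc s + length ?c"
    "regs s1 k = val w a (regs s) (mem s)" "regs s1 (k + 1) = val w e (regs s) (mem s)"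
    "agree k (regs s) (regs s1)" "mem s1 = mem s"
    using Write agr comp_exp2_correct[of P s a k e w B] by auto
  let ?s2 = "exec_instr w (Store A k (k + 1)) s1"
  have "steps w P B 1 s1 ?s2"
    using Write s1 agr by (intro steps_1) (auto simp: add.assoc)
  from steps_trans[OF s1(1) this] show ?case
    using Write s1 agr
    by (intro exI[of _ ?s2] exI[of _ "length ?c + 1"]) (auto simp: agree_def)
next
  case (Seq c \<sigma> \<sigma>1 c' \<sigma>2)
  let ?c = "comp k c (pc s)"
  from Seq.prems obtain s1 i where s1:
    "i \<le> length ?c * Suc (snd (snd \<sigma>1) - snd (snd \<sigma>))" "steps w P B i s s1"
    "pc s1 = pc s + length ?c" "agree k (fst \<sigma>1) (regs s1)" "fst (snd \<sigma>1) = mem s1"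
    using Seq.IH(1)[of s] by (auto simp: Let_def)
  let ?d = "comp k c' (pc s1)"
  from Seq.prems s1 obtain s2 j where s2:
    "j \<le> length ?d * Suc (snd (snd \<sigma>2) - snd (snd \<sigma>1))" "steps w P B j s1 s2"
    "pc s2 = pc s1 + length ?d" "agree k (fst \<sigma>2) (regs s2)" "fst (snd \<sigma>2) = mem s2"
    using Seq.IH(2)[of s1] by (auto simp: Let_def)
  have le: "snd (snd \<sigma>) \<le> snd (snd \<sigma>1)" "snd (snd \<sigma>1) \<le> snd (snd \<sigma>2)"
    using Seq.hyps exec_ticks_mono by blast+
  have "i + j \<le> length ?c * Suc (snd (snd \<sigma>2) - snd (snd \<sigma>)) +
     length ?d * Suc (snd (snd \<sigma>2) - snd (snd \<sigma>))"
    using le by (intro add_mono order.trans[OF s1(1)] order.trans[OF s2(1)] mult_le_mono) auto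
  then show ?case
    using s1 s2 steps_trans[OF s1(2) s2(2)]
    by (intro exI[of _ s2] exI[of _ "i + j"]) (auto simp: Let_def algebra_simps)
next
  case (IfTrue b r m c t \<sigma>' c')
  let ?b = "comp_bexp b (pc s) k"
  have agr: "bsafe w B b (regs s) (mem s)" "bval w b (regs s) (mem s)"
    using IfTrue bval_agree[of b k r "regs s" w m B] by auto
  obtain s1 i where s1: "i \<le> length ?b" "steps w P B i s s1" "pc s1 = pc s + length ?b"
    "regs s1 k = 1" "agree k (regs s) (regs s1)" "mem s1 = mem s"
    using IfTrue.prems agr comp_bexp_correct[of P s b k w B] by (auto simp: Let_def)
  let ?c = "comp k c (pc s1 + 2)"
  let ?c' = "comp k c' (pc s1 + 2 + length ?c + 1)"
  let ?s2 = "exec_instr w (Const (k + 1) 0) s1"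
  let ?s3 = "exec_instr w (JumpEq k (k + 1) (pc s1 + 2 + length ?c + 1)) ?s2"
  have st3: "steps w P B (Suc (Suc 0)) s1 ?s3"
    using IfTrue.prems s1 by (intro steps_Suc) (auto simp: Let_def add.assoc intro: steps_0)
  have s3: "pc ?s3 = pc s1 + 2" "agree k (regs s) (regs ?s3)" "mem ?s3 = mem s"
    using s1 by auto
  have "agree k r (regs ?s3)"
    using s3(2) IfTrue.prems agree_trans by force
  with IfTrue.prems s1 s3 obtain s4 j where s4:
    "j \<le> length ?c * Suc (snd (snd \<sigma>') - t)" "steps w P B j ?s3 s4"
    "pc s4 = pc s1 + 2 + length ?c" "agree k (fst \<sigma>') (regs s4)" "fst (snd \<sigma>') = mem s4"
    using IfTrue.IH[of ?s3] by (auto simp: Let_def add.assoc)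
  let ?s5 = "exec_instr w (Jump (pc s4 + 1 + length ?c')) s4"
  have "steps w P B 1 s4 ?s5"
    using IfTrue.prems s1 s4 by (intro steps_1) (auto simp: Let_def add.assoc)
  from steps_trans[OF s1(2) steps_trans[OF st3 steps_trans[OF s4(2) this]]] show ?case
    using s1 s4
    by (intro exI[of _ ?s5] exI[of _ "i + (Suc (Suc 0) + (j + 1))"])
      (auto simp: Let_def algebra_simps)
next
  case (IfFalse b r m c' t \<sigma>' c)
  let ?b = "comp_bexp b (pc s) k"
  have agr: "bsafe w B b (regs s) (mem s)" "\<not> bval w b (regs s) (mem s)"
    using IfFalse bval_agree[of b k r "regs s" w m B] by auto
  obtain s1 i where s1: "i \<le> length ?b" "steps w P B i s s1" "pc s1 = pc s + length ?b"
    "regs s1 k = 0" "agree k (regs s) (regs s1)" "mem s1 = mem s"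
    using IfFalse.prems agr comp_bexp_correct[of P s b k w B] by (auto simp: Let_def)
  let ?c = "comp k c (pc s1 + 2)"
  let ?q = "pc s1 + 2 + length ?c + 1"
  let ?c' = "comp k c' ?q"
  let ?s2 = "exec_instr w (Const (k + 1) 0) s1"
  let ?s3 = "exec_instr w (JumpEq k (k + 1) ?q) ?s2"
  have st3: "steps w P B (Suc (Suc 0)) s1 ?s3"
    using IfFalse.prems s1 by (intro steps_Suc) (auto simp: Let_def add.assoc intro: steps_0)
  have s3: "pc ?s3 = ?q" "agree k (regs s) (regs ?s3)" "mem ?s3 = mem s"
    using s1 by auto
  have "agree k r (regs ?s3)"
    using s3(2) IfFalse.prems agree_trans by force
  with IfFalse.prems s1 s3 obtain s4 j where s4:
    "j \<le> length ?c' * Suc (snd (snd \<sigma>') - t)" "steps w P B j ?s3 s4"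
    "pc s4 = ?q + length ?c'" "agree k (fst \<sigma>') (regs s4)" "fst (snd \<sigma>') = mem s4"
    using IfFalse.IH[of ?s3] by (auto simp: Let_def add.assoc)
  from steps_trans[OF s1(2) steps_trans[OF st3 s4(2)]] show ?case
    using s1 s4
    by (intro exI[of _ s4] exI[of _ "i + (Suc (Suc 0) + j)"])
      (auto simp: Let_def algebra_simps)
next
  case (WhileFalse b r m c t)
  let ?b = "comp_bexp b (pc s) k"
  have agr: "bsafe w B b (regs s) (mem s)" "\<not> bval w b (regs s) (mem s)"
    using WhileFalse bval_agree[of b k r "regs s" w m B] by auto
  obtain s1 i where s1: "i \<le> length ?b" "steps w P B i s s1" "pc s1 = pc s + length ?b"
    "regs s1 k = 0" "agree k (regs s) (regs s1)" "mem s1 = mem s"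
    using WhileFalse.prems agr comp_bexp_correct[of P s b k w B] by (auto simp: Let_def)
  let ?c = "comp k c (pc s1 + 2)"
  let ?q = "pc s1 + 2 + length ?c + 1"
  let ?s2 = "exec_instr w (Const (k + 1) 0) s1"
  let ?s3 = "exec_instr w (JumpEq k (k + 1) ?q) ?s2"
  have st3: "steps w P B (Suc (Suc 0)) s1 ?s3"
    using WhileFalse.prems s1 by (intro steps_Suc) (auto simp: Let_def add.assoc intro: steps_0)
  have s3: "pc ?s3 = ?q" "agree k (regs s) (regs ?s3)" "mem ?s3 = mem s"
    using s1 by auto
  have "agree k r (regs ?s3)"
    using s3(2) WhileFalse.prems agree_trans by force
  with steps_trans[OF s1(2) st3] show ?case
    using s1 s3 WhileFalse.prems
    by (intro exI[of _ ?s3] exI[of _ "i + Suc (Suc 0)"])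
      (auto simp: Let_def algebra_simps)
next
  case (WhileTrue b r m c t \<sigma>1 \<sigma>2)
  let ?b = "comp_bexp b (pc s) k"
  have agr: "bsafe w B b (regs s) (mem s)" "bval w b (regs s) (mem s)"
    using WhileTrue bval_agree[of b k r "regs s" w m B] by auto
  obtain s1 i where s1: "i \<le> length ?b" "steps w P B i s s1" "pc s1 = pc s + length ?b"
    "regs s1 k = 1" "agree k (regs s) (regs s1)" "mem s1 = mem s"
    using WhileTrue.prems agr comp_bexp_correct[of P s b k w B] by (auto simp: Let_def)
  let ?c = "comp k c (pc s1 + 2)"
  let ?q = "pc s1 + 2 + length ?c + 1"
  let ?s2 = "exec_instr w (Const (k + 1) 0) s1"
  let ?s3 = "exec_instr w (JumpEq k (k + 1) ?q) ?s2"
  have st3: "steps w P B (Suc (Suc 0)) s1 ?s3"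
    using WhileTrue.prems s1 by (intro steps_Suc) (auto simp: Let_def add.assoc intro: steps_0)
  have s3: "pc ?s3 = pc s1 + 2" "agree k (regs s) (regs ?s3)" "mem ?s3 = mem s"
    using s1 by auto
  have "agree k r (regs ?s3)"
    using s3(2) WhileTrue.prems agree_trans by force
  with WhileTrue.prems s1 s3 obtain s4 j where s4:
    "j \<le> length ?c * Suc (snd (snd \<sigma>1) - Suc t)" "steps w P B j ?s3 s4"
    "pc s4 = pc s1 + 2 + length ?c" "agree k (fst \<sigma>1) (regs s4)" "fst (snd \<sigma>1) = mem s4"
    using WhileTrue.IH(1)[of ?s3] by (auto simp: Let_def add.assoc)
  let ?s5 = "exec_instr w (Jump (pc s)) s4"
  have st5: "steps w P B 1 s4 ?s5"
    using WhileTrue.prems s1 s4 by (intro steps_1) (auto simp: Let_def add.assoc)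
  let ?w = "comp k (While b c) (pc s)"
  have s5: "pc ?s5 = pc s" "agree k (fst \<sigma>1) (regs ?s5)" "fst (snd \<sigma>1) = mem ?s5"
    using s4 by auto
  obtain s6 j' where s6: "j' \<le> length ?w * Suc (snd (snd \<sigma>2) - snd (snd \<sigma>1))"
    "steps w P B j' ?s5 s6" "pc s6 = pc s + length ?w"
    "agree k (fst \<sigma>2) (regs s6)" "fst (snd \<sigma>2) = mem s6"
    using WhileTrue.IH(2)[OF WhileTrue.prems(1,2), of ?s5] WhileTrue.prems s5
    unfolding s5(1) by blast
  have le: "Suc t \<le> snd (snd \<sigma>1)" "snd (snd \<sigma>1) \<le> snd (snd \<sigma>2)"
    using WhileTrue.hyps exec_ticks_mono by fastforce+
  have len: "length ?w = length ?b + 3 + length ?c"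
    using s1 by (simp add: Let_def)
  have "i + (Suc (Suc 0) + (j + (1 + j'))) \<le> length ?b + 3 +
      length ?c * Suc (snd (snd \<sigma>1) - Suc t) + j'"
    using s1 s4 by simp
  also have "\<dots> \<le> length ?w * Suc (snd (snd \<sigma>1) - Suc t) + j'"
    unfolding len by (simp add: algebra_simps)
  also have "\<dots> \<le> length ?w * Suc (snd (snd \<sigma>1) - Suc t) +
      length ?w * Suc (snd (snd \<sigma>2) - snd (snd \<sigma>1))"
    using s6(1) by simp
  \<comment> \<open>The tick of this iteration supplies the extra \<open>Suc\<close> of the second
    summand: \<open>Suc (t1 - Suc t) + Suc (t2 - t1) = Suc (t2 - t)\<close>.\<close>
  also have "\<dots> = length ?w * Suc (snd (snd \<sigma>2) - t)"
    unfolding add_mult_distrib2[symmetric] using le by (intro arg_cong2[where f = "(*)"]) auto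
  finally show ?case
    using steps_trans[OF s1(2) steps_trans[OF st3 steps_trans[OF s4(2) steps_trans[OF st5 s6(2)]]]] s6
    by (intro exI[of _ s6] exI[of _ "i + (Suc (Suc 0) + (j + (1 + j')))"]) auto
qed


lemma steps_run:
  "steps w P B j s s' \<Longrightarrow> run w P j s = s' \<and> (\<forall>t < j. \<not> halted P (run w P t s) \<and>
     (\<forall>(A, a) \<in> instr_cells (P ! pc (run w P t s)) (run w P t s). a \<le> B))"
proof (induction rule: steps.induct)
  case (steps_0 s)
  then show ?case by (simp add: run_def)
next
  case (steps_Suc s k s')
  have "run w P (Suc t) s = run w P t (exec_instr w (P ! pc s) s)" for t
    using steps_Suc.hyps by (simp add: run_def funpow_Suc_right step_def halted_def del: funpow.simps)
  moreover have "run w P 0 s = s"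
    by (simp add: run_def)
  ultimately show ?case
    using steps_Suc by (auto simp: All_less_Suc2 halted_def)
qed

fun instr_arrs :: "instr \<Rightarrow> arr set" where
  "instr_arrs (Load d A x) = {A}"
| "instr_arrs (Store A x y) = {A}"
| "instr_arrs _ = {}"

lemma instr_cells_arrs: "(A, a) \<in> instr_cells i s \<Longrightarrow> A \<in> instr_arrs i"
  by (cases i) auto

text \<open>Space is charged per array up to its largest address. The program mentions finitely many
  arrays and all addresses are at most \<open>B\<close>, so the space is linear in \<open>B\<close>,
  with a constant read off the code.\<close>

theorem compile_correct:
  fixes c :: com
  shows "\<exists>P C. \<forall>w B r m r' m' t. w > 0 \<and> exec w B c (r, m, 0) (r', m', t) \<longrightarrow>
    halts w P \<lparr>pc = 0, regs = r, mem = m\<rparr> \<and>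
    (\<forall>x \<in> com_regs c. regs (result w P \<lparr>pc = 0, regs = r, mem = m\<rparr>) x = r' x) \<and>
    mem (result w P \<lparr>pc = 0, regs = r, mem = m\<rparr>) = m' \<and>
    run_time w P \<lparr>pc = 0, regs = r, mem = m\<rparr> \<le> C * Suc t \<and>
    run_space w P \<lparr>pc = 0, regs = r, mem = m\<rparr> \<le> C * Suc B"
proof -
  obtain k where k: "com_regs c \<subseteq> {..<k}"
    using finite_com_regs[of c] finite_nat_set_iff_bounded[of "com_regs c"] by auto
  define P where "P = comp k c 0"
  define arrs where "arrs = (\<Union>i \<in> set P. instr_arrs i)"
  define C where "C = length P + card (\<Union>i \<in> set P. instr_regs i) + card arrs"
  have fin: "finite arrs"
  proof -
    have "finite (instr_arrs i)" for i by (cases i) auto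
    then show ?thesis by (simp add: arrs_def)
  qed
  have "halts w P s \<and> (\<forall>x \<in> com_regs c. regs (result w P s) x = r' x) \<and>
      mem (result w P s) = m' \<and> run_time w P s \<le> C * Suc t \<and> run_space w P s \<le> C * Suc B"
    if w: "w > 0" and ex: "exec w B c (r, m, 0) (r', m', t)" and s: "s = \<lparr>pc = 0, regs = r, mem = m\<rparr>"
    for w B r m r' m' t s
  proof -
    have "code_at P (pc s) (comp k c (pc s))"
      by (simp add: s P_def code_at_def)
    from comp_correct[OF ex w k this] obtain s' j where
      j: "j \<le> length P * Suc t" "steps w P B j s s'" "pc s' = length P"
        "agree k r' (regs s')" "m' = mem s'"
      by (auto simp: s P_def)
    note run = steps_run[OF j(2)]
    have halt: "halted P (run w P j s)"
      using run j(3) by (simp add: halted_def)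
    have rt: "run_time w P s = j"
      unfolding run_time_def using run halt by (intro Least_equality) (auto simp: not_less[symmetric])
    have "result w P s = s'"
      using run by (simp add: result_def rt)
    moreover have "halts w P s"
      using halt by (auto simp: halts_def)
    moreover have "\<forall>x \<in> com_regs c. regs s' x = r' x"
      using j(4) k by (auto simp: agree_def)
    moreover have "run_time w P s \<le> C * Suc t"
      using j(1) mult_le_mono1[of "length P" C "Suc t"] by (simp add: rt C_def)
    moreover have "run_space w P s \<le> C * Suc B"
    proof -
      have acc: "accessed w P s \<subseteq> arrs \<times> {..B}"
      proof safe
        fix A a assume "(A, a) \<in> accessed w P s"
        then obtain u where u: "u < j" "(A, a) \<in> instr_cells (P ! pc (run w P u s)) (run w P u s)"
          by (auto simp: accessed_def rt Let_def)
        then have "pc (run w P u s) < length P" "a \<le> B"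
          using run by (auto simp: halted_def not_le)
        then show "A \<in> arrs" "a \<le> B"
          using instr_cells_arrs[OF u(2)] by (auto simp: arrs_def)
      qed
      have "{(A, a). \<exists>b \<ge> a. (A, b) \<in> accessed w P s} \<subseteq> arrs \<times> {..B}"
        using acc by fastforce
      then have "card {(A, a). \<exists>b \<ge> a. (A, b) \<in> accessed w P s} \<le> card (arrs \<times> {..B})"
        using fin by (intro card_mono) auto
      then have "run_space w P s \<le> card (\<Union>i \<in> set P. instr_regs i) + card arrs * Suc B"
        by (simp add: run_space_def card_cartesian_product)
      also have "\<dots> \<le> C * Suc B"
        unfolding C_def by (simp add: algebra_simps)
      finally show ?thesis .
    qed
    ultimately show ?thesis
      using j(5) by simp
  qed
  then show ?thesis by blast
qed


subsection \<open>Weakest preconditions\<close>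

type_synonym assn = "regfile \<Rightarrow> memory \<Rightarrow> nat \<Rightarrow> bool"

definition wp :: "nat \<Rightarrow> nat \<Rightarrow> com \<Rightarrow> assn \<Rightarrow> assn" where
  "wp w B c Q r m t \<longleftrightarrow> (\<exists>r' m' t'. exec w B c (r, m, t) (r', m', t') \<and> Q r' m' t')"

lemma wp_Assign:
  "safe w B e r m \<Longrightarrow> Q (r(x := val w e r m)) m t \<Longrightarrow> wp w B (x ::= e) Q r m t"
  unfolding wp_def by (blast intro: exec.Assign)

lemma wp_Seq: "wp w B c (wp w B c' Q) r m t \<Longrightarrow> wp w B (c ;; c') Q r m t"
  unfolding wp_def by (blast intro: exec.Seq)

lemma wp_If:
  assumes "bsafe w B b r m" "bval w b r m \<Longrightarrow> wp w B c Q r m t" "\<not> bval w b r m \<Longrightarrow> wp w B c' Q r m t"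
  shows "wp w B (If b c c') Q r m t"
  using assms unfolding wp_def by (cases "bval w b r m") (blast intro: exec.IfTrue exec.IfFalse)+

lemma wp_mono: "wp w B c Q r m t \<Longrightarrow> (\<And>r m t. Q r m t \<Longrightarrow> Q' r m t) \<Longrightarrow> wp w B c Q' r m t"
  unfolding wp_def by blast

text \<open>Every iteration ticks, so a bound \<open>T\<close> on the tick counter ensures termination.\<close>

lemma wp_While:
  assumes "I r m t"
    and safe: "\<And>r m t. I r m t \<Longrightarrow> bsafe w B b r m"
    and step: "\<And>r m t. I r m t \<Longrightarrow> bval w b r m \<Longrightarrow> t < T \<and> wp w B c I r m (Suc t)"
    and exit: "\<And>r m t. I r m t \<Longrightarrow> \<not> bval w b r m \<Longrightarrow> Q r m t"
  shows "wp w B (While b c) Q r m t"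
  using assms(1)
proof (induction "T - t" arbitrary: r m t rule: less_induct)
  case less
  note sf = safe[OF less.prems]
  show ?case
  proof (cases "bval w b r m")
    case True
    from step[OF less.prems True] obtain r' m' t' where
      ex: "t < T" "exec w B c (r, m, Suc t) (r', m', t')" "I r' m' t'"
      unfolding wp_def by blast
    have "T - t' < T - t"
      using exec_ticks_mono[OF ex(2)] ex(1) by auto
    from less.hyps[OF this ex(3)] show ?thesis
      using exec.WhileTrue[OF sf True ex(2)] unfolding wp_def by blast
  next
    case False
    then show ?thesis
      using exec.WhileFalse[OF sf False] exit[OF less.prems False] unfolding wp_def by blast
  qed
qed

definition For :: "reg \<Rightarrow> exp \<Rightarrow> exp \<Rightarrow> com \<Rightarrow> com" where
  "For x a b c = (x ::= a ;; While (Less (Reg x) b) (c ;; x ::= Op Add (Reg x) (Num 1)))"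

text \<open>The invariant receives the counter as a separate argument, so that the body can be
  verified before the register is incremented. The bound expression is reevaluated in every round
  and must keep the value \<open>h\<close>.\<close>

lemma wp_For:
  assumes sa: "safe w B a r m" and le: "val w a r m \<le> h" and h: "h < 2 ^ w"
    and init: "I (val w a r m) (r(x := val w a r m)) m t"
    and bound: "\<And>i r m t. I i r m t \<Longrightarrow> safe w B b r m \<and> val w b r m = h"
    and step: "\<And>i r m t. I i r m t \<Longrightarrow> i < h \<Longrightarrow> r x = i \<Longrightarrow>
      t < T \<and> wp w B c (\<lambda>r m t. r x = i \<and> I (Suc i) (r(x := Suc i)) m t) r m (Suc t)"
    and exit: "\<And>r m t. I h r m t \<Longrightarrow> r x = h \<Longrightarrow> Q r m t"
  shows "wp w B (For x a b c) Q r m t"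
  unfolding For_def
proof (rule wp_Seq, rule wp_Assign[OF sa], rule wp_While[where I = "\<lambda>r m t. I (r x) r m t \<and> r x \<le> h" and T = T])
  show "I ((r(x := val w a r m)) x) (r(x := val w a r m)) m t \<and> (r(x := val w a r m)) x \<le> h"
    using init le by simp
next
  fix r m t assume I: "I (r x) r m t \<and> r x \<le> h"
  then show "bsafe w B (Less (Reg x) b) r m"
    using bound[of "r x" r m t] by simp
  assume "bval w (Less (Reg x) b) r m"
  then have lt: "r x < h"
    using bound I by auto
  show "t < T \<and> wp w B (c;; x ::= Op Add (Reg x) (Num 1)) (\<lambda>r m t. I (r x) r m t \<and> r x \<le> h) r m (Suc t)"
    using step[of "r x" r m t] I lt h
    by (auto intro!: wp_Seq elim!: wp_mono intro!: wp_Assign)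
next
  fix r m t assume I: "I (r x) r m t \<and> r x \<le> h" and "\<not> bval w (Less (Reg x) b) r m"
  then have "r x = h"
    using bound by fastforce
  then show "Q r m t"
    using I exit by auto
qed


section \<open>Properties of the LZ78 factorization\<close>

locale lz78_ctx =
  fixes \<Sigma> :: "nat set" and S :: "nat list" and L :: "nat list list" and dollar :: nat
  assumes S_alph: "set S \<subseteq> \<Sigma>" and S_ne: "S \<noteq> []"
    and S_last: "last S = dollar" and S_butlast: "dollar \<notin> set (butlast S)"
    and L_def: "L = lz78 \<Sigma> S"
begin

definition F :: "nat \<Rightarrow> nat list" where
  "F k = ([] # L) ! k"

lemma F_0 [simp]: "F 0 = []"
  by (simp add: F_def)

lemma F_Suc: "F (Suc k) = L ! k"
  by (simp add: F_def)

lemma F_pos: "k > 0 \<Longrightarrow> F k = L ! (k - 1)"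
  by (cases k) (auto simp: F_def)

lemma is_lz78_L: "is_lz78 \<Sigma> S L"
  unfolding L_def lz78_def by (rule theI'[OF ex1_lz78[OF S_alph]])

lemma concat_L: "concat L = S"
  using is_lz78_L by (simp add: is_lz78_def)

lemma L_longest:
  "i < length L \<Longrightarrow> longest_prefix_in (lz78_candidates \<Sigma> (set (take i L))) (concat (drop i L)) (L ! i)"
  using is_lz78_L by (simp add: is_lz78_def)

lemma L_snoc:
  assumes "i < length L"
  obtains u a where "L ! i = u @ [a]" "u \<in> insert [] (set (take i L))"
  using L_longest[OF assms] by (auto simp: longest_prefix_in_def lz78_candidates_def)

lemma Nil_notin_L: "[] \<notin> set L"
proof
  assume "[] \<in> set L"
  then obtain i where "i < length L" "L ! i = []"
    by (auto simp: in_set_conv_nth)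
  then show False
    using L_snoc[of i thesis for thesis] by simp
qed

lemma concat_take_drop: "concat (take i L) @ concat (drop i L) = S"
  by (metis append_take_drop_id concat_append concat_L)

lemma drop_S: "drop (length (concat (take i L))) S = concat (drop i L)"
  by (metis append_eq_conv_conj concat_take_drop)

text \<open>A repetition of an earlier factor, followed by any further character, would give a
  longer candidate. Only the last factor has no character after it, and that one contains the
  terminal character, which no earlier factor does.\<close>

lemma L_fresh:
  assumes i: "i < length L"
  shows "L ! i \<notin> set (take i L)"
proof
  assume old: "L ! i \<in> set (take i L)"
  have drop: "drop i L = L ! i # drop (Suc i) L"
    using i by (simp add: Cons_nth_drop_Suc)
  have ne: "L ! i \<noteq> []"
    using Nil_notin_L i nth_mem by metis
  show False
  proof (cases "concat (drop (Suc i) L)")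
    case Nil
    then have S: "S = concat (take i L) @ L ! i"
      using concat_take_drop[of i] drop by (metis append_Nil2 concat.simps(2))
    then have "dollar \<in> set (L ! i)"
      using S_last ne last_in_set by fastforce
    then have "dollar \<in> set (concat (take i L))"
      using old by auto
    moreover have "set (concat (take i L)) \<subseteq> set (butlast S)"
      using S ne by (auto simp: butlast_append)
    ultimately show False
      using S_butlast by blast
  next
    case (Cons b R)
    have "b \<in> set S"
      using Cons concat_take_drop[of "Suc i"] by (metis Un_iff list.set_intros(1) set_append)
    then have "L ! i @ [b] \<in> lz78_candidates \<Sigma> (set (take i L))"
      using old S_alph by (auto simp: lz78_candidates_def)
    moreover have "prefix (L ! i @ [b]) (concat (drop i L))"
      using Cons drop by simp
    ultimately show False
      using L_longest[OF i] unfolding longest_prefix_in_def by fastforce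
  qed
qed

lemma distinct_L: "distinct L"
proof -
  have "L ! i \<noteq> L ! j" if "i < length L" "j < i" for i j
    using L_fresh[OF that(1)] nth_mem[of j "take i L"] that by auto
  then show ?thesis
    unfolding distinct_conv_nth by (metis nat_neq_iff)
qed

lemma F_inj: "i \<le> length L \<Longrightarrow> j \<le> length L \<Longrightarrow> F i = F j \<Longrightarrow> i = j"
  using nth_eq_iff_index_eq[of "[] # L" i j] distinct_L Nil_notin_L by (simp add: F_def)

lemma in_set_takeD: "u \<in> insert [] (set (take i L)) \<Longrightarrow> \<exists>j \<le> i. j \<le> length L \<and> F j = u"
proof -
  assume "u \<in> insert [] (set (take i L))"
  then consider "u = []" | j where "j < i" "j < length L" "L ! j = u"
    by (auto simp: in_set_conv_nth)
  then show ?thesis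
  proof cases
    case 1
    then show ?thesis by (intro exI[of _ 0]) simp
  next
    case 2
    then show ?thesis by (intro exI[of _ "Suc j"]) (simp add: F_Suc)
  qed
qed

lemma F_in_set_take: "1 \<le> j \<Longrightarrow> j \<le> i \<Longrightarrow> j \<le> length L \<Longrightarrow> F j \<in> set (take i L)"
  using nth_mem[of "j - 1" "take i L"] by (fastforce simp: F_pos)

lemma F_snoc:
  assumes "1 \<le> k" "k \<le> length L"
  obtains j a where "j < k" "F k = F j @ [a]"
proof -
  obtain u a where "L ! (k - 1) = u @ [a]" "u \<in> insert [] (set (take (k - 1) L))"
    by (rule L_snoc[of "k - 1"]) (use assms in auto)
  moreover from this(2) obtain j where "j \<le> k - 1" "F j = u"
    using in_set_takeD by blast
  ultimately show ?thesis
    using assms by (intro that[of j a]) (auto simp: F_pos)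
qed

text \<open>Every factor arises from an earlier one by appending a character; descending along these
  parents passes through all prefixes.\<close>

lemma F_prefix_closed:
  assumes "k \<le> length L" "prefix u (F k)"
  shows "\<exists>j \<le> k. F j = u"
  using assms
proof (induction k rule: less_induct)
  case (less k)
  show ?case
  proof (cases "k = 0")
    case True
    then show ?thesis using less.prems by auto
  next
    case False
    then have "1 \<le> k"
      by simp
    then obtain j a where j: "j < k" "F k = F j @ [a]"
      using F_snoc less.prems by blast
    then consider "u = F k" | "prefix u (F j)"
      using less.prems by auto
    then show ?thesis
    proof cases
      case 2
      then obtain i where "i \<le> j" "F i = u"
        using less.IH[OF j(1)] j(1) less.prems by auto
      then show ?thesis
        using j(1) by (intro exI[of _ i]) simp
    qed auto
  qed
qed

lemma F_prefix_less:
  assumes "k \<le> length L" "j \<le> length L" "strict_prefix (F j) (F k)"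
  shows "j < k"
proof -
  obtain i where "i \<le> k" "F i = F j"
    using F_prefix_closed assms by (meson strict_prefixE prefix_order.less_imp_le)
  then have "i = j"
    using F_inj assms by auto
  with \<open>i \<le> k\<close> show ?thesis
    using assms(3) by (cases "j = k") auto
qed

text \<open>Maximality reduces to one absence test: a longer candidate would consist of a factor and
  a character, so \<open>F k @ [a]\<close> would be a prefix of a factor and, by prefix closure, a
  factor itself.\<close>

lemma next_factor:
  assumes mm: "mm < length L" and k: "k \<le> mm"
    and pre: "prefix (F k @ [a]) (concat (drop mm L))"
    and new: "\<And>j. j \<le> mm \<Longrightarrow> F j \<noteq> F k @ [a]"
  shows "L ! mm = F k @ [a]"
proof -
  have "a \<in> set S"
    using set_mono_prefix[OF pre] arg_cong[OF concat_take_drop[of mm], of set] by auto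
  then have "a \<in> \<Sigma>"
    using S_alph by auto
  have "longest_prefix_in (lz78_candidates \<Sigma> (set (take mm L))) (concat (drop mm L)) (F k @ [a])"
    unfolding longest_prefix_in_def
  proof (intro conjI ballI impI)
    have "F k = [] \<or> F k \<in> set (take mm L)"
      using k mm F_in_set_take[of k mm] by (cases k) auto
    then show "F k @ [a] \<in> lz78_candidates \<Sigma> (set (take mm L))"
      using \<open>a \<in> \<Sigma>\<close> by (auto simp: lz78_candidates_def)
  next
    show "prefix (F k @ [a]) (concat (drop mm L))"
      by (fact pre)
  next
    fix q assume q: "q \<in> lz78_candidates \<Sigma> (set (take mm L))" "prefix q (concat (drop mm L))"
    then obtain g c where g: "q = g @ [c]" "g \<in> insert [] (set (take mm L))"
      by (auto simp: lz78_candidates_def)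
    show "length q \<le> length (F k @ [a])"
    proof (rule ccontr)
      assume "\<not> length q \<le> length (F k @ [a])"
      then have "prefix (F k @ [a]) g"
        using q g pre by (auto intro: prefix_length_prefix[of _ "concat (drop mm L)"] append_prefixD)
      moreover obtain j where "j \<le> mm" "j \<le> length L" "F j = g"
        using in_set_takeD[OF g(2)] by auto
      ultimately show False
        using F_prefix_closed[of j "F k @ [a]"] new by (metis order_trans)
    qed
  qed
  with L_longest[OF mm] show ?thesis
    using longest_prefix_in_unique by blast
qed

lemma L_not_done: "length (concat (take mm L)) < length S \<Longrightarrow> mm < length L"
  using concat_L by (metis leI nat_neq_iff take_all)

text \<open>Serves to show that m is a word although N may be 2^w. One factor of length at least two
  saves a factor; otherwise all factors are single characters, S has no repetition, and m is the
  number of distinct characters.\<close>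

lemma length_L_cases: "length L < length S \<or> length L \<le> card (set S)"
proof (cases "\<forall>f \<in> set L. length f = 1")
  case True
  have eq: "concat fs = map hd fs \<and> map (\<lambda>a. [a]) (concat fs) = fs"
    if "\<forall>f \<in> set fs. length f = 1" for fs :: "nat list list"
    using that
  proof (induction fs)
    case (Cons f fs)
    then show ?case by (cases f) auto
  qed simp
  have "distinct S"
    using eq[OF True] distinct_L concat_L by (metis distinct_map)
  moreover have "length L = length S"
    using eq[OF True] concat_L by (metis length_map)
  ultimately show ?thesis
    by (simp add: distinct_card)
next
  case False
  then obtain f where f: "f \<in> set L" "length f \<noteq> 1" by auto
  then have "length f \<ge> 2"
    using Nil_notin_L by (cases "length f") (auto simp: Suc_le_eq)
  have "length L + 1 \<le> length (concat fs)" if "f \<in> set fs" "[] \<notin> set fs" "length fs = length L" for fs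
  proof -
    have "length fs + 1 \<le> length (concat fs)"
      using that(1,2)
    proof (induction fs)
      case (Cons g fs)
      have le: "length fs \<le> length (concat fs)" if "[] \<notin> set fs" for fs :: "nat list list"
        using that
      proof (induction fs)
        case (Cons h fs)
        then show ?case by (cases h) auto
      qed simp
      show ?case
      proof (cases "f \<in> set fs")
        case True
        then show ?thesis using Cons by (cases g) auto
      next
        case False
        then have "g = f" using Cons.prems by simp
        then show ?thesis
          using le[of fs] Cons.prems \<open>length f \<ge> 2\<close> by simp
      qed
    qed simp
    with that show ?thesis by simp
  qed
  from this[of L] show ?thesis
    using f Nil_notin_L concat_L by simp
qed

text \<open>The nonempty prefixes of a factor are distinct factors; the sum of their lengths, l (l +
  1) / 2, is at most the total length of all factors, which is N.\<close>

lemma F_length_bound: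
  assumes "k \<le> length L"
  shows "length (F k) * (length (F k) + 1) \<le> 2 * length S"
proof -
  let ?l = "length (F k)"
  let ?T = "(\<lambda>i. take i (F k)) ` {1..?l}"
  have sub: "?T \<subseteq> set L"
  proof
    fix u assume "u \<in> ?T"
    then obtain i where i: "1 \<le> i" "i \<le> ?l" "u = take i (F k)" by auto
    then obtain j where j: "j \<le> k" "F j = u"
      using F_prefix_closed[OF assms, of u] take_is_prefix by metis
    have "u \<noteq> []"
      using i by auto
    then have "j \<noteq> 0"
      using j(2) by (metis F_0)
    then show "u \<in> set L"
      using j assms F_in_set_take[of j "length L"] by simp
  qed
  have "inj_on (\<lambda>i. take i (F k)) {1..?l}"
    by (intro inj_onI) (metis atLeastAtMost_iff length_take min.absorb2)
  then have "(\<Sum>u \<in> ?T. length u) = (\<Sum>i \<in> {1..?l}. i)"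
    by (subst sum.reindex) (auto intro!: sum.cong)
  moreover have "(\<Sum>u \<in> ?T. length u) \<le> (\<Sum>u \<in> set L. length u)"
    using sub by (intro sum_mono2) auto
  moreover have "(\<Sum>u \<in> set L. length u) = length S"
    using sum_list_distinct_conv_sum_set[OF distinct_L, of length] concat_L by (metis length_concat)
  moreover have "2 * (\<Sum>i \<in> {1..l}. i) = l * (l + 1)" for l :: nat
    by (induction l) auto
  ultimately show ?thesis
    by (metis mult_le_mono2)
qed

end


section \<open>Strings as numbers\<close>

text \<open>On strings of equal length over \<open>{..<b}\<close> the order of the numbers is lexicographic.\<close>

fun enc :: "nat \<Rightarrow> nat list \<Rightarrow> nat" where
  "enc b [] = 0"
| "enc b (x # xs) = x * b ^ length xs + enc b xs"

lemma enc_append: "enc b (xs @ ys) = enc b xs * b ^ length ys + enc b ys"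
  by (induction xs) (auto simp: algebra_simps power_add)

lemma enc_less: "set xs \<subseteq> {..<b} \<Longrightarrow> enc b xs < b ^ length xs"
proof (induction xs)
  case (Cons x xs)
  then have "x * b ^ length xs + enc b xs < x * b ^ length xs + b ^ length xs"
    by simp
  also have "\<dots> = (x + 1) * b ^ length xs"
    by simp
  also have "\<dots> \<le> b * b ^ length xs"
    using Cons.prems by (intro mult_le_mono1) auto
  finally show ?case by simp
qed simp

text \<open>Two-digit numbers in base \<open>b\<close> compare lexicographically. This is used for
  strings, for stable sorting by index and for pairs of names.\<close>

lemma mult_add_less_iff:
  fixes A B C D b :: nat
  assumes "B < b" "D < b"
  shows "A * b + B < C * b + D \<longleftrightarrow> A < C \<or> A = C \<and> B < D"
proof -
  have "A * b + B < C * b + D" if "A < C"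
  proof -
    have "A * b + B < (A + 1) * b" using assms by simp
    also have "\<dots> \<le> C * b" using that by (intro mult_le_mono1) auto
    finally show ?thesis by simp
  qed
  moreover have "C * b + D < A * b + B" if "C < A"
  proof -
    have "C * b + D < (C + 1) * b" using assms by simp
    also have "\<dots> \<le> A * b" using that by (intro mult_le_mono1) auto
    finally show ?thesis by simp
  qed
  ultimately show ?thesis
    by (cases A C rule: linorder_cases) (auto dest: less_not_sym)
qed

lemma enc_inj:
  "length xs = length ys \<Longrightarrow> set xs \<subseteq> {..<b} \<Longrightarrow> set ys \<subseteq> {..<b} \<Longrightarrow> enc b xs = enc b ys \<Longrightarrow> xs = ys"
proof (induction xs ys rule: list_induct2)
  case (Cons x xs y ys)
  have "enc b xs < b ^ length xs" "enc b ys < b ^ length xs"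
    using enc_less[of xs b] enc_less[of ys b] Cons by auto
  then have "x = y" "enc b xs = enc b ys"
    using mult_add_less_iff[of "enc b xs" "b ^ length xs" "enc b ys" x y]
      mult_add_less_iff[of "enc b ys" "b ^ length xs" "enc b xs" y x] Cons by auto
  then show ?case using Cons by simp
qed simp

lemma enc_append_less_iff:
  assumes "length ys = length ys'" "set ys \<subseteq> {..<b}" "set ys' \<subseteq> {..<b}"
  shows "enc b (xs @ ys) < enc b (xs' @ ys') \<longleftrightarrow>
    enc b xs < enc b xs' \<or> enc b xs = enc b xs' \<and> enc b ys < enc b ys'"
  using assms enc_less[of ys b] enc_less[of ys' b] by (simp add: enc_append mult_add_less_iff)

text \<open>Sorted windows remain sorted when cut to a common length. This makes the next characters
  behind a shared prefix monotone.\<close>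

lemma enc_take_mono:
  assumes "length xs = length ys" "set xs \<subseteq> {..<b}" "set ys \<subseteq> {..<b}" "enc b xs \<le> enc b ys"
  shows "enc b (take k xs) \<le> enc b (take k ys)"
proof (rule ccontr)
  assume "\<not> ?thesis"
  moreover have "set (drop k xs) \<subseteq> {..<b}" "set (drop k ys) \<subseteq> {..<b}"
    using assms set_drop_subset by fast+
  ultimately have "enc b (take k ys @ drop k ys) < enc b (take k xs @ drop k xs)"
    using assms by (subst enc_append_less_iff) auto
  with assms show False by simp
qed


section \<open>Ranks\<close>

lemma rank_less_iff:
  fixes g :: "nat \<Rightarrow> nat"
  assumes "t < V" "t' < V"
  shows "card {u. u < V \<and> g u < g t} < card {u. u < V \<and> g u < g t'} \<longleftrightarrow> g t < g t'"
proof
  assume "g t < g t'"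
  then show "card {u. u < V \<and> g u < g t} < card {u. u < V \<and> g u < g t'}"
    using assms by (intro psubset_card_mono) (auto intro: less_trans)
next
  assume less: "card {u. u < V \<and> g u < g t} < card {u. u < V \<and> g u < g t'}"
  show "g t < g t'"
  proof (rule ccontr)
    assume "\<not> g t < g t'"
    then have "card {u. u < V \<and> g u < g t'} \<le> card {u. u < V \<and> g u < g t}"
      by (intro card_mono) auto
    with less show False by simp
  qed
qed

lemma rank_bij:
  fixes g :: "nat \<Rightarrow> nat"
  assumes "inj_on g {..<V}"
  shows "bij_betw (\<lambda>t. card {u. u < V \<and> g u < g t}) {..<V} {..<V}"
proof -
  let ?\<pi> = "\<lambda>t. card {u. u < V \<and> g u < g t}"
  have "inj_on ?\<pi> {..<V}"
  proof (rule inj_onI)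
    fix t t' assume t: "t \<in> {..<V}" "t' \<in> {..<V}" "?\<pi> t = ?\<pi> t'"
    then have "g t = g t'"
      using rank_less_iff[of t V t' g] rank_less_iff[of t' V t g] by (simp add: linorder_neq_iff)
    then show "t = t'"
      using t assms by (auto dest: inj_onD)
  qed
  moreover have "?\<pi> t < V" if "t < V" for t
  proof -
    have "?\<pi> t < card {..<V}"
      using that by (intro psubset_card_mono) auto
    then show ?thesis by simp
  qed
  ultimately have "?\<pi> ` {..<V} = {..<V}"
    by (intro endo_inj_surj) auto
  with \<open>inj_on ?\<pi> {..<V}\<close> show ?thesis
    by (simp add: bij_betw_def)
qed

text \<open>The position at which a stable counting sort places the \<open>t\<close>-th of \<open>V\<close> items.\<close>

definition cpos :: "nat \<Rightarrow> (nat \<Rightarrow> nat) \<Rightarrow> nat \<Rightarrow> nat" where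
  "cpos V key t = card {u. u < V \<and> key u < key t} + card {u. u < t \<and> key u = key t}"

text \<open>Breaking ties by the index turns the keys into distinct numbers, for which the position
  is an ordinary rank; bijectivity and monotonicity are then inherited.\<close>

lemma cpos_eq_rank:
  assumes "t < V"
  shows "cpos V key t = card {u. u < V \<and> key u * V + u < key t * V + t}"
proof -
  have "{u. u < V \<and> key u * V + u < key t * V + t} =
      {u. u < V \<and> key u < key t} \<union> {u. u < t \<and> key u = key t}"
    using assms by (auto simp: mult_add_less_iff)
  moreover have "card ({u. u < V \<and> key u < key t} \<union> {u. u < t \<and> key u = key t}) = cpos V key t"
    unfolding cpos_def by (rule card_Un_disjoint) auto
  ultimately show ?thesis by simp
qed

lemma cpos_less_iff:
  assumes "t < V" "t' < V"
  shows "cpos V key t < cpos V key t' \<longleftrightarrow> key t < key t' \<or> key t = key t' \<and> t < t'"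
  using assms rank_less_iff[of t V t' "\<lambda>t. key t * V + t"]
  by (simp add: cpos_eq_rank mult_add_less_iff)

lemma cpos_bij: "bij_betw (cpos V key) {..<V} {..<V}"
proof -
  have "inj_on (\<lambda>t. key t * V + t) {..<V}"
  proof (rule inj_onI)
    fix t t' assume "t \<in> {..<V}" "t' \<in> {..<V}" "key t * V + t = key t' * V + t'"
    then show "t = t'"
      using mult_add_less_iff[of t V t' "key t" "key t'"] mult_add_less_iff[of t' V t "key t'" "key t"]
      by (cases "key t" "key t'" rule: linorder_cases) auto
  qed
  from rank_bij[OF this] show ?thesis
    by (rule bij_betw_cong[THEN iffD1, rotated]) (simp add: cpos_eq_rank)
qed

lemma cpos_less: "t < V \<Longrightarrow> cpos V key t < V"
  using cpos_bij[of V key] by (auto simp: bij_betw_def)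


section \<open>Windows of a straight line program\<close>

text \<open>Variable \<open>i\<close> has the rule \<open>X\<^sub>i \<rightarrow> rc i\<close> if \<open>lc i = 0\<close> and \<open>X\<^sub>i \<rightarrow> X\<^bsub>lc i\<^esub> X\<^bsub>rc i\<^esub>\<close> otherwise.\<close>

locale slp_ctx =
  fixes n :: nat and lc rc :: "nat \<Rightarrow> nat" and vl :: "nat \<Rightarrow> nat list" and b :: nat
  assumes n_pos: "1 \<le> n"
    and leaf: "1 \<le> i \<Longrightarrow> i \<le> n \<Longrightarrow> lc i = 0 \<Longrightarrow> vl i = [rc i]"
    and node: "1 \<le> i \<Longrightarrow> i \<le> n \<Longrightarrow> lc i \<noteq> 0 \<Longrightarrow>
      vl i = vl (lc i) @ vl (rc i) \<and> lc i < i \<and> 1 \<le> rc i \<and> rc i < i"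
    and lc_0: "lc 0 = 0"
    and alph: "1 \<le> i \<Longrightarrow> i \<le> n \<Longrightarrow> set (vl i) \<subseteq> {..<b}"
begin

abbreviation len :: "nat \<Rightarrow> nat" where
  "len i \<equiv> length (vl i)"

definition var :: "nat \<Rightarrow> bool" where
  "var i \<longleftrightarrow> 1 \<le> i \<and> i \<le> n"

lemma nodeD:
  assumes "var i" "lc i \<noteq> 0"
  shows "vl i = vl (lc i) @ vl (rc i)" "len i = len (lc i) + len (rc i)"
    "lc i < i" "rc i < i" "1 \<le> lc i" "1 \<le> rc i" "var (lc i)" "var (rc i)"
  using node[of i] assms by (auto simp: var_def)

lemma len_pos: "var i \<Longrightarrow> 1 \<le> len i"
proof (induction i rule: less_induct)
  case (less i)
  then show ?case
    using nodeD[of i] leaf[of i] by (cases "lc i = 0") (auto simp: var_def intro: trans_le_add1)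
qed

definition sub :: "nat \<Rightarrow> nat \<Rightarrow> nat \<Rightarrow> nat list" where
  "sub i d H = take H (drop d (vl i))"

lemma length_sub: "d + H \<le> len i \<Longrightarrow> length (sub i d H) = H"
  by (simp add: sub_def)

lemma set_sub: "var i \<Longrightarrow> set (sub i d H) \<subseteq> {..<b}"
  using alph[of i] set_take_subset[of H "drop d (vl i)"] set_drop_subset[of d "vl i"]
  by (auto simp: sub_def var_def)

lemma sub_left: "var i \<Longrightarrow> lc i \<noteq> 0 \<Longrightarrow> d + H \<le> len (lc i) \<Longrightarrow> sub i d H = sub (lc i) d H"
  by (simp add: sub_def nodeD(1))

lemma sub_right:
  "var i \<Longrightarrow> lc i \<noteq> 0 \<Longrightarrow> len (lc i) \<le> d \<Longrightarrow> sub i d H = sub (rc i) (d - len (lc i)) H"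
  by (simp add: sub_def nodeD(1))

lemma sub_add: "sub i d (H + H') = sub i d H @ sub i (d + H) H'"
  by (simp add: sub_def take_add add.commute)

text \<open>
  \<open>cwin v s H\<close> is the window of length \<open>H\<close> that starts \<open>s\<close> positions before the border between
  the two children of \<open>v\<close>.
\<close>

definition crossing :: "nat \<Rightarrow> nat \<Rightarrow> nat \<Rightarrow> bool" where
  "crossing v s H \<longleftrightarrow> var v \<and> lc v \<noteq> 0 \<and> 1 \<le> s \<and> s < H \<and> s \<le> len (lc v) \<and> H \<le> s + len (rc v)"

definition cwin :: "nat \<Rightarrow> nat \<Rightarrow> nat \<Rightarrow> nat list" where
  "cwin v s H = sub v (len (lc v) - s) H"

definition subs :: "nat \<Rightarrow> nat list set" where
  "subs H = {sub i d H | i d. var i \<and> d + H \<le> len i}"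

lemma sub_in_subs: "var i \<Longrightarrow> d + H \<le> len i \<Longrightarrow> sub i d H \<in> subs H"
  by (auto simp: subs_def)

lemma crossing_le: "crossing v s H \<Longrightarrow> len (lc v) - s + H \<le> len v"
  using nodeD[of v] by (auto simp: crossing_def)

lemma cwin_in_subs: "crossing v s H \<Longrightarrow> cwin v s H \<in> subs H"
  using crossing_le by (auto simp: cwin_def crossing_def intro: sub_in_subs)

lemma subsD: "u \<in> subs H \<Longrightarrow> length u = H \<and> set u \<subseteq> {..<b}"
  using set_sub length_sub by (fastforce simp: subs_def)

text \<open>A half of a crossing window crosses the same border or lies in one child, close to the
  border: at most 2 H from the end of the left child or from the start of the right one. Names near
  the two ends of each variable therefore suffice for doubling.\<close>

lemma cwin_halves:
  assumes "crossing v s (2 * H)"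
  shows "cwin v s (2 * H) =
    (if s < H then cwin v s H else sub (lc v) (len (lc v) - s) H) @
    (if s \<le> H then sub (rc v) (H - s) H else cwin v (s - H) H)"
    and "s < H \<Longrightarrow> crossing v s H" "H < s \<Longrightarrow> crossing v (s - H) H"
    and "H \<le> s \<Longrightarrow> len (lc v) - s + H \<le> len (lc v)" "s \<le> H \<Longrightarrow> H - s + H \<le> len (rc v)"
proof -
  have v: "var v" "lc v \<noteq> 0" "1 \<le> s" "s < 2 * H" "s \<le> len (lc v)" "2 * H \<le> s + len (rc v)"
    using assms by (auto simp: crossing_def)
  have "sub v (len (lc v) - s) H = sub (lc v) (len (lc v) - s) H" if "\<not> s < H"
    using v that by (intro sub_left) auto
  moreover have "sub v (len (lc v) - s + H) H = sub (rc v) (H - s) H" if "s \<le> H"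
    using v that by (subst sub_right) (auto intro!: arg_cong2[where f = "sub (rc v)"])
  moreover have "sub v (len (lc v) - s + H) H = cwin v (s - H) H" if "\<not> s \<le> H"
    using v that by (simp add: cwin_def)
  ultimately show "cwin v s (2 * H) =
    (if s < H then cwin v s H else sub (lc v) (len (lc v) - s) H) @
    (if s \<le> H then sub (rc v) (H - s) H else cwin v (s - H) H)"
    using sub_add[of v "len (lc v) - s" H H] by (auto simp: cwin_def mult_2)
qed (use assms in \<open>auto simp: crossing_def\<close>)


subsection \<open>The upper part of the derivation tree\<close>

text \<open>
  \<open>bds th i off\<close> lists in order the inner nodes with more than \<open>th\<close> leaves of the derivation tree
  of \<open>i\<close>, each with the position of the last character of its left part; \<open>off\<close> is the position of
  the first character of \<open>i\<close>. The children of these nodes that are not inner nodes themselves are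
  \<open>lvs th i\<close>.
\<close>

function bds :: "nat \<Rightarrow> nat \<Rightarrow> nat \<Rightarrow> (nat \<times> nat) list" where
  "bds th i off = (if th < len i \<and> var i \<and> lc i \<noteq> 0 then
     bds th (lc i) off @ (off + len (lc i) - 1, i) # bds th (rc i) (off + len (lc i)) else [])"
  by pat_completeness auto
termination
  by (relation "measure (\<lambda>(th, i, off). i)") (auto simp: nodeD)

function lvs :: "nat \<Rightarrow> nat \<Rightarrow> nat list" where
  "lvs th i = (if th < len i \<and> var i \<and> lc i \<noteq> 0 then lvs th (lc i) @ lvs th (rc i) else [i])"
  by pat_completeness auto
termination
  by (relation "measure (\<lambda>(th, i). i)") (auto simp: nodeD)

declare bds.simps [simp del] lvs.simps [simp del]

lemma bds_node:
  "th < len i \<Longrightarrow> var i \<Longrightarrow> lc i \<noteq> 0 \<Longrightarrow>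
    bds th i off = bds th (lc i) off @ (off + len (lc i) - 1, i) # bds th (rc i) (off + len (lc i))"
  by (subst bds.simps) simp

lemma lvs_node:
  "th < len i \<Longrightarrow> var i \<Longrightarrow> lc i \<noteq> 0 \<Longrightarrow> lvs th i = lvs th (lc i) @ lvs th (rc i)"
  by (subst lvs.simps) simp

lemma bds_leaf: "\<not> th < len i \<or> lc i = 0 \<Longrightarrow> bds th i off = []"
  by (subst bds.simps) auto

lemma lvs_leaf: "\<not> th < len i \<or> lc i = 0 \<Longrightarrow> lvs th i = [i]"
  by (subst lvs.simps) auto

lemma length_lvs: "var i \<Longrightarrow> length (lvs th i) = length (bds th i off) + 1"
proof (induction i arbitrary: off rule: less_induct)
  case (less i)
  show ?case
  proof (cases "th < len i \<and> lc i \<noteq> 0")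
    case True
    then show ?thesis
      using less.IH[of "lc i" off] less.IH[of "rc i" "off + len (lc i)"] nodeD[OF less.prems] less.prems
      by (simp add: bds_node lvs_node)
  next
    case False
    then show ?thesis using less.prems
      by (auto simp: bds_leaf lvs_leaf)
  qed
qed

text \<open>Threshold 1 expands the derivation tree down to single characters, so the same traversal
  produces the plain text of S.\<close>

lemma lvs_1: "var i \<Longrightarrow> map rc (lvs 1 i) = vl i"
proof (induction i rule: less_induct)
  case (less i)
  show ?case
  proof (cases "lc i \<noteq> 0")
    case True
    note i = nodeD[OF less.prems True]
    have "1 < len i"
      using i(2) len_pos[OF i(7)] len_pos[OF i(8)] by simp
    then show ?thesis
      using less.IH i less.prems True by (simp add: lvs_node)
  next
    case False
    then show ?thesis
      using leaf less.prems by (simp add: lvs_leaf var_def)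
  qed
qed

lemma bds_bounds:
  "var i \<Longrightarrow> (E, v) \<in> set (bds th i off) \<Longrightarrow>
    var v \<and> v \<le> i \<and> lc v \<noteq> 0 \<and> th < len v \<and> off + len (lc v) \<le> E + 1 \<and> E + 1 + len (rc v) \<le> off + len i"
proof (induction i arbitrary: off rule: less_induct)
  case (less i)
  have i: "th < len i" "lc i \<noteq> 0"
    using less.prems bds_leaf[of th i off] by (metis empty_iff empty_set)+
  note nd = nodeD[OF less.prems(1) i(2)]
  have "1 \<le> len (lc i)"
    using len_pos nd by blast
  consider "(E, v) \<in> set (bds th (lc i) off)" | "E = off + len (lc i) - 1" "v = i"
    | "(E, v) \<in> set (bds th (rc i) (off + len (lc i)))"
    using less.prems bds_node[OF i(1) less.prems(1) i(2)] by auto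
  then show ?case
  proof cases
    case 1
    then show ?thesis using less.IH[OF nd(3,7) 1] nd by auto
  next
    case 2
    then show ?thesis using less.prems i nd \<open>1 \<le> len (lc i)\<close> by auto
  next
    case 3
    then show ?thesis using less.IH[OF nd(4,8) 3] nd by auto
  qed
qed

text \<open>No variable occurs below itself, so its occurrences in the derivation tree span disjoint
  substrings.\<close>

lemma bds_count: "var i \<Longrightarrow> count_list (map snd (bds th i off)) v * len v \<le> len i"
proof (induction i arbitrary: off rule: less_induct)
  case (less i)
  show ?case
  proof (cases "th < len i \<and> lc i \<noteq> 0")
    case True
    note nd = nodeD[OF less.prems(1) conjunct2[OF True]]
    have "i \<notin> snd ` set (bds th (lc i) off)" "i \<notin> snd ` set (bds th (rc i) (off + len (lc i)))"
      using bds_bounds[OF nd(7), of _ i th off] bds_bounds[OF nd(8), of _ i th "off + len (lc i)"] nd by auto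
    then have no: "count_list (map snd (bds th (lc i) off)) i = 0"
      "count_list (map snd (bds th (rc i) (off + len (lc i)))) i = 0"
      by (auto simp: count_list_0_iff)
    show ?thesis
      using less.IH[OF nd(3,7), of off] less.IH[OF nd(4,8), of "off + len (lc i)"] less.prems True no nd(2)
      by (auto simp: bds_node add_mult_distrib)
  qed (use less.prems in \<open>auto simp: bds_leaf\<close>)
qed

text \<open>Each variable that occurs has more than \<open>th\<close> leaves and hence at most
  \<open>len i / (th + 1)\<close> occurrences; there are n variables.\<close>

lemma length_bds:
  assumes "var i"
  shows "Suc th * length (bds th i off) \<le> n * len i"
proof -
  let ?xs = "map snd (bds th i off)"
  have sub: "set ?xs \<subseteq> {1..n}"
    using bds_bounds[OF assms] by (fastforce simp: var_def)
  have "length ?xs = (\<Sum>v\<in>set ?xs. count_list ?xs v)"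
    by (rule sum_count_set[symmetric]) auto
  also have "\<dots> = (\<Sum>v\<in>{1..n}. count_list ?xs v)"
    using sub by (intro sum.mono_neutral_left) (auto simp: count_list_0_iff)
  finally have "Suc th * length (bds th i off) = (\<Sum>v\<in>{1..n}. Suc th * count_list ?xs v)"
    by (simp add: sum_distrib_left)
  also have "\<dots> \<le> (\<Sum>v\<in>{1..n}. len i)"
  proof (rule sum_mono)
    fix v assume "v \<in> {1..n}"
    show "Suc th * count_list ?xs v \<le> len i"
    proof (cases "v \<in> set ?xs")
      case True
      then have "Suc th \<le> len v"
        using bds_bounds[OF assms] by (fastforce simp: Suc_le_eq)
      then have "Suc th * count_list ?xs v \<le> len v * count_list ?xs v"
        by (rule mult_le_mono1)
      also have "\<dots> \<le> len i"
        using bds_count[OF assms] by (simp add: mult.commute)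
      finally show ?thesis .
    qed (simp add: count_list_0_iff)
  qed
  finally show ?thesis by simp
qed

text \<open>With E the last position of the left child, the second condition says that the window
  ends inside the right child. Nothing is said about the left end of the node; the order of the
  borders makes up for this.\<close>

definition covers :: "nat \<Rightarrow> nat \<Rightarrow> nat \<times> nat \<Rightarrow> bool" where
  "covers p c = (\<lambda>(E, v). p \<le> E \<and> p + c \<le> E + 1 + len (rc v))"

lemma covers_mono: "covers p' c y \<Longrightarrow> p \<le> p' \<Longrightarrow> covers p c y"
  by (auto simp: covers_def)

text \<open>
  The first border that passes the test \<open>covers\<close> is the one of the lowest node above the whole
  window: borders inside the window and further left belong to nodes of its left subtree.
\<close>

lemma bds_window:
  assumes "2 \<le> c" "var i" "off \<le> p" "p + c \<le> off + len i"
  shows "\<exists>ys E v zs. bds (c - 1) i off = ys @ (E, v) # zs \<and> (\<forall>y \<in> set ys. \<not> covers p c y) \<and>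
    covers p c (E, v) \<and> crossing v (E + 1 - p) c \<and> cwin v (E + 1 - p) c = sub i (p - off) c"
  using assms(2-)
proof (induction i arbitrary: off rule: less_induct)
  case (less i)
  have big: "c - 1 < len i"
    using less.prems assms(1) by simp
  have lc: "lc i \<noteq> 0"
  proof
    assume "lc i = 0"
    then have "len i = 1"
      using leaf[of i] less.prems(1) by (simp add: var_def)
    with big assms(1) show False by simp
  qed
  note nd = nodeD[OF less.prems(1) lc]
  note bds = bds_node[OF big less.prems(1) lc]
  have l1: "1 \<le> len (lc i)"
    using len_pos nd by blast
  show ?case
  proof (cases "p + c \<le> off + len (lc i)")
    case True
    obtain ys E v zs where *: "bds (c - 1) (lc i) off = ys @ (E, v) # zs" "\<forall>y \<in> set ys. \<not> covers p c y"
      "covers p c (E, v)" "crossing v (E + 1 - p) c" "cwin v (E + 1 - p) c = sub (lc i) (p - off) c"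
      using less.IH[OF nd(3,7) less.prems(2) True] by blast
    have "sub (lc i) (p - off) c = sub i (p - off) c"
      using sub_left[OF less.prems(1) lc, of "p - off" c] True less.prems by simp
    then show ?thesis
      unfolding bds *(1) using *
      by (intro exI[of _ ys] exI[of _ E] exI[of _ v]
          exI[of _ "zs @ (off + len (lc i) - 1, i) # bds (c - 1) (rc i) (off + len (lc i))"]) simp
  next
    case notl: False
    show ?thesis
    proof (cases "off + len (lc i) \<le> p")
      case True
      obtain ys E v zs where *: "bds (c - 1) (rc i) (off + len (lc i)) = ys @ (E, v) # zs"
        "\<forall>y \<in> set ys. \<not> covers p c y" "covers p c (E, v)" "crossing v (E + 1 - p) c"
        "cwin v (E + 1 - p) c = sub (rc i) (p - (off + len (lc i))) c"
        using less.IH[OF nd(4,8) True] nd(2) less.prems by auto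
      have "\<not> covers p c y" if "y \<in> set (bds (c - 1) (lc i) off)" for y
        using bds_bounds[OF nd(7), of "fst y" "snd y" "c - 1" off] that True
        by (auto simp: covers_def split: prod.splits)
      moreover have "\<not> covers p c (off + len (lc i) - 1, i)"
        using True l1 by (auto simp: covers_def)
      moreover have "sub (rc i) (p - (off + len (lc i))) c = sub i (p - off) c"
        using sub_right[OF less.prems(1) lc, of "p - off" c] True by (simp add: diff_diff_left)
      ultimately show ?thesis
        unfolding bds *(1) using *
        by (intro exI[of _ "bds (c - 1) (lc i) off @ (off + len (lc i) - 1, i) # ys"] exI[of _ E]
            exI[of _ v] exI[of _ zs]) auto
    next
      case False
      have "\<not> covers p c y" if "y \<in> set (bds (c - 1) (lc i) off)" for y
        using bds_bounds[OF nd(7), of "fst y" "snd y" "c - 1" off] that notl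
        by (auto simp: covers_def split: prod.splits)
      moreover have E: "off + len (lc i) - 1 + 1 - p = off + len (lc i) - p"
        using l1 by simp
      moreover have "covers p c (off + len (lc i) - 1, i)" "crossing i (off + len (lc i) - p) c"
        using False notl less.prems nd(2) lc l1 by (auto simp: covers_def crossing_def)
      moreover have "cwin i (off + len (lc i) - p) c = sub i (p - off) c"
        using False less.prems by (auto simp: cwin_def intro!: arg_cong2[where f = "sub i"])
      ultimately show ?thesis
        unfolding bds E
        by (intro exI[of _ "bds (c - 1) (lc i) off"] exI[of _ "off + len (lc i) - 1"] exI[of _ i]
            exI[of _ "bds (c - 1) (rc i) (off + len (lc i))"]) (auto simp only: E)
    qed
  qed
qed

lemma subs_crossing:
  assumes "2 \<le> H" "u \<in> subs H"
  shows "\<exists>v s. crossing v s H \<and> cwin v s H = u"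
proof -
  obtain i d where i: "var i" "d + H \<le> len i" "u = sub i d H"
    using assms(2) by (auto simp: subs_def)
  with bds_window[OF assms(1) i(1), of 0 d] show ?thesis
    by auto
qed


subsection \<open>Names of windows\<close>

text \<open>A crossing window is addressed by one number with digits v and s in base H; 1 <= s < H
  makes the encoding unambiguous.\<close>

definition items :: "nat \<Rightarrow> nat set" where
  "items H = {v * H + s | v s. crossing v s H}"

definition win :: "nat \<Rightarrow> nat \<Rightarrow> nat list" where
  "win H x = cwin (x div H) (x mod H) H"

lemma win_item: "crossing v s H \<Longrightarrow> win H (v * H + s) = cwin v s H"
  by (simp add: win_def crossing_def)

lemma itemsD: "x \<in> items H \<Longrightarrow> crossing (x div H) (x mod H) H"
  by (auto simp: items_def crossing_def)

lemma items_less: "items H \<subseteq> {..<Suc n * H}"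
proof
  fix x assume "x \<in> items H"
  then obtain v s where x: "x = v * H + s" "v \<le> n" "s < H"
    by (auto simp: items_def crossing_def var_def)
  have "v * H + s < Suc v * H"
    using x by simp
  also have "\<dots> \<le> Suc n * H"
    using x by (intro mult_le_mono1) simp
  finally show "x \<in> {..<Suc n * H}" using x by simp
qed

lemma finite_items: "finite (items H)"
  using items_less finite_subset by blast

lemma card_items: "card (items H) \<le> Suc n * H"
  using card_mono[OF _ items_less] by fastforce

text \<open>Names are required to respect the order of the strings and not only equality, so that
  sorting pairs of names sorts windows of twice the length.\<close>

definition named :: "nat \<Rightarrow> (nat list \<Rightarrow> nat) \<Rightarrow> bool" where
  "named H nm \<longleftrightarrow> (\<forall>u \<in> subs H. \<forall>u' \<in> subs H. nm u < nm u' \<longleftrightarrow> enc b u < enc b u')"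

lemma named_eq: "named H nm \<Longrightarrow> u \<in> subs H \<Longrightarrow> u' \<in> subs H \<Longrightarrow> nm u = nm u' \<longleftrightarrow> enc b u = enc b u'"
  unfolding named_def by (metis linorder_neq_iff)

text \<open>Counting crossing windows with multiplicity instead of distinct strings makes the name
  of a window the position of its first occurrence in the sorted array.\<close>

definition rank :: "nat \<Rightarrow> nat list \<Rightarrow> nat" where
  "rank H u = card {x \<in> items H. enc b (win H x) < enc b u}"

lemma win_in_subs: "x \<in> items H \<Longrightarrow> win H x \<in> subs H"
  unfolding win_def by (rule cwin_in_subs[OF itemsD])

lemma rank_less: "2 \<le> H \<Longrightarrow> u \<in> subs H \<Longrightarrow> rank H u < card (items H)"
proof -
  assume "2 \<le> H" "u \<in> subs H"
  then obtain v s where v: "crossing v s H" "cwin v s H = u"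
    using subs_crossing by blast
  then have "v * H + s \<in> items H" "win H (v * H + s) = u"
    by (auto simp: items_def win_item)
  then show ?thesis
    unfolding rank_def using finite_items by (intro psubset_card_mono) auto
qed

text \<open>The length must be at least two: a single character crosses no border. Length one starts
  the doubling with the characters themselves as names.\<close>

lemma named_rank: "2 \<le> H \<Longrightarrow> named H (rank H)"
  unfolding named_def
proof (intro ballI iffI)
  fix u u' assume H: "2 \<le> H" and u: "u \<in> subs H" "u' \<in> subs H"
  {
    assume less: "enc b u < enc b u'"
    obtain v s where v: "crossing v s H" "cwin v s H = u"
      using subs_crossing H u by blast
    then have "v * H + s \<in> items H" "win H (v * H + s) = u"
      by (auto simp: items_def win_item)
    then show "rank H u < rank H u'"
      unfolding rank_def using finite_items less by (intro psubset_card_mono) (auto intro: less_trans)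
  next
    assume less: "rank H u < rank H u'"
    show "enc b u < enc b u'"
    proof (rule ccontr)
      assume "\<not> enc b u < enc b u'"
      then have "rank H u' \<le> rank H u"
        unfolding rank_def using finite_items by (intro card_mono) auto
      with less show False by simp
    qed
  }
qed

lemma named_1: "named 1 hd"
  unfolding named_def
proof (intro ballI)
  fix u u' assume "u \<in> subs 1" "u' \<in> subs 1"
  then show "hd u < hd u' \<longleftrightarrow> enc b u < enc b u'"
    using subsD[of u 1] subsD[of u' 1] by (cases u; cases u') auto
qed

end


section \<open>Programs\<close>

inductive_cases exec_SkipE: "exec w B Skip s s'"
inductive_cases exec_AssignE: "exec w B (x ::= e) s s'"
inductive_cases exec_WriteE: "exec w B (Write A a e) s s'"
inductive_cases exec_SeqE: "exec w B (c ;; c') s s'"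
inductive_cases exec_IfE: "exec w B (If b c c') s s'"

lemma wp_Skip_iff [simp]: "wp w B Skip Q r m t \<longleftrightarrow> Q r m t"
  by (auto simp: wp_def intro: exec.Skip elim!: exec_SkipE)

lemma wp_Assign_iff [simp]:
  "wp w B (x ::= e) Q r m t \<longleftrightarrow> safe w B e r m \<and> Q (r(x := val w e r m)) m t"
  by (rule iffI) (auto simp: wp_def elim!: exec_AssignE intro: exec.Assign)

lemma wp_Write_iff [simp]:
  "wp w B (Write A a e) Q r m t \<longleftrightarrow> safe w B a r m \<and> safe w B e r m \<and> val w a r m \<le> B \<and>
     Q r (m(A := (m A)(val w a r m := val w e r m))) t"
  by (rule iffI) (auto simp: wp_def elim!: exec_WriteE intro: exec.Write)

lemma wp_Seq_iff [simp]: "wp w B (c ;; c') Q r m t \<longleftrightarrow> wp w B c (wp w B c' Q) r m t"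
proof (rule iffI)
  assume "wp w B (c ;; c') Q r m t"
  then obtain r' m' t' where ex: "exec w B (c ;; c') (r, m, t) (r', m', t')" "Q r' m' t'"
    unfolding wp_def by blast
  from ex(1) show "wp w B c (wp w B c' Q) r m t"
    using ex(2) unfolding wp_def by (elim exec_SeqE) (metis prod_cases3)
qed (rule wp_Seq)

lemma wp_If_iff [simp]:
  "wp w B (If b c c') Q r m t \<longleftrightarrow> bsafe w B b r m \<and>
     (if bval w b r m then wp w B c Q r m t else wp w B c' Q r m t)"
proof (rule iffI)
  assume "wp w B (If b c c') Q r m t"
  then obtain r' m' t' where ex: "exec w B (If b c c') (r, m, t) (r', m', t')" "Q r' m' t'"
    unfolding wp_def by blast
  from ex(1) show "bsafe w B b r m \<and> (if bval w b r m then wp w B c Q r m t else wp w B c' Q r m t)"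
    by (rule exec_IfE) (use ex(2) in \<open>auto simp: wp_def\<close>)
qed (auto intro: wp_If)

abbreviation add_exp (infixl "[+]" 65) where "a [+] b \<equiv> Op Add a b"
abbreviation sub_exp (infixl "[-]" 65) where "a [-] b \<equiv> Op Sub a b"
abbreviation mul_exp (infixl "[*]" 70) where "a [*] b \<equiv> Op Mul a b"
abbreviation div_exp (infixl "[div]" 70) where "a [div] b \<equiv> Op Div a b"
abbreviation mod_exp (infixl "[mod]" 70) where "a [mod] b \<equiv> Op Mod a b"

definition same :: "nat set \<Rightarrow> (nat \<Rightarrow> 'a) \<Rightarrow> (nat \<Rightarrow> 'a) \<Rightarrow> bool" where
  "same X f g \<longleftrightarrow> (\<forall>x. x \<notin> X \<longrightarrow> g x = f x)"

lemma same_refl [simp]: "same X f f"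
  by (simp add: same_def)

lemma same_upd [simp]: "x \<in> X \<Longrightarrow> same X f (g(x := y)) = same X f g"
  by (auto simp: same_def)

text \<open>
  Arrays: \<open>aLM\<close> lengths minus one, cut off at the largest word; \<open>aEB\<close>, \<open>aBV\<close> positions and variables
  of the borders; \<open>aTX\<close> plain text; \<open>aSTK\<close> stack; \<open>aPR\<close>, \<open>aSU\<close> names of the windows near the two
  ends of each variable; \<open>aCR\<close> names of the crossing windows; \<open>aKA\<close>, \<open>aKB\<close> names of their halves;
  \<open>aVI\<close>, \<open>aO1\<close>, \<open>aO2\<close> the crossing windows unsorted, sorted by second half, and sorted; \<open>aCN\<close> counters;
  \<open>aTAG\<close> segment tree; \<open>aLO\<close>, \<open>aHI\<close>, \<open>aFL\<close> intervals and lengths of the factors; \<open>aFC\<close>, \<open>aSB\<close> first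
  child and next sibling in the trie of factors.
\<close>

abbreviation (input) "aLM \<equiv> 4 :: nat"
abbreviation (input) "aEB \<equiv> 5 :: nat"
abbreviation (input) "aBV \<equiv> 6 :: nat"
abbreviation (input) "aTX \<equiv> 7 :: nat"
abbreviation (input) "aSTK \<equiv> 8 :: nat"
abbreviation (input) "aPR \<equiv> 9 :: nat"
abbreviation (input) "aSU \<equiv> 10 :: nat"
abbreviation (input) "aCR \<equiv> 11 :: nat"
abbreviation (input) "aKA \<equiv> 12 :: nat"
abbreviation (input) "aKB \<equiv> 13 :: nat"
abbreviation (input) "aVI \<equiv> 14 :: nat"
abbreviation (input) "aO1 \<equiv> 15 :: nat"
abbreviation (input) "aO2 \<equiv> 16 :: nat"
abbreviation (input) "aCN \<equiv> 17 :: nat"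
abbreviation (input) "aTAG \<equiv> 18 :: nat"
abbreviation (input) "aLO \<equiv> 19 :: nat"
abbreviation (input) "aHI \<equiv> 20 :: nat"
abbreviation (input) "aFL \<equiv> 21 :: nat"
abbreviation (input) "aFC \<equiv> 22 :: nat"
abbreviation (input) "aSB \<equiv> 23 :: nat"

text \<open>\<open>rNM\<close> is N - 1, \<open>rC\<close> the window length, \<open>rTH\<close> the
  threshold of the tree traversal and \<open>rFB\<close> the flag for the plain trie.
  \<open>rH\<close> and \<open>rD\<close> are the current window length and the row width of the
  tables, \<open>rVC\<close> the number of crossing windows, \<open>rRP\<close> the number of leaves
  of the segment tree. \<open>rP\<close> is the position in S, \<open>rM\<close> the number of
  factors so far, \<open>rJ\<close> in the main loop the current border, \<open>rE\<close> and
  \<open>rB\<close> the bounds of the interval of the new factor, \<open>rQE\<close> the last index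
  of the text left for the trie.\<close>

abbreviation (input) "rI \<equiv> 1 :: nat"
abbreviation (input) "rV \<equiv> 2 :: nat"
abbreviation (input) "rNM \<equiv> 3 :: nat"
abbreviation (input) "rC \<equiv> 4 :: nat"
abbreviation (input) "rTH \<equiv> 5 :: nat"
abbreviation (input) "rX \<equiv> 6 :: nat"
abbreviation (input) "rY \<equiv> 7 :: nat"
abbreviation (input) "rSP \<equiv> 8 :: nat"
abbreviation (input) "rK \<equiv> 9 :: nat"
abbreviation (input) "rE \<equiv> 10 :: nat"
abbreviation (input) "rGO \<equiv> 11 :: nat"
abbreviation (input) "rH \<equiv> 12 :: nat"
abbreviation (input) "rD \<equiv> 13 :: nat"
abbreviation (input) "rVC \<equiv> 14 :: nat"
abbreviation (input) "rNB \<equiv> 15 :: nat"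
abbreviation (input) "rJ \<equiv> 16 :: nat"
abbreviation (input) "rS \<equiv> 17 :: nat"
abbreviation (input) "rP \<equiv> 18 :: nat"
abbreviation (input) "rM \<equiv> 19 :: nat"
abbreviation (input) "rQE \<equiv> 20 :: nat"
abbreviation (input) "rQ \<equiv> 21 :: nat"
abbreviation (input) "rCUR \<equiv> 22 :: nat"
abbreviation (input) "rCH \<equiv> 23 :: nat"
abbreviation (input) "rLO \<equiv> 24 :: nat"
abbreviation (input) "rHI \<equiv> 25 :: nat"
abbreviation (input) "rMID \<equiv> 26 :: nat"
abbreviation (input) "rRP \<equiv> 27 :: nat"
abbreviation (input) "rIT \<equiv> 28 :: nat"
abbreviation (input) "rL \<equiv> 29 :: nat"
abbreviation (input) "rA \<equiv> 30 :: nat"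
abbreviation (input) "rB \<equiv> 31 :: nat"
abbreviation (input) "rFB \<equiv> 32 :: nat"

section \<open>Lengths of the variables and traversal of the upper derivation tree\<close>

definition lens_prog :: com where
  "lens_prog = For rI (Num 0) (Reg 0) (
     rV ::= Reg rI [+] Num 1 ;;
     If (Equal (Read 0 (Reg rV)) (Num 0)) (Write aLM (Reg rV) (Num 0)) (
       rX ::= Read aLM (Read 0 (Reg rV)) ;;
       rY ::= Read aLM (Read 1 (Reg rV)) ;;
       If (Less (Reg rX) (MaxWord [-] Reg rY))
         (Write aLM (Reg rV) (Reg rX [+] Reg rY [+] Num 1))
         (Write aLM (Reg rV) MaxWord)))"

text \<open>The stack holds the nodes whose left subtree is being traversed. Leaves and borders
  alternate, so one counter \<open>rK\<close> numbers both. After the last leaf, \<open>rE\<close>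
  is not advanced, so it never exceeds N - 1.\<close>

definition dfs_body :: com where
  "dfs_body =
      If (Less (Read aLM (Reg rX)) (Reg rTH)) (
         Write aTX (Reg rK) (Read 1 (Reg rX)) ;;
         rE ::= Reg rE [+] Read aLM (Reg rX) ;;
         If (Equal (Reg rSP) (Num 0)) (rGO ::= Num 0) (
           rSP ::= Reg rSP [-] Num 1 ;;
           rY ::= Read aSTK (Reg rSP) ;;
           Write aEB (Reg rK) (Reg rE) ;;
           Write aBV (Reg rK) (Reg rY) ;;
           rK ::= Reg rK [+] Num 1 ;;
           rE ::= Reg rE [+] Num 1 ;;
           rX ::= Read 1 (Reg rY)))
       (Write aSTK (Reg rSP) (Reg rX) ;;
        rSP ::= Reg rSP [+] Num 1 ;;
        rX ::= Read 0 (Reg rX))"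

definition dfs_prog :: com where
  "dfs_prog =
     rX ::= Reg 0 ;; rSP ::= Num 0 ;; rK ::= Num 0 ;; rE ::= Num 0 ;; rGO ::= Num 1 ;;
     While (Neg (Equal (Reg rGO) (Num 0))) (
       dfs_body)"

locale ram_ctx = slp_ctx +
  fixes w B :: nat
  assumes w_pos: "0 < w" and n_word: "n < 2 ^ w" and n_B: "n \<le> B" and len_word: "len n \<le> 2 ^ w"
begin

text \<open>N - 1 is a word even if N = 2^w. Variables that do not derive a part of S may be much
  longer, hence the cap at the largest word.\<close>

definition LM :: "nat \<Rightarrow> nat" where
  "LM v = min (len v - 1) (2 ^ w - 1)"

lemma one_less_word: "1 < (2::nat) ^ w"
  using w_pos one_less_power[of "2::nat" w] by linarith

lemma LM_leaf: "var v \<Longrightarrow> lc v = 0 \<Longrightarrow> LM v = 0"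
  using leaf by (simp add: LM_def var_def)

lemma LM_node:
  assumes "var v" "lc v \<noteq> 0"
  shows "LM v = (if LM (lc v) < 2 ^ w - 1 - LM (rc v) then LM (lc v) + LM (rc v) + 1 else 2 ^ w - 1)"
proof -
  have "len v = len (lc v) + len (rc v)" "1 \<le> len (lc v)" "1 \<le> len (rc v)"
    using nodeD[OF assms] len_pos by auto
  then show ?thesis
    unfolding LM_def min_def by (auto; linarith)
qed

lemma lens_prog_wp:
  assumes r0: "r 0 = n" and m0: "m 0 = lc" "m 1 = rc"
    and post: "\<And>r' m' t'. same {rI, rV, rX, rY} r r' \<Longrightarrow> same {aLM} m m' \<Longrightarrow>
      (\<And>v. var v \<Longrightarrow> m' aLM v = LM v) \<Longrightarrow> t' \<le> t + n \<Longrightarrow> Q r' m' t'"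
  shows "wp w B lens_prog Q r m t"
  unfolding lens_prog_def
proof (rule wp_For[where h = n and T = "t + n" and I = "\<lambda>i r' m' t'. same {rI, rV, rX, rY} r r' \<and>
    same {aLM} m m' \<and> (\<forall>v. 1 \<le> v \<and> v \<le> i \<longrightarrow> m' aLM v = LM v) \<and> t' = t + i"])
  fix i r' m' t'
  assume I: "same {rI, rV, rX, rY} r r' \<and> same {aLM} m m' \<and>
    (\<forall>v. 1 \<le> v \<and> v \<le> i \<longrightarrow> m' aLM v = LM v) \<and> t' = t + i" and i: "i < n" "r' rI = i"
  have v: "var (Suc i)" using i by (simp add: var_def)
  have mm: "m' 0 = lc" "m' 1 = rc" "m' (Suc 0) = rc"
    using I m0 by (auto simp: same_def)
  have w: "Suc i < 2 ^ w" "Suc i \<le> B" using i n_word n_B by auto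
  have lm: "LM x \<le> 2 ^ w - 1" for x by (simp add: LM_def)
  let ?Q = "\<lambda>r'' m'' t''. r'' rI = i \<and> same {rI, rV, rX, rY} r (r''(rI := Suc i)) \<and> same {aLM} m m'' \<and>
    (\<forall>v. 1 \<le> v \<and> v \<le> Suc i \<longrightarrow> m'' aLM v = LM v) \<and> t'' = t + Suc i"
  show "t' < t + n \<and> wp w B (
     rV ::= Reg rI [+] Num 1 ;;
     If (Equal (Read 0 (Reg rV)) (Num 0)) (Write aLM (Reg rV) (Num 0)) (
       rX ::= Read aLM (Read 0 (Reg rV)) ;;
       rY ::= Read aLM (Read 1 (Reg rV)) ;;
       If (Less (Reg rX) (MaxWord [-] Reg rY))
         (Write aLM (Reg rV) (Reg rX [+] Reg rY [+] Num 1))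
         (Write aLM (Reg rV) MaxWord))) ?Q r' m' (Suc t')"
  proof (cases "lc (Suc i) = 0")
    case True
    then show ?thesis
      using I i mm w one_less_word v
      by (auto simp: LM_leaf le_Suc_eq)
  next
    case False
    note nd = nodeD[OF v False]
    have "m' aLM (lc (Suc i)) = LM (lc (Suc i))" "m' aLM (rc (Suc i)) = LM (rc (Suc i))"
      using I nd by auto
    moreover have "LM (rc (Suc i)) < 2 ^ w"
      using lm[of "rc (Suc i)"] one_less_word by linarith
    ultimately show ?thesis
      using I i mm w one_less_word v False LM_node[OF v False] lm[of "rc (Suc i)"] nd
      by (auto simp: le_Suc_eq less_diff_conv)
  qed
next
  fix r' m' t'
  assume "same {rI, rV, rX, rY} r r' \<and> same {aLM} m m' \<and>
    (\<forall>v. 1 \<le> v \<and> v \<le> n \<longrightarrow> m' aLM v = LM v) \<and> t' = t + n"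
  then show "Q r' m' t'"
    by (intro post) (auto simp: var_def)
qed (auto simp: n_word r0 same_def)

text \<open>The borders still owed by the stack, top first, when the finished text ends just before
  \<open>e\<close>: the border of the top node, then its right subtree, then the rest of the
  stack.\<close>

fun pbds :: "nat \<Rightarrow> nat \<Rightarrow> nat list \<Rightarrow> (nat \<times> nat) list" where
  "pbds th e [] = []"
| "pbds th e (v # st) = (e - 1, v) # bds th (rc v) e @ pbds th (e + len (rc v)) st"

text \<open>The number of nodes of the visited part of the subtree, a binary tree with
  \<open>length (lvs th v)\<close> leaves. The traversal spends one iteration per node.\<close>

definition cost :: "nat \<Rightarrow> nat \<Rightarrow> nat" where
  "cost th v = 2 * length (lvs th v) - 1"

lemma lvs_ne: "length (lvs th v) \<ge> 1"
proof (induction v rule: less_induct)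
  case (less v)
  then show ?case
    using nodeD[of v] by (subst lvs.simps) (auto intro: trans_le_add1)
qed

lemma cost_pos: "1 \<le> cost th v"
  using lvs_ne[of th v] by (simp add: cost_def)

lemma cost_node: "th < len i \<Longrightarrow> var i \<Longrightarrow> lc i \<noteq> 0 \<Longrightarrow> cost th i = Suc (cost th (lc i) + cost th (rc i))"
  using lvs_ne[of th "lc i"] lvs_ne[of th "rc i"] by (simp add: cost_def lvs_node)

text \<open>The invariant describes the future: the not yet written parts of both lists are the ones
  due from the current node and the stack. The length equation bounds \<open>rE\<close>, the last
  one balances elapsed ticks against remaining nodes.\<close>

definition dfs_inv :: "nat \<Rightarrow> regfile \<Rightarrow> memory \<Rightarrow> nat \<Rightarrow> regfile \<Rightarrow> memory \<Rightarrow> nat \<Rightarrow> nat list \<Rightarrow> bool" where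
  "dfs_inv th r m t r' m' t' st \<longleftrightarrow>
     same {rX, rY, rSP, rK, rE, rGO} r r' \<and> same {aTX, aSTK, aEB, aBV} m m' \<and>
     r' rGO = 1 \<and> var (r' rX) \<and> r' rSP = length st \<and> (\<forall>v \<in> set st. var v \<and> lc v \<noteq> 0) \<and>
     (\<forall>j < length st. m' aSTK j = rev st ! j) \<and>
     r' rK \<le> length (bds th n 0) \<and>
     drop (r' rK) (bds th n 0) = bds th (r' rX) (r' rE) @ pbds th (r' rE + len (r' rX)) st \<and>
     drop (r' rK) (lvs th n) = lvs th (r' rX) @ concat (map (\<lambda>v. lvs th (rc v)) st) \<and>
     r' rE + len (r' rX) + sum_list (map (\<lambda>v. len (rc v)) st) = len n \<and>
     (\<forall>j < r' rK. m' aEB j = fst (bds th n 0 ! j) \<and> m' aBV j = snd (bds th n 0 ! j) \<and>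
        m' aTX j = rc (lvs th n ! j)) \<and>
     t' + cost th (r' rX) + sum_list (map (\<lambda>v. cost th (rc v)) st) = t + cost th n"

lemma length_pbds: "length st \<le> length (pbds th e st)"
proof (induction st arbitrary: e)
  case (Cons v st)
  show ?case using Cons[of "e + len (rc v)"] by simp
qed simp

lemma drop_eq_ConsD: "drop k xs = y # ys \<Longrightarrow> k < length xs \<and> xs ! k = y \<and> drop (Suc k) xs = ys"
  using Cons_nth_drop_Suc[of k xs] by (cases "k < length xs") auto

lemma dfs_prog_wp:
  assumes r0: "r 0 = n" and m0: "m 0 = lc" "m 1 = rc" and lm: "\<And>v. var v \<Longrightarrow> m aLM v = LM v"
    and th: "r rTH = th" "1 \<le> th" and fits: "length (bds th n 0) < B" "length (bds th n 0) < 2 ^ w"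
    and post: "\<And>r' m' t'. same {rX, rY, rSP, rK, rE, rGO} r r' \<Longrightarrow>
      same {aTX, aSTK, aEB, aBV} m m' \<Longrightarrow>
      (\<And>j. j < length (bds th n 0) \<Longrightarrow> m' aEB j = fst (bds th n 0 ! j) \<and> m' aBV j = snd (bds th n 0 ! j)) \<Longrightarrow>
      (\<And>j. j < length (lvs th n) \<Longrightarrow> m' aTX j = rc (lvs th n ! j)) \<Longrightarrow>
      r' rK = length (bds th n 0) \<Longrightarrow> t' \<le> t + 2 * length (bds th n 0) + 1 \<Longrightarrow> Q r' m' t'"
  shows "wp w B dfs_prog Q r m t"
proof -
  let ?D = "bds th n 0" and ?L = "lvs th n"
  have vn: "var n" using n_pos by (simp add: var_def)
  have T: "t + cost th n = t + 2 * length ?D + 1"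
    using length_lvs[OF vn, of th 0] by (simp add: cost_def)
  define I where "I r' m' t' \<longleftrightarrow> (\<exists>st. dfs_inv th r m t r' m' t' st) \<or>
     same {rX, rY, rSP, rK, rE, rGO} r r' \<and> same {aTX, aSTK, aEB, aBV} m m' \<and> r' rGO = 0 \<and>
     (\<forall>j < length ?D. m' aEB j = fst (?D ! j) \<and> m' aBV j = snd (?D ! j)) \<and>
     (\<forall>j < length ?L. m' aTX j = rc (?L ! j)) \<and> r' rK = length ?D \<and> t' \<le> t + cost th n" for r' m' t'
  have body: "t' < t + cost th n \<and> wp w B
     dfs_body I r' m' (Suc t')"
    if inv: "dfs_inv th r m t r' m' t' st" for r' m' t' st
  proof -
    note inv' = inv[unfolded dfs_inv_def]
    define x e k where "x = r' rX" and "e = r' rE" and "k = r' rK"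
    have mm: "m' 0 = lc" "m' (Suc 0) = rc" "m' aLM = m aLM" "r' rTH = th" "m' 1 = rc"
      using inv' m0 th by (auto simp: same_def)
    have vx: "var x" using inv' by (simp add: x_def)
    have xB: "x \<le> B" using vx n_B by (simp add: var_def)
    have lenN: "e + len x + sum_list (map (\<lambda>v. len (rc v)) st) = len n"
      using inv' by (simp add: x_def e_def)
    have lmx: "m' aLM x = len x - 1"
      using lm[OF vx] mm(3) lenN len_word by (simp add: LM_def)
    have l1: "1 \<le> len x" using len_pos vx .
    have dD: "drop k ?D = bds th x e @ pbds th (e + len x) st"
      using inv' by (simp add: x_def e_def k_def)
    have dL: "drop k ?L = lvs th x @ concat (map (\<lambda>v. lvs th (rc v)) st)"
      using inv' by (simp add: x_def e_def k_def)
    have kD: "k \<le> length ?D" using inv' by (simp add: k_def)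
    have stD: "length st \<le> length ?D"
      using arg_cong[OF dD, of length] length_pbds[of st th "e + len x"] by simp
    have tt: "t' + cost th x + sum_list (map (\<lambda>v. cost th (rc v)) st) = t + cost th n"
      using inv' by (simp add: x_def)
    have "t' < t + cost th n" using tt cost_pos[of th x] by simp
    moreover have "wp w B
     dfs_body I r' m' (Suc t')"
    proof (cases "len x - 1 < th")
      case leafx: True
      then have "\<not> th < len x"
        using l1 by linarith
      then have lv: "lvs th x = [x]" "bds th x e = []"
        using lvs_leaf bds_leaf by blast+
      have dL': "k < length ?L" "?L ! k = x" "drop (Suc k) ?L = concat (map (\<lambda>v. lvs th (rc v)) st)"
        using drop_eq_ConsD[of k ?L x] dL lv by auto
      have cx: "cost th x = 1" by (simp add: cost_def lv)
      have es: "e + (len x - 1) < 2 ^ w"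
        using lenN len_word l1 by linarith
      show ?thesis
      proof (cases st)
        case Nil
        have kk: "k = length ?D"
          using dD lv Nil kD by simp
        have "length ?L = Suc k"
          using length_lvs[OF vn, of th 0] kk by simp
        then have "I (r'(rE := e + (len x - 1), rGO := 0)) (m'(aTX := (m' aTX)(k := rc x))) (Suc t')"
          unfolding I_def using inv' kk dL'(2) tt cx Nil
          by (intro disjI2) (auto simp: k_def less_Suc_eq)
        then show ?thesis
          using leafx Nil inv' mm lmx xB es fits kD one_less_word
          unfolding dfs_body_def by (simp add: x_def[symmetric] e_def[symmetric] k_def[symmetric])
      next
        case (Cons v st')
        have v: "var v" "lc v \<noteq> 0" using inv' Cons by auto
        note nd = nodeD[OF v]
        have dD': "k < length ?D" "?D ! k = (e + len x - 1, v)"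
          "drop (Suc k) ?D = bds th (rc v) (e + len x) @ pbds th (e + len x + len (rc v)) st'"
          using drop_eq_ConsD[of k ?D "(e + len x - 1, v)"] dD lv Cons by auto
        \<comment> \<open>The pending right child contributes at least one character, so the
          position after x is still below N and therefore a word.\<close>
        have es': "e + (len x - 1) + 1 < 2 ^ w" "e + (len x - 1) + 1 = e + len x"
          "Suc (e + (len x - 1)) = e + len x" "e + (len x - 1) = e + len x - 1"
          using lenN len_word l1 Cons len_pos[OF nd(8)] by auto
        have stk: "m' aSTK (length st') = v"
          using inv' Cons by (auto simp: nth_append)
        have "dfs_inv th r m t (r'(rSP := length st', rY := v, rK := Suc k, rE := e + len x, rX := rc v))
           (m'(aTX := (m' aTX)(k := rc x), aEB := (m' aEB)(k := e + len x - 1), aBV := (m' aBV)(k := v)))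
           (Suc t') st'"
          unfolding dfs_inv_def
          using inv' dL' dD' tt cx Cons v nd lenN
          by (auto simp: k_def less_Suc_eq nth_append)
        then have fin: "I (r'(rSP := length st', rY := v, rK := Suc k, rE := e + len x, rX := rc v))
           (m'(aTX := (m' aTX)(k := rc x), aEB := (m' aEB)(k := e + len x - 1), aBV := (m' aBV)(k := v)))
           (Suc t')"
          unfolding I_def by blast
        have vB: "v \<le> B" using v n_B by (simp add: var_def)
        have sp: "r' rSP = Suc (length st')" using inv' Cons by simp
        have "Suc k < 2 ^ w" "Suc (length st') < 2 ^ w" "length st' \<le> B" "k \<le> B"
          using dD'(1) fits stD Cons by auto
        then show ?thesis
          using leafx mm lmx xB es es' one_less_word vB stk sp fin
          unfolding dfs_body_def
          by (simp add: x_def[symmetric] e_def[symmetric] k_def[symmetric])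
      qed
    next
      case False
      then have big: "th < len x" using l1 by simp
      have lcx: "lc x \<noteq> 0"
      proof
        assume "lc x = 0"
        then have "len x = 1" using leaf[of x] vx by (simp add: var_def)
        with big th(2) show False by simp
      qed
      note nd = nodeD[OF vx lcx]
      have "dfs_inv th r m t (r'(rSP := Suc (length st), rX := lc x))
         (m'(aSTK := (m' aSTK)(length st := x))) (Suc t') (x # st)"
        unfolding dfs_inv_def
        using inv' dL dD tt cost_node[OF big vx lcx] nd lenN vx lcx lvs_node[OF big vx lcx] bds_node[OF big vx lcx, of e]
        by (auto simp: k_def e_def nth_append less_Suc_eq add.assoc)
      then have fin: "I (r'(rSP := Suc (length st), rX := lc x))
         (m'(aSTK := (m' aSTK)(length st := x))) (Suc t')"
        unfolding I_def by blast
      have sp: "r' rSP = length st" using inv' by simp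
      have "Suc (length st) \<le> length ?D"
        using arg_cong[OF dD, of length] length_pbds[of st th "e + len x"] bds_node[OF big vx lcx, of e] by simp
      then have "Suc (length st) < 2 ^ w" "length st \<le> B"
        using fits by auto
      then show ?thesis
        using False mm lmx xB sp fin one_less_word
        unfolding dfs_body_def by (simp add: x_def[symmetric])
    qed
    ultimately show ?thesis by blast
  qed
  have init: "dfs_inv th r m t (r(rX := n, rSP := 0, rK := 0, rE := 0, rGO := 1)) m t []"
    unfolding dfs_inv_def using vn by simp
  have "wp w B (While (Neg (Equal (Reg rGO) (Num 0))) dfs_body) Q
      (r(rX := n, rSP := 0, rK := 0, rE := 0, rGO := 1)) m t"
  proof (rule wp_While[where I = I and T = "t + cost th n"])
    show "I (r(rX := n, rSP := 0, rK := 0, rE := 0, rGO := 1)) m t"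
      unfolding I_def using init by blast
  next
    fix r' m' t' assume I: "I r' m' t'"
    show "bsafe w B (Neg (Equal (Reg rGO) (Num 0))) r' m'"
      using one_less_word by simp
    {
      assume "bval w (Neg (Equal (Reg rGO) (Num 0))) r' m'"
      then obtain st where "dfs_inv th r m t r' m' t' st"
        using I unfolding I_def by auto
      from body[OF this] show "t' < t + cost th n \<and> wp w B
       dfs_body I r' m' (Suc t')" .
    }
    assume "\<not> bval w (Neg (Equal (Reg rGO) (Num 0))) r' m'"
    then have "r' rGO = 0" by simp
    with I show "Q r' m' t'"
      unfolding I_def T by (intro post) (auto simp: dfs_inv_def)
  qed
  then show ?thesis
    unfolding dfs_prog_def using r0 one_less_word by simp
qed

end


section \<open>Sorting windows by doubling\<close>

declare One_nat_def [simp del]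

section \<open>Stable counting sort and naming by rank\<close>

definition cpass :: "arr \<Rightarrow> arr \<Rightarrow> arr \<Rightarrow> com" where
  "cpass IN KEY OUT =
     For rI (Num 0) (Reg rNB) (Write aCN (Reg rI) (Num 0)) ;;
     For rI (Num 0) (Reg rVC) (
       rX ::= Read KEY (Read IN (Reg rI)) ;;
       Write aCN (Reg rX) (Read aCN (Reg rX) [+] Num 1)) ;;
     rY ::= Num 0 ;;
     For rI (Num 0) (Reg rNB) (
       rX ::= Read aCN (Reg rI) ;;
       Write aCN (Reg rI) (Reg rY) ;;
       rY ::= Reg rY [+] Reg rX) ;;
     For rI (Num 0) (Reg rVC) (
       rV ::= Read IN (Reg rI) ;;
       rX ::= Read KEY (Reg rV) ;;
       Write OUT (Read aCN (Reg rX)) (Reg rV) ;;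
       Write aCN (Reg rX) (Read aCN (Reg rX) [+] Num 1))"

lemma card_less_Suc_eq:
  "card {u. u < Suc i \<and> key u = v} = card {u. u < i \<and> key u = v} + (if key i = v then 1 else 0)"
proof -
  have "{u. u < Suc i \<and> key u = v} = {u. u < i \<and> key u = v} \<union> (if key i = v then {i} else {})"
    by (auto simp: less_Suc_eq)
  then show ?thesis by auto
qed

lemma card_key_less_Suc:
  fixes key :: "nat \<Rightarrow> nat"
  shows "card {u. u < (V::nat) \<and> key u < Suc v} = card {u. u < V \<and> key u < v} + card {u. u < V \<and> key u = v}"
proof -
  have "{u. u < V \<and> key u < Suc v} = {u. u < V \<and> key u < v} \<union> {u. u < V \<and> key u = v}"
    by auto
  moreover have "card ({u. u < V \<and> key u < v} \<union> {u. u < V \<and> key u = v}) =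
      card {u. u < V \<and> key u < v} + card {u. u < V \<and> key u = v}"
    by (rule card_Un_disjoint) auto
  ultimately show ?thesis by simp
qed

lemma card_Collect_less_le: "card {u. u < (V::nat) \<and> P u} \<le> V"
  using card_mono[of "{..<V}" "{u. u < V \<and> P u}"] by auto

lemma cpass_wp:
  fixes r :: regfile and m :: memory and IN KEY OUT :: arr
  defines "NB \<equiv> r rNB" and "VC \<equiv> r rVC"
  defines "key \<equiv> \<lambda>t. m KEY (m IN t)"
  assumes arrs: "IN \<noteq> aCN" "KEY \<noteq> aCN" "OUT \<noteq> aCN" "OUT \<noteq> IN" "OUT \<noteq> KEY"
    and w: "0 < w" "NB < 2 ^ w" "VC < 2 ^ w" "NB \<le> B" "VC \<le> B"
    and keys: "\<And>t. t < VC \<Longrightarrow> key t < NB" "\<And>t. t < VC \<Longrightarrow> m IN t \<le> B"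
    and post: "\<And>r' m' t'. same {rI, rV, rX, rY} r r' \<Longrightarrow> same {aCN, OUT} m m' \<Longrightarrow>
      (\<And>u. u < VC \<Longrightarrow> m' OUT (cpos VC key u) = m IN u) \<Longrightarrow> t' \<le> t + 2 * NB + 2 * VC \<Longrightarrow> Q r' m' t'"
  shows "wp w B (cpass IN KEY OUT) Q r m t"
proof -
  have w0: "(0::nat) < 2 ^ w" "1 < (2::nat) ^ w" "Suc 0 < 2 ^ w"
    using w(1) one_less_power[of "2::nat" w] by (auto simp: One_nat_def)
  let ?S = "{rI, rV, rX, rY}"
  define R where "R = (\<lambda>r' m'. same ?S r r' \<and> same {aCN, OUT} m m')"
  have RD: "r' rNB = NB" "r' rVC = VC" "m' KEY = m KEY" "m' IN = m IN" if "R r' m'" for r' m'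
    using that arrs by (auto simp: R_def same_def NB_def VC_def)
  have R0: "R r m" by (simp add: R_def)
  have Rr: "R (r'(x := y)) m' = R r' m'" if "x \<in> ?S" for r' m' x y
    using that by (simp add: R_def)
  have Rm: "R r' (m'(x := y)) = R r' m'" if "x \<in> {aCN, OUT}" for r' m' x y
    using that by (simp add: R_def)
  note Rs = Rr Rm
  have L4: "wp w B (For rI (Num 0) (Reg rVC) (
       rV ::= Read IN (Reg rI) ;;
       rX ::= Read KEY (Reg rV) ;;
       Write OUT (Read aCN (Reg rX)) (Reg rV) ;;
       Write aCN (Reg rX) (Read aCN (Reg rX) [+] Num 1))) Q r' m' t'"
    if R: "R r' m'" and t: "t' \<le> t + 2 * NB + VC"
      and cn: "\<And>v. v < NB \<Longrightarrow> m' aCN v = card {u. u < VC \<and> key u < v}" for r' m' t'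
  \<comment> \<open>The counter of a key is the start of its block plus the number of its items
    already placed. For the key of item i this is the value of \<open>cpos\<close> at i.\<close>
  proof (rule wp_For[where h = VC and T = "t + 2 * NB + 2 * VC" and I = "\<lambda>i r' m' t'. R r' m' \<and>
      t' \<le> t + 2 * NB + VC + i \<and> (\<forall>v < NB. m' aCN v = card {u. u < VC \<and> key u < v} + card {u. u < i \<and> key u = v}) \<and>
      (\<forall>u < i. m' OUT (cpos VC key u) = m IN u)"], goal_cases)
    case (6 i r1 m1 t1)
    then have R1: "R r1 m1" and i: "i < VC" and r1: "r1 rI = i" by auto
    note RR = RD[OF R1]
    have ki: "m KEY (m IN i) = key i" by (simp add: key_def)
    have cni: "m1 aCN (key i) = cpos VC key i"
      using 6 keys(1)[OF i] by (simp add: cpos_def)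
    have cl: "cpos VC key i < VC" using cpos_less[OF i] .
    have ne: "cpos VC key u \<noteq> cpos VC key i" if "u < i" for u
      using cpos_less_iff[of u VC i key] cpos_less_iff[of i VC u key] i that by auto
    show ?case
      using 6 RR arrs ki cni cl w w0 keys[OF i] ne
      by (auto simp: Rs card_less_Suc_eq All_less_Suc)
  next
    case (7 r1 m1 t1)
    then show ?case by (intro post) (auto simp: R_def)
  next
    case (5 i r1 m1 t1)
    then show ?case using RD[of r1 m1] by simp
  qed (use R t cn w w0 in \<open>auto simp: Rs\<close>)
  have L3: "wp w B (For rI (Num 0) (Reg rNB) (
       rX ::= Read aCN (Reg rI) ;;
       Write aCN (Reg rI) (Reg rY) ;;
       rY ::= Reg rY [+] Reg rX)) (wp w B (For rI (Num 0) (Reg rVC) (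
       rV ::= Read IN (Reg rI) ;;
       rX ::= Read KEY (Reg rV) ;;
       Write OUT (Read aCN (Reg rX)) (Reg rV) ;;
       Write aCN (Reg rX) (Read aCN (Reg rX) [+] Num 1))) Q) r' m' t'"
    if R: "R r' m'" and t: "t' \<le> t + NB + VC" and y: "r' rY = 0"
      and cn: "\<And>v. v < NB \<Longrightarrow> m' aCN v = card {u. u < VC \<and> key u = v}" for r' m' t'
  \<comment> \<open>Prefix sums in place: below i the counters are block starts already, from i on
    they are still frequencies.\<close>
  proof (rule wp_For[where h = NB and T = "t + 2 * NB + VC" and I = "\<lambda>i r' m' t'. R r' m' \<and>
      t' \<le> t + NB + VC + i \<and> (\<forall>v < NB. m' aCN v = (if i \<le> v then card {u. u < VC \<and> key u = v} else card {u. u < VC \<and> key u < v})) \<and>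
      r' rY = card {u. u < VC \<and> key u < i}"], goal_cases)
    case (6 i r1 m1 t1)
    then have R1: "R r1 m1" by auto
    note RR = RD[OF R1]
    have le: "card {u. u < VC \<and> key u < i} + card {u. u < VC \<and> key u = i} < 2 ^ w"
      using card_Collect_less_le[of VC "\<lambda>u. key u < Suc i"] card_key_less_Suc[of VC key i] w by simp
    show ?case
      using 6 RR w w0 le by (auto simp: Rs card_key_less_Suc)
  next
    case (7 r1 m1 t1)
    then show ?case by (intro L4) auto
  next
    case (5 i r1 m1 t1)
    then show ?case using RD[of r1 m1] by simp
  qed (use R t cn w w0 y in \<open>auto simp: Rs\<close>)
  have L2: "wp w B (For rI (Num 0) (Reg rVC) (
       rX ::= Read KEY (Read IN (Reg rI)) ;;
       Write aCN (Reg rX) (Read aCN (Reg rX) [+] Num 1)))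
      (\<lambda>r' m' t'. R r' m' \<and> t' \<le> t + NB + VC \<and> (\<forall>v < NB. m' aCN v = card {u. u < VC \<and> key u = v})) r' m' t'"
    if R: "R r' m'" and t: "t' \<le> t + NB"
      and cn: "\<And>v. v < NB \<Longrightarrow> m' aCN v = 0" for r' m' t'
  proof (rule wp_For[where h = VC and T = "t + NB + VC" and I = "\<lambda>i r' m' t'. R r' m' \<and>
      t' \<le> t + NB + i \<and> (\<forall>v < NB. m' aCN v = card {u. u < i \<and> key u = v})"], goal_cases)
    case (6 i r1 m1 t1)
    then have R1: "R r1 m1" and i: "i < VC" by auto
    note RR = RD[OF R1]
    have ki: "m KEY (m IN i) = key i" by (simp add: key_def)
    have "card {u. u < i \<and> key u = key i} < VC"
      using card_Collect_less_le[of i "\<lambda>u. key u = key i"] i by simp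
    then show ?case
      using 6 RR w w0 ki keys[OF i] by (auto simp: Rs card_less_Suc_eq)
  next
    case (5 i r1 m1 t1)
    then show ?case using RD[of r1 m1] by simp
  qed (use R t cn w w0 in \<open>auto simp: Rs\<close>)
  have L1: "wp w B (For rI (Num 0) (Reg rNB) (Write aCN (Reg rI) (Num 0)))
      (\<lambda>r' m' t'. R r' m' \<and> t' \<le> t + NB \<and> (\<forall>v < NB. m' aCN v = 0)) r m t"
  proof (rule wp_For[where h = NB and T = "t + NB" and I = "\<lambda>i r' m' t'. R r' m' \<and>
      t' \<le> t + i \<and> (\<forall>v < i. m' aCN v = 0)"], goal_cases)
    case (6 i r1 m1 t1)
    then have R1: "R r1 m1" by auto
    note RR = RD[OF R1]
    show ?case
      using 6 RR w w0 by (auto simp: Rs less_Suc_eq)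
  next
    case (5 i r1 m1 t1)
    then show ?case using RD[of r1 m1] by simp
  qed (use R0 w w0 in \<open>auto simp: Rs\<close>)
  show ?thesis
    unfolding cpass_def wp_Seq_iff
  proof (rule wp_mono[OF L1], goal_cases)
    case (1 r1 m1 t1)
    show ?case
    proof (rule wp_mono[OF L2[of r1 m1 t1]], goal_cases)
      case (4 r2 m2 t2)
      then show ?case
        using w0 by (auto simp: Rs intro!: L3)
    qed (use 1 in auto)
  qed
qed

text \<open>\<open>rS\<close> is the index at which the current run of equal pairs began. In a
  sorted array this is the number of strictly smaller entries, hence the rank.\<close>

definition name_prog :: com where
  "name_prog =
     rS ::= Num 0 ;; rV ::= Read aO2 (Num 0) ;;
     For rI (Num 0) (Reg rVC) (
       rX ::= Read aO2 (Reg rI) ;;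
       If (Conj (Equal (Read aKA (Reg rX)) (Read aKA (Reg rV))) (Equal (Read aKB (Reg rX)) (Read aKB (Reg rV))))
         Skip (rS ::= Reg rI) ;;
       Write aCR (Reg rX) (Reg rS) ;;
       rV ::= Reg rX)"

lemma name_prog_wp:
  fixes r :: regfile and m :: memory and q :: "nat \<Rightarrow> nat"
  defines "VC \<equiv> r rVC"
  assumes w: "0 < w" "VC < 2 ^ w" "VC \<le> B" and le: "\<And>u. u < VC \<Longrightarrow> m aO2 u \<le> B"
    and inj: "inj_on (m aO2) {..<VC}"
    and q: "\<And>u u'. u < VC \<Longrightarrow> u' < VC \<Longrightarrow> q (m aO2 u) = q (m aO2 u') \<longleftrightarrow>
      m aKA (m aO2 u) = m aKA (m aO2 u') \<and> m aKB (m aO2 u) = m aKB (m aO2 u')"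
    and sorted: "\<And>u u'. u \<le> u' \<Longrightarrow> u' < VC \<Longrightarrow> q (m aO2 u) \<le> q (m aO2 u')"
    and post: "\<And>r' m' t'. same {rI, rV, rX, rS} r r' \<Longrightarrow> same {aCR} m m' \<Longrightarrow>
      (\<And>u. u < VC \<Longrightarrow> m' aCR (m aO2 u) = card {u'. u' < VC \<and> q (m aO2 u') < q (m aO2 u)}) \<Longrightarrow>
      t' \<le> t + VC \<Longrightarrow> Q r' m' t'"
  shows "wp w B name_prog Q r m t"
proof -
  have w0: "(0::nat) < 2 ^ w" by simp
  define rk where "rk u = card {u'. u' < VC \<and> q (m aO2 u') < q (m aO2 u)}" for u
  define R where "R = (\<lambda>r' m'. same {rI, rV, rX, rS} r r' \<and> same {aCR} m m')"
  have RD: "r' rVC = VC" "m' aKA = m aKA" "m' aKB = m aKB" "m' aO2 = m aO2" if "R r' m'" for r' m'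
    using that by (auto simp: R_def same_def VC_def)
  have Rr: "R (r'(x := y)) m' = R r' m'" if "x \<in> {rI, rV, rX, rS}" for r' m' x y
    using that by (simp add: R_def)
  have Rm: "R r' (m'(aCR := y)) = R r' m'" for r' m' y
    by (simp add: R_def)
  have rk0: "rk 0 = 0"
  proof -
    have "{u'. u' < VC \<and> q (m aO2 u') < q (m aO2 0)} = {}"
      using sorted[of 0] by (auto simp: not_less[symmetric])
    then show ?thesis by (simp add: rk_def)
  qed
  have rkeq: "rk i = rk (i - 1)" if "q (m aO2 i) = q (m aO2 (i - 1))" for i
    using that by (simp add: rk_def)
  have rkne: "rk i = i" if "q (m aO2 i) \<noteq> q (m aO2 (i - 1))" "i < VC" for i
  proof -
    have "i \<noteq> 0" using that by (cases i) auto
    have less: "q (m aO2 (i - 1)) < q (m aO2 i)"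
      using sorted[of "i - 1" i] that by (simp add: order.strict_iff_order)
    have "{u'. u' < VC \<and> q (m aO2 u') < q (m aO2 i)} = {..<i}"
    proof (intro set_eqI iffI)
      fix u assume "u \<in> {u'. u' < VC \<and> q (m aO2 u') < q (m aO2 i)}"
      then have "\<not> i \<le> u" using sorted[of i u] by (auto simp: not_less[symmetric])
      then show "u \<in> {..<i}" by simp
    next
      fix u assume "u \<in> {..<i}"
      then have "q (m aO2 u) \<le> q (m aO2 (i - 1))" "u < VC"
        using sorted[of u "i - 1"] that by auto
      then show "u \<in> {u'. u' < VC \<and> q (m aO2 u') < q (m aO2 i)}"
        using less by simp
    qed
    then show ?thesis by (simp add: rk_def)
  qed
  have main: "wp w B (For rI (Num 0) (Reg rVC) (
       rX ::= Read aO2 (Reg rI) ;;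
       If (Conj (Equal (Read aKA (Reg rX)) (Read aKA (Reg rV))) (Equal (Read aKB (Reg rX)) (Read aKB (Reg rV))))
         Skip (rS ::= Reg rI) ;;
       Write aCR (Reg rX) (Reg rS) ;;
       rV ::= Reg rX)) Q (r(rS := 0, rV := m aO2 0)) m t"
  \<comment> \<open>At i = 0 truncated subtraction gives i - 1 = 0: the first entry is compared with
    itself and gets the initial name 0.\<close>
  proof (rule wp_For[where h = VC and T = "t + VC" and I = "\<lambda>i r' m' t'. R r' m' \<and> t' \<le> t + i \<and>
      r' rV = m aO2 (i - 1) \<and> r' rS = rk (i - 1) \<and> (\<forall>u < i. m' aCR (m aO2 u) = rk u)"], goal_cases)
    case (6 i r1 m1 t1)
    then have R1: "R r1 m1" and i: "i < VC" by auto
    note RR = RD[OF R1]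
    have ne: "m aO2 u \<noteq> m aO2 i" if "u < i" for u
      using inj_onD[OF inj, of u i] that i by auto
    have qq: "q (m aO2 i) = q (m aO2 (i - 1)) \<longleftrightarrow>
      m aKA (m aO2 i) = m aKA (m aO2 (i - 1)) \<and> m aKB (m aO2 i) = m aKB (m aO2 (i - 1))"
      using q[of i "i - 1"] i by simp
    have BB: "m aO2 i \<le> B" "m aO2 (i - 1) \<le> B" "i \<le> B"
      using le[of i] le[of "i - 1"] i w by auto
    show ?case
    proof (cases "q (m aO2 i) = q (m aO2 (i - 1))")
      case True
      then have "m aKA (m aO2 i) = m aKA (m aO2 (i - 1))" "m aKB (m aO2 i) = m aKB (m aO2 (i - 1))"
        using qq by auto
      then show ?thesis
        using 6 RR BB rkeq[OF True] ne by (auto simp: Rr Rm less_Suc_eq)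
    next
      case False
      then have "\<not> (m aKA (m aO2 i) = m aKA (m aO2 (i - 1)) \<and> m aKB (m aO2 i) = m aKB (m aO2 (i - 1)))"
        using qq by auto
      then show ?thesis
        using 6 RR BB rkne[OF False i] ne by (auto simp: Rr Rm less_Suc_eq)
    qed
  next
    case (7 r1 m1 t1)
    then show ?case by (intro post) (auto simp: R_def rk_def)
  next
    case 4
    then show ?case using rk0 by (simp add: R_def)
  next
    case (5 i r1 m1 t1)
    then show ?case using RD[of r1 m1] by simp
  qed (use w in auto)
  then show ?thesis
    unfolding name_prog_def using w0 by simp
qed

section \<open>Names of the windows near both ends of each variable\<close>

definition dp_pre :: com where
  "dp_pre =
     If (Neg (Less (Read aLM (Reg rX)) (Reg rJ [+] Reg rH [-] Num 1)))
       (Write aPR (Reg rV [*] Reg rD [+] Reg rJ) (Read aPR (Reg rX [*] Reg rD [+] Reg rJ)))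
     (If (Less (Read aLM (Reg rX)) (Reg rJ))
       (Write aPR (Reg rV [*] Reg rD [+] Reg rJ)
         (Read aPR (Reg rY [*] Reg rD [+] (Reg rJ [-] Read aLM (Reg rX) [-] Num 1))))
       (Write aPR (Reg rV [*] Reg rD [+] Reg rJ)
         (Read aCR (Reg rV [*] Reg rH [+] (Read aLM (Reg rX) [-] Reg rJ [+] Num 1)))))"

text \<open>Column j concerns the window starting j positions before the end, which exists only for
  j >= H. The cases are: inside the right child, inside the left child, and crossing, where the
  window starts j minus the length of the right child before the border.\<close>

definition dp_suf :: com where
  "dp_suf =
     If (Less (Reg rJ) (Reg rH)) Skip
     (If (Neg (Less (Read aLM (Reg rY)) (Reg rJ [-] Num 1)))
       (Write aSU (Reg rV [*] Reg rD [+] Reg rJ) (Read aSU (Reg rY [*] Reg rD [+] Reg rJ)))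
     (If (Less (Read aLM (Reg rY)) (Reg rJ [-] Reg rH))
       (Write aSU (Reg rV [*] Reg rD [+] Reg rJ)
         (Read aSU (Reg rX [*] Reg rD [+] (Reg rJ [-] Read aLM (Reg rY) [-] Num 1))))
       (Write aSU (Reg rV [*] Reg rD [+] Reg rJ)
         (Read aCR (Reg rV [*] Reg rH [+] (Reg rJ [-] Read aLM (Reg rY) [-] Num 1))))))"

definition dp_body :: com where
  "dp_body =
     If (Equal (Reg rX) (Num 0))
       (Write aPR (Reg rV [*] Reg rD [+] Reg rJ) (Reg rY) ;;
        Write aSU (Reg rV [*] Reg rD [+] Reg rJ) (Reg rY))
       (dp_pre ;; dp_suf)"

definition dp_prog :: com where
  "dp_prog = For rI (Num 0) (Reg 0) (
     rV ::= Reg rI [+] Num 1 ;; rX ::= Read 0 (Reg rV) ;; rY ::= Read 1 (Reg rV) ;;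
     For rJ (Num 0) (Reg rD) dp_body)"

text \<open>16 c (n + 1) dominates all table sizes: rows are at most 4 c wide, as the last round
  works with twice the final window length 2 c. The summand \<open>b\<close> is for characters used
  as names.\<close>

locale sort_ctx = ram_ctx +
  fixes c :: nat
  assumes c_ge: "2 \<le> c" and cap_word: "16 * c * Suc n + b + 16 < 2 ^ w"
    and cap_B: "16 * c * Suc n + b + 16 \<le> B"
begin

lemma idx_bound:
  assumes "v \<le> n" "d < D" "D \<le> 4 * c"
  shows "v * D + d < 2 ^ w" "v * D + d \<le> B" "v * D < 2 ^ w" "v * D + d < Suc n * D"
proof -
  have "v * D + d < Suc v * D" using assms by simp
  also have "\<dots> \<le> Suc n * D" using assms by (intro mult_le_mono1) simp
  finally show *: "v * D + d < Suc n * D" .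
  also have "Suc n * D \<le> Suc n * (4 * c)" using assms by (intro mult_le_mono2)
  also have "\<dots> \<le> 16 * c * Suc n" by simp
  finally have "v * D + d < 16 * c * Suc n" .
  then show "v * D + d < 2 ^ w" "v * D + d \<le> B" "v * D < 2 ^ w"
    using cap_word cap_B by auto
qed

lemma small_word: "x \<le> 16 * c + b + 16 \<Longrightarrow> x < 2 ^ w" "x \<le> 16 * c + b + 16 \<Longrightarrow> x \<le> B"
proof -
  have "16 * c \<le> 16 * c * Suc n" by simp
  then show "x \<le> 16 * c + b + 16 \<Longrightarrow> x < 2 ^ w" "x \<le> 16 * c + b + 16 \<Longrightarrow> x \<le> B"
    using cap_word cap_B by linarith+
qed

lemma row_less: "v < v' \<Longrightarrow> d < D \<Longrightarrow> v * D + d < v' * D + d'" for v v' d d' D :: nat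
proof -
  assume "v < v'" "d < D"
  then have "v * D + d < Suc v * D" by simp
  also have "\<dots> \<le> v' * D" using \<open>v < v'\<close> by (intro mult_le_mono1) simp
  finally show ?thesis by simp
qed

text \<open>A capped length that is smaller than some word has not been capped. After a failed
  comparison, the stored value may therefore be used in arithmetic.\<close>

lemma LM_exact: "LM x < y \<Longrightarrow> y < 2 ^ w \<Longrightarrow> var x \<Longrightarrow> len x = LM x + 1"
  using len_pos[of x] by (auto simp: LM_def min_def split: if_splits)

lemma LM_le: "LM x \<le> len x - 1"
  by (simp add: LM_def)

lemma LM_word: "LM x < 2 ^ w"
  using one_less_word by (auto simp: LM_def min_def)

definition cr_ok :: "nat \<Rightarrow> (nat list \<Rightarrow> nat) \<Rightarrow> memory \<Rightarrow> bool" where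
  "cr_ok H nm m \<longleftrightarrow> (\<forall>v s. crossing v s H \<longrightarrow> m aCR (v * H + s) = nm (cwin v s H))"

text \<open>Only windows that fit into the variable are constrained; the program fills every cell of
  a row without testing this and may leave arbitrary values in the others.\<close>

definition pr_ok :: "nat \<Rightarrow> nat \<Rightarrow> (nat list \<Rightarrow> nat) \<Rightarrow> memory \<Rightarrow> nat \<Rightarrow> nat \<Rightarrow> bool" where
  "pr_ok H D nm m v j \<longleftrightarrow> (\<forall>d < j. d + H \<le> len v \<longrightarrow> m aPR (v * D + d) = nm (sub v d H))"

definition su_ok :: "nat \<Rightarrow> nat \<Rightarrow> (nat list \<Rightarrow> nat) \<Rightarrow> memory \<Rightarrow> nat \<Rightarrow> nat \<Rightarrow> bool" where
  "su_ok H D nm m v j \<longleftrightarrow> (\<forall>s < j. H \<le> s \<and> s \<le> len v \<longrightarrow> m aSU (v * D + s) = nm (sub v (len v - s) H))"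

definition base_ok :: "memory \<Rightarrow> bool" where
  "base_ok m \<longleftrightarrow> m 0 = lc \<and> m 1 = rc \<and> (\<forall>v. var v \<longrightarrow> m aLM v = LM v)"

lemma dp_pre_wp:
  assumes v: "var v" "lc v \<noteq> 0" and base: "base_ok m" and cr: "cr_ok H nm m"
    and H: "1 \<le> H" "H \<le> D" "D \<le> 4 * c" and j: "j < D"
    and r: "r rV = v" "r rX = lc v" "r rY = rc v" "r rJ = j" "r rH = H" "r rD = D"
    and ok: "\<And>v'. 1 \<le> v' \<Longrightarrow> v' < v \<Longrightarrow> pr_ok H D nm m v' D"
    and post: "\<And>y. (j + H \<le> len v \<Longrightarrow> y = nm (sub v j H)) \<Longrightarrow>
      Q r (m(aPR := (m aPR)(v * D + j := y))) t"
  shows "wp w B dp_pre Q r m t"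
proof -
  note nd = nodeD[OF v]
  have lm: "m aLM (lc v) = LM (lc v)"
    using base nd by (auto simp: base_ok_def)
  have vn: "v \<le> n" "lc v \<le> n" "rc v \<le> n" "lc v \<le> B"
    using v nd n_B by (auto simp: var_def)
  have jH: "j + H < 2 ^ w" "1 \<le> j + H" "j < 2 ^ w" using small_word(1)[of "j + H"] j H by auto
  note ib = idx_bound[OF vn(1) j H(3)] idx_bound[OF vn(2) j H(3)]
  have ib3: "rc v * D + d < 2 ^ w" "rc v * D + d \<le> B" "rc v * D < 2 ^ w" if "d < D" for d
    using idx_bound[OF vn(3) that H(3)] by auto
  have ib4: "v * H + d < 2 ^ w" "v * H + d \<le> B" "v * H < 2 ^ w" if "d < H" for d
    using idx_bound[OF vn(1) that] H by auto
  note one = one_less_word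
  show ?thesis
  proof (cases "j + H - 1 \<le> LM (lc v)")
    case True
    have "j + H \<le> len (lc v)"
      using True LM_le[of "lc v"] len_pos[OF nd(7)] by linarith
    then have "m aPR (lc v * D + j) = nm (sub v j H)"
      using ok[of "lc v"] nd j v by (auto simp: pr_ok_def sub_left)
    then show ?thesis
      unfolding dp_pre_def using True r lm ib jH vn one post[of "m aPR (lc v * D + j)"] by simp
  next
    case notl: False
    have ex: "len (lc v) = LM (lc v) + 1"
      by (rule LM_exact[of _ "j + H - 1"]) (use notl jH nd in auto)
    show ?thesis
    proof (cases "LM (lc v) < j")
      case True
      let ?d = "j - LM (lc v) - 1"
      have d: "?d < D" "1 \<le> j - LM (lc v)" "j - LM (lc v) < 2 ^ w" using j True jH by auto
      have "m aPR (rc v * D + ?d) = nm (sub v j H)" if "j + H \<le> len v"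
      proof -
        have "sub v j H = sub (rc v) ?d H"
          using sub_right[OF v, of j H] True ex by (simp add: diff_diff_left)
        moreover have "?d + H \<le> len (rc v)"
          using that nd(2) ex True by linarith
        moreover have "pr_ok H D nm m (rc v) D"
          using ok nd by blast
        ultimately show ?thesis
          using d(1) unfolding pr_ok_def by metis
      qed
      then show ?thesis
        unfolding dp_pre_def
        using True notl r lm ib ib3[OF d(1)] d jH vn one post[of "m aPR (rc v * D + ?d)"] by simp
    next
      case False
      let ?s = "LM (lc v) - j + 1"
      have s: "?s < H" using notl False by linarith
      have "m aCR (v * H + ?s) = nm (sub v j H)" if "j + H \<le> len v"
      proof -
        have "crossing v ?s H"
          using v s ex nd(2) that False notl by (auto simp: crossing_def)
        moreover have "cwin v ?s H = sub v j H"
          using ex False by (simp add: cwin_def)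
        ultimately show ?thesis
          using cr by (auto simp: cr_ok_def)
      qed
      moreover have "?s < 2 ^ w" "LM (lc v) < 2 ^ w" "j \<le> LM (lc v)"
        using s H small_word(1)[of H] LM_word False by auto
      ultimately show ?thesis
        unfolding dp_pre_def
        using False notl r lm ib ib4[OF s] jH vn one post[of "m aCR (v * H + ?s)"] by simp
    qed
  qed
qed

lemma dp_suf_wp:
  assumes v: "var v" "lc v \<noteq> 0" and base: "base_ok m" and cr: "cr_ok H nm m"
    and H: "1 \<le> H" "H \<le> D" "D \<le> 4 * c" and j: "j < D"
    and r: "r rV = v" "r rX = lc v" "r rY = rc v" "r rJ = j" "r rH = H" "r rD = D"
    and ok: "\<And>v'. 1 \<le> v' \<Longrightarrow> v' < v \<Longrightarrow> su_ok H D nm m v' D"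
    and post: "\<And>y. (H \<le> j \<Longrightarrow> j \<le> len v \<Longrightarrow> y = nm (sub v (len v - j) H)) \<Longrightarrow>
      Q r (m(aSU := (m aSU)(v * D + j := y))) t"
  shows "wp w B dp_suf Q r m t"
proof (cases "j < H")
  case True
  \<comment> \<open>Doing nothing is presented as rewriting the cell with its own value, so that the
    common postcondition applies.\<close>
  have "m(aSU := (m aSU)(v * D + j := m aSU (v * D + j))) = m" by simp
  then show ?thesis
    unfolding dp_suf_def using True r post[of "m aSU (v * D + j)"] by simp
next
  case jH: False
  note nd = nodeD[OF v]
  have lm: "m aLM (rc v) = LM (rc v)"
    using base nd by (auto simp: base_ok_def)
  have vn: "v \<le> n" "lc v \<le> n" "rc v \<le> n" "rc v \<le> B"
    using v nd n_B by (auto simp: var_def)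
  have jw: "j < 2 ^ w" "1 \<le> j" "H \<le> j" using small_word(1)[of j] j H jH by auto
  note ib = idx_bound[OF vn(1) j H(3)] idx_bound[OF vn(3) j H(3)]
  have ib3: "lc v * D + d < 2 ^ w" "lc v * D + d \<le> B" "lc v * D < 2 ^ w" if "d < D" for d
    using idx_bound[OF vn(2) that H(3)] by auto
  have ib4: "v * H + d < 2 ^ w" "v * H + d \<le> B" "v * H < 2 ^ w" if "d < H" for d
    using idx_bound[OF vn(1) that] H by auto
  note one = one_less_word
  show ?thesis
  proof (cases "j - 1 \<le> LM (rc v)")
    case True
    have "j \<le> len (rc v)"
      using True LM_le[of "rc v"] len_pos[OF nd(8)] by linarith
    then have "len (lc v) \<le> len v - j" "len v - j - len (lc v) = len (rc v) - j"
      using nd(2) by linarith+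
    then have "sub v (len v - j) H = sub (rc v) (len (rc v) - j) H"
      using sub_right[OF v] by metis
    then have "m aSU (rc v * D + j) = nm (sub v (len v - j) H)"
      using ok[of "rc v"] nd j jw \<open>j \<le> len (rc v)\<close> by (auto simp: su_ok_def)
    then show ?thesis
      unfolding dp_suf_def using True jH r lm ib jw vn one post[of "m aSU (rc v * D + j)"] by simp
  next
    case notr: False
    have ex: "len (rc v) = LM (rc v) + 1"
      by (rule LM_exact[of _ "j - 1"]) (use notr jw nd in auto)
    let ?s = "j - LM (rc v) - 1"
    have d: "?s < D" "1 \<le> j - LM (rc v)" "j - LM (rc v) < 2 ^ w" "LM (rc v) \<le> j" using j notr jw by auto
    show ?thesis
    proof (cases "LM (rc v) < j - H")
      case True
      have "m aSU (lc v * D + ?s) = nm (sub v (len v - j) H)" if "j \<le> len v"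
      proof -
        have s: "?s \<le> len (lc v)" "H \<le> ?s" "len v - j = len (lc v) - ?s"
          using that nd(2) ex True jw notr by linarith+
        moreover have "len v - j + H \<le> len (lc v)"
          using s by linarith
        ultimately have "sub v (len v - j) H = sub (lc v) (len (lc v) - ?s) H"
          using sub_left[OF v] by metis
        moreover have "su_ok H D nm m (lc v) D"
          using ok nd by blast
        ultimately show ?thesis
          using d(1) s unfolding su_ok_def by metis
      qed
      then show ?thesis
        unfolding dp_suf_def
        using True notr jH ib(1-3) ib3[OF d(1)] d jw vn(4) one post[of "m aSU (lc v * D + ?s)"]
        by (simp add: r lm)
    next
      case False
      have s: "?s < H" using notr False jw H by linarith
      have "m aCR (v * H + ?s) = nm (sub v (len v - j) H)" if "j \<le> len v"
      proof -
        have "crossing v ?s H" "len (lc v) - ?s = len v - j"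
          using v s ex nd(2) that False notr jw by (auto simp: crossing_def)
        then show ?thesis
          using cr by (auto simp: cr_ok_def cwin_def)
      qed
      then show ?thesis
        unfolding dp_suf_def
        using False notr jH ib(1-3) ib4[OF s] d jw vn(4) one post[of "m aCR (v * H + ?s)"]
        by (simp add: r lm)
    qed
  qed
qed

text \<open>Both children have smaller indices, so their rows are complete when row v is filled. A
  terminal has a window only for H = 1, and there the name has to be its character.\<close>

lemma dp_prog_wp:
  assumes base: "base_ok m" and cr: "cr_ok H nm m" and nm1: "H = 1 \<Longrightarrow> nm = hd"
    and H: "1 \<le> H" "H \<le> D" "D \<le> 4 * c" and r: "r 0 = n" "r rH = H" "r rD = D"
    and post: "\<And>r' m' t'. same {rI, rV, rX, rY, rJ} r r' \<Longrightarrow> same {aPR, aSU} m m' \<Longrightarrow>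
      (\<And>v. var v \<Longrightarrow> pr_ok H D nm m' v D \<and> su_ok H D nm m' v D) \<Longrightarrow>
      t' \<le> t + n * Suc D \<Longrightarrow> Q r' m' t'"
  shows "wp w B dp_prog Q r m t"
proof -
  define R where "R = (\<lambda>r' m'. same {rI, rV, rX, rY, rJ} r r' \<and> same {aPR, aSU} m m')"
  have RD: "r' 0 = n" "r' rH = H" "r' rD = D" "base_ok m'" "cr_ok H nm m'" if "R r' m'" for r' m'
    using that base cr r by (auto simp: R_def same_def base_ok_def cr_ok_def)
  have Rr: "R (r'(x := y)) m' = R r' m'" if "x \<in> {rI, rV, rX, rY, rJ}" for r' m' x y
    using that by (simp add: R_def)
  have Rm: "R r' (m'(x := y)) = R r' m'" if "x \<in> {aPR, aSU}" for r' m' x y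
    using that by (simp add: R_def)
  have Dw: "D < 2 ^ w" using small_word(1)[of D] H by simp
  define ok where "ok m' v \<longleftrightarrow> pr_ok H D nm m' v D \<and> su_ok H D nm m' v D" for m' v
  have ok_upd: "ok (m'(A := (m' A)(v * D + j := y))) v' = ok m' v'" if "v' < v" for m' A v v' j y
  proof -
    have "v' * D + d \<noteq> v * D + j" if "d < D" for d
      using row_less[OF \<open>v' < v\<close> that, of j] by simp
    then show ?thesis by (auto simp: ok_def pr_ok_def su_ok_def)
  qed
  have inner: "wp w B (For rJ (Num 0) (Reg rD) dp_body)
      (\<lambda>r' m' t''. R r' m' \<and> (\<forall>v'. 1 \<le> v' \<and> v' \<le> v \<longrightarrow> ok m' v') \<and> t'' \<le> t' + D \<and> r' rI = r1 rI) r1 m1 t'"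
    if R1: "R r1 m1" and v: "var v" and rv: "r1 rV = v" "r1 rX = lc v" "r1 rY = rc v"
      and okv: "\<And>v'. 1 \<le> v' \<Longrightarrow> v' < v \<Longrightarrow> ok m1 v'" for r1 m1 t' v
  proof (rule wp_For[where h = D and T = "t' + D" and I = "\<lambda>j r' m' t''. R r' m' \<and>
      r' rV = v \<and> r' rX = lc v \<and> r' rY = rc v \<and> r' rI = r1 rI \<and> t'' \<le> t' + j \<and>
      (\<forall>v'. 1 \<le> v' \<and> v' < v \<longrightarrow> ok m' v') \<and> pr_ok H D nm m' v j \<and> su_ok H D nm m' v j"], goal_cases)
    case (6 j r2 m2 t2)
    then have R2: "R r2 m2" and j: "j < D" by auto
    note RR = RD[OF R2]
    have vn: "v \<le> n" using v by (simp add: var_def)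
    note ib = idx_bound[OF vn j H(3)]
    show ?case
    proof (cases "lc v = 0")
      case True
      have vl: "vl v = [rc v]" using leaf[of v] v True by (simp add: var_def)
      have "nm (sub v j H) = rc v" if "j + H \<le> len v"
      proof -
        have "j = 0" "H = 1" using that vl H(1) by auto
        then show ?thesis using nm1 by (simp add: sub_def vl One_nat_def)
      qed
      then have pr: "pr_ok H D nm (m2(aPR := (m2 aPR)(v * D + j := rc v), aSU := (m2 aSU)(v * D + j := rc v))) v (Suc j)"
        using 6 by (auto simp: pr_ok_def All_less_Suc)
      have "nm (sub v (len v - j) H) = rc v" if "H \<le> j" "j \<le> len v"
      proof -
        have "j = 1" "H = 1" using that vl H(1) by auto
        then show ?thesis using nm1 by (simp add: sub_def vl One_nat_def)
      qed
      then have su: "su_ok H D nm (m2(aPR := (m2 aPR)(v * D + j := rc v), aSU := (m2 aSU)(v * D + j := rc v))) v (Suc j)"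
        using 6 by (auto simp: su_ok_def All_less_Suc)
      have oko: "\<forall>v'. 1 \<le> v' \<and> v' < v \<longrightarrow>
          ok (m2(aPR := (m2 aPR)(v * D + j := rc v), aSU := (m2 aSU)(v * D + j := rc v))) v'"
        using 6 ok_upd[of _ v "m2(aPR := (m2 aPR)(v * D + j := rc v))" aSU j "rc v"]
          ok_upd[of _ v m2 aPR j "rc v"] by simp
      show ?thesis
        unfolding dp_body_def
        using 6 True RR ib one_less_word pr su oko by (auto simp: Rr Rm)
    next
      case False
      have "wp w B (dp_pre ;; dp_suf) (\<lambda>r m t. r rJ = j \<and> R (r(rJ := Suc j)) m \<and>
         (r(rJ := Suc j)) rV = v \<and> (r(rJ := Suc j)) rX = lc v \<and> (r(rJ := Suc j)) rY = rc v \<and>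
         (r(rJ := Suc j)) rI = r1 rI \<and> t \<le> t' + Suc j \<and>
         (\<forall>v'. 1 \<le> v' \<and> v' < v \<longrightarrow> ok m v') \<and> pr_ok H D nm m v (Suc j) \<and> su_ok H D nm m v (Suc j)) r2 m2 (Suc t2)"
        unfolding wp_Seq_iff
      proof (rule dp_pre_wp[OF v False RR(4,5) H j], goal_cases)
        case (8 y)
        let ?m3 = "m2(aPR := (m2 aPR)(v * D + j := y))"
        have b3: "base_ok ?m3" "cr_ok H nm ?m3"
          using RR by (auto simp: base_ok_def cr_ok_def)
        have ok3: "\<forall>v'. 1 \<le> v' \<and> v' < v \<longrightarrow> ok ?m3 v'"
          using 6 ok_upd[of _ v m2 aPR j y] by simp
        show ?case
        proof (rule dp_suf_wp[OF v False b3 H j], goal_cases)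
          case (8 z)
          let ?m4 = "?m3(aSU := (?m3 aSU)(v * D + j := z))"
          have "\<forall>v'. 1 \<le> v' \<and> v' < v \<longrightarrow> ok ?m4 v'"
            using ok3 ok_upd[of _ v ?m3 aSU j z] by simp
          moreover have "pr_ok H D nm ?m4 v (Suc j)"
            using 6 \<open>j + H \<le> len v \<Longrightarrow> y = nm (sub v j H)\<close> by (auto simp: pr_ok_def All_less_Suc)
          moreover have "su_ok H D nm ?m4 v (Suc j)"
            using 6 8 by (auto simp: su_ok_def All_less_Suc)
          ultimately show ?case
            using 6 by (auto simp: Rr Rm)
        qed (use 6 RR ok3 in \<open>auto simp: ok_def\<close>)
      qed (use 6 RR in \<open>auto simp: ok_def\<close>)
      then show ?thesis
        unfolding dp_body_def using 6 False one_less_word by simp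
    qed
  next
    case (7 r2 m2 t2)
    then show ?case by (auto simp: ok_def le_less)
  next
    case (5 j r2 m2 t2)
    then show ?case using RD[of r2 m2] by simp
  qed (use R1 rv okv Dw in \<open>auto simp: Rr pr_ok_def su_ok_def\<close>)
  show ?thesis
    unfolding dp_prog_def
  proof (rule wp_For[where h = n and T = "t + n * Suc D" and I = "\<lambda>i r' m' t'. R r' m' \<and>
      t' \<le> t + i * Suc D \<and> (\<forall>v'. 1 \<le> v' \<and> v' \<le> i \<longrightarrow> ok m' v')"], goal_cases)
    case (6 i r1 m1 t1)
    then have R1: "R r1 m1" and i: "i < n" by auto
    note RR = RD[OF R1]
    have v: "var (Suc i)" using i by (simp add: var_def)
    have iw: "Suc i < 2 ^ w" "Suc i \<le> B" using i n_word n_B by auto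
    have mm: "m1 0 = lc" "m1 1 = rc" using RR(4) by (auto simp: base_ok_def)
    have "i * Suc D < n * Suc D" using i by (intro mult_less_mono1) auto
    moreover have "wp w B (For rJ (Num 0) (Reg rD) dp_body)
       (\<lambda>r m t. r rI = i \<and> R (r(rI := Suc i)) m \<and> t \<le> Suc (t1 + D) \<and>
         (\<forall>v'. 1 \<le> v' \<and> v' \<le> Suc i \<longrightarrow> ok m v'))
       (r1(rV := Suc i, rX := lc (Suc i), rY := rc (Suc i))) m1 (Suc t1)"
      by (rule wp_mono[OF inner[OF _ v]]) (use 6 in \<open>auto simp: Rr\<close>)
    then have "wp w B (For rJ (Num 0) (Reg rD) dp_body)
       (\<lambda>r m t'. r rI = i \<and> R (r(rI := Suc i)) m \<and> t' \<le> t + Suc i * Suc D \<and>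
         (\<forall>v'. 1 \<le> v' \<and> v' \<le> Suc i \<longrightarrow> ok m v'))
       (r1(rV := Suc i, rX := lc (Suc i), rY := rc (Suc i))) m1 (Suc t1)"
      by (rule wp_mono) (use 6 in auto)
    ultimately show ?case
      using 6 iw mm one_less_word by (simp flip: Suc_eq_plus1)
  next
    case (7 r1 m1 t1)
    then show ?case by (intro post) (auto simp: R_def ok_def var_def)
  next
    case (5 i r1 m1 t1)
    then show ?case using RD[of r1 m1] by simp
  qed (use n_word in \<open>auto simp: R_def\<close>)
qed

section \<open>Enumeration of the crossing windows of doubled length\<close>

lemma subs_halves:
  assumes "u \<in> subs (2 * H)"
  shows "take H u \<in> subs H" "drop H u \<in> subs H"
proof -
  obtain i d where i: "var i" "d + 2 * H \<le> len i" "u = sub i d (2 * H)"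
    using assms by (auto simp: subs_def)
  then have "u = sub i d H @ sub i (d + H) H"
    using sub_add[of i d H H] by (simp add: mult_2)
  moreover have "length (sub i d H) = H"
    using i by (intro length_sub) simp
  ultimately have "take H u = sub i d H" "drop H u = sub i (d + H) H"
    by auto
  then show "take H u \<in> subs H" "drop H u \<in> subs H"
    using i by (auto intro: sub_in_subs)
qed

lemma cwin_take_drop:
  assumes "crossing v s (2 * H)"
  shows "take H (cwin v s (2 * H)) = (if s < H then cwin v s H else sub (lc v) (len (lc v) - s) H)"
    "drop H (cwin v s (2 * H)) = (if s \<le> H then sub (rc v) (H - s) H else cwin v (s - H) H)"
proof -
  note h = cwin_halves[OF assms]
  define A where "A = (if s < H then cwin v s H else sub (lc v) (len (lc v) - s) H)"
  define A' where "A' = (if s \<le> H then sub (rc v) (H - s) H else cwin v (s - H) H)"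
  have "length A = H"
    unfolding A_def using h(2,4) cwin_in_subs subsD length_sub by auto
  moreover have "cwin v s (2 * H) = A @ A'"
    using h(1) by (simp add: A_def A'_def)
  ultimately have "take H (cwin v s (2 * H)) = A" "drop H (cwin v s (2 * H)) = A'"
    by auto
  then show "take H (cwin v s (2 * H)) = (if s < H then cwin v s H else sub (lc v) (len (lc v) - s) H)"
    "drop H (cwin v s (2 * H)) = (if s \<le> H then sub (rc v) (H - s) H else cwin v (s - H) H)"
    by (auto simp: A_def A'_def)
qed

lemma item_iff: "s < D \<Longrightarrow> v * D + s \<in> items D \<longleftrightarrow> crossing v s D"
  using itemsD[of "v * D + s" D] by (auto simp: items_def)

lemma items_below_Suc:
  assumes "s < D"
  shows "{x \<in> items D. x < v * D + Suc s} =
    (if crossing v s D then insert (v * D + s) {x \<in> items D. x < v * D + s} else {x \<in> items D. x < v * D + s})"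
  using item_iff[OF assms, of v] by (auto simp: less_Suc_eq)

text \<open>Column 0 carries no window, since s >= 1, and neither does the row of a terminal. A
  sweep through rows and columns is thus described by one increasing threshold.\<close>

lemma items_row:
  assumes "1 \<le> D"
  shows "{x \<in> items D. x < Suc v * D + 1} = {x \<in> items D. x < v * D + D}"
    "lc v = 0 \<Longrightarrow> {x \<in> items D. x < v * D + D} = {x \<in> items D. x < v * D + 1}"
proof -
  have "x < Suc v * D + 1 \<longleftrightarrow> x < v * D + D" if "x \<in> items D" for x
  proof -
    have "x \<noteq> Suc v * D"
      using itemsD[OF that] assms by (auto simp: crossing_def)
    moreover have "Suc v * D = v * D + D" by simp
    ultimately show ?thesis by (intro iffI; linarith)
  qed
  then show "{x \<in> items D. x < Suc v * D + 1} = {x \<in> items D. x < v * D + D}"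
    by blast
  assume v: "lc v = 0"
  have "x \<notin> items D" if "v * D + 1 \<le> x" "x < v * D + D" for x
  proof
    assume "x \<in> items D"
    moreover have "x div D = v"
      using that assms by (intro div_nat_eqI) (auto simp: mult.commute)
    ultimately show False
      using itemsD[of x D] v by (simp add: crossing_def)
  qed
  moreover have "x < v * D + D" if "x < v * D + 1" for x
    using that assms by linarith
  ultimately show "{x \<in> items D. x < v * D + D} = {x \<in> items D. x < v * D + 1}"
    by (meson Collect_cong not_le)
qed

lemma items_row_0: "{x \<in> items D. x < D + 1} = {}"
proof -
  have "D < x" if item: "x \<in> items D" for x
  proof -
    obtain v s where x: "x = v * D + s" "crossing v s D"
      using item by (auto simp: items_def)
    then have "1 \<le> v" "1 \<le> s" by (auto simp: crossing_def var_def)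
    then have "1 * D \<le> v * D" by (intro mult_le_mono1)
    then show ?thesis using x(1) \<open>1 \<le> s\<close> by linarith
  qed
  then show ?thesis by force
qed

lemma items_all: "{x \<in> items D. x < Suc n * D + 1} = items D"
  using items_less[of D] by force

end

text \<open>Tests whether offset \<open>rJ\<close> gives a window of length \<open>rD\<close> across
  the border of \<open>rV\<close>; if so, it collects the names of both halves according to
  \<open>cwin_halves\<close> and appends the window to the list.\<close>

definition pair_body :: com where
  "pair_body =
     If (Conj (Neg (Less (Read aLM (Reg rX)) (Reg rJ [-] Num 1)))
              (Neg (Less (Read aLM (Reg rY)) (Reg rD [-] Reg rJ [-] Num 1))))
      (If (Less (Reg rJ) (Reg rH))
         (Write aKA (Reg rV [*] Reg rD [+] Reg rJ) (Read aCR (Reg rV [*] Reg rH [+] Reg rJ)))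
         (Write aKA (Reg rV [*] Reg rD [+] Reg rJ) (Read aSU (Reg rX [*] Reg rD [+] Reg rJ))) ;;
       If (Less (Reg rH) (Reg rJ))
         (Write aKB (Reg rV [*] Reg rD [+] Reg rJ) (Read aCR (Reg rV [*] Reg rH [+] (Reg rJ [-] Reg rH))))
         (Write aKB (Reg rV [*] Reg rD [+] Reg rJ) (Read aPR (Reg rY [*] Reg rD [+] (Reg rH [-] Reg rJ)))) ;;
       Write aVI (Reg rVC) (Reg rV [*] Reg rD [+] Reg rJ) ;;
       rVC ::= Reg rVC [+] Num 1)
      Skip"

definition pairs_prog :: com where
  "pairs_prog =
     rVC ::= Num 0 ;;
     For rI (Num 0) (Reg 0) (
       rV ::= Reg rI [+] Num 1 ;; rX ::= Read 0 (Reg rV) ;; rY ::= Read 1 (Reg rV) ;;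
       If (Equal (Reg rX) (Num 0)) Skip (For rJ (Num 1) (Reg rD) pair_body))"

context sort_ctx
begin

lemma pair_body_wp:
  fixes H :: nat
  defines "D \<equiv> 2 * H"
  assumes v: "var v" "lc v \<noteq> 0" and base: "base_ok m" and cr: "cr_ok H nm m"
    and ok: "\<And>v. var v \<Longrightarrow> pr_ok H D nm m v D \<and> su_ok H D nm m v D"
    and H: "1 \<le> H" "H \<le> c" and j: "1 \<le> j" "j < D"
    and r: "r rV = v" "r rX = lc v" "r rY = rc v" "r rJ = j" "r rH = H" "r rD = D" "r rVC \<le> v * D + j"
    and post1: "crossing v j D \<Longrightarrow> Q (r(rVC := r rVC + 1))
      (m(aKA := (m aKA)(v * D + j := nm (take H (cwin v j D))),
         aKB := (m aKB)(v * D + j := nm (drop H (cwin v j D))),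
         aVI := (m aVI)(r rVC := v * D + j))) t"
    and post2: "\<not> crossing v j D \<Longrightarrow> Q r m t"
  shows "wp w B pair_body Q r m t"
proof -
  note nd = nodeD[OF v]
  have lm: "m aLM (lc v) = LM (lc v)" "m aLM (rc v) = LM (rc v)"
    using base nd by (auto simp: base_ok_def)
  have vn: "v \<le> n" "lc v \<le> n" "rc v \<le> n" "lc v \<le> B" "rc v \<le> B"
    using v nd n_B by (auto simp: var_def)
  have D4: "D \<le> 4 * c" "H \<le> 4 * c" using H by (auto simp: D_def)
  have Dw: "D < 2 ^ w" "j < 2 ^ w" "D - j < 2 ^ w" "1 \<le> D - j" using small_word(1)[of D] D4 j by auto
  note ib = idx_bound[OF vn(1) j(2) D4(1)] idx_bound[OF vn(2) j(2) D4(1)]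
  have vw: "r rVC + 1 < 2 ^ w" "r rVC \<le> B" "r rVC < 2 ^ w"
  proof -
    have "r rVC + 1 \<le> Suc n * D" using r(7) ib(4) by simp
    also have "\<dots> \<le> Suc n * (4 * c)"
      using D4(1) by (rule mult_le_mono2)
    also have "\<dots> \<le> 16 * c * Suc n" by simp
    finally show "r rVC + 1 < 2 ^ w" "r rVC \<le> B" "r rVC < 2 ^ w"
      using cap_word cap_B by auto
  qed
  note one = one_less_word
  \<comment> \<open>The cap does no harm here: j and D - j are words, and a capped length compares
    with a word like the true one.\<close>
  have test: "j - 1 \<le> LM (lc v) \<and> D - j - 1 \<le> LM (rc v) \<longleftrightarrow> crossing v j D"
  proof -
    have "j - 1 \<le> LM (lc v) \<longleftrightarrow> j \<le> len (lc v)"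
      using Dw j len_pos[OF nd(7)] by (auto simp: LM_def)
    moreover have "D - j - 1 \<le> LM (rc v) \<longleftrightarrow> D \<le> j + len (rc v)"
      using Dw j len_pos[OF nd(8)] by (auto simp: LM_def)
    ultimately show ?thesis using v j by (auto simp: crossing_def)
  qed
  define tst where "tst = Conj (Neg (Less (Read aLM (Reg rX)) (Reg rJ [-] Num 1)))
    (Neg (Less (Read aLM (Reg rY)) (Reg rD [-] Reg rJ [-] Num 1)))"
  have bv: "bval w tst r m \<longleftrightarrow> crossing v j D"
    unfolding test[symmetric] tst_def by (simp add: r lm not_less)
  have bs: "bsafe w B tst r m"
    unfolding tst_def using vn(4,5) one Dw j by (simp add: r)
  show ?thesis
  proof (cases "crossing v j D")
    case False
    then show ?thesis
      unfolding pair_body_def tst_def[symmetric] wp_If_iff bv using bs post2 by simp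
  next
    case True
    note h = cwin_halves(2-)[OF True[unfolded D_def]] and td = cwin_take_drop[OF True[unfolded D_def], folded D_def]
    have jl: "j \<le> len (lc v)" using True by (simp add: crossing_def)
    define ka where "ka = nm (take H (cwin v j D))"
    define kb where "kb = nm (drop H (cwin v j D))"
    have a1: "m aCR (v * H + j) = ka" if "j < H"
      using that h(1) cr td by (simp add: cr_ok_def ka_def)
    have a2: "m aSU (lc v * D + j) = ka" if "\<not> j < H"
      using that ok[OF nd(7)] td jl j by (simp add: su_ok_def ka_def)
    have b1: "m aCR (v * H + (j - H)) = kb" if "H < j"
    proof -
      have "m aCR (v * H + (j - H)) = nm (cwin v (j - H) H)"
        using cr h(2)[OF that] unfolding cr_ok_def by blast
      then show ?thesis using that td(2) by (simp add: kb_def)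
    qed
    have b2: "m aPR (rc v * D + (H - j)) = kb" if "\<not> H < j"
    proof -
      have "H - j < D" "H - j + H \<le> len (rc v)" using h(4) that H by (auto simp: D_def)
      then have "m aPR (rc v * D + (H - j)) = nm (sub (rc v) (H - j) H)"
        using ok[OF nd(8)] unfolding pr_ok_def by blast
      then show ?thesis using td that by (simp add: kb_def)
    qed
    have i1: "v * H + j < 2 ^ w" "v * H + j \<le> B" "v * H < 2 ^ w" if "j < H"
      using idx_bound[OF vn(1) that D4(2)] by auto
    have i2: "v * H + (j - H) < 2 ^ w" "v * H + (j - H) \<le> B" "v * H < 2 ^ w" if "H < j"
      using idx_bound[OF vn(1) _ D4(2), of "j - H"] j that by (auto simp: D_def)
    have i3: "rc v * D + (H - j) < 2 ^ w" "rc v * D + (H - j) \<le> B" "rc v * D < 2 ^ w" if "\<not> H < j"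
      using idx_bound[OF vn(3) _ D4(1), of "H - j"] H j that by (auto simp: D_def)
    have Hw: "H < 2 ^ w" using Dw by (simp add: D_def)
    have "Q (r(rVC := r rVC + 1)) (m(aKA := (m aKA)(v * D + j := ka), aKB := (m aKB)(v * D + j := kb),
         aVI := (m aVI)(r rVC := v * D + j))) t"
      using post1[OF True] by (simp add: ka_def kb_def)
    then show ?thesis
      unfolding pair_body_def tst_def[symmetric] wp_If_iff bv
      using r one j True bs ib(1-3,5-7) vw Hw a1 a2 b1 b2 i1 i2 i3
      by (cases "j < H"; cases "H < j") simp_all
  qed
qed

lemma pairs_prog_wp:
  fixes H :: nat
  defines "D \<equiv> 2 * H"
  assumes base: "base_ok m" and cr: "cr_ok H nm m"
    and ok: "\<And>v. var v \<Longrightarrow> pr_ok H D nm m v D \<and> su_ok H D nm m v D"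
    and H: "1 \<le> H" "H \<le> c" and r: "r 0 = n" "r rH = H" "r rD = D"
    and post: "\<And>r' m' t'. same {rI, rV, rX, rY, rJ, rVC} r r' \<Longrightarrow> same {aKA, aKB, aVI} m m' \<Longrightarrow>
      bij_betw (m' aVI) {..<r' rVC} (items D) \<Longrightarrow>
      (\<And>x. x \<in> items D \<Longrightarrow> m' aKA x = nm (take H (win D x)) \<and> m' aKB x = nm (drop H (win D x))) \<Longrightarrow>
      t' \<le> t + n * Suc D \<Longrightarrow> Q r' m' t'"
  shows "wp w B pairs_prog Q r m t"
proof -
  define R where "R = (\<lambda>r' m'. same {rI, rV, rX, rY, rJ, rVC} r r' \<and> same {aKA, aKB, aVI} m m')"
  have RD: "r' 0 = n" "r' rH = H" "r' rD = D" "base_ok m'" "cr_ok H nm m'"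
    "\<And>v. var v \<Longrightarrow> pr_ok H D nm m' v D \<and> su_ok H D nm m' v D" if "R r' m'" for r' m'
    using that base cr r ok by (auto simp: R_def same_def base_ok_def cr_ok_def pr_ok_def su_ok_def)
  have Rr: "R (r'(x := y)) m' = R r' m'" if "x \<in> {rI, rV, rX, rY, rJ, rVC}" for r' m' x y
    using that by (simp add: R_def)
  have Rm: "R r' (m'(x := y)) = R r' m'" if "x \<in> {aKA, aKB, aVI}" for r' m' x y
    using that by (simp add: R_def)
  have D1: "1 \<le> D" "D \<le> 4 * c" using H by (auto simp: D_def)
  have Dw: "D < 2 ^ w" using small_word(1)[of D] D1 by simp
  define P where "P y r' m' \<longleftrightarrow> R r' m' \<and> bij_betw (m' aVI) {..<r' rVC} {x \<in> items D. x < y} \<and>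
    (\<forall>x \<in> items D. x < y \<longrightarrow> m' aKA x = nm (take H (win D x)) \<and> m' aKB x = nm (drop H (win D x)))"
    for y and r' :: regfile and m' :: memory
  have P_cong: "P y r' m' = P y' r' m'" if "{x \<in> items D. x < y} = {x \<in> items D. x < y'}" for y y' r' m'
  proof -
    have "x \<in> items D \<Longrightarrow> x < y \<longleftrightarrow> x < y'" for x using that by blast
    then show ?thesis unfolding P_def that by auto
  qed
  have PR: "P y (r'(x := z)) m' = P y r' m'" if "x \<in> {rI, rV, rX, rY, rJ}" for y r' m' x z
    using that by (auto simp: P_def Rr)
  have VC: "r' rVC \<le> y" if "P y r' m'" for y r' m'
  proof -
    have "r' rVC = card {x \<in> items D. x < y}"
      using that bij_betw_same_card[of "m' aVI" "{..<r' rVC}"] by (simp add: P_def)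
    also have "\<dots> \<le> card {..<y}" by (intro card_mono) auto
    finally show ?thesis by simp
  qed
  have inner: "wp w B (For rJ (Num 1) (Reg rD) pair_body)
      (\<lambda>r' m' t''. P (v * D + D) r' m' \<and> t'' \<le> t' + D \<and> r' rI = r1 rI) r1 m1 t'"
    if P1: "P (v * D + 1) r1 m1" and v: "var v" "lc v \<noteq> 0" and rv: "r1 rV = v" "r1 rX = lc v" "r1 rY = rc v"
    for r1 m1 t' v
  proof (rule wp_For[where h = D and T = "t' + D" and I = "\<lambda>j r' m' t''. P (v * D + j) r' m' \<and> 1 \<le> j \<and>
      r' rV = v \<and> r' rX = lc v \<and> r' rY = rc v \<and> r' rI = r1 rI \<and> t'' < t' + j"], goal_cases)
    case (6 j r2 m2 t2)
    then have P2: "P (v * D + j) r2 m2" and j: "j < D" "1 \<le> j" by auto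
    have R2: "R r2 m2" using P2 by (simp add: P_def)
    note RR = RD[OF R2]
    have "wp w B pair_body (\<lambda>r m t. r rJ = j \<and> P (v * D + Suc j) (r(rJ := Suc j)) m \<and> 1 \<le> Suc j \<and>
         (r(rJ := Suc j)) rV = v \<and> (r(rJ := Suc j)) rX = lc v \<and> (r(rJ := Suc j)) rY = rc v \<and>
         (r(rJ := Suc j)) rI = r1 rI \<and> t < t' + Suc j) r2 m2 (Suc t2)"
    proof (rule pair_body_wp[where j = j and H = H, folded D_def, OF v RR(4,5) _ H], goal_cases)
      case 11
      have ins: "{x \<in> items D. x < v * D + Suc j} = insert (v * D + j) {x \<in> items D. x < v * D + j}"
        using items_below_Suc[OF j(1), of v] 11 by simp
      have bij: "bij_betw ((m2 aVI)(r2 rVC := v * D + j)) {..<r2 rVC + 1} {x \<in> items D. x < v * D + Suc j}"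
      proof -
        have "bij_betw ((m2 aVI)(r2 rVC := v * D + j)) {..<r2 rVC} {x \<in> items D. x < v * D + j}"
          using P2 by (subst bij_betw_cong[of _ _ "m2 aVI"]) (auto simp: P_def)
        then have "bij_betw ((m2 aVI)(r2 rVC := v * D + j)) (insert (r2 rVC) {..<r2 rVC})
            (insert (v * D + j) {x \<in> items D. x < v * D + j})"
          unfolding bij_betw_def inj_on_insert image_insert by auto
        then show ?thesis unfolding ins[symmetric] by (simp add: lessThan_Suc flip: Suc_eq_plus1)
      qed
      have win: "win D (v * D + j) = cwin v j D" by (rule win_item[OF 11])
      show ?case
        using 6 bij P2 win by (auto simp: P_def Rr Rm less_Suc_eq)
    next
      case 12
      then have "{x \<in> items D. x < v * D + Suc j} = {x \<in> items D. x < v * D + j}"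
        using items_below_Suc[OF j(1), of v] by simp
      then show ?case
        using 6 P_cong[of "v * D + Suc j" "v * D + j" r2 m2] by (auto simp: PR)
    qed (use 6 RR j VC[OF P2] in auto)
    then show ?case using 6 by simp
  next
    case (5 j r2 m2 t2)
    then show ?case using RD[of r2 m2] by (simp add: P_def)
  qed (use P1 rv Dw D1 one_less_word in \<open>auto simp: PR\<close>)
  have main: "wp w B (For rI (Num 0) (Reg 0) (
       rV ::= Reg rI [+] Num 1 ;; rX ::= Read 0 (Reg rV) ;; rY ::= Read 1 (Reg rV) ;;
       If (Equal (Reg rX) (Num 0)) Skip (For rJ (Num 1) (Reg rD) pair_body))) Q (r(rVC := 0)) m t"
  proof (rule wp_For[where h = n and T = "t + n * Suc D" and I = "\<lambda>i r' m' t'. P (Suc i * D + 1) r' m' \<and>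
      t' \<le> t + i * Suc D"], goal_cases)
    case (6 i r1 m1 t1)
    then have P1: "P (Suc i * D + 1) r1 m1" and i: "i < n" "r1 rI = i" by auto
    then have R1: "R r1 m1" by (simp add: P_def)
    note RR = RD[OF R1]
    have v: "var (Suc i)" using i by (simp add: var_def)
    have iw: "Suc i < 2 ^ w" "Suc i \<le> B" using i n_word n_B by auto
    have mm: "m1 0 = lc" "m1 1 = rc" using RR(4) by (auto simp: base_ok_def)
    have lt: "t1 < t + n * Suc D"
      using 6 mult_less_mono1[of i n "Suc D"] i by linarith
    let ?Q = "\<lambda>r m t'. r rI = i \<and> P (Suc (Suc i) * D + 1) (r(rI := Suc i)) m \<and> t' \<le> t + Suc i * Suc D"
    show ?case
    proof (cases "lc (Suc i) = 0")
      case True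
      have "P (Suc (Suc i) * D + 1) r1 m1"
        using P1 P_cong[of "Suc (Suc i) * D + 1" "Suc i * D + 1" r1 m1] items_row[OF D1(1), of "Suc i"] True by simp
      then show ?thesis
        using 6 lt iw mm True one_less_word by (simp add: PR flip: Suc_eq_plus1)
    next
      case False
      have "wp w B (For rJ (Num 1) (Reg rD) pair_body) ?Q
         (r1(rV := Suc i, rX := lc (Suc i), rY := rc (Suc i))) m1 (Suc t1)"
      proof (rule wp_mono[OF inner[OF _ v False]], goal_cases)
        case (5 r2 m2 t2)
        moreover have "P (Suc (Suc i) * D + 1) r2 m2"
          using 5 P_cong[of "Suc (Suc i) * D + 1" "Suc i * D + D" r2 m2] items_row(1)[OF D1(1), of "Suc i"] by simp
        ultimately show ?case using 6 by (auto simp: PR)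
      qed (use P1 in \<open>auto simp: PR\<close>)
      then show ?thesis
        using 6 lt iw mm False one_less_word by (simp flip: Suc_eq_plus1)
    qed
  next
    case (7 r1 m1 t1)
    then have Pn: "P (Suc n * D + 1) r1 m1" and t1: "t1 \<le> t + n * Suc D" by auto
    have lt: "x < Suc n * D + 1" if "x \<in> items D" for x
      using items_less[of D] that by force
    show ?case
    proof (rule post)
      show "bij_betw (m1 aVI) {..<r1 rVC} (items D)"
        using Pn unfolding P_def items_all by blast
      show "m1 aKA x = nm (take H (win D x)) \<and> m1 aKB x = nm (drop H (win D x))" if "x \<in> items D" for x
        using Pn that lt[OF that] unfolding P_def by blast
    qed (use Pn t1 in \<open>auto simp: P_def R_def\<close>)
  next
    case (5 i r1 m1 t1)
    then show ?case using RD[of r1 m1] by (simp add: P_def)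
  next
    case 4
    show ?case using items_row_0[of D] by (simp add: P_def R_def bij_betw_def)
  qed (use n_word in auto)
  then show ?thesis
    unfolding pairs_prog_def by simp
qed

end


section \<open>Radix sort of pairs of names and the doubling rounds\<close>

lemma mult_add_eq_iff:
  fixes A B C D b :: nat
  assumes "B < b" "D < b"
  shows "A * b + B = C * b + D \<longleftrightarrow> A = C \<and> B = D"
proof
  assume eq: "A * b + B = C * b + D"
  then show "A = C \<and> B = D"
    using mult_add_less_iff[of B b D A C] mult_add_less_iff[of D b B C A] assms
    by (cases A C rule: linorder_cases) auto
qed simp

text \<open>Radix sort with the less significant digit first: the second pass sorts by first halves
  and, being stable, keeps the order by second halves within equal keys.\<close>

lemma two_pass:
  fixes VI O1 O2 KA KB :: "nat \<Rightarrow> nat"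
  assumes bij: "bij_betw VI {..<V} X"
    and o1: "\<And>u. u < V \<Longrightarrow> O1 (cpos V (\<lambda>t. KB (VI t)) u) = VI u"
    and o2: "\<And>u. u < V \<Longrightarrow> O2 (cpos V (\<lambda>t. KA (O1 t)) u) = O1 u"
    and KB: "\<And>x. x \<in> X \<Longrightarrow> KB x < NB"
  shows "bij_betw O1 {..<V} X" "bij_betw O2 {..<V} X"
    "a \<le> a' \<Longrightarrow> a' < V \<Longrightarrow> KA (O2 a) * NB + KB (O2 a) \<le> KA (O2 a') * NB + KB (O2 a')"
proof -
  let ?p1 = "cpos V (\<lambda>t. KB (VI t))" and ?p2 = "cpos V (\<lambda>t. KA (O1 t))"
  have "bij_betw (O1 \<circ> ?p1) {..<V} X"
    using bij by (subst bij_betw_cong[of _ _ VI]) (auto simp: o1)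
  then show b1: "bij_betw O1 {..<V} X"
    using bij_betw_comp_iff[OF cpos_bij] by blast
  have "bij_betw (O2 \<circ> ?p2) {..<V} X"
    using b1 by (subst bij_betw_cong[of _ _ O1]) (auto simp: o2)
  then show b2: "bij_betw O2 {..<V} X"
    using bij_betw_comp_iff[OF cpos_bij] by blast
  have surj: "\<exists>u < V. cpos V key u = a" if "a < V" for key a
    using cpos_bij[of V key] that unfolding bij_betw_def by (metis imageE lessThan_iff)
  assume a: "a \<le> a'" "a' < V"
  show "KA (O2 a) * NB + KB (O2 a) \<le> KA (O2 a') * NB + KB (O2 a')"
  proof (cases "a = a'")
    case False
    then have less: "a < a'" "a < V" using a by auto
    obtain u u' where u: "u < V" "?p2 u = a" "u' < V" "?p2 u' = a'"
      using surj[of a "\<lambda>t. KA (O1 t)"] surj[of a' "\<lambda>t. KA (O1 t)"] less a by blast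
    obtain s s' where s: "s < V" "?p1 s = u" "s' < V" "?p1 s' = u'"
      using surj[of u "\<lambda>t. KB (VI t)"] surj[of u' "\<lambda>t. KB (VI t)"] u by blast
    have O: "O2 a = O1 u" "O2 a' = O1 u'" "O1 u = VI s" "O1 u' = VI s'"
      using o1 o2 u s by blast+
    have X: "KB (O2 a) < NB" "KB (O2 a') < NB"
      using b2 less a KB by (auto simp: bij_betw_def)
    have "KA (O2 a) < KA (O2 a') \<or> KA (O2 a) = KA (O2 a') \<and> u < u'"
      using cpos_less_iff[of u V u' "\<lambda>t. KA (O1 t)"] u less O by auto
    moreover have "KB (O2 a) \<le> KB (O2 a')" if "u < u'"
      using cpos_less_iff[of s V s' "\<lambda>t. KB (VI t)"] s that O by auto
    ultimately show ?thesis
      using mult_add_less_iff[OF X, of "KA (O2 a)" "KA (O2 a')"] by auto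
  qed simp
qed

text \<open>One round from window length H to D = 2 H. The number of counters, (n + 1) D + b,
  exceeds every name of length H, be it a rank or a character.\<close>

definition level_body :: "nat \<Rightarrow> com" where
  "level_body b =
     rNB ::= (Reg 0 [+] Num 1) [*] Reg rD [+] Num b ;;
     pairs_prog ;; cpass aVI aKB aO1 ;; cpass aO1 aKA aO2 ;; name_prog ;;
     rH ::= Reg rD ;; rD ::= Reg rD [+] Reg rD ;; dp_prog"

definition rank_prog :: "nat \<Rightarrow> com" where
  "rank_prog b =
     rH ::= Num 1 ;; rD ::= Num 2 ;; dp_prog ;;
     While (Less (Reg rH) (Reg rC)) (level_body b)"

context sort_ctx
begin

definition sorted_ok :: "nat \<Rightarrow> regfile \<Rightarrow> memory \<Rightarrow> bool" where
  "sorted_ok H r m \<longleftrightarrow> bij_betw (m aO2) {..<r rVC} (items H) \<and>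
     (\<forall>a a'. a \<le> a' \<longrightarrow> a' < r rVC \<longrightarrow> enc b (win H (m aO2 a)) \<le> enc b (win H (m aO2 a')))"

text \<open>The bound on names joins two regimes: characters below \<open>b\<close> for H = 1, and
  afterwards ranks below the number of crossing windows, at most (n + 1) H.\<close>

definition names_ok :: "nat \<Rightarrow> (nat list \<Rightarrow> nat) \<Rightarrow> memory \<Rightarrow> bool" where
  "names_ok H nm m \<longleftrightarrow> named H nm \<and> (H = 1 \<longrightarrow> nm = hd) \<and> (\<forall>u \<in> subs H. nm u < Suc n * H + b) \<and>
     cr_ok H nm m \<and> (\<forall>v. var v \<longrightarrow> pr_ok H (2 * H) nm m v (2 * H) \<and> su_ok H (2 * H) nm m v (2 * H))"

text \<open>Names below \<open>NB\<close> make the pair a two-digit number; since names respect the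
  order of the halves, the pairs compare like the concatenated strings.\<close>

lemma pair_order:
  assumes nm: "named H nm" and bd: "\<forall>u \<in> subs H. nm u < NB" and x: "x \<in> items (2 * H)" "y \<in> items (2 * H)"
  defines "q \<equiv> \<lambda>x. nm (take H (win (2 * H) x)) * NB + nm (drop H (win (2 * H) x))"
  shows "q x < q y \<longleftrightarrow> enc b (win (2 * H) x) < enc b (win (2 * H) y)"
proof -
  have s: "take H (win (2 * H) z) \<in> subs H" "drop H (win (2 * H) z) \<in> subs H" if "z \<in> items (2 * H)" for z
    using subs_halves[OF win_in_subs[OF that]] by auto
  note sx = s[OF x(1)] and sy = s[OF x(2)]
  have "q x < q y \<longleftrightarrow> nm (take H (win (2 * H) x)) < nm (take H (win (2 * H) y)) \<or>
      nm (take H (win (2 * H) x)) = nm (take H (win (2 * H) y)) \<and>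
      nm (drop H (win (2 * H) x)) < nm (drop H (win (2 * H) y))"
    unfolding q_def using bd sx sy by (intro mult_add_less_iff) auto
  also have "\<dots> \<longleftrightarrow> enc b (take H (win (2 * H) x)) < enc b (take H (win (2 * H) y)) \<or>
      enc b (take H (win (2 * H) x)) = enc b (take H (win (2 * H) y)) \<and>
      enc b (drop H (win (2 * H) x)) < enc b (drop H (win (2 * H) y))"
    using nm named_eq[OF nm] sx sy by (simp add: named_def)
  also have "\<dots> \<longleftrightarrow> enc b (take H (win (2 * H) x) @ drop H (win (2 * H) x)) <
      enc b (take H (win (2 * H) y) @ drop H (win (2 * H) y))"
    using subsD[OF sx(2)] subsD[OF sy(2)] by (intro enc_append_less_iff[symmetric]) auto
  finally show ?thesis by simp
qed

lemma level_body_wp: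
  assumes base: "base_ok m" and names: "names_ok H nm m" and H: "1 \<le> H" "H < c" "2 * H \<le> c"
    and r: "r 0 = n" "r rH = H" "r rD = 2 * H"
    and post: "\<And>r' m' t'. same {rI, rV, rX, rY, rJ, rVC, rS, rNB, rH, rD} r r' \<Longrightarrow>
      same {aPR, aSU, aCR, aKA, aKB, aVI, aO1, aO2, aCN} m m' \<Longrightarrow> r' rH = 2 * H \<Longrightarrow> r' rD = 4 * H \<Longrightarrow>
      names_ok (2 * H) (rank (2 * H)) m' \<Longrightarrow> sorted_ok (2 * H) r' m' \<Longrightarrow>
      t' \<le> t + 39 * (Suc n + b) * H \<Longrightarrow> Q r' m' t'"
  shows "wp w B (level_body b) Q r m t"
proof -
  define D where "D = 2 * H"
  define NB where "NB = Suc n * D + b"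
  have D: "D \<le> 4 * c" "2 * D \<le> 4 * c" "1 \<le> D" "2 \<le> D" "D \<le> c" using H by (auto simp: D_def)
  have nm: "named H nm" "\<forall>u \<in> subs H. nm u < Suc n * H + b" "cr_ok H nm m"
    "\<And>v. var v \<Longrightarrow> pr_ok H D nm m v D \<and> su_ok H D nm m v D"
    using names by (auto simp: names_ok_def D_def)
  have "Suc n * H \<le> Suc n * D" by (simp add: D_def)
  then have bd: "\<forall>u \<in> subs H. nm u < NB" using nm(2) by (auto simp: NB_def intro: less_le_trans)
  have NDB: "Suc n * D \<le> 16 * c * Suc n"
  proof -
    have "Suc n * D \<le> Suc n * (16 * c)" using D by (intro mult_le_mono2) simp
    then show ?thesis by (simp add: mult.commute)
  qed
  then have NBw: "NB < 2 ^ w" "NB \<le> B" "Suc n * D < 2 ^ w" "Suc n < 2 ^ w"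
    using cap_word cap_B D(3) mult_le_mono2[OF D(3), of "Suc n"] by (auto simp: NB_def)
  have bw: "b < 2 ^ w" using cap_word by simp
  have cardI: "card (items D) \<le> Suc n * D" by (rule card_items)
  let ?r1 = "r(rNB := NB)"
  have s1: "wp w B (rNB ::= (Reg 0 [+] Num 1) [*] Reg rD [+] Num b) Q' r m t" if "Q' ?r1 m t" for Q'
    using that r NBw bw one_less_word by (simp add: NB_def D_def flip: Suc_eq_plus1)
  have "wp w B pairs_prog (wp w B (cpass aVI aKB aO1) (wp w B (cpass aO1 aKA aO2) (wp w B name_prog
     (wp w B (rH ::= Reg rD) (wp w B (rD ::= Reg rD [+] Reg rD) (wp w B dp_prog Q)))))) ?r1 m t"
  proof (rule pairs_prog_wp[where H = H and nm = nm, folded D_def, OF base nm(3,4)], goal_cases)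
    case (7 r2 m2 t2)
    note P2 = this
    define V where "V = r2 rVC"
    have V: "V = card (items D)" using bij_betw_same_card[OF P2(3)] by (simp add: V_def)
    have Vw: "V < 2 ^ w" "V \<le> B" using cardI NBw V by (auto simp: NB_def)
    have k2: "m2 aKA x < NB \<and> m2 aKB x < NB" if "x \<in> items D" for x
      using P2(4)[OF that] bd subs_halves[of "win D x" H, folded D_def] win_in_subs[OF that] by auto
    have vi: "m2 aVI u \<in> items D" if "u < V" for u
      using P2(3) that by (auto simp: bij_betw_def V_def)
    have itB: "x \<le> B" if "x \<in> items D" for x
      using items_less[of D] that NBw by (force simp: NB_def)
    have r2: "r2 rNB = NB" "r2 rD = D" "r2 0 = n" "r2 rH = H" using P2(1) r by (auto simp: same_def D_def)
    show ?case
    proof (rule cpass_wp, goal_cases)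
      case (13 r3 m3 t3)
      note P3 = this
      have r3: "r3 rNB = NB" "r3 rVC = V" "r3 rD = D" "r3 0 = n" using P3(1) r2 by (auto simp: same_def V_def)
      have m3: "m3 aKA = m2 aKA" "m3 aKB = m2 aKB" using P3(2) by (auto simp: same_def)
      have o1: "\<And>u. u < V \<Longrightarrow> m3 aO1 (cpos V (\<lambda>t. m2 aKB (m2 aVI t)) u) = m2 aVI u"
        using P3(3) by (simp add: V_def)
      \<comment> \<open>\<open>two_pass\<close> speaks about both passes, but the second has not run
        yet. A fictitious output of it is supplied by means of the inverse of
        \<open>cpos\<close>.\<close>
      have bij1: "bij_betw (m3 aO1) {..<V} (items D)"
        using P2(3) o1 by (intro two_pass(1)[of "m2 aVI" V "items D" "m3 aO1" "m2 aKB"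
            "(\<lambda>a. m3 aO1 (inv_into {..<V} (cpos V (\<lambda>t. m2 aKA (m3 aO1 t))) a))" "m2 aKA" NB])
          (auto simp: V_def k2 bij_betw_inv_into_left[OF cpos_bij])
      have o1i: "m3 aO1 u \<in> items D" if "u < V" for u
        using bij1 that by (auto simp: bij_betw_def)
      show ?case
      proof (rule cpass_wp, goal_cases)
        case (13 r4 m4 t4)
        note P4 = this
        have r4: "r4 rVC = V" "r4 rD = D" "r4 0 = n" using P4(1) r3 by (auto simp: same_def)
        have m4: "m4 aKA = m2 aKA" "m4 aKB = m2 aKB" using P4(2) m3 by (auto simp: same_def)
        have o2: "\<And>u. u < V \<Longrightarrow> m4 aO2 (cpos V (\<lambda>t. m2 aKA (m3 aO1 t)) u) = m3 aO1 u"
          using P4(3) by (simp add: r3 m3)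
        note tp = two_pass[where VI = "m2 aVI" and V = V and X = "items D" and KB = "m2 aKB" and
            ?O1.0 = "m3 aO1" and ?O2.0 = "m4 aO2" and KA = "m2 aKA" and NB = NB]
        have bij2: "bij_betw (m4 aO2) {..<V} (items D)"
          by (rule tp(2)) (use P2(3) o1 o2 k2 in \<open>auto simp: V_def\<close>)
        define q where "q x = m2 aKA x * NB + m2 aKB x" for x
        have srt: "q (m4 aO2 a) \<le> q (m4 aO2 a')" if "a \<le> a'" "a' < V" for a a'
          unfolding q_def by (rule tp(3)) (use P2(3) o1 o2 k2 that in \<open>auto simp: V_def\<close>)
        have qe: "q x < q y \<longleftrightarrow> enc b (win D x) < enc b (win D y)" if "x \<in> items D" "y \<in> items D" for x y
          using pair_order[OF nm(1) bd, of x y, folded D_def] that P2(4) by (simp add: q_def)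
        have o2i: "m4 aO2 u \<in> items D" if "u < V" for u
          using bij2 that by (auto simp: bij_betw_def)
        show ?case
        proof (rule name_prog_wp[where q = q], goal_cases)
          case (8 r5 m5 t5)
          note P5 = this
          have r5: "r5 rVC = V" "r5 rD = D" "r5 0 = n" using P5(1) r4 by (auto simp: same_def)
          have m5: "m5 aO2 = m4 aO2" using P5(2) by (auto simp: same_def)
          have m5b: "base_ok m5"
            using base P5(2) P4(2) P3(2) P2(2) by (auto simp: base_ok_def same_def)
          have rk: "card {u'. u' < V \<and> q (m4 aO2 u') < q (m4 aO2 u)} = rank D (win D (m4 aO2 u))" if u: "u < V" for u
          proof -
            have "bij_betw (m4 aO2) {u'. u' < V \<and> q (m4 aO2 u') < q (m4 aO2 u)}
                {x \<in> items D. enc b (win D x) < enc b (win D (m4 aO2 u))}"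
            proof (rule bij_betw_subset[OF bij2])
              show "m4 aO2 ` {u'. u' < V \<and> q (m4 aO2 u') < q (m4 aO2 u)} =
                {x \<in> items D. enc b (win D x) < enc b (win D (m4 aO2 u))}"
                using bij2 o2i qe u unfolding bij_betw_def by (auto 0 3 simp: image_iff)
            qed auto
            from bij_betw_same_card[OF this] show ?thesis by (simp add: rank_def)
          qed
          have cr5: "cr_ok D (rank D) m5"
            unfolding cr_ok_def
          proof (intro allI impI)
            fix v s assume cr: "crossing v s D"
            then have "v * D + s \<in> items D" by (auto simp: items_def)
            then obtain u where u: "u < V" "m4 aO2 u = v * D + s"
              using bij2 unfolding bij_betw_def by (metis imageE lessThan_iff)
            then have "m5 aCR (v * D + s) = rank D (win D (v * D + s))"
              using P5(3)[of u] rk[of u] r4 by simp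
            then show "m5 aCR (v * D + s) = rank D (cwin v s D)"
              using win_item[OF cr] by simp
          qed
          have "wp w B dp_prog Q (r5(rH := D, rD := D + D)) m5 t5"
          proof (rule dp_prog_wp[OF m5b cr5, where D = "D + D"], goal_cases)
            case (8 r6 m6 t6)
            note P6 = this
            have "rank D u < Suc n * D + b" if "u \<in> subs D" for u
              using rank_less[OF D(4) that] cardI by simp
            then have "names_ok D (rank D) m6"
              unfolding names_ok_def mult_2 using named_rank[OF D(4)] cr5 P6(2,3) D(4)
              by (auto simp: cr_ok_def same_def)
            then have n6: "names_ok (2 * H) (rank (2 * H)) m6"
              by (simp add: D_def)
            have s6: "sorted_ok (2 * H) r6 m6"
            proof -
              have "enc b (win D (m4 aO2 a)) \<le> enc b (win D (m4 aO2 a'))" if "a \<le> a'" "a' < V" for a a'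
                using srt[OF that] qe[OF o2i o2i, of a' a] that by (simp add: not_less[symmetric])
              moreover have "r6 rVC = V" "m6 aO2 = m4 aO2"
                using P6(1,2) r5 m5 by (auto simp: same_def)
              ultimately show ?thesis
                using bij2 by (simp add: sorted_ok_def D_def)
            qed
            have "t6 \<le> t + n * Suc D + 2 * (2 * NB + 2 * V) + V + n * Suc (D + D)"
              using P6(4) P5(4) P4(4) P3(4) P2(5) r2 r3 r4 by (simp add: V_def)
            \<comment> \<open>With X = (n + 1) H: 3 X for pairing, 16 X + 4 b for the two passes, 2
              X for naming and 5 X for the new tables. This is below 39 (X + b H).\<close>
            also have "\<dots> \<le> t + 39 * (Suc n + b) * H"
            proof -
              define X where "X = Suc n * H"
              define Y where "Y = b * H"
              have D2: "Suc n * D = 2 * X" by (simp add: X_def D_def)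
              have fin: "t + p1 + 2 * (2 * NB + 2 * V) + V + p2 \<le> t + (39 * X + 39 * Y)"
                if "p1 \<le> 3 * X" "p2 \<le> 5 * X" "V \<le> 2 * X" "b \<le> Y" "NB = 2 * X + b" for p1 p2
                using that le0[of X] le0[of Y] by (simp add: algebra_simps)
              have V2: "V \<le> 2 * X" using V cardI D2 by simp
              have "n * Suc D \<le> Suc n * (3 * H)" "n * Suc (D + D) \<le> Suc n * (5 * H)"
                using H by (intro mult_le_mono; simp add: D_def)+
              then have n2: "n * Suc D \<le> 3 * X" "n * Suc (D + D) \<le> 5 * X"
                by (simp_all add: X_def)
              have bY: "b \<le> Y" using H by (simp add: Y_def)
              have NB2: "NB = 2 * X + b" using D2 by (simp add: NB_def)
              have eq: "39 * (Suc n + b) * H = 39 * X + 39 * Y"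
                unfolding X_def Y_def by (simp add: algebra_simps)
              show ?thesis unfolding eq by (rule fin[OF n2 V2 bY NB2])
            qed
            finally have t6: "t6 \<le> t + 39 * (Suc n + b) * H" .
            show ?case
            proof (rule post[OF _ _ _ _ n6 s6 t6])
              show "same {rI, rV, rX, rY, rJ, rVC, rS, rNB, rH, rD} r r6"
                using P6(1) P5(1) P4(1) P3(1) P2(1) by (auto simp: same_def)
              show "same {aPR, aSU, aCR, aKA, aKB, aVI, aO1, aO2, aCN} m m6"
                using P6(2) P5(2) P4(2) P3(2) P2(2) by (auto simp: same_def)
              show "r6 rH = 2 * H" "r6 rD = 4 * H"
                using P6(1) by (auto simp: same_def D_def)
            qed
          qed (use D r5 in auto)
          moreover have "D + D < 2 ^ w" using small_word(1)[of "D + D"] D by simp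
          ultimately show ?case using r5 by simp
        next
          case (6 u u')
          then have "u < V" "u' < V" by (simp_all add: r4)
          then show ?case
            unfolding q_def m4 using k2[OF o2i] by (intro mult_add_eq_iff) auto
        qed (use w_pos Vw r4 o2i itB srt bij2 in \<open>auto simp: bij_betw_def\<close>)
      qed (use w_pos Vw NBw r3 m3 o1i itB k2 in auto)
    qed (use w_pos Vw NBw r2 vi itB k2 in \<open>auto simp: V_def\<close>)
  qed (use H r in \<open>auto simp: D_def\<close>)
  then show ?thesis
    unfolding level_body_def wp_Seq_iff by (rule s1)
qed

lemma rank_prog_wp:
  assumes base: "base_ok m" and r: "r 0 = n" "r rC = c" and c: "c = 2 ^ e"
    and post: "\<And>r' m' t'. same {rI, rV, rX, rY, rJ, rVC, rS, rNB, rH, rD} r r' \<Longrightarrow>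
      same {aPR, aSU, aCR, aKA, aKB, aVI, aO1, aO2, aCN} m m' \<Longrightarrow>
      cr_ok c (rank c) m' \<Longrightarrow> sorted_ok c r' m' \<Longrightarrow> t' \<le> t + 40 * (Suc n + b) * c \<Longrightarrow> Q r' m' t'"
  shows "wp w B (rank_prog b) Q r m t"
proof -
  let ?S = "{rI, rV, rX, rY, rJ, rVC, rS, rNB, rH, rD}" and ?M = "{aPR, aSU, aCR, aKA, aKB, aVI, aO1, aO2, aCN}"
  define I where "I r' m' t' \<longleftrightarrow> same ?S r r' \<and> same ?M m m' \<and> (\<exists>k. k \<le> e \<and> r' rH = 2 ^ k \<and> r' rD = 2 * 2 ^ k \<and>
    (\<exists>nm. names_ok (2 ^ k) nm m' \<and> (k > 0 \<longrightarrow> nm = rank (2 ^ k) \<and> sorted_ok (2 ^ k) r' m')) \<and>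
    t' \<le> t + 40 * (Suc n + b) * 2 ^ k)" for r' m' t'
  have e: "0 < e" using c c_ge by (cases e) auto
  have T: "t + 40 * (Suc n + b) * 2 ^ k \<le> t + 40 * (Suc n + b) * c" if "k \<le> e" for k
    unfolding c using that by (intro add_left_mono mult_le_mono2 power_increasing) auto
  have baseI: "base_ok m'" if "same ?M m m'" for m'
    using that base by (auto simp: base_ok_def same_def)
  have two: "(2::nat) < 2 ^ w" using small_word(1)[of 2] by simp
  have "wp w B dp_prog (wp w B (While (Less (Reg rH) (Reg rC)) (level_body b)) Q) (r(rH := 1, rD := 2)) m t"
  proof (rule dp_prog_wp[where H = 1 and D = 2 and nm = hd, OF base], goal_cases)
    case (9 r1 m1 t1)
    note P1 = this
    have cr1: "cr_ok 1 hd m'" for m' by (auto simp: cr_ok_def crossing_def)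
    have hd: "hd u < Suc n * 1 + b" if "u \<in> subs 1" for u
      using subsD[OF that] by (cases u) auto
    have nl: "n * 3 \<le> 40 * (Suc n + b)" by simp
    have I1: "I r1 m1 t1"
      unfolding I_def
    proof (intro conjI exI[of _ 0] exI[of _ hd])
      show "names_ok (2 ^ 0) hd m1"
        using named_1 cr1 hd P1(3) by (auto simp: names_ok_def)
      show "t1 \<le> t + 40 * (Suc n + b) * 2 ^ 0" using P1(4) nl by simp
    qed (use P1 in \<open>auto simp: same_def\<close>)
    show ?case
    proof (rule wp_While[where I = I and T = "t + 41 * (Suc n + b) * c + 1", OF I1], goal_cases)
      case (1 r2 m2 t2)
      then show ?case by simp
    next
      case (2 r2 m2 t2)
      then obtain k nm where k: "same ?S r r2" "same ?M m m2" "k \<le> e" "r2 rH = 2 ^ k" "r2 rD = 2 * 2 ^ k"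
        "names_ok (2 ^ k) nm m2" "t2 \<le> t + 40 * (Suc n + b) * 2 ^ k"
        unfolding I_def by blast
      have r2: "r2 0 = n" "r2 rC = c" using k(1) r by (auto simp: same_def)
      have lt: "2 ^ k < c" using 2(2) k(4) r2 by simp
      then have ke: "Suc k \<le> e" using c by (simp add: Suc_le_eq)
      then have le: "2 * 2 ^ k \<le> c" unfolding c using power_increasing[of "Suc k" e "2::nat"] by simp
      have "c \<le> (Suc n + b) * c" by simp
      then have small: "t2 < t + 41 * (Suc n + b) * c + 1"
        using k(7) T[OF k(3)] by (simp add: algebra_simps)
      \<comment> \<open>A round costs at most 40 Z including its tick, while the bound accumulated
        so far is 40 Z. The total doubles together with the window length, so the geometric sum
        needs no evaluation.\<close>
      have tk: "t2 + 1 + 39 * (Suc n + b) * 2 ^ k \<le> t + 40 * (Suc n + b) * 2 ^ Suc k"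
      proof -
        define Z where "Z = (Suc n + b) * 2 ^ k"
        have "0 < Z" by (simp add: Z_def)
        moreover have "40 * (Suc n + b) * 2 ^ k = 40 * Z" "39 * (Suc n + b) * 2 ^ k = 39 * Z"
          "40 * (Suc n + b) * 2 ^ Suc k = 80 * Z"
          unfolding Z_def by (simp_all only: mult.assoc power_Suc mult.left_commute)
        ultimately show ?thesis using k(7) by linarith
      qed
      have "wp w B (level_body b) I r2 m2 (Suc t2)"
      proof (rule level_body_wp[OF baseI[OF k(2)] k(6) _ lt le r2(1) k(4,5)], goal_cases)
        case (2 r3 m3 t3)
        show ?case
          unfolding I_def
        proof (intro conjI exI[of _ "Suc k"] exI[of _ "rank (2 ^ Suc k)"] impI)
          show "same ?S r r3" "same ?M m m3"
            using 2(1,2) k(1,2) by (auto simp: same_def)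
          show "t3 \<le> t + 40 * (Suc n + b) * 2 ^ Suc k"
            using 2(7) tk by simp
        qed (use 2 ke in auto)
      qed simp
      with small show ?case by blast
    next
      case (3 r2 m2 t2)
      then obtain k nm where k: "same ?S r r2" "same ?M m m2" "k \<le> e" "r2 rH = 2 ^ k"
        "names_ok (2 ^ k) nm m2" "k > 0 \<longrightarrow> nm = rank (2 ^ k) \<and> sorted_ok (2 ^ k) r2 m2"
        "t2 \<le> t + 40 * (Suc n + b) * 2 ^ k"
        unfolding I_def by blast
      have "r2 rC = c" using k(1) r by (auto simp: same_def)
      then have "c \<le> 2 ^ k" using 3(2) k(4) by simp
      then have ck: "2 ^ k = c" using k(3) c power_increasing[of k e "2::nat"] by auto
      then have "k > 0" using c_ge by (cases k) auto
      show ?case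
        using k ck \<open>k > 0\<close> by (intro post) (auto simp: names_ok_def)
    qed
  qed (use r c_ge in \<open>auto simp: cr_ok_def crossing_def\<close>)
  then show ?thesis
    unfolding rank_prog_def using two one_less_word by simp
qed

end


section \<open>Painting intervals\<close>

text \<open>The root is node 1, so halving the node number ends at 0 after the root has been
  inspected.\<close>

definition query_prog :: com where
  "query_prog =
     rA ::= Num 0 ;;
     While (Neg (Equal (Reg rX) (Num 0))) (
       If (Less (Reg rA) (Read aTAG (Reg rX))) (rA ::= Read aTAG (Reg rX)) Skip ;;
       rX ::= Reg rX [div] Num 2)"

text \<open>The usual bottom-up decomposition of a half-open interval into subtrees. Tags are
  overwritten without comparison, because the new factor has the largest index so far.\<close>

definition paint_body :: com where
  "paint_body =
     If (Equal (Reg rLO [mod] Num 2) (Num 1)) (Write aTAG (Reg rLO) (Reg rM) ;; rLO ::= Reg rLO [+] Num 1) Skip ;;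
     If (Equal (Reg rHI [mod] Num 2) (Num 1)) (rHI ::= Reg rHI [-] Num 1 ;; Write aTAG (Reg rHI) (Reg rM)) Skip ;;
     rLO ::= Reg rLO [div] Num 2 ;; rHI ::= Reg rHI [div] Num 2"

definition paint_prog :: com where
  "paint_prog = While (Less (Reg rLO) (Reg rHI)) paint_body"

lemma query_prog_wp:
  assumes w: "2 < (2::nat) ^ w" and v: "v \<le> B" "v < 2 ^ Suc h" and r: "r rX = v"
    and post: "\<And>r' t'. same {rA, rX} r r' \<Longrightarrow> (\<And>i. i \<le> h \<Longrightarrow> m aTAG (v div 2 ^ i) \<le> r' rA \<or> v div 2 ^ i = 0) \<Longrightarrow>
      (r' rA = 0 \<or> (\<exists>i \<le> h. r' rA = m aTAG (v div 2 ^ i))) \<Longrightarrow> t' \<le> t + Suc h \<Longrightarrow> Q r' m t'"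
  shows "wp w B query_prog Q r m t"
proof -
  define I where "I r' m' t' \<longleftrightarrow> same {rA, rX} r r' \<and> m' = m \<and> (\<exists>i. r' rX = v div 2 ^ i \<and> i \<le> Suc h \<and> t' = t + i \<and>
    (\<forall>j < i. m aTAG (v div 2 ^ j) \<le> r' rA \<or> v div 2 ^ j = 0) \<and>
    (r' rA = 0 \<or> (\<exists>j < i. j \<le> h \<and> r' rA = m aTAG (v div 2 ^ j))))" for r' m' t'
  have wo: "1 < (2::nat) ^ w" using w by simp
  have "wp w B (While (Neg (Equal (Reg rX) (Num 0))) (
       If (Less (Reg rA) (Read aTAG (Reg rX))) (rA ::= Read aTAG (Reg rX)) Skip ;;
       rX ::= Reg rX [div] Num 2)) Q (r(rA := 0)) m t"
  proof (rule wp_While[where I = I and T = "t + Suc h"], goal_cases)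
    case 1
    then show ?case unfolding I_def using r by (intro conjI exI[of _ 0]) auto
  next
    case (2 r1 m1 t1)
    then show ?case using wo by simp
  next
    case (3 r1 m1 t1)
    then obtain i where i: "same {rA, rX} r r1" "m1 = m" "r1 rX = v div 2 ^ i" "i \<le> Suc h" "t1 = t + i"
      "\<forall>j < i. m aTAG (v div 2 ^ j) \<le> r1 rA \<or> v div 2 ^ j = 0"
      "r1 rA = 0 \<or> (\<exists>j < i. j \<le> h \<and> r1 rA = m aTAG (v div 2 ^ j))"
      unfolding I_def by blast
    have ne: "v div 2 ^ i \<noteq> 0" using 3(2) i(3) by simp
    have ih: "i \<le> h"
    proof (rule ccontr)
      assume "\<not> i \<le> h"
      then have "i = Suc h" using i(4) by simp
      then show False using ne v(2) by simp
    qed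
    have dv: "v div 2 ^ i div 2 = v div 2 ^ Suc i"
      by (simp add: div_mult2_eq[symmetric] mult.commute)
    have B: "v div 2 ^ i \<le> B" using v(1) div_le_dividend le_trans by blast
    have A: "I (r1(rA := m aTAG (v div 2 ^ i), rX := v div 2 ^ Suc i)) m (Suc t1)" if "r1 rA < m aTAG (v div 2 ^ i)"
      unfolding I_def using i ih that
      by (intro conjI exI[of _ "Suc i"]) (auto simp: All_less_Suc intro: less_imp_le_nat order.trans)
    have A': "I (r1(rX := v div 2 ^ Suc i)) m (Suc t1)" if "\<not> r1 rA < m aTAG (v div 2 ^ i)"
      unfolding I_def using i ih that
      by (intro conjI exI[of _ "Suc i"]) (auto simp: All_less_Suc less_Suc_eq not_less)
    show ?case
      using i(2,3,5) ih B A A' w dv by simp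
  next
    case (4 r1 m1 t1)
    then obtain i where i: "same {rA, rX} r r1" "m1 = m" "r1 rX = v div 2 ^ i" "i \<le> Suc h" "t1 = t + i"
      "\<forall>j < i. m aTAG (v div 2 ^ j) \<le> r1 rA \<or> v div 2 ^ j = 0"
      "r1 rA = 0 \<or> (\<exists>j < i. j \<le> h \<and> r1 rA = m aTAG (v div 2 ^ j))"
      unfolding I_def by blast
    have z: "v div 2 ^ i = 0" using 4(2) i(3) by simp
    have z': "v div 2 ^ j = 0" if "i \<le> j" for j
    proof -
      have "v div 2 ^ j \<le> v div 2 ^ i" using that by (intro div_le_mono2) (auto intro: power_increasing)
      then show ?thesis using z by simp
    qed
    show ?case
      unfolding i(2)
    proof (rule post)
      show "m aTAG (v div 2 ^ j) \<le> r1 rA \<or> v div 2 ^ j = 0" if "j \<le> h" for j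
        using i(6) z'[of j] by (cases "j < i") auto
    qed (use i in auto)
  qed
  then show ?thesis
    unfolding query_prog_def using wo by simp
qed

text \<open>With leaves 2^H, ..., 2^(H+1) - 1, the number of a node determines its height, as the
  levels occupy disjoint ranges between consecutive powers of two.\<close>

lemma div_pow_level:
  fixes v x :: nat
  assumes v: "2 ^ H \<le> v" "v < 2 * 2 ^ H" and x: "2 ^ (H - l) \<le> v div 2 ^ i" "v div 2 ^ i < 2 * 2 ^ (H - l)" "l \<le> H"
  shows "i = l"
proof -
  have iH: "i \<le> H"
  proof (rule ccontr)
    assume "\<not> i \<le> H"
    then have "2 * 2 ^ H \<le> (2::nat) ^ i" using power_increasing[of "Suc H" i "2::nat"] by simp
    then have "v div 2 ^ i = 0" using v by simp
    then show False using x(1) by simp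
  qed
  have split: "(2::nat) ^ H = 2 ^ (H - i) * 2 ^ i"
    using iH by (simp add: power_add[symmetric])
  have lo: "2 ^ (H - i) \<le> v div 2 ^ i"
  proof -
    have "2 ^ (H - i) * 2 ^ i div 2 ^ i \<le> v div 2 ^ i"
      using v(1) split by (intro div_le_mono) simp
    then show ?thesis by simp
  qed
  have hi: "v div 2 ^ i < 2 * 2 ^ (H - i)"
    using v(2) split by (simp add: less_mult_imp_div_less mult.assoc)
  have "(2::nat) ^ (H - i) < 2 ^ Suc (H - l)" "(2::nat) ^ (H - l) < 2 ^ Suc (H - i)"
    using lo hi x by auto
  then have "H - i < Suc (H - l)" "H - l < Suc (H - i)"
    by (auto intro: power_less_imp_less_exp[of "2::nat"] simp del: power_Suc)
  then show ?thesis using iH x(3) by simp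
qed

text \<open>An odd left end is a right child whose sibling lies outside, and for odd h the node h -
  1 is a left child whose sibling h lies outside. Without these two nodes the interval consists of
  full sibling pairs and is given by their parents. Separating the lowest bits turns all claims into
  linear arithmetic.\<close>

lemma paint_step_arith:
  fixes l h y :: nat
  assumes "l < h"
  defines "l' \<equiv> if l mod 2 = 1 then l + 1 else l" and "h' \<equiv> if h mod 2 = 1 then h - 1 else h"
  shows "l' \<le> h'" "l \<le> y \<Longrightarrow> y < h \<Longrightarrow> (l mod 2 = 1 \<and> y = l) \<or> (h mod 2 = 1 \<and> y = h - 1) \<or> l' div 2 \<le> y div 2 \<and> y div 2 < h' div 2"
    "l' div 2 \<le> y div 2 \<Longrightarrow> y div 2 < h' div 2 \<Longrightarrow> l \<le> y \<and> y < h"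
    "2 * A \<le> l \<Longrightarrow> A \<le> l' div 2" "h \<le> 2 * A \<Longrightarrow> h' div 2 \<le> A"
proof -
  define e f g where "e = l mod 2" and "f = y mod 2" and "g = h mod 2"
  define a z d where "a = l div 2" and "z = y div 2" and "d = h div 2"
  have dec: "l = 2 * a + e" "y = 2 * z + f" "h = 2 * d + g"
    by (simp_all add: a_def z_def d_def e_def f_def g_def)
  have bits: "e = 0 \<or> e = 1" "f = 0 \<or> f = 1" "g = 0 \<or> g = 1"
    by (auto simp: e_def f_def g_def One_nat_def)
  have l2: "l' = 2 * (a + e)" and h2: "h' = 2 * d"
    unfolding l'_def h'_def using dec(1,3) bits(1,3) e_def g_def by auto
  then have half: "l' div 2 = a + e" "h' div 2 = d" by auto
  have ley: "2 * a + e < 2 * d + g" using assms(1) dec by simp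
  show "l' \<le> h'"
    unfolding l2 h2 using bits ley by auto
  show "(l mod 2 = 1 \<and> y = l) \<or> (h mod 2 = 1 \<and> y = h - 1) \<or> l' div 2 \<le> y div 2 \<and> y div 2 < h' div 2"
    if "l \<le> y" "y < h"
  proof -
    have "2 * a + e \<le> 2 * z + f" "2 * z + f < 2 * d + g" using that dec by auto
    then have "e = 1 \<and> 2 * z + f = 2 * a + e \<or> g = 1 \<and> 2 * z + f = 2 * d + g - 1 \<or> a + e \<le> z \<and> z < d"
      using bits by (elim disjE; simp; presburger)
    then show ?thesis
      unfolding half z_def[symmetric] e_def[symmetric] g_def[symmetric] using dec by metis
  qed
  show "l \<le> y \<and> y < h" if "l' div 2 \<le> y div 2" "y div 2 < h' div 2"
    using that bits unfolding half z_def[symmetric] dec by auto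
  show "2 * A \<le> l \<Longrightarrow> A \<le> l' div 2" unfolding half dec(1) using bits(1) by auto
  show "h \<le> 2 * A \<Longrightarrow> h' div 2 \<le> A" unfolding half dec(3) by auto
qed

text \<open>
  After \<open>i\<close> rounds the interval \<open>{lo..<hi}\<close> of leaves is tagged except below the nodes \<open>{l..<h}\<close> at
  height \<open>i\<close>. The root is node \<open>1\<close>, and the parent of node \<open>x\<close> is \<open>x div 2\<close>.
\<close>

definition paint_inv :: "nat \<Rightarrow> nat \<Rightarrow> nat \<Rightarrow> nat \<Rightarrow> (nat \<Rightarrow> nat) \<Rightarrow> (nat \<Rightarrow> nat) \<Rightarrow> nat \<Rightarrow> nat \<Rightarrow> nat \<Rightarrow> bool" where
  "paint_inv H lo hi k tag tag' i l h \<longleftrightarrow>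
     (\<forall>x. tag' x = tag x \<or> tag' x = k \<and> (\<forall>v j. 2 ^ H \<le> v \<longrightarrow> v < 2 * 2 ^ H \<longrightarrow> v div 2 ^ j = x \<longrightarrow> lo \<le> v \<and> v < hi)) \<and>
     (\<forall>v. lo \<le> v \<longrightarrow> v < hi \<longrightarrow> (\<exists>j < i. j \<le> H \<and> tag' (v div 2 ^ j) = k) \<or> l \<le> v div 2 ^ i \<and> v div 2 ^ i < h) \<and>
     (\<forall>v. l \<le> v div 2 ^ i \<longrightarrow> v div 2 ^ i < h \<longrightarrow> lo \<le> v \<and> v < hi) \<and>
     (l < h \<longrightarrow> i \<le> H \<and> 2 ^ (H - i) \<le> l \<and> h \<le> 2 * 2 ^ (H - i)) \<and> i \<le> Suc H"

text \<open>A tagged node lies in {l..<h} at height i. By \<open>div_pow_level\<close> every leaf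
  below it reaches it after exactly i halvings, so the invariant places the whole subtree inside the
  painted interval.\<close>

lemma paint_inv_step:
  assumes inv: "paint_inv H lo hi k tag tag' i l h" and less: "l < h"
  defines "l' \<equiv> if l mod 2 = 1 then l + 1 else l" and "h' \<equiv> if h mod 2 = 1 then h - 1 else h"
  defines "tag1 \<equiv> if l mod 2 = 1 then tag'(l := k) else tag'"
  defines "tag2 \<equiv> if h mod 2 = 1 then tag1(h - 1 := k) else tag1"
  shows "paint_inv H lo hi k tag tag2 (Suc i) (l' div 2) (h' div 2)"
proof -
  note I = inv[unfolded paint_inv_def]
  have iH: "i \<le> H" "2 ^ (H - i) \<le> l" "h \<le> 2 * 2 ^ (H - i)" using I less by auto
  note ar = paint_step_arith[OF less, folded l'_def h'_def]
  have dv: "v div 2 ^ Suc i = v div 2 ^ i div 2" for v :: nat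
    by (simp add: div_mult2_eq[symmetric] mult.commute)
  have own: "lo \<le> v \<and> v < hi" if "2 ^ H \<le> v" "v < 2 * 2 ^ H" "v div 2 ^ j = x" "l \<le> x" "x < h" for v j x
  proof -
    have "j = i"
      using that iH by (intro div_pow_level[of H v i j]) auto
    then show ?thesis using I that by blast
  qed
  have t2: "tag2 x = (if l mod 2 = 1 \<and> x = l \<or> h mod 2 = 1 \<and> x = h - 1 then k else tag' x)" for x
    by (auto simp: tag2_def tag1_def)
  have 1: "tag2 x = tag x \<or> tag2 x = k \<and> (\<forall>v j. 2 ^ H \<le> v \<longrightarrow> v < 2 * 2 ^ H \<longrightarrow> v div 2 ^ j = x \<longrightarrow> lo \<le> v \<and> v < hi)" for x
  proof (cases "l mod 2 = 1 \<and> x = l \<or> h mod 2 = 1 \<and> x = h - 1")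
    case True
    then have "l \<le> x" "x < h" using less by auto
    then have "\<forall>v j. 2 ^ H \<le> v \<longrightarrow> v < 2 * 2 ^ H \<longrightarrow> v div 2 ^ j = x \<longrightarrow> lo \<le> v \<and> v < hi"
      using own by blast
    then show ?thesis using True t2 by simp
  next
    case False
    have eq: "tag2 x = tag' x" unfolding t2 using False by (rule if_not_P)
    show ?thesis unfolding eq using I by blast
  qed
  have 2: "(\<exists>j < Suc i. j \<le> H \<and> tag2 (v div 2 ^ j) = k) \<or> l' div 2 \<le> v div 2 ^ Suc i \<and> v div 2 ^ Suc i < h' div 2"
    if v: "lo \<le> v" "v < hi" for v
  proof -
    consider j where "j < i" "j \<le> H" "tag' (v div 2 ^ j) = k" | "l \<le> v div 2 ^ i" "v div 2 ^ i < h"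
      using I v by blast
    then show ?thesis
    proof cases
      case 1
      then have "tag2 (v div 2 ^ j) = k" by (simp add: t2)
      then show ?thesis using 1 by (intro disjI1 exI[of _ j]) simp
    next
      case 2
      from ar(2)[OF 2] consider "tag2 (v div 2 ^ i) = k" | "l' div 2 \<le> v div 2 ^ i div 2" "v div 2 ^ i div 2 < h' div 2"
        using t2 by auto
      then show ?thesis
      proof cases
        case 1
        then show ?thesis using iH by (intro disjI1 exI[of _ i]) simp
      next
        case 2
        then show ?thesis using dv by simp
      qed
    qed
  qed
  have 3: "lo \<le> v \<and> v < hi" if "l' div 2 \<le> v div 2 ^ Suc i" "v div 2 ^ Suc i < h' div 2" for v
    using ar(3)[of "v div 2 ^ i"] that dv I by auto
  have 4: "Suc i \<le> H \<and> 2 ^ (H - Suc i) \<le> l' div 2 \<and> h' div 2 \<le> 2 * 2 ^ (H - Suc i)" if lt: "l' div 2 < h' div 2"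
  \<comment> \<open>At the root level only {1..<2} can be left. Its odd left end is tagged, and
    nothing remains for a further round.\<close>
  proof (cases "i = H")
    case True
    then have "l' div 2 \<ge> 1 \<or> l = 0" "h' div 2 \<le> 1"
      using iH ar(5)[of 1] by (auto simp: l'_def)
    then show ?thesis using lt iH True by auto
  next
    case False
    then have "2 ^ (H - i) = 2 * (2::nat) ^ (H - Suc i)"
      using iH by (metis Suc_diff_Suc le_neq_implies_less power_Suc)
    then show ?thesis
      using iH False ar(4)[of "2 ^ (H - Suc i)"] ar(5)[of "2 * 2 ^ (H - Suc i)"] by auto
  qed
  show ?thesis
    unfolding paint_inv_def using 1 2 3 4 iH(1) by blast
qed

lemma paint_prog_wp:
  assumes w: "2 < (2::nat) ^ w" and H: "2 * 2 ^ H \<le> B" "2 * 2 ^ H < (2::nat) ^ w"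
    and r: "r rLO = 2 ^ H + lo" "r rHI = 2 ^ H + hi" "hi \<le> 2 ^ H" "r rM = k"
    and post: "\<And>r' m' t'. same {rLO, rHI} r r' \<Longrightarrow> same {aTAG} m m' \<Longrightarrow>
      (\<And>x. m' aTAG x = m aTAG x \<or> m' aTAG x = k \<and> (\<forall>u j. u < 2 ^ H \<longrightarrow> (2 ^ H + u) div 2 ^ j = x \<longrightarrow> lo \<le> u \<and> u < hi)) \<Longrightarrow>
      (\<And>u. lo \<le> u \<Longrightarrow> u < hi \<Longrightarrow> \<exists>j \<le> H. m' aTAG ((2 ^ H + u) div 2 ^ j) = k) \<Longrightarrow> t' \<le> t + Suc H \<Longrightarrow> Q r' m' t'"
  shows "wp w B paint_prog Q r m t"
proof -
  define I where "I r' m' t' \<longleftrightarrow> same {rLO, rHI} r r' \<and> same {aTAG} m m' \<and>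
    (\<exists>i. t' = t + i \<and> paint_inv H (2 ^ H + lo) (2 ^ H + hi) k (m aTAG) (m' aTAG) i (r' rLO) (r' rHI))" for r' m' t'
  have wo: "1 < (2::nat) ^ w" using w by simp
  show ?thesis
    unfolding paint_prog_def
  proof (rule wp_While[where I = I and T = "t + Suc H"], goal_cases)
    case 1
    show ?case unfolding I_def using r by (auto simp: paint_inv_def intro!: exI[of _ 0])
  next
    case (2 r1 m1 t1)
    then show ?case by simp
  next
    case (3 r1 m1 t1)
    then obtain i where i: "same {rLO, rHI} r r1" "same {aTAG} m m1" "t1 = t + i"
      "paint_inv H (2 ^ H + lo) (2 ^ H + hi) k (m aTAG) (m1 aTAG) i (r1 rLO) (r1 rHI)"
      unfolding I_def by blast
    define l h where "l = r1 rLO" and "h = r1 rHI"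
    have less: "l < h" using 3(2) by (simp add: l_def h_def)
    have iH: "i \<le> H" "h \<le> 2 * 2 ^ (H - i)" using i(4) less by (auto simp: paint_inv_def l_def h_def)
    have "h \<le> 2 * 2 ^ H" by (rule order_trans[OF iH(2)]) (simp add: power_increasing)
    then have hB: "h \<le> B" "h < 2 ^ w" "l \<le> B" "l + 1 < 2 ^ w" "h - 1 \<le> B"
      using H less by linarith+
    have rM: "r1 rM = k" using i(1) r(4) by (auto simp: same_def)
    let ?l' = "if l mod 2 = 1 then l + 1 else l" and ?h' = "if h mod 2 = 1 then h - 1 else h"
    let ?t1 = "if l mod 2 = 1 then (m1 aTAG)(l := k) else m1 aTAG"
    let ?t2 = "if h mod 2 = 1 then ?t1(h - 1 := k) else ?t1"
    have stp: "paint_inv H (2 ^ H + lo) (2 ^ H + hi) k (m aTAG) ?t2 (Suc i) (?l' div 2) (?h' div 2)"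
      using paint_inv_step[OF i(4)[folded l_def h_def] less] .
    have fin: "I r' m' (Suc t1)" if "same {rLO, rHI} r1 r'" "r' rLO = ?l' div 2" "r' rHI = ?h' div 2"
      "same {aTAG} m1 m'" "m' aTAG = ?t2" for r' m'
      unfolding I_def using stp i(1-3) that
      by (intro conjI exI[of _ "Suc i"]) (auto simp: same_def)
    have "wp w B paint_body I r1 m1 (Suc t1)"
      unfolding paint_body_def using hB w wo less
      by (cases "l mod 2 = 1"; cases "h mod 2 = 1") (auto simp: l_def[symmetric] h_def[symmetric] rM intro!: fin)
    then show ?case using i(3) iH by simp
  next
    case (4 r1 m1 t1)
    then obtain i where i: "same {rLO, rHI} r r1" "same {aTAG} m m1" "t1 = t + i"
      "paint_inv H (2 ^ H + lo) (2 ^ H + hi) k (m aTAG) (m1 aTAG) i (r1 rLO) (r1 rHI)"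
      unfolding I_def by blast
    have nl: "\<not> r1 rLO < r1 rHI" using 4(2) by simp
    note inv = i(4)[unfolded paint_inv_def]
    show ?case
    proof (rule post[OF i(1,2)])
      show "m1 aTAG x = m aTAG x \<or> m1 aTAG x = k \<and> (\<forall>u j. u < 2 ^ H \<longrightarrow> (2 ^ H + u) div 2 ^ j = x \<longrightarrow> lo \<le> u \<and> u < hi)" for x
      proof (cases "m1 aTAG x = m aTAG x")
        case False
        then have *: "m1 aTAG x = k" "\<And>v j. 2 ^ H \<le> v \<Longrightarrow> v < 2 * 2 ^ H \<Longrightarrow> v div 2 ^ j = x \<Longrightarrow> 2 ^ H + lo \<le> v \<and> v < 2 ^ H + hi"
          using inv by blast+
        have "lo \<le> u \<and> u < hi" if "u < 2 ^ H" "(2 ^ H + u) div 2 ^ j = x" for u j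
          using *(2)[of "2 ^ H + u" j] that by simp
        then show ?thesis using *(1) by blast
      qed simp
      show "\<exists>j \<le> H. m1 aTAG ((2 ^ H + u) div 2 ^ j) = k" if "lo \<le> u" "u < hi" for u
      proof -
        have "2 ^ H + lo \<le> 2 ^ H + u" "2 ^ H + u < 2 ^ H + hi" using that by auto
        then show ?thesis using inv nl by (meson le_less_trans)
      qed
      show "t1 \<le> t + Suc H" using i(3) inv by simp
    qed
  qed
qed


section \<open>The LZ78 trie\<close>

text \<open>A linked list terminated by 0. This is unambiguous because siblings in the trie are
  factors with index at least 1.\<close>

fun chain :: "(nat \<Rightarrow> nat) \<Rightarrow> nat \<Rightarrow> nat list \<Rightarrow> bool" where
  "chain sb x [] \<longleftrightarrow> x = 0"
| "chain sb x (y # ys) \<longleftrightarrow> x = y \<and> y \<noteq> 0 \<and> chain sb (sb y) ys"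

lemma chain_upd: "z \<notin> set xs \<Longrightarrow> chain (sb(z := y)) x xs = chain sb x xs"
  by (induction xs arbitrary: x) auto

definition add_prog :: com where
  "add_prog =
     rM ::= Reg rM [+] Num 1 ;; Write 2 (Reg rM) (Reg rA) ;; Write 3 (Reg rM) (Reg rCH) ;;
     Write aSB (Reg rM) (Read aFC (Reg rA)) ;; Write aFC (Reg rA) (Reg rM)"

text \<open>Conjunctions evaluate both sides, so cell 0 of array 3 is read at the end of a list; the
  address is legal and the first conjunct already decides.\<close>

definition search_prog :: com where
  "search_prog =
     rX ::= Read aFC (Reg rCUR) ;;
     While (Conj (Neg (Equal (Reg rX) (Num 0))) (Neg (Equal (Read 3 (Reg rX)) (Reg rCH))))
       (rX ::= Read aSB (Reg rX))"

text \<open>The test against the last index precedes the increment, so the index never passes the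
  end of the text and cannot overflow.\<close>

definition tail_body :: com where
  "tail_body =
     rCH ::= Read aTX (Reg rQ) ;; search_prog ;;
     If (Equal (Reg rX) (Num 0)) (rA ::= Reg rCUR ;; add_prog ;; rCUR ::= Num 0) (rCUR ::= Reg rX) ;;
     If (Equal (Reg rQ) (Reg rQE)) (rGO ::= Num 0) (rQ ::= Reg rQ [+] Num 1)"

definition tail_prog :: com where
  "tail_prog =
     rCUR ::= Num 0 ;; rQ ::= Num 0 ;; rGO ::= Num 1 ;;
     While (Neg (Equal (Reg rGO) (Num 0))) tail_body"

locale trie_ctx = lz78_ctx +
  fixes w B b :: nat
  assumes w_gt: "0 < w" and L_word: "length L < 2 ^ w" and L_B: "length L \<le> B" and S_b: "set S \<subseteq> {..<b}"
begin

text \<open>The output arrays 2 and 3 double as parent pointers and edge labels. The final clause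
  lets a new node start with an empty list of children without initialization.\<close>

definition trie :: "memory \<Rightarrow> nat \<Rightarrow> bool" where
  "trie m mm \<longleftrightarrow> mm \<le> length L \<and> (\<forall>k. 1 \<le> k \<and> k \<le> mm \<longrightarrow> m 2 k < k \<and> F k = F (m 2 k) @ [m 3 k]) \<and>
     (\<forall>k \<le> mm. \<exists>xs. chain (m aSB) (m aFC k) xs \<and> set xs = {j. 1 \<le> j \<and> j \<le> mm \<and> m 2 j = k} \<and> distinct xs) \<and>
     (\<forall>k > mm. m aFC k = 0)"

lemma trie_0: "(\<And>k. m aFC k = 0) \<Longrightarrow> trie m 0"
  unfolding trie_def by (auto intro!: exI[of _ "[]"])

lemma trie_add:
  assumes T: "trie m mm" and k: "k \<le> mm" and lt: "mm < length L" and F: "L ! mm = F k @ [a]"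
    and m': "m' 2 = (m 2)(Suc mm := k)" "m' 3 = (m 3)(Suc mm := a)"
      "m' aSB = (m aSB)(Suc mm := m aFC k)" "m' aFC = (m aFC)(k := Suc mm)"
  shows "trie m' (Suc mm)"
  unfolding trie_def
proof (intro conjI allI impI)
  show "Suc mm \<le> length L" using lt by simp
  fix j
  { assume j: "1 \<le> j \<and> j \<le> Suc mm"
    show "m' 2 j < j" "F j = F (m' 2 j) @ [m' 3 j]"
      using T k F j by (auto simp: trie_def m' F_Suc le_Suc_eq) }
  { assume j: "Suc mm < j"
    then show "m' aFC j = 0" using T k by (auto simp: m' trie_def) }
  assume j: "j \<le> Suc mm"
  consider "j = Suc mm" | "j = k" | "j \<le> mm" "j \<noteq> k" using j by linarith
  then show "\<exists>xs. chain (m' aSB) (m' aFC j) xs \<and> set xs = {i. 1 \<le> i \<and> i \<le> Suc mm \<and> m' 2 i = j} \<and> distinct xs"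
  proof cases
    case 1
    have "m aFC (Suc mm) = 0" using T by (simp add: trie_def)
    moreover have "{i. 1 \<le> i \<and> i \<le> Suc mm \<and> m' 2 i = j} = {}"
      using T k 1 by (force simp: trie_def m' le_Suc_eq)
    ultimately show ?thesis using 1 k by (intro exI[of _ "[]"]) (simp add: m')
  next
    case 2
    obtain xs where xs: "chain (m aSB) (m aFC k) xs" "set xs = {i. 1 \<le> i \<and> i \<le> mm \<and> m 2 i = k}" "distinct xs"
      using T k by (auto simp: trie_def)
    then have "Suc mm \<notin> set xs" by simp
    moreover have "{i. 1 \<le> i \<and> i \<le> Suc mm \<and> m' 2 i = j} = insert (Suc mm) {i. 1 \<le> i \<and> i \<le> mm \<and> m 2 i = k}"
      unfolding m' using 2 k by (auto simp: le_Suc_eq)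
    ultimately show ?thesis
      using xs 2 by (intro exI[of _ "Suc mm # xs"]) (simp add: m' chain_upd)
  next
    case 3
    obtain xs where xs: "chain (m aSB) (m aFC j) xs" "set xs = {i. 1 \<le> i \<and> i \<le> mm \<and> m 2 i = j}" "distinct xs"
      using T 3 by (auto simp: trie_def)
    then have "Suc mm \<notin> set xs" by simp
    moreover have "{i. 1 \<le> i \<and> i \<le> Suc mm \<and> m' 2 i = j} = {i. 1 \<le> i \<and> i \<le> mm \<and> m 2 i = j}"
      unfolding m' using 3 by (auto simp: le_Suc_eq)
    ultimately show ?thesis
      using xs 3 by (intro exI[of _ xs]) (simp add: m' chain_upd)
  qed
qed

lemma set_F: "k \<le> length L \<Longrightarrow> set (F k) \<subseteq> set S"
proof (cases k)
  case (Suc k')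
  assume "k \<le> length L"
  then have "L ! k' \<in> set L" using Suc by simp
  then show ?thesis using Suc concat_L[symmetric] by (auto simp: F_Suc)
qed simp

text \<open>Siblings have the same parent and are distinct factors, so their last characters differ
  and are below \<open>b\<close>; a list of children has at most \<open>b\<close> entries.\<close>

lemma search_prog_wp:
  assumes T: "trie m mm" and r: "r rCUR = k" "k \<le> mm" "r rCH = a"
    and post: "\<And>r' t'. same {rX} r r' \<Longrightarrow> (r' rX = 0 \<and> (\<forall>j \<le> mm. F j \<noteq> F k @ [a]) \<or>
      1 \<le> r' rX \<and> r' rX \<le> mm \<and> F (r' rX) = F k @ [a]) \<Longrightarrow> t' \<le> t + b \<Longrightarrow> Q r' m t'"
  shows "wp w B search_prog Q r m t"
proof -
  have mmL: "mm \<le> length L" "mm \<le> B" using T L_B by (auto simp: trie_def)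
  obtain xs where xs: "chain (m aSB) (m aFC k) xs" "set xs = {j. 1 \<le> j \<and> j \<le> mm \<and> m 2 j = k}" "distinct xs"
    using T r by (auto simp: trie_def)
  have Fx: "F x = F k @ [m 3 x]" if "x \<in> set xs" for x
    using T that xs(2) by (auto simp: trie_def)
  have lenxs: "length xs \<le> b"
  proof -
    have "inj_on (m 3) (set xs)"
    proof (rule inj_onI)
      fix x y assume "x \<in> set xs" "y \<in> set xs" "m 3 x = m 3 y"
      then have "F x = F y" using Fx by simp
      then show "x = y" using F_inj[of x y] \<open>x \<in> set xs\<close> \<open>y \<in> set xs\<close> xs(2) mmL by auto
    qed
    moreover have "m 3 ` set xs \<subseteq> {..<b}"
    proof
      fix z assume "z \<in> m 3 ` set xs"
      then obtain x where x: "x \<in> set xs" "z = m 3 x" by auto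
      then have "z \<in> set (F x)" using Fx by simp
      then show "z \<in> {..<b}" using set_F[of x] x xs(2) mmL S_b by auto
    qed
    ultimately have "card (set xs) \<le> card {..<b}"
      by (intro card_inj_on_le) auto
    then show ?thesis using xs(3) by (simp add: distinct_card)
  qed
  define I where "I r' m' t' \<longleftrightarrow> same {rX} r r' \<and> m' = m \<and> (\<exists>zs ys. xs = zs @ ys \<and> chain (m aSB) (r' rX) ys \<and>
    (\<forall>z \<in> set zs. m 3 z \<noteq> a) \<and> t' + length ys = t + length xs)" for r' m' t'
  have wo: "(0::nat) < 2 ^ w" by simp
  have "wp w B (While (Conj (Neg (Equal (Reg rX) (Num 0))) (Neg (Equal (Read 3 (Reg rX)) (Reg rCH))))
       (rX ::= Read aSB (Reg rX))) Q (r(rX := m aFC k)) m t"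
  proof (rule wp_While[where I = I and T = "t + length xs"], goal_cases)
    case 1
    show ?case unfolding I_def using xs(1) by (intro conjI exI[of _ "[]"] exI[of _ xs]) auto
  next
    case (2 r1 m1 t1)
    then obtain zs ys where "m1 = m" "xs = zs @ ys" "chain (m aSB) (r1 rX) ys" unfolding I_def by blast
    then have "r1 rX \<in> set xs \<or> r1 rX = 0" by (cases ys) auto
    then have "r1 rX \<le> B" using xs(2) mmL by auto
    then show ?case by simp
  next
    case (3 r1 m1 t1)
    then obtain zs ys where i: "same {rX} r r1" "m1 = m" "xs = zs @ ys" "chain (m aSB) (r1 rX) ys"
      "\<forall>z \<in> set zs. m 3 z \<noteq> a" "t1 + length ys = t + length xs" unfolding I_def by blast
    have rc: "r1 rCH = a" using i(1) r by (auto simp: same_def)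
    obtain y ys' where ys: "ys = y # ys'" "r1 rX = y" using i(4) 3(2) by (cases ys) auto
    have "y \<in> set xs" using i(3) ys by simp
    then have yB: "y \<le> B" using xs(2) mmL by auto
    have "m 3 y \<noteq> a" using 3(2) i(2) ys rc by simp
    then have "I (r1(rX := m aSB y)) m (Suc t1)"
      unfolding I_def using i ys by (intro conjI exI[of _ "zs @ [y]"] exI[of _ ys']) auto
    then show ?case using i ys yB by simp
  next
    case (4 r1 m1 t1)
    then obtain zs ys where i: "same {rX} r r1" "m1 = m" "xs = zs @ ys" "chain (m aSB) (r1 rX) ys"
      "\<forall>z \<in> set zs. m 3 z \<noteq> a" "t1 + length ys = t + length xs" unfolding I_def by blast
    have rc: "r1 rCH = a" using i(1) r by (auto simp: same_def)
    have res: "r1 rX = 0 \<and> (\<forall>j \<le> mm. F j \<noteq> F k @ [a]) \<or> 1 \<le> r1 rX \<and> r1 rX \<le> mm \<and> F (r1 rX) = F k @ [a]"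
    proof (cases ys)
      case Nil
      have "F j \<noteq> F k @ [a]" if "j \<le> mm" for j
      proof
        assume Fj: "F j = F k @ [a]"
        then have "j \<noteq> 0" by (metis F_0 snoc_eq_iff_butlast)
        then have j: "1 \<le> j" by simp
        then have "F j = F (m 2 j) @ [m 3 j]" "m 2 j < j" using T that by (auto simp: trie_def)
        then have "F (m 2 j) = F k" "m 3 j = a" using Fj by auto
        then have "m 2 j = k" using F_inj[of "m 2 j" k] \<open>m 2 j < j\<close> that mmL r(2) by auto
        then have "j \<in> set xs" using xs(2) j that by auto
        then show False using i(3,5) Nil \<open>m 3 j = a\<close> by auto
      qed
      then show ?thesis using i(4) Nil by simp
    next
      case (Cons y ys')
      then have y: "r1 rX = y" "y \<noteq> 0" "y \<in> set xs" using i by auto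
      then have "m 3 y = a" using 4(2) i(2) rc by simp
      then show ?thesis using Fx[OF y(3)] y xs(2) by auto
    qed
    show ?case
      unfolding i(2) using res i(1,6) lenxs by (intro post) auto
  qed
  then show ?thesis
    unfolding search_prog_def using r mmL by simp
qed

lemma tail_step:
  assumes pre: "concat (take mm L) @ F k = take q S" and q: "q < length S" and k: "k \<le> mm" and mm: "mm \<le> length L"
    and new: "\<And>j. j \<le> mm \<Longrightarrow> F j \<noteq> F k @ [S ! q]"
  shows "mm < length L" "L ! mm = F k @ [S ! q]" "concat (take (Suc mm) L) = take (Suc q) S"
proof -
  have tk: "concat (take mm L) @ F k @ [S ! q] = take (Suc q) S"
    using pre q by (simp add: take_Suc_conv_app_nth)
  have "length (concat (take mm L)) < length S"
    using arg_cong[OF tk, of length] q by simp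
  then show lt: "mm < length L" by (rule L_not_done)
  have "concat (take mm L) @ (F k @ [S ! q]) @ drop (Suc q) S = concat (take mm L) @ concat (drop mm L)"
    using tk concat_take_drop[of mm] append_take_drop_id[of "Suc q" S] by (metis append.assoc)
  then have "concat (drop mm L) = (F k @ [S ! q]) @ drop (Suc q) S" by simp
  then show Lm: "L ! mm = F k @ [S ! q]"
    using lt k new by (intro next_factor) auto
  show "concat (take (Suc mm) L) = take (Suc q) S"
    using tk Lm lt by (simp add: take_Suc_conv_app_nth)
qed

text \<open>A known factor completed by the last character would contain the terminal symbol, yet
  all known factors are parts of the text before it. Hence the last character always closes a new
  factor.\<close>

lemma tail_end:
  assumes pre: "concat (take mm L) @ F k = take q S" and q: "Suc q = length S" and j: "j \<le> mm" "mm \<le> length L" "1 \<le> j"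
    and F: "F j = F k @ [S ! q]"
  shows False
proof -
  have "S ! q = dollar" using q S_last S_ne by (metis diff_Suc_1 last_conv_nth)
  then have "dollar \<in> set (F j)" using F by simp
  moreover have "F j \<in> set (take mm L)" using F_in_set_take j by simp
  ultimately have "dollar \<in> set (take q S)" using pre by (metis UnCI UN_I set_append set_concat)
  moreover have "take q S = butlast S" using q by (simp add: butlast_conv_take flip: q)
  ultimately show False using S_butlast by simp
qed

lemma take_all_L: "concat (take mm L) = S \<Longrightarrow> mm \<le> length L \<Longrightarrow> mm = length L"
proof (rule ccontr)
  assume a: "concat (take mm L) = S" "mm \<le> length L" "mm \<noteq> length L"
  then have "concat (drop mm L) = []" using concat_take_drop[of mm] by simp
  moreover have "L ! mm \<in> set (drop mm L)" using a by (simp add: Cons_nth_drop_Suc[symmetric])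
  moreover have "L ! mm \<noteq> []" using a(2,3) Nil_notin_L by (metis le_neq_implies_less nth_mem)
  ultimately show False by auto
qed

text \<open>Completed factors followed by the string of the current trie node always spell the text
  consumed so far. The trie may already contain the factors of the first \<open>p0\<close>
  characters.\<close>

lemma tail_prog_wp:
  assumes T: "trie m mm0" and r: "r rM = mm0" "r rQE = QE" and p0: "p0 = length (concat (take mm0 L))"
    and QE: "p0 + QE + 1 = length S" "QE \<le> B" "QE < 2 ^ w" and tx: "\<And>q. q \<le> QE \<Longrightarrow> m aTX q = S ! (p0 + q)"
    and post: "\<And>r' m' t'. trie m' (length L) \<Longrightarrow> r' rM = length L \<Longrightarrow> t' \<le> t + Suc QE * Suc b \<Longrightarrow> Q r' m' t'"
  shows "wp w B tail_prog Q r m t"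
proof -
  have wo: "1 < (2::nat) ^ w" using w_gt one_less_power[of "2::nat" w] by simp
  define I where "I r' m' t' \<longleftrightarrow> same {aFC, aSB, 2, 3} m m' \<and> r' rQE = QE \<and>
    (r' rGO = 0 \<and> trie m' (length L) \<and> r' rM = length L \<and> t' \<le> t + Suc QE * Suc b \<or>
     r' rGO = 1 \<and> trie m' (r' rM) \<and> r' rCUR \<le> r' rM \<and> r' rQ \<le> QE \<and>
     concat (take (r' rM) L) @ F (r' rCUR) = take (p0 + r' rQ) S \<and> t' \<le> t + r' rQ * Suc b)" for r' m' t'
  have "wp w B (While (Neg (Equal (Reg rGO) (Num 0))) tail_body) Q (r(rCUR := 0, rQ := 0, rGO := 1)) m t"
  proof (rule wp_While[where I = I and T = "t + Suc QE * Suc b"], goal_cases)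
    case 1
    have "concat (take mm0 L) = take p0 S"
      using concat_take_drop[of mm0] p0 by (metis append_eq_conv_conj)
    then show ?case unfolding I_def using T r by simp
  next
    case (2 r1 m1 t1)
    then show ?case by simp
  next
    case (3 r1 m1 t1)
    define mm k q where "mm = r1 rM" and "k = r1 rCUR" and "q = r1 rQ"
    have i: "same {aFC, aSB, 2, 3} m m1" "r1 rQE = QE" "r1 rGO = 1" "trie m1 mm" "k \<le> mm" "q \<le> QE"
      "concat (take mm L) @ F k = take (p0 + q) S" "t1 \<le> t + q * Suc b"
      using 3 unfolding I_def by (auto simp: mm_def k_def q_def)
    have mmL: "mm \<le> length L" using i(4) by (simp add: trie_def)
    define a where "a = S ! (p0 + q)"
    have txq: "m1 aTX q = a" using i(1,6) tx[of q] by (simp add: same_def a_def)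
    have qB: "q \<le> B" "q < 2 ^ w" using i(6) QE by auto
    have qN: "p0 + q < length S" using i(6) QE by simp
    have tT: "q * Suc b \<le> QE * Suc b" using i(6) by (rule mult_le_mono1)
    have "wp w B search_prog (wp w B (If (Equal (Reg rX) (Num 0)) (rA ::= Reg rCUR ;; add_prog ;; rCUR ::= Num 0) (rCUR ::= Reg rX))
        (wp w B (If (Equal (Reg rQ) (Reg rQE)) (rGO ::= Num 0) (rQ ::= Reg rQ [+] Num 1)) I))
        (r1(rCH := a)) m1 (Suc t1)"
    proof (rule search_prog_wp[OF i(4), of _ k a], goal_cases)
      case (4 r2 t2)
      note P2 = this
      have r2: "r2 rM = mm" "r2 rCUR = k" "r2 rQ = q" "r2 rCH = a" "r2 rQE = QE" "r2 rGO = 1"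
        using P2(1) i by (auto simp: same_def mm_def k_def q_def)
      have t2: "t2 \<le> t + Suc q * Suc b" using P2(3) i(8) by simp
      have t2': "t2 \<le> t + Suc QE * Suc b" using t2 tT by simp
      show ?case
        using P2(2)
      proof (elim disjE conjE)
        assume new: "r2 rX = 0" "\<forall>j \<le> mm. F j \<noteq> F k @ [a]"
        note ts = tail_step[OF i(7) qN i(5) mmL, folded a_def]
        have ts': "mm < length L" "L ! mm = F k @ [a]" "concat (take (Suc mm) L) = take (Suc (p0 + q)) S"
          using ts new(2) by auto
        let ?m3 = "m1(2 := (m1 2)(Suc mm := k), 3 := (m1 3)(Suc mm := a), aSB := (m1 aSB)(Suc mm := m1 aFC k), aFC := (m1 aFC)(k := Suc mm))"
        have T3: "trie ?m3 (Suc mm)"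
          by (rule trie_add[OF i(4,5) ts'(1,2)]) auto
        have sm: "same {aFC, aSB, 2, 3} m ?m3" using i(1) by simp
        have bnd: "Suc mm < 2 ^ w" "Suc mm \<le> B" "k \<le> B" using ts'(1) L_word L_B i(5) by auto
        show ?case
        proof (cases "q = QE")
          case True
          have "concat (take (Suc mm) L) = S" using ts'(3) True QE(1) by simp
          then have "Suc mm = length L" using take_all_L[of "Suc mm"] ts'(1) by simp
          then have "I (r2(rA := k, rM := Suc mm, rCUR := 0, rGO := 0)) ?m3 t2"
            unfolding I_def using T3 sm r2 t2' by auto
          then show ?thesis
            using new r2 bnd wo True unfolding add_prog_def by (simp flip: Suc_eq_plus1)
        next
          case False
          then have "I (r2(rA := k, rM := Suc mm, rCUR := 0, rQ := Suc q)) ?m3 t2"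
            unfolding I_def using T3 sm r2 t2 ts'(3) i(6) by auto
          moreover have "Suc q < 2 ^ w" using False i(6) QE(3) by simp
          ultimately show ?thesis
            using new r2 bnd wo False unfolding add_prog_def by (simp flip: Suc_eq_plus1)
        qed
      next
        assume old: "1 \<le> r2 rX" "r2 rX \<le> mm" "F (r2 rX) = F k @ [a]"
        have ne: "q \<noteq> QE"
          using tail_end[OF i(7), of "r2 rX"] old mmL QE(1) by (auto simp: a_def)
        have "concat (take mm L) @ F (r2 rX) = take (p0 + Suc q) S"
          using old(3) i(7) qN by (simp add: take_Suc_conv_app_nth a_def)
        then have "I (r2(rCUR := r2 rX, rQ := Suc q)) m1 t2"
          unfolding I_def using i old r2 t2 ne by auto
        moreover have "Suc q < 2 ^ w" using ne i(6) QE(3) by simp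
        ultimately show ?case
          using old r2 wo ne by (simp flip: Suc_eq_plus1)
      qed
    qed (use i in \<open>auto simp: k_def\<close>)
    then show ?case
      unfolding tail_body_def using txq qB i(8) tT by (simp add: q_def[symmetric])
  next
    case (4 r1 m1 t1)
    then show ?case unfolding I_def by (auto intro: post)
  qed
  then show ?thesis
    unfolding tail_prog_def using wo by simp
qed

end


section \<open>Factorizing with windows\<close>

text \<open>The window starts s positions before the border. Character l therefore lies s - l before
  the end of the left child if l < s, and at offset l - s in the right child otherwise.\<close>

definition getch_prog :: com where
  "getch_prog =
     rV ::= Reg rIT [div] Reg rC ;; rS ::= Reg rIT [mod] Reg rC ;;
     If (Less (Reg rL) (Reg rS))
       (rY ::= Read aSU (Read 0 (Reg rV) [*] Reg rD [+] (Reg rS [-] Reg rL)))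
       (rY ::= Read aPR (Read 1 (Reg rV) [*] Reg rD [+] (Reg rL [-] Reg rS)))"

text \<open>The two variants find the first position whose character is at least, respectively
  greater than, the wanted one.\<close>

definition bs_cmp :: "bool \<Rightarrow> bexp" where
  "bs_cmp strict = (if strict then Less (Reg rY) (Reg rCH) else Neg (Less (Reg rCH) (Reg rY)))"

definition bs_body :: "bool \<Rightarrow> com" where
  "bs_body strict =
     rMID ::= (Reg rLO [+] Reg rHI) [div] Num 2 ;; rIT ::= Read aO2 (Reg rMID) ;; getch_prog ;;
     If (bs_cmp strict) (rLO ::= Reg rMID [+] Num 1) (rHI ::= Reg rMID)"

definition bs_prog :: "bool \<Rightarrow> com" where
  "bs_prog strict = While (Less (Reg rLO) (Reg rHI)) (bs_body strict)"

text \<open>Negation of \<open>covers\<close> with both sides lowered by one: E plus the length of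
  the right child is at most N - 1, whereas E + 1 plus that length could be 2^w.\<close>

definition walk_prog :: com where
  "walk_prog =
     While (Neg (Conj (Neg (Less (Read aEB (Reg rJ)) (Reg rP)))
         (Neg (Less (Read aEB (Reg rJ) [+] Read aLM (Read 1 (Read aBV (Reg rJ))) [+] Num 1) (Reg rP [+] Reg rC [-] Num 1)))))
       (rJ ::= Reg rJ [+] Num 1)"

text \<open>\<open>c_sq\<close> makes every factor shorter than a window. \<open>c_pow\<close> lets
  the doubling end exactly at c and the segment tree, grown from c leaves, have a power of two of
  them.\<close>

locale main_ctx = sort_ctx n lc rc vl b w B c + trie_ctx \<Sigma> S L dollar w B b
  for n lc rc vl b w B c \<Sigma> S L dollar +
  fixes e :: nat
  assumes S_vl: "S = vl n" and c_sq: "2 * length S < c * (c + 1)" and c_pow: "c = 2 ^ e"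
    and K_B: "length (bds (c - 1) n 0) < B" "length (bds (c - 1) n 0) + 1 < 2 ^ w"
begin

lemma var_n: "var n"
  using n_pos by (simp add: var_def)

lemma F_less_c: "k \<le> length L \<Longrightarrow> length (F k) < c"
proof (rule ccontr)
  assume k: "k \<le> length L" "\<not> length (F k) < c"
  then have "c * (c + 1) \<le> length (F k) * (length (F k) + 1)" by (intro mult_le_mono) auto
  with F_length_bound[OF k(1)] c_sq show False by simp
qed

text \<open>After sorting, the end tables are refilled with windows of length one. They then give
  access to the 2 c characters at either end of every variable.\<close>

definition chars_ok :: "memory \<Rightarrow> bool" where
  "chars_ok m \<longleftrightarrow> (\<forall>v. var v \<longrightarrow> pr_ok 1 (2 * c) hd m v (2 * c) \<and> su_ok 1 (2 * c) hd m v (2 * c))"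

lemma hd_sub: "d < len i \<Longrightarrow> hd (sub i d 1) = vl i ! d"
  by (simp add: sub_def hd_take hd_drop_conv_nth)

lemma win_nth:
  assumes x: "x \<in> items c" and l: "l < c"
  defines "v \<equiv> x div c" and "s \<equiv> x mod c"
  shows "win c x ! l = (if l < s then vl (lc v) ! (len (lc v) - (s - l)) else vl (rc v) ! (l - s))"
proof -
  have cr: "crossing v s c" using itemsD[OF x] by (simp add: v_def s_def)
  then have v: "var v" "lc v \<noteq> 0" "s \<le> len (lc v)" "c \<le> s + len (rc v)" by (auto simp: crossing_def)
  note nd = nodeD[OF v(1,2)]
  have "win c x ! l = vl v ! (len (lc v) - s + l)"
    using l crossing_le[OF cr] by (simp add: win_def v_def[symmetric] s_def[symmetric] cwin_def sub_def)
  also have "\<dots> = (if l < s then vl (lc v) ! (len (lc v) - (s - l)) else vl (rc v) ! (l - s))"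
    using v(3) by (auto simp: nd(1) nth_append intro!: arg_cong[where f = "(!) _"])
  finally show ?thesis .
qed

lemma getch_wp:
  assumes x: "x \<in> items c" and l: "l < c" and base: "base_ok m" and ch: "chars_ok m"
    and r: "r rIT = x" "r rL = l" "r rC = c" "r rD = 2 * c"
    and post: "\<And>r'. same {rV, rS, rY} r r' \<Longrightarrow> r' rY = win c x ! l \<Longrightarrow> Q r' m t"
  shows "wp w B getch_prog Q r m t"
proof -
  define v s where "v = x div c" and "s = x mod c"
  have cr: "crossing v s c" using itemsD[OF x] by (simp add: v_def s_def)
  then have v: "var v" "lc v \<noteq> 0" "1 \<le> s" "s < c" "s \<le> len (lc v)" "c \<le> s + len (rc v)" by (auto simp: crossing_def)
  note nd = nodeD[OF v(1,2)]
  have vn: "v \<le> B" "lc v \<le> n" "rc v \<le> n" using v(1) n_B nd by (auto simp: var_def)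
  have mm: "m 0 = lc" "m 1 = rc" using base by (auto simp: base_ok_def)
  have sw: "s < 2 ^ w" "l < 2 ^ w" using small_word(1)[of s] small_word(1)[of l] v(4) l by auto
  have i1: "lc v * (2 * c) + (s - l) < 2 ^ w" "lc v * (2 * c) + (s - l) \<le> B" "lc v * (2 * c) < 2 ^ w"
    using idx_bound[OF vn(2), of "s - l" "2 * c"] v(4) by auto
  have i2: "rc v * (2 * c) + (l - s) < 2 ^ w" "rc v * (2 * c) + (l - s) \<le> B" "rc v * (2 * c) < 2 ^ w"
    using idx_bound[OF vn(3), of "l - s" "2 * c"] l by auto
  note wn = win_nth[OF x l, folded v_def s_def]
  show ?thesis
  proof (cases "l < s")
    case True
    have "su_ok 1 (2 * c) hd m (lc v) (2 * c)" using ch nd(7) by (auto simp: chars_ok_def)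
    moreover have "s - l < 2 * c" "1 \<le> s - l" "s - l \<le> len (lc v)" using True v by auto
    ultimately have "m aSU (lc v * (2 * c) + (s - l)) = hd (sub (lc v) (len (lc v) - (s - l)) 1)"
      unfolding su_ok_def by blast
    also have "\<dots> = win c x ! l"
      using True wn \<open>1 \<le> s - l\<close> \<open>s - l \<le> len (lc v)\<close> by (subst hd_sub) auto
    finally have eq: "m aSU (lc v * (2 * c) + (s - l)) = win c x ! l" .
    have "Q (r(rV := v, rS := s, rY := m aSU (lc v * (2 * c) + (s - l)))) m t"
      by (rule post) (auto simp: eq)
    then show ?thesis
      unfolding getch_prog_def using True i1 vn(1) sw by (simp add: r mm v_def[symmetric] s_def[symmetric])
  next
    case False
    have "pr_ok 1 (2 * c) hd m (rc v) (2 * c)" using ch nd(8) by (auto simp: chars_ok_def)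
    moreover have "l - s < 2 * c" "l - s + 1 \<le> len (rc v)" using False v l by auto
    ultimately have "m aPR (rc v * (2 * c) + (l - s)) = hd (sub (rc v) (l - s) 1)"
      unfolding pr_ok_def by blast
    also have "\<dots> = win c x ! l"
      using False wn \<open>l - s + 1 \<le> len (rc v)\<close> by (subst hd_sub) auto
    finally have eq: "m aPR (rc v * (2 * c) + (l - s)) = win c x ! l" .
    have "Q (r(rV := v, rS := s, rY := m aPR (rc v * (2 * c) + (l - s)))) m t"
      by (rule post) (auto simp: eq)
    then show ?thesis
      unfolding getch_prog_def using False i2 vn(1) sw by (simp add: r mm v_def[symmetric] s_def[symmetric])
  qed
qed

text \<open>The predicate is downward closed on the interval by monotonicity, so there is one
  turning point. An interval shorter than 2^g is used up after g halvings.\<close>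

lemma bs_prog_wp:
  assumes l: "l < c" and base: "base_ok m" and ch: "chars_ok m"
    and r: "r rL = l" "r rC = c" "r rD = 2 * c" "r rCH = a" "r rLO = lo" "r rHI = hi"
    and hi: "lo \<le> hi" "hi \<le> V" "2 * V < 2 ^ w" "V \<le> B" and it: "\<And>u. u < V \<Longrightarrow> m aO2 u \<in> items c"
    and mono: "\<And>u u'. lo \<le> u \<Longrightarrow> u \<le> u' \<Longrightarrow> u' < hi \<Longrightarrow> win c (m aO2 u) ! l \<le> win c (m aO2 u') ! l"
    and g: "hi - lo < 2 ^ g"
    and post: "\<And>r' t'. same {rV, rS, rY, rIT, rMID, rLO, rHI} r r' \<Longrightarrow> lo \<le> r' rLO \<Longrightarrow> r' rLO \<le> hi \<Longrightarrow>
      (\<And>u. lo \<le> u \<Longrightarrow> u < r' rLO \<Longrightarrow> if strict then win c (m aO2 u) ! l < a else win c (m aO2 u) ! l \<le> a) \<Longrightarrow>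
      (\<And>u. r' rLO \<le> u \<Longrightarrow> u < hi \<Longrightarrow> \<not> (if strict then win c (m aO2 u) ! l < a else win c (m aO2 u) ! l \<le> a)) \<Longrightarrow>
      t' \<le> t + g \<Longrightarrow> Q r' m t'"
  shows "wp w B (bs_prog strict) Q r m t"
proof -
  define P where "P u \<longleftrightarrow> (if strict then win c (m aO2 u) ! l < a else win c (m aO2 u) ! l \<le> a)" for u
  have Pm: "P u" if "lo \<le> u" "u \<le> u'" "u' < hi" "P u'" for u u'
    using mono[OF that(1-3)] that(4) by (auto simp: P_def split: if_splits)
  define I where "I r' m' t' \<longleftrightarrow> same {rV, rS, rY, rIT, rMID, rLO, rHI} r r' \<and> m' = m \<and> lo \<le> r' rLO \<and> r' rLO \<le> r' rHI \<and>
    r' rHI \<le> hi \<and> (\<forall>u. lo \<le> u \<longrightarrow> u < r' rLO \<longrightarrow> P u) \<and> (\<forall>u. r' rHI \<le> u \<longrightarrow> u < hi \<longrightarrow> \<not> P u) \<and>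
    (\<exists>g'. r' rHI - r' rLO < 2 ^ g' \<and> t' + g' \<le> t + g)" for r' m' t'
  have two: "(2::nat) < 2 ^ w" using small_word(1)[of 2] by simp
  show ?thesis
    unfolding bs_prog_def
  proof (rule wp_While[where I = I and T = "t + g"], goal_cases)
    case 1
    show ?case unfolding I_def using r hi g by auto
  next
    case (2 r1 m1 t1)
    then show ?case by simp
  next
    case (3 r1 m1 t1)
    define x y where "x = r1 rLO" and "y = r1 rHI"
    obtain g' where i: "same {rV, rS, rY, rIT, rMID, rLO, rHI} r r1" "m1 = m" "lo \<le> x" "x \<le> y" "y \<le> hi"
      "\<forall>u. lo \<le> u \<longrightarrow> u < x \<longrightarrow> P u" "\<forall>u. y \<le> u \<longrightarrow> u < hi \<longrightarrow> \<not> P u" "y - x < 2 ^ g'" "t1 + g' \<le> t + g"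
      using 3(1) unfolding I_def x_def y_def by blast
    have xy: "x < y" using 3(2) by (simp add: x_def y_def)
    define z where "z = (x + y) div 2"
    have z: "x \<le> z" "z < y" "z < V" using xy i hi by (auto simp: z_def)
    obtain g2 where g2: "g' = Suc g2" using i(8) xy by (cases g') auto
    have gl: "y - (z + 1) < 2 ^ g2" "z - x < 2 ^ g2" using i(8) g2 xy by (auto simp: z_def)
    have r1: "r1 rL = l" "r1 rC = c" "r1 rD = 2 * c" "r1 rCH = a" using i(1) r by (auto simp: same_def)
    have xw: "x + y < 2 ^ w" "z \<le> B" "z + 1 < 2 ^ w" using i hi z xy by auto
    have "wp w B getch_prog (wp w B (If (bs_cmp strict) (rLO ::= Reg rMID [+] Num 1) (rHI ::= Reg rMID)) I)
       (r1(rMID := z, rIT := m aO2 z)) m (Suc t1)"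
    proof (rule getch_wp[OF it[OF z(3)] l base ch], goal_cases)
      case (5 r2)
      have r2: "r2 rMID = z" "r2 rCH = a" "r2 rLO = x" "r2 rHI = y" using 5(1) r1 by (auto simp: same_def x_def y_def)
      have s2: "same {rV, rS, rY, rIT, rMID, rLO, rHI} r r2" using 5(1) i(1) by (auto simp: same_def)
      have bv: "bval w (bs_cmp strict) r2 m \<longleftrightarrow> P z"
        using 5(2) r2(2) by (auto simp: bs_cmp_def P_def)
      have bsf: "bsafe w B (bs_cmp strict) r2 m" by (simp add: bs_cmp_def)
      have I1: "I (r2(rLO := z + 1)) m (Suc t1)" if Pz: "P z"
        unfolding I_def
      proof (intro conjI exI[of _ g2] allI impI)
        fix u assume "lo \<le> u" "u < (r2(rLO := z + 1)) rLO"
        then show "P u" using Pm[of u z] Pz z i(5) by simp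
      qed (use s2 i z r2 gl g2 in auto)
      have I2: "I (r2(rHI := z)) m (Suc t1)" if Pz: "\<not> P z"
        unfolding I_def
      proof (intro conjI exI[of _ g2] allI impI)
        fix u assume "(r2(rHI := z)) rHI \<le> u" "u < hi"
        then show "\<not> P u" using Pm[of z u] Pz z i(3) by auto
      qed (use s2 i z r2 gl g2 in auto)
      show ?case
        using bv bsf r2 xw two I1 I2 by simp
    qed (use r1 in auto)
    then show ?case
      unfolding bs_body_def using i(2,9) g2 xw two by (simp add: x_def[symmetric] y_def[symmetric] z_def[symmetric])
  next
    case (4 r1 m1 t1)
    obtain g' where i: "same {rV, rS, rY, rIT, rMID, rLO, rHI} r r1" "m1 = m" "lo \<le> r1 rLO" "r1 rLO \<le> r1 rHI" "r1 rHI \<le> hi"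
      "\<forall>u. lo \<le> u \<longrightarrow> u < r1 rLO \<longrightarrow> P u" "\<forall>u. r1 rHI \<le> u \<longrightarrow> u < hi \<longrightarrow> \<not> P u" "t1 + g' \<le> t + g"
      using 4(1) unfolding I_def by blast
    have eq: "r1 rHI = r1 rLO" using 4(2) i(4) by simp
    show ?case
      unfolding i(2)
    proof (rule post[OF i(1,3)])
      show "if strict then win c (m aO2 u) ! l < a else win c (m aO2 u) ! l \<le> a" if "lo \<le> u" "u < r1 rLO" for u
        using i(6) that unfolding P_def by blast
      show "\<not> (if strict then win c (m aO2 u) ! l < a else win c (m aO2 u) ! l \<le> a)" if "r1 rLO \<le> u" "u < hi" for u
        using i(7) that unfolding P_def eq by blast
    qed (use i eq in auto)
  qed
qed

abbreviation borders :: "(nat \<times> nat) list" where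
  "borders \<equiv> bds (c - 1) n 0"

definition borders_ok :: "memory \<Rightarrow> bool" where
  "borders_ok m \<longleftrightarrow> (\<forall>j < length borders. m aEB j = fst (borders ! j) \<and> m aBV j = snd (borders ! j))"

text \<open>A border that fails the test fails it for all later positions, so \<open>rJ\<close>
  never moves back. The equation for the ticks charges the walk to the advance of \<open>rJ\<close>
  and makes its total cost the number of borders.\<close>

lemma walk_prog_wp:
  assumes base: "base_ok m" and bo: "borders_ok m" and r: "r rP = p" "r rC = c" "r rJ = j"
    and p: "p + 2 * c \<le> length S" and no: "\<And>i. i < j \<Longrightarrow> i < length borders \<and> \<not> covers p c (borders ! i)"
    and post: "\<And>r' t' E v. same {rJ} r r' \<Longrightarrow> r' rJ < length borders \<Longrightarrow> j \<le> r' rJ \<Longrightarrow>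
      (\<And>i. i < r' rJ \<Longrightarrow> \<not> covers p c (borders ! i)) \<Longrightarrow> borders ! r' rJ = (E, v) \<Longrightarrow>
      p \<le> E \<Longrightarrow> E + 1 < length S \<Longrightarrow> crossing v (E + 1 - p) c \<Longrightarrow> cwin v (E + 1 - p) c = take c (drop p S) \<Longrightarrow>
      t' + j = t + r' rJ \<Longrightarrow> Q r' m t'"
  shows "wp w B walk_prog Q r m t"
proof -
  obtain ys E v zs where win: "borders = ys @ (E, v) # zs" "\<forall>y \<in> set ys. \<not> covers p c y"
    "covers p c (E, v)" "crossing v (E + 1 - p) c" "cwin v (E + 1 - p) c = sub n (p - 0) c"
    using bds_window[OF c_ge var_n, of 0 p] p S_vl by auto
  define k where "k = length ys"
  have kK: "k < length borders" "borders ! k = (E, v)" using win(1) by (auto simp: k_def)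
  have nok: "\<not> covers p c (borders ! i)" if "i < k" for i
    using win(1,2) that by (simp add: k_def nth_append)
  have jk: "j \<le> k"
  proof (rule ccontr)
    assume "\<not> j \<le> k"
    then show False using no[of k] kK win(3) by simp
  qed
  define b where "b = Neg (Conj (Neg (Less (Read aEB (Reg rJ)) (Reg rP)))
         (Neg (Less (Read aEB (Reg rJ) [+] Read aLM (Read 1 (Read aBV (Reg rJ))) [+] Num 1) (Reg rP [+] Reg rC [-] Num 1))))"
  have lenS: "length S = len n" by (simp add: S_vl)
  have test: "bsafe w B b r1 m \<and> (bval w b r1 m \<longleftrightarrow> \<not> covers p c (borders ! i))"
    if i: "i < length borders" and r1: "r1 rJ = i" "r1 rP = p" "r1 rC = c" for r1 i
  proof -
    obtain E' v' where b': "borders ! i = (E', v')" by (cases "borders ! i")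
    then have "(E', v') \<in> set borders" using i by (metis nth_mem)
    note bb = bds_bounds[OF var_n this]
    have eb: "m aEB i = E'" "m aBV i = v'" using bo i b' by (auto simp: borders_ok_def)
    have v': "var v'" "lc v' \<noteq> 0" using bb by auto
    note nd = nodeD[OF v']
    have mm: "m 1 = rc" "m aLM (rc v') = LM (rc v')" using base nd by (auto simp: base_ok_def)
    have "len (rc v') \<le> len n" "1 \<le> len (rc v')" using bb len_pos[OF nd(8)] by auto
    then have lm: "LM (rc v') + 1 = len (rc v')" using len_word by (auto simp: LM_def)
    have vB: "v' \<le> B" "rc v' \<le> B" using v' nd n_B by (auto simp: var_def)
    have iB: "i \<le> B" using i K_B by simp
    have Ew: "E' + LM (rc v') + 1 < 2 ^ w" "E' + LM (rc v') < 2 ^ w" using bb lm len_word by linarith+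
    have pw: "p + c < 2 ^ w" "1 \<le> p + c" using p lenS len_word c_ge by linarith+
    have "covers p c (borders ! i) \<longleftrightarrow> p \<le> E' \<and> p + c - 1 \<le> E' + LM (rc v') + 1"
      using lm c_ge by (auto simp: covers_def b')
    then show ?thesis
      unfolding b_def using Ew pw vB iB one_less_word by (auto simp: r1 eb mm not_less)
  qed
  define I where "I r' m' t' \<longleftrightarrow> same {rJ} r r' \<and> m' = m \<and> j \<le> r' rJ \<and> r' rJ \<le> k \<and> t' + j = t + r' rJ"
    for r' and m' :: memory and t'
  have "wp w B (While b (rJ ::= Reg rJ [+] Num 1)) Q r m t"
  proof (rule wp_While[where I = I and T = "t + k - j"], goal_cases)
    case 1
    show ?case unfolding I_def using r jk by simp
  next
    case (2 r1 m1 t1)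
    then show ?case using test[of "r1 rJ" r1] kK r by (auto simp: I_def same_def)
  next
    case (3 r1 m1 t1)
    then have i: "same {rJ} r r1" "m1 = m" "j \<le> r1 rJ" "r1 rJ \<le> k" "t1 + j = t + r1 rJ" by (auto simp: I_def)
    have "\<not> covers p c (borders ! r1 rJ)"
      using 3(2) i test[of "r1 rJ" r1] kK r by (auto simp: same_def)
    then have "r1 rJ < k" using i(4) kK win(3) by (cases "r1 rJ = k") auto
    moreover have "r1 rJ + 1 < 2 ^ w" using \<open>r1 rJ < k\<close> kK K_B by simp
    ultimately show ?case using i one_less_word by (auto simp: I_def)
  next
    case (4 r1 m1 t1)
    then have i: "same {rJ} r r1" "m1 = m" "j \<le> r1 rJ" "r1 rJ \<le> k" "t1 + j = t + r1 rJ" by (auto simp: I_def)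
    have "covers p c (borders ! r1 rJ)"
      using 4(2) i test[of "r1 rJ" r1] kK r by (auto simp: same_def)
    then have eq: "r1 rJ = k" using i(4) nok by (cases "r1 rJ < k") auto
    have "(E, v) \<in> set borders" using win(1) by simp
    note bb = bds_bounds[OF var_n this]
    have "1 \<le> len (rc v)" using bb len_pos[of "rc v"] nodeD[of v] by auto
    then have "E + 1 < length S" using bb lenS by simp
    moreover have "p \<le> E" using win(3) by (simp add: covers_def)
    ultimately show ?case
      unfolding i(2) using i kK nok win(4,5) by (intro post[of r1 E v]) (auto simp: eq sub_def S_vl)
  qed
  then show ?thesis unfolding walk_prog_def b_def .
qed

end


section \<open>Locating windows and maintaining the intervals of the factors\<close>

definition loc_prog :: com where
  "loc_prog =
     rV ::= Read aBV (Reg rJ) ;;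
     rIT ::= Reg rV [*] Reg rC [+] (Read aEB (Reg rJ) [+] Num 1 [-] Reg rP) ;;
     rX ::= Reg rRP [+] Read aCR (Reg rIT)"

text \<open>The windows starting with the extended factor form a subinterval of the interval of the
  old factor, delimited by a lower and an upper bound search for the next character.\<close>

definition int_prog :: com where
  "int_prog =
     rCH ::= Reg rY ;;
     rLO ::= Read aLO (Reg rA) ;; rHI ::= Read aHI (Reg rA) ;; bs_prog True ;; rE ::= Reg rLO ;;
     rLO ::= Read aLO (Reg rA) ;; rHI ::= Read aHI (Reg rA) ;; bs_prog False ;; rB ::= Reg rLO"

definition ins_prog :: com where
  "ins_prog =
     add_prog ;; Write aFL (Reg rM) (Reg rL [+] Num 1) ;; Write aLO (Reg rM) (Reg rE) ;; Write aHI (Reg rM) (Reg rB) ;;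
     rLO ::= Reg rRP [+] Reg rE ;; rHI ::= Reg rRP [+] Reg rB ;; paint_prog ;;
     rP ::= Reg rP [+] Reg rL [+] Num 1"

definition main_body :: com where
  "main_body = walk_prog ;; loc_prog ;; query_prog ;; rL ::= Read aFL (Reg rA) ;; getch_prog ;; int_prog ;; ins_prog"

text \<open>The guard says p + 2 c <= N. As a factor takes at most c characters, p + c <= N holds
  after each round; so the tail is never empty, and at the end it is shorter than 2 c, within reach
  of the suffix table of the start variable.\<close>

definition main_loop :: com where
  "main_loop = While (Neg (Less (Reg rNM [-] Reg rP) (Reg rC [+] Reg rC [-] Num 1))) main_body"

context main_ctx
begin

abbreviation swin :: "memory \<Rightarrow> nat \<Rightarrow> nat list" where
  "swin m u \<equiv> win c (m aO2 u)"

lemma length_win: "x \<in> items c \<Longrightarrow> length (win c x) = c" and set_win: "x \<in> items c \<Longrightarrow> set (win c x) \<subseteq> {..<b}"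
  using win_in_subs[of x c] subsD by auto

text \<open>As many entries are strictly smaller as the rank says, so this position begins the run
  of copies of W in the sorted array. The name of a window thus directly gives a leaf of the segment
  tree.\<close>

lemma rank_pos:
  assumes srt: "sorted_ok c r m" and W: "W \<in> subs c"
  shows "rank c W < r rVC" "swin m (rank c W) = W"
proof -
  define V where "V = r rVC"
  have bij: "bij_betw (m aO2) {..<V} (items c)"
    and mono: "\<And>a a'. a \<le> a' \<Longrightarrow> a' < V \<Longrightarrow> enc b (swin m a) \<le> enc b (swin m a')"
    using srt by (auto simp: sorted_ok_def V_def)
  have V: "V = card (items c)" using bij_betw_same_card[OF bij] by simp
  show lt: "rank c W < r rVC" using rank_less[OF c_ge W] V by (simp add: V_def)
  have it: "m aO2 u \<in> items c" if "u < V" for u using bij that by (auto simp: bij_betw_def)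
  let ?A = "{u. u < V \<and> enc b (swin m u) < enc b W}"
  have "bij_betw (m aO2) ?A {x \<in> items c. enc b (win c x) < enc b W}"
  proof (rule bij_betw_subset[OF bij])
    show "m aO2 ` ?A = {x \<in> items c. enc b (win c x) < enc b W}"
      using bij it unfolding bij_betw_def by (auto 0 3 simp: image_iff)
  qed auto
  then have rk: "rank c W = card ?A" using bij_betw_same_card by (fastforce simp: rank_def)
  obtain v s where v: "crossing v s c" "cwin v s c = W" using subs_crossing[OF c_ge W] by blast
  then have "v * c + s \<in> items c" "win c (v * c + s) = W" by (auto simp: items_def win_item)
  then obtain a0 where a0: "a0 < V" "swin m a0 = W"
    using bij unfolding bij_betw_def by (metis imageE lessThan_iff)
  \<comment> \<open>Otherwise sortedness would put all positions 0, ..., rank into the set, one more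
    than its size.\<close>
  have notA: "rank c W \<notin> ?A"
  proof
    assume "rank c W \<in> ?A"
    then have "{..rank c W} \<subseteq> ?A" using mono by (fastforce intro: le_less_trans)
    then have "card {..rank c W} \<le> card ?A" by (intro card_mono) auto
    then show False using rk by simp
  qed
  have le: "rank c W \<le> a0"
  proof -
    have "?A \<subseteq> {..<a0}"
    proof
      fix u assume u: "u \<in> ?A"
      show "u \<in> {..<a0}"
      proof (rule ccontr)
        assume "u \<notin> {..<a0}"
        then have "enc b W \<le> enc b (swin m u)" using mono[of a0 u] u a0 by simp
        then show False using u by simp
      qed
    qed
    then show ?thesis using rk card_mono[of "{..<a0}" ?A] by simp
  qed
  have "enc b (swin m (rank c W)) = enc b W"
    using mono[OF le a0(1)] a0(2) notA lt by (simp add: V_def)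
  moreover have "swin m (rank c W) \<in> subs c"
    using it lt win_in_subs by (simp add: V_def)
  ultimately show "swin m (rank c W) = W"
    using subsD[OF W] subsD[of "swin m (rank c W)" c] by (intro enc_inj[of _ _ b]) auto
qed

definition static :: "nat \<Rightarrow> nat \<Rightarrow> regfile \<Rightarrow> memory \<Rightarrow> bool" where
  "static V h r m \<longleftrightarrow> r rC = c \<and> r rD = 2 * c \<and> r rVC = V \<and> r rRP = 2 ^ h \<and> r rNM = length S - 1 \<and> r 0 = n \<and>
     base_ok m \<and> chars_ok m \<and> cr_ok c (rank c) m \<and> sorted_ok c r m \<and> borders_ok m"

definition mregs :: "nat set" where
  "mregs = {rJ, rV, rIT, rX, rA, rL, rS, rY, rCH, rLO, rHI, rMID, rE, rB, rM, rP}"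

definition marrs :: "nat set" where
  "marrs = {aTAG, 2, 3, aSB, aFC, aFL, aLO, aHI}"

lemma static_same: "static V h r m \<Longrightarrow> same mregs r r' \<Longrightarrow> same marrs m m' \<Longrightarrow> static V h r' m'"
proof -
  assume st: "static V h r m" and sr: "same mregs r r'" and sm: "same marrs m m'"
  have eqr: "r' rC = r rC" "r' rD = r rD" "r' rVC = r rVC" "r' rRP = r rRP" "r' rNM = r rNM" "r' 0 = r 0"
    using sr by (simp_all add: same_def mregs_def)
  have eqm: "m' 0 = m 0" "m' 1 = m 1" "m' aLM = m aLM" "m' aPR = m aPR" "m' aSU = m aSU" "m' aCR = m aCR"
    "m' aO2 = m aO2" "m' aEB = m aEB" "m' aBV = m aBV"
    using sm by (simp_all add: same_def marrs_def)
  show ?thesis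
    using st unfolding static_def base_ok_def chars_ok_def cr_ok_def sorted_ok_def borders_ok_def pr_ok_def su_ok_def
      eqr eqm .
qed

definition ints :: "nat \<Rightarrow> memory \<Rightarrow> nat \<Rightarrow> bool" where
  "ints V m mm \<longleftrightarrow> (\<forall>k \<le> mm. m aLO k \<le> m aHI k \<and> m aHI k \<le> V \<and> m aFL k = length (F k) \<and>
     (\<forall>u < V. m aLO k \<le> u \<and> u < m aHI k \<longleftrightarrow> prefix (F k) (swin m u)))"

definition tags :: "nat \<Rightarrow> memory \<Rightarrow> nat \<Rightarrow> bool" where
  "tags h m mm \<longleftrightarrow> (\<forall>u < 2 ^ h.
     (\<forall>i \<le> h. let k = m aTAG ((2 ^ h + u) div 2 ^ i) in k = 0 \<or> k \<le> mm \<and> m aLO k \<le> u \<and> u < m aHI k) \<and>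
     (\<forall>k. 1 \<le> k \<longrightarrow> k \<le> mm \<longrightarrow> m aLO k \<le> u \<longrightarrow> u < m aHI k \<longrightarrow> (\<exists>i \<le> h. k \<le> m aTAG ((2 ^ h + u) div 2 ^ i))))"

lemma intsD:
  assumes "ints V m mm" "k \<le> mm"
  shows "m aLO k \<le> m aHI k" "m aHI k \<le> V" "m aFL k = length (F k)"
    "u < V \<Longrightarrow> prefix (F k) (swin m u) \<longleftrightarrow> m aLO k \<le> u \<and> u < m aHI k"
  using assms unfolding ints_def by auto

lemma tagsD:
  assumes "tags h m mm" "u < 2 ^ h"
  shows "i \<le> h \<Longrightarrow> x = m aTAG ((2 ^ h + u) div 2 ^ i) \<Longrightarrow> x = 0 \<or> x \<le> mm \<and> m aLO x \<le> u \<and> u < m aHI x"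
    "1 \<le> k \<Longrightarrow> k \<le> mm \<Longrightarrow> m aLO k \<le> u \<Longrightarrow> u < m aHI k \<Longrightarrow> \<exists>i \<le> h. k \<le> m aTAG ((2 ^ h + u) div 2 ^ i)"
  using assms unfolding tags_def Let_def by simp_all

definition walked :: "nat \<Rightarrow> nat \<Rightarrow> bool" where
  "walked p j \<longleftrightarrow> (\<forall>i < j. i < length borders \<and> \<not> covers p c (borders ! i))"

definition dyn :: "nat \<Rightarrow> nat \<Rightarrow> regfile \<Rightarrow> memory \<Rightarrow> bool" where
  "dyn V h r m \<longleftrightarrow> trie m (r rM) \<and> r rP = length (concat (take (r rM) L)) \<and> walked (r rP) (r rJ) \<and>
     ints V m (r rM) \<and> tags h m (r rM)"

lemma query_result:
  assumes i: "ints V m mm" and tg: "tags h m mm" and u: "u < V" "V \<le> 2 ^ h"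
    and ge: "\<And>i. i \<le> h \<Longrightarrow> m aTAG ((2 ^ h + u) div 2 ^ i) \<le> k \<or> (2 ^ h + u) div 2 ^ i = 0"
    and eq: "k = 0 \<or> (\<exists>i \<le> h. k = m aTAG ((2 ^ h + u) div 2 ^ i))"
  shows "k \<le> mm" "prefix (F k) (swin m u)" "\<And>k'. k' \<le> mm \<Longrightarrow> prefix (F k') (swin m u) \<Longrightarrow> k' \<le> k"
proof -
  have uh: "u < 2 ^ h" using u by simp
  have "k = 0 \<or> k \<le> mm \<and> m aLO k \<le> u \<and> u < m aHI k"
    using tagsD(1)[OF tg uh] eq by metis
  then show km: "k \<le> mm" and "prefix (F k) (swin m u)"
    using intsD(4)[OF i _ u(1), of k] by auto
  fix k' assume k': "k' \<le> mm" "prefix (F k') (swin m u)"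
  show "k' \<le> k"
  proof (cases "k' = 0")
    case False
    then have "1 \<le> k'" "m aLO k' \<le> u" "u < m aHI k'" using intsD(4)[OF i k'(1) u(1)] k'(2) by auto
    then obtain j where j: "j \<le> h" "k' \<le> m aTAG ((2 ^ h + u) div 2 ^ j)"
      using tagsD(2)[OF tg uh _ k'(1)] by blast
    have "(2::nat) ^ j \<le> 2 ^ h + u" using power_increasing[OF j(1), of "2::nat"] by linarith
    then have "(2 ^ h + u) div 2 ^ j \<noteq> 0" by (simp add: div_eq_0_iff)
    then show ?thesis using ge[OF j(1)] j(2) by simp
  qed simp
qed

text \<open>If \<open>F k\<close> with the next character were already a factor, it would be a
  longer prefix of the window and so have an index above k, against the maximality of k.\<close>

lemma new_factor:
  assumes W: "W = take c (drop p S)" and p: "p = length (concat (take mm L))" "p + c \<le> length S" and mm: "mm \<le> length L"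
    and k: "k \<le> mm" "prefix (F k) W" "\<And>k'. k' \<le> mm \<Longrightarrow> prefix (F k') W \<Longrightarrow> k' \<le> k"
  shows "mm < length L" "L ! mm = F k @ [W ! length (F k)]" "length (F k) < c"
    "length (concat (take (Suc mm) L)) = p + length (F k) + 1"
proof -
  show lt: "mm < length L"
    by (rule L_not_done) (use p c_ge in auto)
  show lk: "length (F k) < c" using F_less_c k(1) mm by simp
  have lW: "length W = c" using W p by simp
  have pre: "prefix (F k @ [W ! length (F k)]) W"
  proof -
    have "F k = take (length (F k)) W" using k(2) by (metis append_eq_conv_conj prefix_def)
    then have "F k @ [W ! length (F k)] = take (Suc (length (F k))) W"
      using lk lW by (simp add: take_Suc_conv_app_nth)
    then show ?thesis using take_is_prefix by metis
  qed
  have "drop p S = concat (drop mm L)" unfolding p(1) by (rule drop_S)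
  then have "prefix W (concat (drop mm L))" unfolding W using take_is_prefix by metis
  then show Lm: "L ! mm = F k @ [W ! length (F k)]"
  proof (intro next_factor[OF lt k(1)])
    show "prefix (F k @ [W ! length (F k)]) (concat (drop mm L))" if "prefix W (concat (drop mm L))"
      using pre that by (rule prefix_order.trans)
    fix j assume j: "j \<le> mm"
    show "F j \<noteq> F k @ [W ! length (F k)]"
    proof
      assume eq: "F j = F k @ [W ! length (F k)]"
      then have "j \<le> k" using k(3)[OF j] pre by simp
      moreover have "k < j" using F_prefix_less[of j k] eq j k(1) mm by (simp add: strict_prefix_def)
      ultimately show False by simp
    qed
  qed
  show "length (concat (take (Suc mm) L)) = p + length (F k) + 1"
    using Lm lt p(1) by (simp add: take_Suc_conv_app_nth)
qed

lemma prefix_snoc_iff: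
  assumes "length f < length W"
  shows "prefix (f @ [a]) W \<longleftrightarrow> prefix f W \<and> W ! length f = a"
proof
  assume "prefix (f @ [a]) W"
  then show "prefix f W \<and> W ! length f = a"
    by (auto simp: prefix_def nth_append)
next
  assume pre: "prefix f W \<and> W ! length f = a"
  then obtain zs where zs: "W = f @ zs" by (auto simp: prefix_def)
  then obtain z zs' where "zs = z # zs'" using assms by (cases zs) auto
  then show "prefix (f @ [a]) W" using zs pre by (simp add: nth_append)
qed

text \<open>All windows in the interval begin with \<open>F k\<close>, so their sorted order, cut
  after one more character, is the order of that character.\<close>

lemma interval_mono:
  assumes srt: "sorted_ok c r m" "r rVC = V" and i: "ints V m mm" and k: "k \<le> mm" "mm \<le> length L"
    and u: "m aLO k \<le> u" "u \<le> u'" "u' < m aHI k"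
  shows "swin m u ! length (F k) \<le> swin m u' ! length (F k)"
proof -
  let ?l = "length (F k)"
  have V: "u' < V" "u < V" using intsD(2)[OF i k(1)] u by auto
  have it: "m aO2 x \<in> items c" if "x < V" for x
    using srt that by (auto simp: sorted_ok_def bij_betw_def)
  have lc: "?l < c" using F_less_c k by simp
  have pre: "prefix (F k) (swin m u)" "prefix (F k) (swin m u')"
    using intsD(4)[OF i k(1) V(2)] intsD(4)[OF i k(1) V(1)] u by auto
  have tk: "take (Suc ?l) (swin m x) = F k @ [swin m x ! ?l]" if "x < V" "prefix (F k) (swin m x)" for x
    using that length_win[OF it[OF that(1)]] lc by (metis append_eq_conv_conj prefix_def take_Suc_conv_app_nth)
  have "enc b (swin m u) \<le> enc b (swin m u')" using srt u V by (simp add: sorted_ok_def)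
  then have "enc b (take (Suc ?l) (swin m u)) \<le> enc b (take (Suc ?l) (swin m u'))"
    using it V length_win set_win by (intro enc_take_mono) auto
  then show ?thesis
    unfolding tk[OF V(2) pre(1)] tk[OF V(1) pre(2)] by (simp add: enc_append)
qed

lemma tags_paint:
  assumes tg: "tags h m mm" and ln: "m' aLO = (m aLO)(Suc mm := lo)" "m' aHI = (m aHI)(Suc mm := hi)"
    and t1: "\<And>x. m' aTAG x = m aTAG x \<or> m' aTAG x = Suc mm \<and> (\<forall>u j. u < (2::nat) ^ h \<longrightarrow> (2 ^ h + u) div 2 ^ j = x \<longrightarrow> lo \<le> u \<and> u < hi)"
    and t2: "\<And>u. lo \<le> u \<Longrightarrow> u < hi \<Longrightarrow> \<exists>j \<le> h. m' aTAG ((2 ^ h + u) div 2 ^ j) = Suc mm"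
  shows "tags h m' (Suc mm)"
  unfolding tags_def Let_def
proof (intro allI impI conjI)
  fix u i :: nat assume u: "u < 2 ^ h" and i: "i \<le> h"
  let ?x = "(2 ^ h + u) div 2 ^ i"
  have old: "m aTAG ?x = 0 \<or> m aTAG ?x \<le> mm \<and> m aLO (m aTAG ?x) \<le> u \<and> u < m aHI (m aTAG ?x)"
    using tagsD(1)[OF tg u i] by blast
  show "m' aTAG ?x = 0 \<or> m' aTAG ?x \<le> Suc mm \<and> m' aLO (m' aTAG ?x) \<le> u \<and> u < m' aHI (m' aTAG ?x)"
    using t1[of ?x]
  proof (elim disjE conjE)
    assume "m' aTAG ?x = m aTAG ?x"
    then show ?thesis using old by (auto simp: ln)
  next
    assume "m' aTAG ?x = Suc mm" "\<forall>u j. u < (2::nat) ^ h \<longrightarrow> (2 ^ h + u) div 2 ^ j = ?x \<longrightarrow> lo \<le> u \<and> u < hi"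
    then show ?thesis using u by (auto simp: ln)
  qed
next
  fix u k :: nat assume u: "u < 2 ^ h" and k: "1 \<le> k" "k \<le> Suc mm" "m' aLO k \<le> u" "u < m' aHI k"
  show "\<exists>i \<le> h. k \<le> m' aTAG ((2 ^ h + u) div 2 ^ i)"
  proof (cases "k = Suc mm")
    case True
    then show ?thesis using t2[of u] k by (auto simp: ln)
  next
    case False
    then have "k \<le> mm" "m aLO k \<le> u" "u < m aHI k" using k by (auto simp: ln)
    then obtain i where i: "i \<le> h" "k \<le> m aTAG ((2 ^ h + u) div 2 ^ i)"
      using tagsD(2)[OF tg u k(1)] by blast
    \<comment> \<open>Painting can only raise a tag: old tags are at most \<open>mm\<close>, the new
      one is \<open>Suc mm\<close>.\<close>
    moreover have "m aTAG ((2 ^ h + u) div 2 ^ i) \<le> m' aTAG ((2 ^ h + u) div 2 ^ i)"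
    proof -
      have "m aTAG ((2 ^ h + u) div 2 ^ i) \<le> mm"
        using tagsD(1)[OF tg u i(1)] by fastforce
      then show ?thesis using t1[of "(2 ^ h + u) div 2 ^ i"] by auto
    qed
    ultimately show ?thesis using le_trans by blast
  qed
qed

lemma walked_mono: "walked p j \<Longrightarrow> p \<le> p' \<Longrightarrow> walked p' j"
  unfolding walked_def using covers_mono by blast

lemma staticD:
  assumes "static V h r m"
  shows "r rC = c" "r rD = 2 * c" "r rVC = V" "r rRP = 2 ^ h" "r rNM = length S - 1" "r 0 = n"
    "base_ok m" "chars_ok m" "cr_ok c (rank c) m" "sorted_ok c r m" "borders_ok m"
    "\<And>u. u < V \<Longrightarrow> m aO2 u \<in> items c"
  using assms by (auto simp: static_def sorted_ok_def bij_betw_def)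

lemma int_prog_wp:
  assumes st: "static V h r m" and i: "ints V m mm" and mm: "mm \<le> length L" and k: "r rA = k" "k \<le> mm"
    and r: "r rL = length (F k)" "r rY = a" and V: "V \<le> 2 ^ h" "2 * 2 ^ h \<le> B" "2 * 2 ^ h < (2::nat) ^ w"
    and post: "\<And>r' t'. same {rV, rS, rY, rIT, rMID, rLO, rHI, rE, rB, rCH} r r' \<Longrightarrow> r' rCH = a \<Longrightarrow> r' rE \<le> r' rB \<Longrightarrow> r' rB \<le> V \<Longrightarrow>
      (\<And>u. u < V \<Longrightarrow> r' rE \<le> u \<and> u < r' rB \<longleftrightarrow> prefix (F k @ [a]) (swin m u)) \<Longrightarrow> t' \<le> t + 2 * Suc h \<Longrightarrow> Q r' m t'"
  shows "wp w B int_prog Q r m t"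
proof -
  note sd = staticD[OF st]
  define lo hi where "lo = m aLO k" and "hi = m aHI k"
  have lh: "lo \<le> hi" "hi \<le> V" using intsD(1,2)[OF i k(2)] by (auto simp: lo_def hi_def)
  have kB: "k \<le> B" using k mm L_B by simp
  have lc: "length (F k) < c" using F_less_c k mm by simp
  have VB: "2 * V < 2 ^ w" "V \<le> B" using V by linarith+
  have g: "hi - lo < 2 ^ Suc h"
  proof -
    have "hi - lo \<le> 2 ^ h" using lh V(1) by linarith
    also have "(2::nat) ^ h < 2 ^ Suc h" by simp
    finally show ?thesis .
  qed
  have mono: "win c (m aO2 u) ! length (F k) \<le> win c (m aO2 u') ! length (F k)" if "lo \<le> u" "u \<le> u'" "u' < hi" for u u'
    using interval_mono[OF sd(10,3) i k(2) mm, of u u'] that by (simp add: lo_def hi_def)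
  let ?rest = "wp w B (rLO ::= Read aLO (Reg rA)) (wp w B (rHI ::= Read aHI (Reg rA)) (wp w B (bs_prog False) (wp w B (rB ::= Reg rLO) Q)))"
  have "wp w B (bs_prog True) (wp w B (rE ::= Reg rLO) ?rest) (r(rCH := a, rLO := lo, rHI := hi)) m t"
  proof (rule bs_prog_wp[where a = a and lo = lo and hi = hi and V = V and g = "Suc h", OF lc sd(7,8)], goal_cases)
    case (14 r1 t1)
    note P1 = this
    have r1: "r1 rA = k" "r1 rL = length (F k)" "r1 rC = c" "r1 rD = 2 * c" "r1 rCH = a"
      using P1(1) k r sd by (auto simp: same_def)
    have "wp w B (bs_prog False) (wp w B (rB ::= Reg rLO) Q) (r1(rE := r1 rLO, rLO := lo, rHI := hi)) m t1"
    proof (rule bs_prog_wp[where a = a and lo = lo and hi = hi and V = V and g = "Suc h", OF lc sd(7,8)], goal_cases)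
      case (14 r2 t2)
      note P2 = this
      have e2: "r2 rE = r1 rLO" using P2(1) by (auto simp: same_def)
      \<comment> \<open>Were the bounds in the wrong order, the character at the upper bound would
        be both smaller and greater than \<open>a\<close>.\<close>
      have ord: "r2 rE \<le> r2 rLO"
      proof (rule ccontr)
        assume n: "\<not> r2 rE \<le> r2 rLO"
        then have "r2 rLO < r1 rLO" "r2 rLO < hi" using e2 P1(3) by auto
        then show False using P1(4)[of "r2 rLO"] P2(2) P2(5)[of "r2 rLO"] by auto
      qed
      have iff: "r2 rE \<le> u \<and> u < r2 rLO \<longleftrightarrow> prefix (F k @ [a]) (swin m u)" if u: "u < V" for u
      proof -
        have W: "length (swin m u) = c" using length_win sd(12)[OF u] by blast
        have "prefix (F k @ [a]) (swin m u) \<longleftrightarrow> lo \<le> u \<and> u < hi \<and> swin m u ! length (F k) = a"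
          using prefix_snoc_iff[of "F k" "swin m u" a] lc W intsD(4)[OF i k(2) u] by (auto simp: lo_def hi_def)
        also have "\<dots> \<longleftrightarrow> r2 rE \<le> u \<and> u < r2 rLO"
        proof
          assume u': "lo \<le> u \<and> u < hi \<and> swin m u ! length (F k) = a"
          have "r1 rLO \<le> u" using P1(4)[of u] u' by (auto simp: not_less[symmetric])
          moreover have "u < r2 rLO" using P2(5)[of u] u' by (auto simp: not_less[symmetric])
          ultimately show "r2 rE \<le> u \<and> u < r2 rLO" using e2 by simp
        next
          assume u': "r2 rE \<le> u \<and> u < r2 rLO"
          have lh': "lo \<le> u" "u < hi" using u' e2 P1(2) P2(3) by auto
          then have "\<not> swin m u ! length (F k) < a" "swin m u ! length (F k) \<le> a"
            using P1(5)[of u] P2(4)[of u] u' e2 by auto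
          then show "lo \<le> u \<and> u < hi \<and> swin m u ! length (F k) = a" using lh' by simp
        qed
        finally show ?thesis by simp
      qed
      have "Q (r2(rB := r2 rLO)) m t2"
      proof (rule post)
        show "same {rV, rS, rY, rIT, rMID, rLO, rHI, rE, rB, rCH} r (r2(rB := r2 rLO))"
          using P2(1) P1(1) by (auto simp: same_def)
        show "(r2(rB := r2 rLO)) rCH = a" using P2(1) r1 by (auto simp: same_def)
        show "t2 \<le> t + 2 * Suc h" using P1(6) P2(6) by simp
      qed (use ord P2(3) lh iff in auto)
      then show ?case by simp
    qed (use r1 lh VB sd(12) mono g in auto)
    then show ?case using kB r1 by (simp add: lo_def hi_def)
  qed (use k r sd lh VB mono g in auto)
  then show ?thesis
    unfolding int_prog_def using kB k r by (simp add: lo_def hi_def)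
qed

lemma ins_prog_wp:
  assumes st: "static V h r m" and T: "trie m mm" and i: "ints V m mm" and tg: "tags h m mm" and mm: "mm < length L"
    and k: "k \<le> mm" "L ! mm = F k @ [a]"
    and r: "r rM = mm" "r rA = k" "r rCH = a" "r rL = length (F k)" "r rP + length (F k) + 1 < 2 ^ w"
    and int: "r rE \<le> r rB" "r rB \<le> V" "\<And>u. u < V \<Longrightarrow> r rE \<le> u \<and> u < r rB \<longleftrightarrow> prefix (F k @ [a]) (swin m u)"
    and V: "V \<le> 2 ^ h" "2 * 2 ^ h \<le> B" "2 * 2 ^ h < (2::nat) ^ w"
    and post: "\<And>r' m' t'. same {rLO, rHI, rM, rP} r r' \<Longrightarrow> same marrs m m' \<Longrightarrow> r' rM = Suc mm \<Longrightarrow>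
      r' rP = r rP + length (F k) + 1 \<Longrightarrow> trie m' (Suc mm) \<Longrightarrow> ints V m' (Suc mm) \<Longrightarrow> tags h m' (Suc mm) \<Longrightarrow>
      t' \<le> t + Suc h \<Longrightarrow> Q r' m' t'"
  shows "wp w B ins_prog Q r m t"
proof -
  note sd = staticD[OF st]
  define lo hi l where "lo = r rE" and "hi = r rB" and "l = length (F k)"
  have two: "(2::nat) < 2 ^ w" using small_word(1)[of 2] by simp
  have bnd: "mm + 1 < 2 ^ w" "mm + 1 \<le> B" "k \<le> B" using mm k L_word L_B by auto
  have lw: "l + 1 < 2 ^ w" using F_less_c[of k] k mm small_word(1)[of "l + 1"] by (simp add: l_def)
  define m2 where "m2 = m(2 := (m 2)(mm + 1 := k), 3 := (m 3)(mm + 1 := a), aSB := (m aSB)(mm + 1 := m aFC k),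
    aFC := (m aFC)(k := mm + 1), aFL := (m aFL)(mm + 1 := l + 1), aLO := (m aLO)(mm + 1 := lo), aHI := (m aHI)(mm + 1 := hi))"
  define r2 where "r2 = r(rM := mm + 1, rLO := 2 ^ h + lo, rHI := 2 ^ h + hi)"
  have T2: "trie m2 (Suc mm)"
    by (rule trie_add[OF T k(1) mm k(2)]) (auto simp: m2_def)
  have O2: "m2 aO2 = m aO2" by (simp add: m2_def)
  have i2: "ints V m2 (Suc mm)"
    unfolding ints_def
  proof (intro allI impI)
    fix k' assume k': "k' \<le> Suc mm"
    show "m2 aLO k' \<le> m2 aHI k' \<and> m2 aHI k' \<le> V \<and> m2 aFL k' = length (F k') \<and>
      (\<forall>u<V. (m2 aLO k' \<le> u \<and> u < m2 aHI k') = prefix (F k') (swin m2 u))"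
    proof (cases "k' = Suc mm")
      case True
      have "F k' = F k @ [a]" using True k(2) by (simp add: F_Suc)
      then show ?thesis using int True by (simp add: m2_def lo_def hi_def l_def)
    next
      case False
      then have k'': "k' \<le> mm" using k' by simp
      then have "m2 aLO k' = m aLO k'" "m2 aHI k' = m aHI k'" "m2 aFL k' = m aFL k'" by (auto simp: m2_def)
      then show ?thesis using intsD[OF i k''] O2 by simp
    qed
  qed
  have fin: "wp w B paint_prog (wp w B (rP ::= Reg rP [+] Reg rL [+] Num 1) Q) r2 m2 t"
  proof (rule paint_prog_wp[where H = h and lo = lo and hi = hi and k = "Suc mm"], goal_cases)
    case (8 r3 m3 t3)
    note P3 = this
    have r3: "r3 rP = r rP" "r3 rL = l" "r3 rM = Suc mm" using P3(1) r by (auto simp: same_def r2_def l_def)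
    have m3: "m3 2 = m2 2" "m3 3 = m2 3" "m3 aSB = m2 aSB" "m3 aFC = m2 aFC" "m3 aFL = m2 aFL" "m3 aLO = m2 aLO"
      "m3 aHI = m2 aHI" "m3 aO2 = m2 aO2"
      using P3(2) by (auto simp: same_def)
    have "Q (r3(rP := r rP + l + 1)) m3 t3"
    proof (rule post)
      show "same {rLO, rHI, rM, rP} r (r3(rP := r rP + l + 1))" using P3(1) by (auto simp: same_def r2_def)
      show "same marrs m m3" using P3(2) by (auto simp: same_def marrs_def m2_def)
      show "trie m3 (Suc mm)" using T2 unfolding trie_def m3 .
      show "ints V m3 (Suc mm)" using i2 unfolding ints_def m3 .
      show "tags h m3 (Suc mm)"
      proof (rule tags_paint[OF tg])
        show "m3 aLO = (m aLO)(Suc mm := lo)" "m3 aHI = (m aHI)(Suc mm := hi)" using m3 by (auto simp: m2_def)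
        show "m3 aTAG x = m aTAG x \<or> m3 aTAG x = Suc mm \<and> (\<forall>u j. u < (2::nat) ^ h \<longrightarrow> (2 ^ h + u) div 2 ^ j = x \<longrightarrow> lo \<le> u \<and> u < hi)" for x
          using P3(3)[of x] by (simp add: m2_def)
      qed (rule P3(4))
    qed (use r3 P3(5) in \<open>auto simp: l_def\<close>)
    then show ?case using r3 r(5) two by (simp add: l_def)
  qed (use two V int sd in \<open>auto simp: r2_def hi_def lo_def\<close>)
  have w2: "2 ^ h + lo < 2 ^ w" "2 ^ h + hi < 2 ^ w" using V int by (auto simp: lo_def hi_def)
  have r2': "r(rM := mm + 1, rLO := 2 ^ h + r rE, rHI := 2 ^ h + r rB) = r2" by (simp add: r2_def lo_def hi_def)
  show ?thesis
    unfolding ins_prog_def add_prog_def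
    using fin w2 bnd lw two by (simp add: r sd(4) lo_def[symmetric] hi_def[symmetric] l_def[symmetric] m2_def r2_def)
qed

text \<open>The 4 (h + 1) steps are one query, two binary searches and one painting, with h + 1
  each; walking over borders is paid by \<open>rJ\<close>. The condition p + 2 c <= N leaves the
  addition p + c free of overflow.\<close>

lemma main_body_wp:
  assumes st: "static V h r m" and dy: "dyn V h r m" and p: "r rP + 2 * c \<le> length S"
    and V: "V \<le> 2 ^ h" "2 * 2 ^ h \<le> B" "2 * 2 ^ h < (2::nat) ^ w"
    and post: "\<And>r' m' t'. same mregs r r' \<Longrightarrow> same marrs m m' \<Longrightarrow> dyn V h r' m' \<Longrightarrow> r rM < length L \<Longrightarrow> r' rM = Suc (r rM) \<Longrightarrow>
      r' rP \<le> r rP + c \<Longrightarrow> r rJ \<le> r' rJ \<Longrightarrow> r' rJ \<le> length borders \<Longrightarrow> t' + r rJ \<le> t + r' rJ + 4 * Suc h \<Longrightarrow> Q r' m' t'"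
  shows "wp w B main_body Q r m t"
proof -
  note sd = staticD[OF st]
  define mm p j where "mm = r rM" and "p = r rP" and "j = r rJ"
  have d: "trie m mm" "p = length (concat (take mm L))" "walked p j" "ints V m mm" "tags h m mm"
    using dy by (auto simp: dyn_def mm_def p_def j_def)
  have mmL: "mm \<le> length L" using d(1) by (simp add: trie_def)
  have lS: "length S \<le> 2 ^ w" using len_word by (simp add: S_vl)
  have two: "(2::nat) < 2 ^ w" using small_word(1)[of 2] by simp
  show ?thesis
    unfolding main_body_def wp_Seq_iff
  proof (rule walk_prog_wp[where p = p and j = j, OF sd(7,11)], goal_cases)
    case (6 r1 t1 E v)
    note P1 = this
    define W where "W = take c (drop p S)"
    define s where "s = E + 1 - p"
    have cr: "crossing v s c" "cwin v s c = W" using P1(8,9) by (auto simp: s_def W_def)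
    have vv: "var v" "s < c" using cr(1) by (auto simp: crossing_def)
    have Ws: "W \<in> subs c" using cwin_in_subs[OF cr(1)] cr(2) by simp
    define u where "u = rank c W"
    have u: "u < V" "swin m u = W" using rank_pos[OF sd(10) Ws] sd(3) by (auto simp: u_def)
    have cru: "m aCR (v * c + s) = u" using sd(9) cr by (auto simp: cr_ok_def u_def)
    have vn: "v \<le> n" "v \<le> B" using vv n_B by (auto simp: var_def)
    have ib: "v * c + s < 2 ^ w" "v * c + s \<le> B" "v * c < 2 ^ w" using idx_bound[OF vn(1) vv(2)] by auto
    have r1: "r1 rC = c" "r1 rP = p" "r1 rRP = 2 ^ h" "r1 rM = mm"
      using P1(1) sd by (auto simp: same_def p_def mm_def)
    have eb: "m aEB (r1 rJ) = E" "m aBV (r1 rJ) = v" using sd(11) P1(2,5) by (auto simp: borders_ok_def)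
    have jB: "r1 rJ \<le> B" using P1(2) K_B by simp
    have Ew: "E + 1 < 2 ^ w" using P1(7) lS by simp
    have uw: "2 ^ h + u < 2 ^ w" "2 ^ h + u \<le> B" "2 ^ h + u < 2 ^ Suc h" using u V by auto
    let ?r2 = "r1(rV := v, rIT := v * c + s, rX := 2 ^ h + u)"
    have "wp w B query_prog (wp w B (rL ::= Read aFL (Reg rA)) (wp w B getch_prog (wp w B int_prog (wp w B ins_prog Q)))) ?r2 m t1"
    proof (rule query_prog_wp[where v = "2 ^ h + u" and h = h], goal_cases)
      case (5 r3 t3)
      note P3 = this
      define k where "k = r3 rA"
      have qr: "k \<le> mm" "prefix (F k) W" "\<And>k'. k' \<le> mm \<Longrightarrow> prefix (F k') W \<Longrightarrow> k' \<le> k"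
        using query_result[OF d(4,5) u(1) V(1), of k] P3(2,3) u(2) by (auto simp: k_def)
      have pc: "p + c \<le> length S" using p by (simp add: p_def)
      have nf: "mm < length L" "L ! mm = F k @ [W ! length (F k)]" "length (F k) < c"
        "length (concat (take (Suc mm) L)) = p + length (F k) + 1"
        using new_factor[OF W_def d(2) pc mmL qr(1,2)] qr(3) by blast+
      define l where "l = length (F k)"
      define a where "a = W ! l"
      have it: "v * c + s \<in> items c" using cr(1) by (auto simp: items_def)
      have wx: "win c (v * c + s) = W" using win_item[OF cr(1)] cr(2) by simp
      have r3: "r3 rIT = v * c + s" "r3 rC = c" "r3 rD = 2 * c" "r3 rM = mm" "r3 rP = p" "r3 rJ = r1 rJ"
        using P3(1) P1(1) sd r1 by (auto simp: same_def)
      have s3: "same mregs r r3" using P3(1) P1(1) by (auto simp: same_def mregs_def)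
      have fl: "m aFL k = l" using intsD(3)[OF d(4) qr(1)] by (simp add: l_def)
      have kB: "k \<le> B" using qr(1) mmL L_B by simp
      have "wp w B getch_prog (wp w B int_prog (wp w B ins_prog Q)) (r3(rL := l)) m t3"
      proof (rule getch_wp[OF it nf(3)[folded l_def] sd(7,8)], goal_cases)
        case (5 r4)
        note P4 = this
        have r4: "r4 rA = k" "r4 rL = l" "r4 rY = a" "r4 rM = mm" "r4 rP = p" "r4 rJ = r1 rJ"
          using P4 r3 wx by (auto simp: same_def k_def a_def)
        have s4: "same mregs r r4" using P4(1) s3 by (auto simp: same_def mregs_def)
        have st4: "static V h r4 m" using static_same[OF st s4] by simp
        show ?case
        proof (rule int_prog_wp[OF st4 d(4) mmL r4(1) qr(1) r4(2)[unfolded l_def] r4(3) V], goal_cases)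
          case (1 r5 t5)
          note P5 = this
          have r5: "r5 rA = k" "r5 rL = length (F k)" "r5 rM = mm" "r5 rP = p" "r5 rJ = r1 rJ"
            using P5(1) r4 by (auto simp: same_def l_def)
          have s5: "same mregs r r5" using P5(1) s4 by (auto simp: same_def mregs_def)
          have st5: "static V h r5 m" using static_same[OF st s5] by simp
          have pw: "r5 rP + length (F k) + 1 < 2 ^ w" using r5 nf(3) p lS c_ge by (simp add: p_def[symmetric])
          show ?case
          proof (rule ins_prog_wp[OF st5 d(1,4,5) nf(1) qr(1) nf(2)[folded l_def, folded a_def] r5(3,1) P5(2) r5(2) pw P5(3,4,5) V], goal_cases)
            case (2 r6 m6 t6)
            note P6 = this
            show ?case
            proof (rule post)
              show "same mregs r r6" using P6(1) s5 by (auto simp: same_def mregs_def)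
              have r6: "r6 rJ = r1 rJ" using P6(1) r5 by (auto simp: same_def)
              have "walked p (r1 rJ)" unfolding walked_def using P1(2,4) by auto
              then have "walked (r6 rP) (r6 rJ)" using walked_mono P6(4) r5 r6 by simp
              moreover have "r6 rP = length (concat (take (r6 rM) L))" using P6(3,4) nf(4) r5 by simp
              ultimately show "dyn V h r6 m6" using P6 by (simp add: dyn_def)
              show "r6 rP \<le> r rP + c" using P6(4) nf(3) r5 by (simp add: p_def)
              show "r rJ \<le> r6 rJ" "r6 rJ \<le> length borders" using r6 P1(2,3) by (auto simp: j_def)
              show "t6 + r rJ \<le> t + r6 rJ + 4 * Suc h"
                using P6(8) P5(6) P3(4) P1(10) r6 by (simp add: j_def)
            qed (use P6 nf(1) in \<open>auto simp: mm_def\<close>)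
          qed
        qed
      qed (use r3 in auto)
      then show ?case using kB fl by (simp add: k_def)
    qed (use two uw in auto)
    then show ?case
      unfolding loc_prog_def using jB vn ib eb Ew uw cru r1 P1(6) two by (simp add: s_def)
  qed (use p d(3) sd in \<open>auto simp: p_def j_def walked_def\<close>)
qed

lemma main_loop_wp:
  assumes st: "static V h r m" and dy: "dyn V h r m" and r: "r rM = 0" "r rJ = 0" and cS: "2 * c \<le> length S"
    and V: "V \<le> 2 ^ h" "2 * 2 ^ h \<le> B" "2 * 2 ^ h < (2::nat) ^ w"
    and post: "\<And>r' m' t'. static V h r' m' \<Longrightarrow> trie m' (r' rM) \<Longrightarrow> r' rP = length (concat (take (r' rM) L)) \<Longrightarrow>
      r' rP < length S \<Longrightarrow> length S < r' rP + 2 * c \<Longrightarrow>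
      t' \<le> t + length L * (4 * Suc h + 1) + length borders \<Longrightarrow> Q r' m' t'"
  shows "wp w B main_loop Q r m t"
proof -
  define I where "I r' m' t' \<longleftrightarrow> static V h r' m' \<and> dyn V h r' m' \<and> r' rP + c \<le> length S \<and> r' rJ \<le> length borders \<and>
    r' rM \<le> length L \<and> t' \<le> t + r' rM * (4 * Suc h + 1) + r' rJ" for r' m' t'
  have lS: "length S \<le> 2 ^ w" using len_word by (simp add: S_vl)
  have Tb: "t + k * (4 * Suc h + 1) + j \<le> t + length L * (4 * Suc h + 1) + length borders"
    if "k \<le> length L" "j \<le> length borders" for k j
    using that by (intro add_mono mult_le_mono) auto
  have test: "bsafe w B (Neg (Less (Reg rNM [-] Reg rP) (Reg rC [+] Reg rC [-] Num 1))) r' m' \<and>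
    (bval w (Neg (Less (Reg rNM [-] Reg rP) (Reg rC [+] Reg rC [-] Num 1))) r' m' \<longleftrightarrow> r' rP + 2 * c \<le> length S)"
    if "I r' m' t'" for r' m' t'
  proof -
    have "static V h r' m'" "r' rP + c \<le> length S" using that by (auto simp: I_def)
    moreover have "c + c < 2 ^ w" using small_word(1)[of "c + c"] by simp
    ultimately show ?thesis using lS c_ge one_less_word by (auto simp: staticD)
  qed
  show ?thesis
    unfolding main_loop_def
  proof (rule wp_While[where I = I and T = "t + length L * (4 * Suc h + 1) + length borders + 1"], goal_cases)
    case 1
    show ?case unfolding I_def using st dy r cS by (auto simp: dyn_def)
  next
    case (2 r1 m1 t1)
    then show ?case using test by blast
  next
    case (3 r1 m1 t1)
    then have i: "static V h r1 m1" "dyn V h r1 m1" "r1 rJ \<le> length borders" "r1 rM \<le> length L"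
      "t1 \<le> t + r1 rM * (4 * Suc h + 1) + r1 rJ" "r1 rP + 2 * c \<le> length S"
      using test[of r1 m1 t1] unfolding I_def by auto
    have "wp w B main_body I r1 m1 (Suc t1)"
    proof (rule main_body_wp[OF i(1,2,6) V], goal_cases)
      case (1 r2 m2 t2)
      have "t2 \<le> t + Suc (r1 rM) * (4 * Suc h + 1) + r2 rJ"
        using 1(9) i(5) by simp
      then show ?case
        unfolding I_def using 1 static_same[OF i(1) 1(1,2)] i(6) by auto
    qed
    moreover have "t1 < t + length L * (4 * Suc h + 1) + length borders + 1"
      using i(5) Tb[OF i(4,3)] by linarith
    ultimately show ?case by blast
  next
    case (4 r1 m1 t1)
    then have i: "static V h r1 m1" "dyn V h r1 m1" "r1 rJ \<le> length borders" "r1 rM \<le> length L"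
      "t1 \<le> t + r1 rM * (4 * Suc h + 1) + r1 rJ" "\<not> r1 rP + 2 * c \<le> length S" "r1 rP + c \<le> length S"
      using test[of r1 m1 t1] unfolding I_def by auto
    show ?case
      using i Tb[OF i(4,3)] c_ge by (intro post) (auto simp: dyn_def)
  qed
qed

end


section \<open>Preparation of the main loop and extraction of the tail\<close>

definition rp_loop :: com where
  "rp_loop = While (Less (Reg rRP) (Reg rVC)) (rRP ::= Reg rRP [+] Reg rRP)"

definition init_prog :: com where
  "init_prog =
     Write aLO (Num 0) (Num 0) ;; Write aHI (Num 0) (Reg rVC) ;; Write aFL (Num 0) (Num 0) ;;
     rP ::= Num 0 ;; rJ ::= Num 0"

definition copy_prog :: com where
  "copy_prog =
     rQE ::= Reg rNM [-] Reg rP ;;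
     For rI (Num 0) (Reg rQE [+] Num 1)
       (Write aTX (Reg rI) (Read aSU (Reg 0 [*] Reg rD [+] (Reg rQE [-] Reg rI [+] Num 1))))"

definition setup_prog :: "nat \<Rightarrow> com" where
  "setup_prog b =
     rank_prog b ;; rH ::= Num 1 ;; rD ::= Reg rC [+] Reg rC ;; dp_prog ;;
     rRP ::= Reg rC ;; rp_loop ;; init_prog ;; main_loop ;; copy_prog"

context main_ctx
begin

text \<open>At most (n + 1) c windows exist, so doubling from c stops below twice that number. The
  iteration count is logarithmic in n, but n + 1 is good enough as a bound.\<close>

lemma rp_loop_wp:
  assumes r: "r rRP = c" "r rVC \<le> Suc n * c"
    and post: "\<And>r' t' h. same {rRP} r r' \<Longrightarrow> r' rRP = 2 ^ h \<Longrightarrow> r rVC \<le> 2 ^ h \<Longrightarrow> 2 * 2 ^ h \<le> 4 * c * Suc n \<Longrightarrow>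
      t' \<le> t + Suc n \<Longrightarrow> Q r' m t'"
  shows "wp w B rp_loop Q r m t"
proof -
  define I where "I r' m' t' \<longleftrightarrow> same {rRP} r r' \<and> m' = m \<and> (\<exists>i. r' rRP = c * 2 ^ i \<and> t' = t + i \<and> 2 ^ i \<le> 2 * Suc n \<and> i \<le> Suc n)"
    for r' and m' :: memory and t'
  show ?thesis
    unfolding rp_loop_def
  proof (rule wp_While[where I = I and T = "t + Suc n"], goal_cases)
    case 1
    show ?case unfolding I_def using r by (intro conjI exI[of _ 0]) auto
  next
    case (2 r1 m1 t1)
    then show ?case by simp
  next
    case (3 r1 m1 t1)
    then obtain i where i: "same {rRP} r r1" "m1 = m" "r1 rRP = c * 2 ^ i" "t1 = t + i" unfolding I_def by blast
    have "r1 rVC = r rVC" using i(1) by (auto simp: same_def)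
    then have "c * 2 ^ i < Suc n * c" using 3(2) i(3) r(2) by simp
    then have lt: "2 ^ i < Suc n" using c_ge by (metis mult.commute mult_less_cancel2)
    then have iN: "i < Suc n" using less_exp[of i] by linarith
    have "c * 2 ^ i * 2 \<le> c * Suc n * 2" using lt by (intro mult_le_mono) auto
    then have "c * 2 ^ i + c * 2 ^ i < 2 ^ w" using cap_word by simp
    moreover have "I (r1(rRP := c * 2 ^ i + c * 2 ^ i)) m (Suc t1)"
      unfolding I_def using i lt iN by (intro conjI exI[of _ "Suc i"]) auto
    ultimately show ?case using i iN by simp
  next
    case (4 r1 m1 t1)
    then obtain i where i: "same {rRP} r r1" "m1 = m" "r1 rRP = c * 2 ^ i" "t1 = t + i" "2 ^ i \<le> 2 * Suc n" "i \<le> Suc n"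
      unfolding I_def by blast
    have V: "r1 rVC = r rVC" using i(1) by (auto simp: same_def)
    have c2: "c * 2 ^ i = 2 ^ (e + i)" by (simp add: c_pow power_add)
    have "c * 2 ^ i \<le> c * (2 * Suc n)" using i(5) by (rule mult_le_mono2)
    then have "2 * 2 ^ (e + i) \<le> 4 * c * Suc n" unfolding c2[symmetric] by simp
    then show ?case
      unfolding i(2) using i V 4(2) c2 by (intro post[of r1 "e + i"]) auto
  qed
qed

lemma copy_prog_wp:
  assumes st: "static V h r m" and p: "r rP = p" "p < length S" "length S < p + 2 * c"
    and post: "\<And>r' m' t'. same {rQE, rI} r r' \<Longrightarrow> same {aTX} m m' \<Longrightarrow> r' rQE = length S - 1 - p \<Longrightarrow>
      (\<And>q. q \<le> length S - 1 - p \<Longrightarrow> m' aTX q = S ! (p + q)) \<Longrightarrow> t' \<le> t + 2 * c \<Longrightarrow> Q r' m' t'"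
  shows "wp w B copy_prog Q r m t"
proof -
  note sd = staticD[OF st]
  define QE where "QE = length S - 1 - p"
  have lS: "length S \<le> 2 ^ w" using len_word by (simp add: S_vl)
  have QE: "QE + 1 < 2 * c" "p + QE + 1 = length S" using p by (auto simp: QE_def)
  have Qw: "QE + 1 < 2 ^ w" "QE \<le> B" using small_word(1)[of "QE + 1"] small_word(2)[of QE] QE by auto
  have su: "m aSU (n * (2 * c) + (QE - q + 1)) = S ! (p + q)" if q: "q \<le> QE" for q
  proof -
    have "su_ok 1 (2 * c) hd m n (2 * c)" using sd(8) var_n by (auto simp: chars_ok_def)
    moreover have "QE - q + 1 < 2 * c" "1 \<le> QE - q + 1" "QE - q + 1 \<le> len n" using QE q by (auto simp: S_vl)
    ultimately have "m aSU (n * (2 * c) + (QE - q + 1)) = hd (sub n (len n - (QE - q + 1)) 1)"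
      unfolding su_ok_def by blast
    also have "len n - (QE - q + 1) = p + q" using QE q by (simp add: S_vl)
    also have "hd (sub n (p + q) 1) = S ! (p + q)" using QE q by (subst hd_sub) (auto simp: S_vl)
    finally show ?thesis .
  qed
  have ib: "n * (2 * c) + (QE - q + 1) < 2 ^ w" "n * (2 * c) + (QE - q + 1) \<le> B" "n * (2 * c) < 2 ^ w" for q
    using idx_bound[of n "QE - q + 1" "2 * c"] QE by auto
  let ?r1 = "r(rQE := QE)"
  have "wp w B (For rI (Num 0) (Reg rQE [+] Num 1)
       (Write aTX (Reg rI) (Read aSU (Reg 0 [*] Reg rD [+] (Reg rQE [-] Reg rI [+] Num 1))))) Q ?r1 m t"
  proof (rule wp_For[where h = "QE + 1" and T = "t + (QE + 1)" and I = "\<lambda>i r' m' t'. same {rQE, rI} r r' \<and>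
      same {aTX} m m' \<and> r' rQE = QE \<and> (\<forall>q < i. m' aTX q = S ! (p + q)) \<and> t' = t + i"], goal_cases)
    case (6 i r1 m1 t1)
    have r1: "r1 0 = n" "r1 rD = 2 * c" "m1 aSU = m aSU" using 6 sd by (auto simp: same_def)
    have iQ: "i \<le> QE" "i \<le> B" "i < 2 ^ w" "QE < 2 ^ w" "QE - i + 1 < 2 ^ w" using 6 Qw by auto
    show ?case
      using 6 iQ r1 su[OF iQ(1)] ib(1,2)[of i] ib(3) one_less_word by (simp add: All_less_Suc)
  next
    case (7 r1 m1 t1)
    then show ?case using QE by (intro post) (auto simp: QE_def)
  next
    case (5 i r1 m1 t1)
    then show ?case using Qw one_less_word by simp
  qed (use Qw in auto)
  moreover have "p \<le> length S - 1" "length S - 1 < 2 ^ w" using p lS by auto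
  ultimately show ?thesis
    unfolding copy_prog_def using p(1) sd(5) by (simp add: QE_def)
qed

lemma setup_prog_wp:
  assumes base: "base_ok m" and bo: "borders_ok m" and z: "\<And>k. m aFC k = 0" "\<And>x. m aTAG x = 0"
    and r: "r 0 = n" "r rC = c" "r rNM = length S - 1" "r rM = 0" and cS: "2 * c \<le> length S"
    and lg: "4 * c * Suc n \<le> 2 ^ g"
    and post: "\<And>r' m' t' mm p0 QE. trie m' mm \<Longrightarrow> r' rM = mm \<Longrightarrow> r' rQE = QE \<Longrightarrow> p0 = length (concat (take mm L)) \<Longrightarrow>
      p0 + QE + 1 = length S \<Longrightarrow> QE < 2 * c \<Longrightarrow> (\<And>q. q \<le> QE \<Longrightarrow> m' aTX q = S ! (p0 + q)) \<Longrightarrow>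
      t' \<le> t + 50 * (Suc n + b) * c + length L * (4 * g + 1) + length borders \<Longrightarrow> Q r' m' t'"
  shows "wp w B (setup_prog b) Q r m t"
  unfolding setup_prog_def wp_Seq_iff
proof (rule rank_prog_wp[OF base r(1,2) c_pow], goal_cases)
  case (1 r1 m1 t1)
  note P1 = this
  have r1: "r1 0 = n" "r1 rC = c" "r1 rNM = length S - 1" "r1 rM = 0" using P1(1) r by (auto simp: same_def)
  have b1: "base_ok m1" using P1(2) base by (auto simp: same_def base_ok_def)
  have cw: "c + c < 2 ^ w" using small_word(1)[of "c + c"] by simp
  let ?r2 = "r1(rH := 1, rD := c + c)"
  have "wp w B dp_prog (wp w B (rRP ::= Reg rC) (wp w B rp_loop (wp w B init_prog (wp w B main_loop (wp w B copy_prog Q))))) ?r2 m1 t1"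
  proof (rule dp_prog_wp[where H = 1 and D = "c + c" and nm = hd, OF b1], goal_cases)
    case (9 r3 m3 t3)
    note P3 = this
    have r3: "r3 0 = n" "r3 rC = c" "r3 rNM = length S - 1" "r3 rM = 0" "r3 rD = 2 * c" "r3 rVC = r1 rVC"
      using P3(1) r1 by (auto simp: same_def)
    have ch: "chars_ok m3" unfolding chars_ok_def mult_2 using P3(3) by blast
    define V where "V = r1 rVC"
    have bijV: "bij_betw (m1 aO2) {..<V} (items c)" using P1(4) by (simp add: sorted_ok_def V_def)
    have VC: "V \<le> Suc n * c" using bij_betw_same_card[OF bijV] card_items[of c] by simp
    have m3: "m3 x = m1 x" if "x \<noteq> aPR" "x \<noteq> aSU" for x using P3(2) that by (auto simp: same_def)
    have m1: "m1 aEB = m aEB" "m1 aBV = m aBV" "m1 aFC = m aFC" "m1 aTAG = m aTAG" using P1(2) by (auto simp: same_def)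
    have b3: "base_ok m3" "cr_ok c (rank c) m3" "borders_ok m3"
      using b1 P1(3) bo m3 m1 by (auto simp: base_ok_def cr_ok_def borders_ok_def)
    have "wp w B rp_loop (wp w B init_prog (wp w B main_loop (wp w B copy_prog Q))) (r3(rRP := c)) m3 t3"
    proof (rule rp_loop_wp, goal_cases)
      case (3 r4 t4 h)
      note P4 = this
      have r4: "r4 0 = n" "r4 rC = c" "r4 rNM = length S - 1" "r4 rM = 0" "r4 rD = 2 * c" "r4 rVC = V"
        using P4(1) r3 by (auto simp: same_def V_def)
      have Vh: "V \<le> 2 ^ h" using P4(3) r3 by (simp add: V_def)
      have hB: "2 * 2 ^ h \<le> B" "2 * 2 ^ h < (2::nat) ^ w"
        using P4(4) cap_word cap_B by linarith+
      have "(2::nat) ^ Suc h \<le> 2 ^ g" using P4(4) lg by simp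
      then have hg: "Suc h \<le> g" by (rule power_le_imp_le_exp[rotated]) simp
      let ?m5 = "m3(aLO := (m3 aLO)(0 := 0), aHI := (m3 aHI)(0 := V), aFL := (m3 aFL)(0 := 0))"
      let ?r5 = "r4(rP := 0, rJ := 0)"
      have st: "static V h ?r5 ?m5"
        unfolding static_def
      proof (intro conjI)
        show "base_ok ?m5" "cr_ok c (rank c) ?m5" "borders_ok ?m5" "chars_ok ?m5"
          using b3 ch by (auto simp: base_ok_def cr_ok_def borders_ok_def chars_ok_def pr_ok_def su_ok_def)
        show "sorted_ok c ?r5 ?m5" using P1(4) m3 r4 by (simp add: sorted_ok_def V_def)
      qed (use r4 P4(2) in auto)
      \<comment> \<open>Before any factor is known, only the empty one has an interval, namely all
        windows. Memory cells still at 0 represent an empty trie and an untagged tree.\<close>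
      have dy: "dyn V h ?r5 ?m5"
        unfolding dyn_def
      proof (intro conjI)
        have "trie ?m5 0" by (rule trie_0) (use m3 m1 z in auto)
        then show "trie ?m5 (?r5 rM)" using r4 by simp
        show "ints V ?m5 (?r5 rM)" using r4 by (simp add: ints_def)
        show "tags h ?m5 (?r5 rM)" using r4 m3 m1 z by (simp add: tags_def)
      qed (use r4 in \<open>auto simp: walked_def\<close>)
      have "wp w B main_loop (wp w B copy_prog Q) ?r5 ?m5 t4"
      proof (rule main_loop_wp[OF st dy _ _ cS Vh hB], goal_cases)
        case (3 r6 m6 t6)
        note P6 = this
        show ?case
        proof (rule copy_prog_wp[OF P6(1) refl P6(4,5)], goal_cases)
          case (1 r7 m7 t7)
          note P7 = this
          have m7: "m7 2 = m6 2" "m7 3 = m6 3" "m7 aSB = m6 aSB" "m7 aFC = m6 aFC" using P7(2) by (auto simp: same_def)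
          show ?case
          proof (rule post[where mm = "r6 rM" and ?p0.0 = "r6 rP" and QE = "length S - 1 - r6 rP"])
            show "trie m7 (r6 rM)" using P6(2) unfolding trie_def m7 .
            show "r7 rM = r6 rM" using P7(1) by (auto simp: same_def)
            show "r6 rP + (length S - 1 - r6 rP) + 1 = length S" using P6(4) by simp
            show "m7 aTX q = S ! (r6 rP + q)" if "q \<le> length S - 1 - r6 rP" for q
              using P7(4)[OF that] .
            show "length S - 1 - r6 rP < 2 * c" using P6(5) c_ge by linarith
            have "t7 \<le> t + 40 * (Suc n + b) * c + n * Suc (c + c) + Suc n + (length L * (4 * Suc h + 1) + length borders) + 2 * c"
              using P7(5) P6(6) P4(5) P3(4) P1(5) by simp
            \<comment> \<open>With X = (n + 1) c, refilling the tables takes 3 X, sizing the segment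
              tree X and copying the tail 2 X; together with 40 for sorting this stays below
              50.\<close>
            also have "\<dots> \<le> t + 50 * (Suc n + b) * c + length L * (4 * g + 1) + length borders"
            proof -
              define X where "X = Suc n * c"
              have a1: "n * Suc (c + c) \<le> 3 * X"
              proof -
                have "n * Suc (c + c) \<le> Suc n * (3 * c)" using c_ge by (intro mult_le_mono) auto
                then show ?thesis by (simp add: X_def)
              qed
              have "Suc n * 1 \<le> X" unfolding X_def using c_ge by (intro mult_le_mono2) linarith
              moreover have "1 * c \<le> X" unfolding X_def by (intro mult_le_mono1) linarith
              ultimately have a2: "Suc n \<le> X" "2 * c \<le> 2 * X" by simp_all
              have a3: "length L * (4 * Suc h + 1) \<le> length L * (4 * g + 1)" using hg by (intro mult_le_mono2) simp
              have a4: "40 * (Suc n + b) * c + 10 * X \<le> 50 * (Suc n + b) * c" by (simp add: X_def algebra_simps)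
              show ?thesis using a1 a2 a3 a4 by linarith
            qed
            finally show "t7 \<le> t + 50 * (Suc n + b) * c + length L * (4 * g + 1) + length borders" .
          qed (use P6(3) P7(3) in auto)
        qed
      qed (use r4 in auto)
      then show ?case
        unfolding init_prog_def using r4 by simp
    qed (use r3 VC in \<open>auto simp: V_def\<close>)
    then show ?case using r3 by simp
  qed (use c_ge r1 in \<open>auto simp: cr_ok_def crossing_def\<close>)
  then show ?case using r1 cw one_less_word by simp
qed

end


section \<open>The whole program\<close>

primrec halve :: "nat \<Rightarrow> exp \<Rightarrow> exp" where
  "halve 0 a = a"
| "halve (Suc q) a = Op Shr (halve q a) (Num 1)"

lemma val_halve: "val w (halve q a) r m = val w a r m div 2 ^ q"
  by (induction q) (auto simp: div_mult2_eq[symmetric] mult.commute)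

lemma safe_halve: "1 < (2::nat) ^ w \<Longrightarrow> safe w B a r m \<Longrightarrow> safe w B (halve q a) r m"
  by (induction q) auto

text \<open>Division replaces the comparison of c^2 with N - 1, because the square might
  overflow.\<close>

definition c_loop :: com where
  "c_loop = While (Neg (Less (Reg rNM [div] Reg rC) (Reg rC))) (rC ::= Reg rC [+] Reg rC)"

text \<open>The factor 64 leaves room for addresses up to \<open>16 c (n + 1)\<close> in a word when \<open>N \<le> 2\<^sup>w\<close>.\<close>

definition sel_prog :: com where
  "sel_prog =
     rC ::= Num 1 ;; c_loop ;; rC ::= Reg rC [+] Reg rC ;;
     If (Less (Reg 0) (Reg rNM [div] Reg rC [div] Num 64)) (rTH ::= Reg rC [-] Num 1 ;; rFB ::= Num 0) Skip"

text \<open>The input may have so few word bits that even the constant \<open>q\<close> is no word, hence \<open>halve\<close>.\<close>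

definition pre_prog :: "nat \<Rightarrow> com" where
  "pre_prog q =
     lens_prog ;; rNM ::= Read aLM (Reg 0) ;; rTH ::= Num 1 ;; rFB ::= Num 1 ;;
     If (Equal (halve q (Reg rNM)) (Num 0)) Skip sel_prog"

definition lz_prog :: "nat \<Rightarrow> nat \<Rightarrow> com" where
  "lz_prog b q =
     pre_prog q ;; dfs_prog ;; rM ::= Num 0 ;;
     If (Equal (Reg rFB) (Num 0)) (setup_prog b) (rQE ::= Reg rNM) ;;
     tail_prog ;; 0 ::= Reg rM"

context ram_ctx
begin

lemma c_loop_wp:
  assumes NM: "r rNM = NM" "NM < 2 ^ w" "1 \<le> NM" and w2: "2 < (2::nat) ^ w" and r: "r rC = 1"
    and i0: "NM < 2 ^ i0 * 2 ^ i0" "\<And>i. i < i0 \<Longrightarrow> 2 ^ i * 2 ^ i \<le> NM"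
    and post: "\<And>r' t'. same {rC} r r' \<Longrightarrow> r' rC = 2 ^ i0 \<Longrightarrow> t' \<le> t + i0 \<Longrightarrow> Q r' m t'"
  shows "wp w B c_loop Q r m t"
proof -
  define I where "I r' m' t' \<longleftrightarrow> same {rC} r r' \<and> m' = m \<and> (\<exists>i. r' rC = 2 ^ i \<and> t' = t + i \<and> i \<le> i0)"
    for r' and m' :: memory and t'
  have test: "NM div 2 ^ i < 2 ^ i \<longleftrightarrow> i = i0" if "i \<le> i0" for i
  proof (cases "i = i0")
    case True
    then show ?thesis using i0(1) by (simp add: less_mult_imp_div_less)
  next
    case False
    then have "2 ^ i * 2 ^ i \<le> NM" using i0(2) that by simp
    then have "2 ^ i * 2 ^ i div 2 ^ i \<le> NM div 2 ^ i" by (rule div_le_mono)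
    then show ?thesis using False by simp
  qed
  show ?thesis
    unfolding c_loop_def
  proof (rule wp_While[where I = I and T = "t + i0"], goal_cases)
    case 1
    show ?case unfolding I_def using r by (intro conjI exI[of _ 0]) auto
  next
    case (2 r1 m1 t1)
    then show ?case by simp
  next
    case (3 r1 m1 t1)
    then obtain i where i: "same {rC} r r1" "m1 = m" "r1 rC = 2 ^ i" "t1 = t + i" "i \<le> i0" unfolding I_def by blast
    have "r1 rNM = NM" using i(1) NM by (auto simp: same_def)
    then have "i \<noteq> i0" using 3(2) test[OF i(5)] i(3) by auto
    then have lt: "i < i0" using i(5) by simp
    define X :: nat where "X = 2 ^ i"
    have X: "X * X \<le> NM" "1 \<le> X" using i0(2)[OF lt] by (auto simp: X_def)
    have "X + X < 2 ^ w"
    proof (cases "X = 1")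
      case True
      then show ?thesis using w2 by simp
    next
      case False
      then have "2 * X \<le> X * X" using X by (intro mult_le_mono1) simp
      then show ?thesis using X NM(2) by linarith
    qed
    moreover have "I (r1(rC := X + X)) m (Suc t1)"
      unfolding I_def using i lt by (intro conjI exI[of _ "Suc i"]) (auto simp: X_def)
    ultimately show ?case using i lt by (simp add: X_def)
  next
    case (4 r1 m1 t1)
    then obtain i where i: "same {rC} r r1" "m1 = m" "r1 rC = 2 ^ i" "t1 = t + i" "i \<le> i0" unfolding I_def by blast
    have "r1 rNM = NM" using i(1) NM by (auto simp: same_def)
    then have "i = i0" using 4(2) test[OF i(5)] i(3) by auto
    then show ?case unfolding i(2) using i by (intro post) auto
  qed
qed

text \<open>Since q >= 7, passing the first test means N - 1 >= 128, so the constant 64 is a word.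
  Small inputs never execute the computation of \<open>c\<close>.\<close>

lemma pre_prog_wp:
  fixes q :: nat
  defines "NM \<equiv> len n - 1"
  assumes r: "r 0 = n" and m: "m 0 = lc" "m 1 = rc" and q: "7 \<le> q"
    and i0: "NM < 2 ^ i0 * 2 ^ i0" "\<And>i. i < i0 \<Longrightarrow> 2 ^ i * 2 ^ i \<le> NM" and c: "c = 2 * 2 ^ i0"
    and fallback: "\<And>r' m' t'. r' 0 = n \<Longrightarrow> r' rNM = NM \<Longrightarrow> r' rTH = 1 \<Longrightarrow> r' rFB = 1 \<Longrightarrow> same {aLM} m m' \<Longrightarrow>
      (\<And>v. var v \<Longrightarrow> m' aLM v = LM v) \<Longrightarrow> t' \<le> t + n + (if NM < 2 ^ q then 0 else c) \<Longrightarrow>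
      NM < 2 ^ q \<or> 2 ^ q \<le> NM \<and> NM div c div 64 \<le> n \<Longrightarrow> Q r' m' t'"
    and main: "\<And>r' m' t'. r' 0 = n \<Longrightarrow> r' rNM = NM \<Longrightarrow> r' rTH = c - 1 \<Longrightarrow> r' rFB = 0 \<Longrightarrow> r' rC = c \<Longrightarrow> same {aLM} m m' \<Longrightarrow>
      (\<And>v. var v \<Longrightarrow> m' aLM v = LM v) \<Longrightarrow> t' \<le> t + n + c \<Longrightarrow>
      2 ^ q \<le> NM \<Longrightarrow> n < NM div c div 64 \<Longrightarrow> Q r' m' t'"
  shows "wp w B (pre_prog q) Q r m t"
  unfolding pre_prog_def wp_Seq_iff
proof (rule lens_prog_wp[where r = r and m = m], goal_cases)
  case (4 r1 m1 t1)
  note P1 = this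
  have vn: "var n" using n_pos by (simp add: var_def)
  have NMw: "NM < 2 ^ w" using len_word one_less_word by (simp add: NM_def)
  have r1: "r1 0 = n" "m1 aLM n = NM" using P1(1) r P1(3)[OF vn] NMw by (auto simp: same_def LM_def NM_def)
  let ?r2 = "r1(rNM := NM, rTH := 1, rFB := 1)"
  have hv: "val w (halve q (Reg rNM)) ?r2 m1 = NM div 2 ^ q" by (simp add: val_halve)
  have hs: "safe w B (halve q (Reg rNM)) ?r2 m1" using one_less_word by (simp add: safe_halve)
  have "wp w B (If (Equal (halve q (Reg rNM)) (Num 0)) Skip sel_prog) Q ?r2 m1 t1"
  proof (cases "NM div 2 ^ q = 0")
    case True
    then have lt: "NM < 2 ^ q" by (simp add: div_eq_0_iff)
    have "Q ?r2 m1 t1"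
      by (rule fallback) (use r1 P1(2,3,4) lt in auto)
    then show ?thesis using True hv hs by simp
  next
    case False
    then have ge: "2 ^ q \<le> NM" by (simp add: div_eq_0_iff)
    have "(2::nat) ^ 7 \<le> 2 ^ q" using q by (intro power_increasing) auto
    then have NM128: "128 \<le> NM" using ge by simp
    then have w64: "64 < (2::nat) ^ w" "2 < (2::nat) ^ w" using NMw by linarith+
    have "wp w B c_loop (wp w B (rC ::= Reg rC [+] Reg rC) (wp w B
       (If (Less (Reg 0) (Reg rNM [div] Reg rC [div] Num 64)) (rTH ::= Reg rC [-] Num 1 ;; rFB ::= Num 0) Skip) Q)) (?r2(rC := 1)) m1 t1"
    proof (rule c_loop_wp[where NM = NM and ?i0.0 = i0], goal_cases)
      case (8 r3 t3)
      note P3 = this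
      have r3: "r3 0 = n" "r3 rNM = NM" "r3 rTH = 1" "r3 rFB = 1" using P3(1) r1 by (auto simp: same_def)
      \<comment> \<open>Here c = 4 Y with Y^2 <= N - 1. For Y > 4 this gives c <= Y^2 < 2^w; for Y
        <= 4, c is at most 16.\<close>
      have cw: "c < 2 ^ w"
      proof (cases i0)
        case (Suc i)
        define Y :: nat where "Y = 2 ^ i"
        have Y: "Y * Y \<le> NM" "c = 4 * Y" using i0(2)[of i] Suc c by (auto simp: Y_def)
        show ?thesis
        proof (cases "Y \<le> 4")
          case True
          then show ?thesis using Y w64 by simp
        next
          case False
          then have "4 * Y \<le> Y * Y" by (intro mult_le_mono1) simp
          then show ?thesis using Y NMw by linarith
        qed
      qed (use c w64 in simp)
      have "i0 < 2 ^ i0" by (rule less_exp)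
      then have t3: "t3 \<le> t + n + c" using P3(3) P1(4) c by linarith
      have "0 < c" using c by simp
      then have c1: "1 \<le> c" by linarith
      have cc: "2 ^ i0 + 2 ^ i0 = c" using c by simp
      have m: "Q (r3(rC := c, rTH := c - 1, rFB := 0)) m1 t3" if "n < NM div c div 64"
        by (rule main) (use r3 P1(2,3) t3 that ge in auto)
      have f: "Q (r3(rC := c)) m1 t3" if "\<not> n < NM div c div 64"
        by (rule fallback) (use r3 P1(2,3) t3 that ge in auto)
      show ?case
        using P3(2) r3 cw c1 cc w64 one_less_word m f by simp
    qed (use NM128 NMw w64 i0 in auto)
    then show ?thesis
      unfolding sel_prog_def using False hv hs one_less_word by simp
  qed
  then show ?case using r1 n_B one_less_word by (simp del: wp_If_iff)
qed (use r m in auto)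

end


locale full_ctx = ram_ctx n lc rc vl b w B + trie_ctx \<Sigma> S L dollar w B b
  for n lc rc vl b w B \<Sigma> S L dollar +
  assumes S_eq: "S = vl n"
begin

lemma rest_fallback_wp:
  assumes r: "r 0 = n" "r rNM = length S - 1" "r rTH = 1" "r rFB = 1" and m: "m 0 = lc" "m 1 = rc" "\<And>v. var v \<Longrightarrow> m aLM v = LM v"
    and z: "\<And>k. m aFC k = 0" and B: "length S \<le> B"
    and post: "\<And>r' m' t'. r' 0 = length L \<Longrightarrow> trie m' (length L) \<Longrightarrow> t' \<le> t + 2 * length S + length S * Suc b \<Longrightarrow> Q r' m' t'"
  shows "wp w B dfs_prog (wp w B (rM ::= Num 0) (wp w B (If (Equal (Reg rFB) (Num 0)) (setup_prog b) (rQE ::= Reg rNM))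
    (wp w B tail_prog (wp w B (0 ::= Reg rM) Q)))) r m t"
proof -
  have vn: "var n" using n_pos by (simp add: var_def)
  have S1: "1 \<le> length S" using S_ne by (cases S) auto
  have lv: "length (lvs 1 n) = length S" using arg_cong[OF lvs_1[OF vn], of length] by (simp add: S_eq)
  then have bd: "length (bds 1 n 0) + 1 = length S" using length_lvs[OF vn, of 1 0] by simp
  have lS: "length S \<le> 2 ^ w" using len_word by (simp add: S_eq)
  show ?thesis
  proof (rule dfs_prog_wp[where th = 1], goal_cases)
    case (9 r1 m1 t1)
    note P1 = this
    have r1: "r1 rNM = length S - 1" "r1 rFB = 1" using P1(1) r by (auto simp: same_def)
    have "trie m1 0" by (rule trie_0) (use P1(2) z in \<open>auto simp: same_def\<close>)
    moreover have tx: "m1 aTX q = S ! q" if "q < length S" for q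
      using P1(4)[of q] that lv lvs_1[OF vn] by (metis S_eq nth_map)
    moreover have "wp w B tail_prog (wp w B (0 ::= Reg rM) Q) (r1(rM := 0, rQE := length S - 1)) m1 t1"
    proof (rule tail_prog_wp[OF \<open>trie m1 0\<close>, where QE = "length S - 1" and ?p0.0 = 0], goal_cases)
      case (8 r2 m2 t2)
      have "Suc (length S - 1) = length S" using S1 by linarith
      then have "Suc (length S - 1) * Suc b = length S * Suc b" by (rule arg_cong)
      then have "Q (r2(0 := length L)) m2 t2"
        using 8 P1(6) bd by (intro post) auto
      then show ?case using 8(2) by simp
    qed (use S1 lS B tx in auto)
    ultimately show ?case using r1 by simp
  qed (use r m bd B lS in auto)
qed

end

context main_ctx
begin

lemma rest_main_wp:
  assumes r: "r 0 = n" "r rNM = length S - 1" "r rTH = c - 1" "r rFB = 0" "r rC = c"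
    and m: "m 0 = lc" "m 1 = rc" "\<And>v. var v \<Longrightarrow> m aLM v = LM v"
    and z: "\<And>k. m aFC k = 0" "\<And>x. m aTAG x = 0" and cS: "2 * c \<le> length S" and lg: "4 * c * Suc n \<le> 2 ^ g"
    and post: "\<And>r' m' t'. r' 0 = length L \<Longrightarrow> trie m' (length L) \<Longrightarrow>
      t' \<le> t + 3 * length borders + 1 + 50 * (Suc n + b) * c + length L * (4 * g + 1) + 2 * c * Suc b \<Longrightarrow> Q r' m' t'"
  shows "wp w B dfs_prog (wp w B (rM ::= Num 0) (wp w B (If (Equal (Reg rFB) (Num 0)) (setup_prog b) (rQE ::= Reg rNM))
    (wp w B tail_prog (wp w B (0 ::= Reg rM) Q)))) r m t"
proof (rule dfs_prog_wp[where th = "c - 1"], goal_cases)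
  case (9 r1 m1 t1)
  note P1 = this
  have r1: "r1 0 = n" "r1 rC = c" "r1 rNM = length S - 1" "r1 rFB = 0" using P1(1) r by (auto simp: same_def)
  have b1: "base_ok m1" "borders_ok m1" using P1(2,3) m by (auto simp: base_ok_def borders_ok_def same_def)
  have z1: "m1 aFC k = 0" "m1 aTAG k = 0" for k using P1(2) z by (auto simp: same_def)
  have "wp w B (setup_prog b) (wp w B tail_prog (wp w B (0 ::= Reg rM) Q)) (r1(rM := 0)) m1 t1"
  proof (rule setup_prog_wp[OF b1 z1 _ _ _ _ cS lg], goal_cases)
    case (5 r2 m2 t2 mm p0 QE)
    note P2 = this
    have QB: "QE \<le> B" "QE < 2 ^ w" using small_word[of QE] P2(6) by auto
    show ?case
    proof (rule tail_prog_wp[OF P2(1,2,3,4,5) QB], goal_cases)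
      case (1 q)
      then show ?case using P2(7) by simp
    next
      case (2 r3 m3 t3)
      have "Suc QE * Suc b \<le> 2 * c * Suc b" using P2(6) by (intro mult_le_mono1) simp
      then have "Q (r3(0 := length L)) m3 t3"
        using 2 P2(8) P1(6) by (intro post) auto
      then show ?case using 2(2) by simp
    qed
  qed (use r1 in auto)
  then show ?case using r1 by simp
qed (use r m c_ge K_B in auto)

end

section \<open>Powers of two, square roots and the resulting resource bounds\<close>

lemma ex_pow2_between: "1 \<le> X \<Longrightarrow> \<exists>g. X \<le> 2 ^ g \<and> 2 ^ g \<le> 2 * (X::nat)"
proof (induction X rule: less_induct)
  case (less X)
  show ?case
  proof (cases "X = 1")
    case True
    then show ?thesis by (intro exI[of _ 0]) simp
  next
    case False
    then have "X - 1 < X" "1 \<le> X - 1" using less.prems by linarith+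
    then obtain g where g: "X - 1 \<le> 2 ^ g" "2 ^ g \<le> 2 * (X - 1)" using less.IH by blast
    show ?thesis
    proof (cases "X \<le> 2 ^ g")
      case True
      then show ?thesis using g by (intro exI[of _ g]) simp
    next
      case False
      then have "2 ^ g = X - 1" using g by simp
      then show ?thesis using \<open>X \<noteq> 1\<close> less.prems by (intro exI[of _ "Suc g"]) simp
    qed
  qed
qed

lemma ex_sqrt_pow2: "\<exists>i0. (X::nat) < 2 ^ i0 * 2 ^ i0 \<and> (\<forall>i < i0. 2 ^ i * 2 ^ i \<le> X)"
proof -
  have "X < 2 ^ X * 1" using less_exp[of X] by simp
  also have "\<dots> \<le> 2 ^ X * 2 ^ X" by (intro mult_le_mono2 one_le_power) simp
  finally have "X < 2 ^ X * 2 ^ X" .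
  then have "X < 2 ^ (LEAST i. X < 2 ^ i * 2 ^ i) * 2 ^ (LEAST i. X < 2 ^ i * 2 ^ i)"
    by (rule LeastI)
  moreover have "\<forall>i < (LEAST i. X < 2 ^ i * 2 ^ i). 2 ^ i * 2 ^ i \<le> X"
    using not_less_Least by (auto simp: not_less[symmetric])
  ultimately show ?thesis by blast
qed

text \<open>The second claim confines the characters of S to the n stored right-hand sides. It
  bounds the number of distinct characters, and with it m in the case where all factors are single
  characters.\<close>

lemma slp_ctx_slp:
  assumes slp: "is_slp \<Sigma> G" and b: "\<Sigma> \<subseteq> {..<b}"
  shows "slp_ctx (length G) (mem (slp_config G) 0) (mem (slp_config G) 1) (slp_val G) b"
    and "i \<in> {1..length G} \<Longrightarrow> set (slp_val G i) \<subseteq> \<Sigma> \<inter> mem (slp_config G) 1 ` {1..length G}"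
proof -
  have tm: "a \<in> \<Sigma>" if "i \<in> {1..length G}" "slp_rhs G i = Terminal a" for i a
    using slp that by (force simp: is_slp_def)
  have conc: "l \<in> {1..<i} \<and> r \<in> {1..<i}" if "i \<in> {1..length G}" "slp_rhs G i = Concat l r" for i l r
    using slp that by (force simp: is_slp_def)
  have sub: "set (slp_val G i) \<subseteq> \<Sigma> \<inter> mem (slp_config G) 1 ` {1..length G}" if "i \<in> {1..length G}" for i
    using that
  proof (induction i rule: less_induct)
    case (less i)
    show ?case
    proof (cases "slp_rhs G i")
      case (Terminal a)
      then have "mem (slp_config G) 1 i = a" using less.prems by (simp add: slp_config_def)
      then show ?thesis
        using Terminal less.prems tm by (subst slp_val.simps) auto
    next
      case (Concat l r)
      then show ?thesis
        using conc[OF less.prems Concat] less.IH[of l] less.IH[of r] less.prems by (subst slp_val.simps) auto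
    qed
  qed
  show "i \<in> {1..length G} \<Longrightarrow> set (slp_val G i) \<subseteq> \<Sigma> \<inter> mem (slp_config G) 1 ` {1..length G}" by (rule sub)
  show "slp_ctx (length G) (mem (slp_config G) 0) (mem (slp_config G) 1) (slp_val G) b"
  proof
    show "1 \<le> length G" using slp by (cases G) (auto simp: is_slp_def)
    show "mem (slp_config G) 0 0 = 0" by (simp add: slp_config_def)
  next
    fix i assume i: "1 \<le> i" "i \<le> length G"
    then have i': "i \<in> {1..length G}" by simp
    show "set (slp_val G i) \<subseteq> {..<b}" using sub[OF i'] b by auto
    { assume "mem (slp_config G) 0 i = 0"
      then obtain a where "slp_rhs G i = Terminal a"
        using i' conc[OF i'] by (cases "slp_rhs G i") (auto simp: slp_config_def)
      then show "slp_val G i = [mem (slp_config G) 1 i]"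
        using i' by (subst slp_val.simps) (simp add: slp_config_def) }
    { assume "mem (slp_config G) 0 i \<noteq> 0"
      then obtain l r where lr: "slp_rhs G i = Concat l r"
        using i' by (cases "slp_rhs G i") (auto simp: slp_config_def)
      then show "slp_val G i = slp_val G (mem (slp_config G) 0 i) @ slp_val G (mem (slp_config G) 1 i) \<and>
        mem (slp_config G) 0 i < i \<and> 1 \<le> mem (slp_config G) 1 i \<and> mem (slp_config G) 1 i < i"
        using i' conc[OF i' lr] by (subst slp_val.simps) (simp add: slp_config_def) }
  qed
qed

lemma (in trie_ctx) trie_output:
  "trie m' (length L) \<Longrightarrow> k \<in> {1..length L} \<Longrightarrow> m' 2 k < k \<and> ([] # L) ! k = ([] # L) ! m' 2 k @ [m' 3 k]"
  unfolding trie_def F_def by auto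

lemma (in full_ctx) lz_prog_fallback_wp:
  fixes q :: nat
  defines "NM \<equiv> length S - 1"
  assumes r: "r 0 = n" and m: "m 0 = lc" "m 1 = rc" "\<And>k. m aFC k = 0" and q: "7 \<le> q"
    and i0: "NM < 2 ^ i0 * 2 ^ i0" "\<And>i. i < i0 \<Longrightarrow> 2 ^ i * 2 ^ i \<le> NM" and c: "c = 2 * 2 ^ i0"
    and sel: "\<not> (2 ^ q \<le> NM \<and> n < NM div c div 64)" and B: "length S \<le> B"
  shows "wp w B (lz_prog b q) (\<lambda>r' m' t'. r' 0 = length L \<and>
    (\<forall>k \<in> {1..length L}. m' 2 k < k \<and> ([] # L) ! k = ([] # L) ! m' 2 k @ [m' 3 k]) \<and>
    t' \<le> n + c + 2 * length S + length S * Suc b) r m 0"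
proof -
  have NM: "len n - 1 = NM" by (simp add: NM_def S_eq)
  show ?thesis
    unfolding lz_prog_def wp_Seq_iff
  proof (rule pre_prog_wp[where ?i0.0 = i0 and c = c and r = r and m = m], goal_cases)
    case (8 r1 m1 t1)
    note P1 = this
    have m1: "m1 0 = lc" "m1 1 = rc" "m1 aFC k = 0" for k using P1(5) m by (auto simp: same_def)
    have t1: "t1 \<le> n + c" using P1(7) by (auto split: if_splits)
    show ?case
      by (rule rest_fallback_wp) (use P1 m1 t1 B NM trie_output in \<open>auto simp: NM_def\<close>)
  qed (use r m q i0 c sel NM in auto)
qed

lemma (in main_ctx) lz_prog_main_wp:
  fixes q :: nat
  defines "NM \<equiv> length S - 1"
  assumes r: "r 0 = n" and m: "m 0 = lc" "m 1 = rc" "\<And>k. m aFC k = 0" "\<And>x. m aTAG x = 0" and q: "7 \<le> q"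
    and i0: "NM < 2 ^ i0 * 2 ^ i0" "\<And>i. i < i0 \<Longrightarrow> 2 ^ i * 2 ^ i \<le> NM" and c: "c = 2 * 2 ^ i0"
    and sel: "2 ^ q \<le> NM \<and> n < NM div c div 64"
    and cS: "2 * c \<le> length S" and lg: "4 * c * Suc n \<le> 2 ^ g"
  shows "wp w B (lz_prog b q) (\<lambda>r' m' t'. r' 0 = length L \<and>
    (\<forall>k \<in> {1..length L}. m' 2 k < k \<and> ([] # L) ! k = ([] # L) ! m' 2 k @ [m' 3 k]) \<and>
    t' \<le> n + c + 3 * length (bds (c - 1) n 0) + 1 + 50 * (Suc n + b) * c + length L * (4 * g + 1) + 2 * c * Suc b) r m 0"
proof -
  have NM: "len n - 1 = NM" by (simp add: NM_def S_vl)
  show ?thesis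
    unfolding lz_prog_def wp_Seq_iff
  proof (rule pre_prog_wp[where ?i0.0 = i0 and c = c and r = r and m = m], goal_cases)
    case (9 r1 m1 t1)
    note P1 = this
    have m1: "m1 0 = lc" "m1 1 = rc" "m1 aFC k = 0" "m1 aTAG k = 0" for k using P1(6) m by (auto simp: same_def)
    show ?case
      by (rule rest_main_wp[where g = g]) (use P1 m1 cS lg NM trie_output in \<open>auto simp: NM_def\<close>)
  qed (use r m q i0 c sel NM in auto)
qed

lemma window_le_sqrt:
  assumes "1 \<le> N" "\<And>i. i < i0 \<Longrightarrow> 2 ^ i * 2 ^ i \<le> N - (1::nat)"
  shows "real (2 * 2 ^ i0) \<le> 4 * sqrt (real N)"
proof (cases i0)
  case 0
  have "1 \<le> sqrt (real N)" using assms(1) by simp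
  then have "2 \<le> 4 * sqrt (real N)" by linarith
  then show ?thesis using 0 by simp
next
  case (Suc j)
  then have "2 ^ j * 2 ^ j \<le> N" using assms(2)[of j] by simp
  from of_nat_mono[OF this, where 'a = real] have "(2 ^ j) * (2 ^ j) \<le> real N" by simp
  then have "(2::real) ^ j \<le> sqrt (real N)" by (intro real_le_rsqrt) (simp add: power2_eq_square)
  then show ?thesis using Suc by simp
qed

lemma two_sqrt_le_window:
  assumes "N - 1 < 2 ^ i0 * (2::nat) ^ i0"
  shows "2 * sqrt (real N) \<le> real (2 * 2 ^ i0)"
proof -
  have "N \<le> 2 ^ i0 * 2 ^ i0" using assms by linarith
  from of_nat_mono[OF this, where 'a = real] have "real N \<le> (2 ^ i0) * (2 ^ i0)" by simp
  then have "sqrt (real N) \<le> 2 ^ i0" by (intro real_le_lsqrt) (simp_all add: power2_eq_square)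
  then show ?thesis by simp
qed

text \<open>Everything reduces to N <= A x. Either N <= 2^q, or the failed test gives N <= 64 (n +
  1) c, which is at most 64 * 2 n * 4 sqrt N = 512 x.\<close>

lemma fallback_bounds:
  fixes n N c q b m :: nat and x A :: real
  defines "x \<equiv> real n * sqrt (real N)" and "A \<equiv> 2 ^ q + 512"
  assumes n: "1 \<le> n" and N: "1 \<le> N" and c: "real c \<le> 4 * sqrt (real N)" "0 < c"
    and sel: "\<not> (2 ^ q \<le> N - 1 \<and> n < (N - 1) div c div 64)"
  shows "real (Suc (n + c + 2 * N + N * Suc b)) \<le> ((b + 3) * A + 6) * x"
    and "real (Suc (N + n + m)) \<le> (A + 2) * (x + m)"
proof -
  have s: "1 \<le> sqrt (real N)" using N by simp
  have nx: "real n \<le> x" unfolding x_def using s by (simp add: mult_le_cancel_left1)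
  have sx: "sqrt (real N) \<le> x" unfolding x_def using n s by (simp add: mult_le_cancel_right1)
  have x1: "1 \<le> x" using nx n by linarith
  have cx: "real c \<le> 4 * x" using c(1) sx by linarith
  have NA: "real N \<le> A * x"
  proof (cases "2 ^ q \<le> N - 1")
    case True
    then have "(N - 1) div (c * 64) < Suc n" using sel by (simp add: div_mult2_eq)
    then have "N - 1 < Suc n * (c * 64)" using c(2) by (simp only: div_less_iff_less_mult)
    then have "N \<le> 64 * Suc n * c" using N by (simp add: algebra_simps)
    then have "real N \<le> real (64 * Suc n * c)" by (rule of_nat_mono)
    also have "\<dots> = real (64 * Suc n) * real c" by simp
    also have "\<dots> \<le> (128 * real n) * (4 * sqrt (real N))" using n c s by (intro mult_mono) auto
    also have "\<dots> = 512 * x" by (simp add: x_def)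
    also have "\<dots> \<le> A * x" using x1 by (intro mult_right_mono) (auto simp: A_def)
    finally show ?thesis .
  next
    case False
    then have "N \<le> 2 ^ q" by linarith
    from of_nat_mono[OF this, where 'a = real] have "real N \<le> 2 ^ q" by simp
    also have "\<dots> \<le> A * 1" by (simp add: A_def)
    also have "\<dots> \<le> A * x" using x1 by (intro mult_left_mono) (auto simp: A_def)
    finally show ?thesis .
  qed
  have "(real b + 3) * real N \<le> (real b + 3) * (A * x)" using NA by (intro mult_left_mono) auto
  then show "real (Suc (n + c + 2 * N + N * Suc b)) \<le> ((b + 3) * A + 6) * x"
    using nx cx x1 by (simp add: algebra_simps)
  have "0 \<le> A * m" "0 \<le> real m" by (simp_all add: A_def)
  then show "real (Suc (N + n + m)) \<le> (A + 2) * (x + m)"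
    using NA nx x1 by (simp add: algebra_simps)
qed

text \<open>The lower bound on c limits the borders: K <= n N / c <= x / 2. The upper bound gives n
  c <= 4 x, and 2^g <= N turns the tree height into log N.\<close>

lemma main_bounds:
  fixes n N c b m K g :: nat and x :: real
  defines "x \<equiv> real n * sqrt (real N)"
  assumes n: "1 \<le> n" and N: "1 \<le> N" and c: "real c \<le> 4 * sqrt (real N)" "2 * sqrt (real N) \<le> real c"
    and K: "c * K \<le> n * N" and g: "2 ^ g \<le> N" "1 \<le> g"
  shows "real (Suc (n + c + 3 * K + 1 + 50 * (Suc n + b) * c + m * (4 * g + 1) + 2 * c * Suc b))
      \<le> (208 * b + 450) * x + 5 * (m * log 2 (real N))"
    and "real (Suc (16 * c * Suc n + b + 16 + K + 1 + m + n)) \<le> (b + 150) * x + m"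
proof -
  have s: "1 \<le> sqrt (real N)" using N by simp
  have nx: "real n \<le> x" unfolding x_def using s by (simp add: mult_le_cancel_left1)
  have sx: "sqrt (real N) \<le> x" unfolding x_def using n s by (simp add: mult_le_cancel_right1)
  have x1: "1 \<le> x" using nx n by linarith
  have cx: "real c \<le> 4 * x" using c(1) sx by linarith
  have "sqrt (real N) * (2 * real K) \<le> real c * real K" using mult_right_mono[OF c(2), of "real K"] by simp
  also have "\<dots> \<le> real n * real N" using of_nat_mono[OF K, where 'a = real] by simp
  also have "\<dots> = sqrt (real N) * x" by (simp add: x_def)
  finally have Kx: "2 * real K \<le> x" using s by (simp add: mult_le_cancel_left)
  have ncx: "real (Suc n + b) * real c \<le> ((b + 2) * n) * (4 * sqrt (real N))"
  proof (intro mult_mono)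
    have "b * 1 \<le> b * n" using n by (intro mult_le_mono2)
    moreover have "(b + 2) * n = b * n + n + n" by (simp add: algebra_simps)
    ultimately have "Suc n + b \<le> (b + 2) * n" using n by linarith
    then show "real (Suc n + b) \<le> real ((b + 2) * n)" by (rule of_nat_mono)
  qed (use c in auto)
  then have ncx: "real (Suc n + b) * real c \<le> 4 * (b + 2) * x" by (simp add: x_def algebra_simps)
  have cb: "real c * (b + 1) \<le> (4 * x) * (b + 1)" using cx by (intro mult_right_mono) auto
  have "real c * Suc n \<le> (4 * sqrt (real N)) * (2 * n)" using c n by (intro mult_mono) auto
  then have cn: "real c * Suc n \<le> 8 * x" by (simp add: x_def algebra_simps)
  have "real g \<le> log 2 (real N)" using g(1) N le_log2_of_power by blast
  then have "real (4 * g + 1) \<le> 5 * log 2 (real N)" using g(2) by simp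
  then have mg: "real m * (4 * g + 1) \<le> real m * (5 * log 2 (real N))" by (intro mult_left_mono) auto
  have bx: "real b \<le> b * x" using mult_left_mono[OF x1, of "real b"] by simp
  show "real (Suc (n + c + 3 * K + 1 + 50 * (Suc n + b) * c + m * (4 * g + 1) + 2 * c * Suc b))
      \<le> (208 * b + 450) * x + 5 * (m * log 2 (real N))"
    using nx cx Kx ncx cb mg x1 by (simp add: algebra_simps)
  show "real (Suc (16 * c * Suc n + b + 16 + K + 1 + m + n)) \<le> (b + 150) * x + m"
    using cn bx Kx nx x1 by (simp add: algebra_simps)
qed


section \<open>Choice of the parameters and the final bounds\<close>

lemma lz_prog_correct:
  fixes \<Sigma> :: "nat set" and G :: "nat slp" and S :: "nat list" and w b q :: nat
  defines "n \<equiv> length G" and "N \<equiv> length S" and "L \<equiv> lz78 \<Sigma> S"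
  defines "D \<equiv> (real b + 3) * (2 ^ q + 512) + 208 * real b + 600"
  assumes slp: "is_slp \<Sigma> G" and S: "S = slp_string G" and b: "\<Sigma> \<subseteq> {..<b}" and q: "q = 2 * (b + 16)"
    and last: "last S \<notin> set (butlast S)"
    and w: "log 2 (real N) \<le> real w" "n < 2 ^ w"
  shows "\<exists>B r' m' t'. exec w B (lz_prog b q) (regs (slp_config G), mem (slp_config G), 0) (r', m', t') \<and>
    r' 0 = length L \<and> (\<forall>k \<in> {1..length L}. m' 2 k < k \<and> ([] # L) ! k = ([] # L) ! m' 2 k @ [m' 3 k]) \<and>
    real (Suc t') \<le> D * (real n * sqrt (real N) + real (length L) * log 2 (real N)) \<and>
    real (Suc B) \<le> D * (real n * sqrt (real N) + real (length L))"
proof -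
  let ?r = "regs (slp_config G)" and ?m = "mem (slp_config G)"
  interpret slp_ctx n "?m 0" "?m 1" "slp_val G" b
    unfolding n_def by (rule slp_ctx_slp(1)[OF slp b])
  have Sv: "S = slp_val G n" by (simp add: S slp_string_def n_def)
  have "n \<in> {1..length G}" using n_pos by (simp add: n_def)
  then have sub: "set S \<subseteq> \<Sigma> \<inter> ?m 1 ` {1..n}" unfolding Sv n_def by (rule slp_ctx_slp(2)[OF slp b])
  have vn: "var n" using n_pos by (simp add: var_def)
  have N1: "1 \<le> N" using len_pos[OF vn] by (simp add: N_def Sv)
  then have Sne: "S \<noteq> []" by (auto simp: N_def)
  interpret lz78_ctx \<Sigma> S L "last S"
    using sub Sne last by unfold_locales (auto simp: L_def)
  have w0: "0 < w" using w(2) n_pos by (cases w) auto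
  have Nw: "N \<le> 2 ^ w"
  proof -
    have "real N \<le> 2 powr real w" using w(1) N1 by (simp add: log_le_iff)
    then have "real N \<le> real (2 ^ w)" by (simp add: powr_realpow)
    then show ?thesis by (simp only: of_nat_le_iff)
  qed
  \<comment> \<open>n is a word by assumption, which settles the case without a factor of length
    two; in the other case m < N <= 2^w.\<close>
  have "card (set S) \<le> n"
    using card_mono[of "?m 1 ` {1..n}" "set S"] sub card_image_le[of "{1..n}" "?m 1"] by auto
  then have Lw: "length L < 2 ^ w" using length_L_cases Nw w(2) by (auto simp: N_def)
  have Sb: "set S \<subseteq> {..<b}" using sub b by auto
  have r0: "?r 0 = n" by (simp add: slp_config_def n_def)
  have z: "?m aFC k = 0" "?m aTAG k = 0" for k by (auto simp: slp_config_def split: slp_rule.splits)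
  obtain i0 where i0: "N - 1 < 2 ^ i0 * 2 ^ i0" "\<forall>i < i0. 2 ^ i * 2 ^ i \<le> N - 1" using ex_sqrt_pow2 by blast
  define c where "c = (2::nat) * 2 ^ i0"
  have c_le: "real c \<le> 4 * sqrt (real N)" unfolding c_def using window_le_sqrt[OF N1, of i0] i0(2) by blast
  have c_ge_sqrt: "2 * sqrt (real N) \<le> real c" unfolding c_def by (rule two_sqrt_le_window[OF i0(1)])
  have q7: "7 \<le> q" by (simp add: q)
  have c0: "0 < c" by (simp add: c_def)
  let ?x = "real n * sqrt (real N)" and ?l = "real (length L) * log 2 (real N)"
  have x0: "0 \<le> ?x" by simp
  have l0: "0 \<le> ?l" using N1 by simp
  have A0: "0 \<le> (real b + 2) * (2 ^ q + 512)" by simp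
  have scale: "E * X \<le> D * X" if "E \<le> D" "0 \<le> X" for E X using that by (intro mult_right_mono)
  show ?thesis
  proof (cases "2 ^ q \<le> N - 1 \<and> n < (N - 1) div c div 64")
    case False
    define B where "B = N + n + length L"
    interpret full_ctx n "?m 0" "?m 1" "slp_val G" b w B \<Sigma> S L "last S"
      using w0 w(2) Nw Lw Sb Sv by unfold_locales (auto simp: B_def N_def)
    note P = lz_prog_fallback_wp[of ?r ?m q i0 c, folded N_def, OF r0 refl refl z(1) q7 i0(1) _ c_def False]
    note bnd = fallback_bounds[OF n_pos N1 c_le c0 False]
    have "wp w B (lz_prog b q) (\<lambda>r' m' t'. r' 0 = length L \<and>
      (\<forall>k \<in> {1..length L}. m' 2 k < k \<and> ([] # L) ! k = ([] # L) ! m' 2 k @ [m' 3 k]) \<and>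
      t' \<le> n + c + 2 * N + N * Suc b) ?r ?m 0"
      by (rule P) (use i0(2) in \<open>auto simp: B_def\<close>)
    then obtain r' m' t' where ex: "exec w B (lz_prog b q) (?r, ?m, 0) (r', m', t')" "r' 0 = length L"
      "\<forall>k \<in> {1..length L}. m' 2 k < k \<and> ([] # L) ! k = ([] # L) ! m' 2 k @ [m' 3 k]"
      "t' \<le> n + c + 2 * N + N * Suc b" unfolding wp_def by blast
    have "real (Suc t') \<le> real (Suc (n + c + 2 * N + N * Suc b))" using ex(4) by (intro of_nat_mono Suc_le_mono[THEN iffD2])
    also have "\<dots> \<le> ((real b + 3) * (2 ^ q + 512) + 6) * ?x" using bnd(1) by simp
    also have "\<dots> \<le> D * ?x" using x0 by (intro scale) (simp_all add: D_def)
    also have "\<dots> \<le> D * (?x + ?l)" using l0 by (intro mult_left_mono) (simp_all add: D_def)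
    finally have T: "real (Suc t') \<le> D * (?x + ?l)" .
    have "real (Suc B) \<le> ((2 ^ q + 512) + 2) * (?x + length L)" unfolding B_def by (rule bnd(2))
    also have "\<dots> \<le> D * (?x + length L)"
    proof (rule scale)
      show "2 ^ q + 512 + 2 \<le> D" using A0 by (simp add: D_def algebra_simps)
    qed simp
    finally show ?thesis using ex T by blast
  next
    case True
    have two: "2 ^ q \<le> N - 1" and big: "64 * c * Suc n \<le> N - 1"
    proof -
      have "Suc n \<le> (N - 1) div (c * 64)" using True by (simp add: div_mult2_eq Suc_le_eq)
      then have "Suc n * (c * 64) \<le> N - 1" using c0 by (simp only: less_eq_div_iff_mult_less_eq zero_less_mult_iff zero_less_numeral conj_absorb simp_thms)
      then show "64 * c * Suc n \<le> N - 1" by (simp only: mult_ac)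
    qed (use True in blast)
    \<comment> \<open>Here the choice q = 2 (b + 16) pays off: 4^(b + 16) <= N - 1 < 4^i0 forces b +
      16 < c, so \<open>b\<close> and all small constants are absorbed by c.\<close>
    have "(2::nat) ^ q < 2 ^ (i0 + i0)" using two i0(1) by (simp only: power_add)
    then have "q < i0 + i0" by simp
    then have "b + 16 < i0" unfolding q mult_2 by simp
    then have bc: "b + 16 < c" unfolding c_def using less_exp[of i0] by linarith
    have c1: "c * 1 \<le> c * Suc n" by (intro mult_le_mono2) simp
    define K where "K = length (bds (c - 1) n 0)"
    have cK: "c * K \<le> n * N" using length_bds[OF vn, of "c - 1" 0] c0 by (simp add: K_def N_def Sv)
    \<comment> \<open>From c K <= n N together with 4 N <= c^2 and 64 c n <= N. This keeps the
      number of borders, which is not covered by the table sizes, well within a word.\<close>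
    have K_le: "256 * K \<le> N"
    proof -
      have N4: "4 * N \<le> c * c" using i0(1) by (simp add: c_def)
      have "(N * 256) * K = 64 * ((4 * N) * K)" by simp
      also have "\<dots> \<le> 64 * ((c * c) * K)" using N4 by (intro mult_le_mono2 mult_le_mono1)
      also have "\<dots> = 64 * c * (c * K)" by simp
      also have "\<dots> \<le> 64 * c * (n * N)" using cK by (intro mult_le_mono2)
      also have "\<dots> = (64 * c * n) * N" by simp
      also have "\<dots> \<le> N * N" using big by (intro mult_le_mono1) simp
      finally show ?thesis using N1 by (simp add: mult.assoc)
    qed
    define B where "B = 16 * c * Suc n + b + 16 + K + 1 + length L + n"
    obtain g where g: "4 * c * Suc n \<le> 2 ^ g" "2 ^ g \<le> 2 * (4 * c * Suc n)"
      using ex_pow2_between[of "4 * c * Suc n"] c0 by (auto simp: Suc_le_eq)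
    have g1: "2 ^ g \<le> N" "1 \<le> g"
    proof -
      show "2 ^ g \<le> N" using g(2) big by linarith
      have "1 < (2::nat) ^ g" using g(1) c1 bc by linarith
      then show "1 \<le> g" by (cases g) auto
    qed
    \<comment> \<open>The selection test gives 64 c (n + 1) <= N - 1 < 2^w, and b + 16 < c.\<close>
    have cap: "16 * c * Suc n + b + 16 < 2 ^ w" using big bc c1 Nw by linarith
    have cS: "2 * c \<le> N" using big c1 by linarith
    have csq: "2 * N < c * (c + 1)"
    proof -
      have "4 * N \<le> c * c" using i0(1) by (simp add: c_def)
      then show ?thesis using c0 N1 unfolding add_mult_distrib2 by linarith
    qed
    have K1: "K + 1 < 2 ^ w" using K_le cS bc Nw by linarith
    interpret main_ctx n "?m 0" "?m 1" "slp_val G" b w B c \<Sigma> S L "last S" "Suc i0"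
      using w0 w(2) Nw Lw Sb Sv cap csq K1 bc
      by unfold_locales (auto simp: B_def N_def K_def[symmetric] c_def[symmetric])
    note P = lz_prog_main_wp[of ?r ?m q i0 g, folded N_def K_def, OF r0 refl refl z q7 i0(1) _ c_def True cS g(1)]
    note bnd = main_bounds[OF n_pos N1 c_le c_ge_sqrt cK g1]
    have "wp w B (lz_prog b q) (\<lambda>r' m' t'. r' 0 = length L \<and>
      (\<forall>k \<in> {1..length L}. m' 2 k < k \<and> ([] # L) ! k = ([] # L) ! m' 2 k @ [m' 3 k]) \<and>
      t' \<le> n + c + 3 * K + 1 + 50 * (Suc n + b) * c + length L * (4 * g + 1) + 2 * c * Suc b) ?r ?m 0"
      by (rule P) (use i0(2) in auto)
    then obtain r' m' t' where ex: "exec w B (lz_prog b q) (?r, ?m, 0) (r', m', t')" "r' 0 = length L"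
      "\<forall>k \<in> {1..length L}. m' 2 k < k \<and> ([] # L) ! k = ([] # L) ! m' 2 k @ [m' 3 k]"
      "t' \<le> n + c + 3 * K + 1 + 50 * (Suc n + b) * c + length L * (4 * g + 1) + 2 * c * Suc b" unfolding wp_def by blast
    have "real (Suc t') \<le> real (Suc (n + c + 3 * K + 1 + 50 * (Suc n + b) * c + length L * (4 * g + 1) + 2 * c * Suc b))"
      using ex(4) by (intro of_nat_mono Suc_le_mono[THEN iffD2])
    also have "\<dots> \<le> (208 * b + 450) * ?x + 5 * ?l" by (rule bnd(1))
    also have "\<dots> \<le> D * ?x + D * ?l" using x0 l0 by (intro add_mono scale) (simp_all add: D_def)
    finally have T: "real (Suc t') \<le> D * (?x + ?l)" by (simp only: distrib_left)
    have "real (Suc B) \<le> (b + 150) * ?x + 1 * real (length L)" using bnd(2) by (simp add: B_def)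
    also have "\<dots> \<le> D * ?x + D * real (length L)" using x0 by (intro add_mono scale) (simp_all add: D_def)
    finally show ?thesis using ex T by (auto simp only: distrib_left)
  qed
qed

theorem theorem2:
  fixes \<Sigma> :: "nat set" and dollar :: nat
  assumes "finite \<Sigma>" and "dollar \<in> \<Sigma>"
  shows "\<exists>(P :: program) (C :: real). \<forall>(w :: nat) (G :: nat slp) S n N fs m.
    is_slp \<Sigma> G \<and> n = length G \<and>
    S = slp_string G \<and> N = length S \<and>
    last S = dollar \<and> dollar \<notin> set (butlast S) \<and>
    fs = lz78 \<Sigma> S \<and> m = length fs \<and>
    log 2 (real N) \<le> real w \<and> slp_fits w G
    \<longrightarrow>
    halts w P (slp_config G) \<and>
    lz78_pairs fs (output_pairs (result w P (slp_config G))) \<and>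
    real (run_time w P (slp_config G)) \<le> C * (real n * sqrt (real N) + real m * log 2 (real N)) \<and>
    real (run_space w P (slp_config G)) \<le> C * (real n * sqrt (real N) + real m)"
proof -
  \<comment> \<open>The alphabet is fixed first, so b, the threshold exponent q and the factor D are
    constants independent of the word size and the input.\<close>
  define b where "b = Suc (Max \<Sigma>)"
  define q where "q = 2 * (b + 16)"
  define D where "D = (real b + 3) * (2 ^ q + 512) + 208 * real b + 600"
  have b: "\<Sigma> \<subseteq> {..<b}" using assms(1) by (auto simp: b_def less_Suc_eq_le)
  obtain P C where PC: "\<forall>w B r m r' m' t. w > 0 \<and> exec w B (lz_prog b q) (r, m, 0) (r', m', t) \<longrightarrow>
    halts w P \<lparr>pc = 0, regs = r, mem = m\<rparr> \<and>
    (\<forall>x \<in> com_regs (lz_prog b q). regs (result w P \<lparr>pc = 0, regs = r, mem = m\<rparr>) x = r' x) \<and>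
    mem (result w P \<lparr>pc = 0, regs = r, mem = m\<rparr>) = m' \<and>
    run_time w P \<lparr>pc = 0, regs = r, mem = m\<rparr> \<le> C * Suc t \<and>
    run_space w P \<lparr>pc = 0, regs = r, mem = m\<rparr> \<le> C * Suc B"
    using compile_correct[of "lz_prog b q"] by (elim exE) (rule that)
  have "0 \<in> com_regs (lz_prog b q)" by (simp add: lz_prog_def)
  show ?thesis
  proof (intro exI[of _ P] exI[of _ "real C * D"] allI impI, elim conjE)
    fix w G S n N fs m
    assume slp: "is_slp \<Sigma> G" and n: "n = length G" and S: "S = slp_string G" and N: "N = length S"
      and last: "last S = dollar" "dollar \<notin> set (butlast S)" and fs: "fs = lz78 \<Sigma> S" and m: "m = length fs"
      and w: "log 2 (real N) \<le> real w" and fits: "slp_fits w G"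
    have nw: "length G < 2 ^ w" using fits by (simp add: slp_fits_def)
    moreover have "G \<noteq> []" using slp by (simp add: is_slp_def)
    ultimately have w0: "0 < w" by (cases w) auto
    obtain B r' m' t' where ex: "exec w B (lz_prog b q) (regs (slp_config G), mem (slp_config G), 0) (r', m', t')"
      "r' 0 = m" "\<forall>k \<in> {1..m}. m' 2 k < k \<and> ([] # fs) ! k = ([] # fs) ! m' 2 k @ [m' 3 k]"
      "real (Suc t') \<le> D * (real n * sqrt (real N) + real m * log 2 (real N))"
      "real (Suc B) \<le> D * (real n * sqrt (real N) + real m)"
      using lz_prog_correct[OF slp S b q_def _ w[unfolded N] nw] last unfolding n N fs m D_def by auto
    have cfg: "\<lparr>pc = 0, regs = regs (slp_config G), mem = mem (slp_config G)\<rparr> = slp_config G"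
      by (simp add: slp_config_def)
    note R = PC[rule_format, OF conjI[OF w0 ex(1)], unfolded cfg]
    have r0: "regs (result w P (slp_config G)) 0 = m" using R \<open>0 \<in> _\<close> ex(2) by auto
    have "lz78_pairs fs (output_pairs (result w P (slp_config G)))"
      unfolding lz78_pairs_def
    proof (intro conjI ballI)
      show "length (output_pairs (result w P (slp_config G))) = length fs" by (simp add: output_pairs_def r0 m)
    next
      fix i assume i: "i \<in> {1..length fs}"
      then have "1 + (i - 1) < m + 1" "1 + (i - 1) = i" "i - 1 < length [1..<m + 1]" by (auto simp: m)
      then have "output_pairs (result w P (slp_config G)) ! (i - 1) = (m' 2 i, m' 3 i)"
        using R by (simp only: output_pairs_def r0 nth_map nth_upt)
      then show "case output_pairs (result w P (slp_config G)) ! (i - 1) of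
          (j, c) \<Rightarrow> j < i \<and> ([] # fs) ! i = ([] # fs) ! j @ [c]"
        using ex(3) i m by simp
    qed
    moreover have "real (run_time w P (slp_config G)) \<le> real C * D * (real n * sqrt (real N) + real m * log 2 (real N))"
    proof -
      have "real (run_time w P (slp_config G)) \<le> real (C * Suc t')" using R by (intro of_nat_mono) blast
      also have "\<dots> = real C * real (Suc t')" by (rule of_nat_mult)
      also have "\<dots> \<le> real C * (D * (real n * sqrt (real N) + real m * log 2 (real N)))"
        using ex(4) by (intro mult_left_mono) auto
      finally show ?thesis by (simp only: mult.assoc)
    qed
    moreover have "real (run_space w P (slp_config G)) \<le> real C * D * (real n * sqrt (real N) + real m)"
    proof -
      have "real (run_space w P (slp_config G)) \<le> real (C * Suc B)" using R by (intro of_nat_mono) blast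
      also have "\<dots> = real C * real (Suc B)" by (rule of_nat_mult)
      also have "\<dots> \<le> real C * (D * (real n * sqrt (real N) + real m))"
        using ex(5) by (intro mult_left_mono) auto
      finally show ?thesis by (simp only: mult.assoc)
    qed
    ultimately show "halts w P (slp_config G) \<and>
      lz78_pairs fs (output_pairs (result w P (slp_config G))) \<and>
      real (run_time w P (slp_config G)) \<le> real C * D * (real n * sqrt (real N) + real m * log 2 (real N)) \<and>
      real (run_space w P (slp_config G)) \<le> real C * D * (real n * sqrt (real N) + real m)"
      using R by blast
  qed
qed

end
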